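(* The functors $S_*,C_*^{ord}:\mathbf{Op}_{\mathbf{Top}}\to\mathbf{Op}_{\mathbf C_*(\mathbb Z)}$ are weakly equivalent (with respect to quasi-isomorphism). In particular, for a topological operad $P$ the dg operads $S_*(P)$ and $C_*^{ord}(P)$ are weakly equivalent.
   Context: For a symmetric monoidal category $\mathcal C$, $\mathbf{Op}_{\mathcal C}$ is the category of unital symmetric operads $P=(P(l))_{l\ge1}$ in $\mathcal C$ (with right $\Sigma_l$-actions, composition morphisms $P(l)\otimes P(m_1)\otimes\cdots\otimes P(m_l)\to P(m_1+\cdots+m_l)$ and unit $\mathbf 1\to P(1)$, satisfying equivariance, associativity and unit axioms). A topological operad is an operad in $\mathbf{Top}$ (cartesian product); a dg operad is an operad in $\mathbf C_*(\mathbb Z)$, the symmetric monoidal category of bounded below chain complexes of abelian groups (commutativity isomorphism with sign $(-1)^{pq}$). A symmetric (lax) monoidal functor $F:\mathcal C\to\mathcal D$ applied componentwise induces a functor $\mathbf{Op}_{\mathcal C}\to\mathbf{Op}_{\mathcal D}$, also denoted $F$. A morphism of dg operads is a weak equivalence (quasi-isomorphism) if it is a quasi-isomorphism in each arity. Two functors with values in $\mathbf{Op}_{\mathbf C_*(\mathbb Z)}$ are weakly equivalent if they are connected by a finite zigzag of natural transformations all of whose components are weak equivalences; two dg operads are weakly equivalent if connected by a finite zigzag of quasi-isomorphisms of dg operads. $S_*(X)$: singular chains, with Künneth morphism the shuffle product $\sigma\otimes\tau\mapsto\sum_{(\mu,\nu)}\varepsilon(\mu,\nu)\,(s_{\nu_q}\cdots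 s_{\nu_1}\sigma,\ s_{\mu_p}\cdots s_{\mu_1}\tau)$ over $(p,q)$-shuffles. $C_*^{ord}(X)$: ordered cubical chains. $Q_p(X)$ is the free abelian group on continuous maps $I^p\to X$ with $d(c)=\sum_{i=1}^p\sum_{\epsilon\in\{0,1\}}(-1)^{i+\epsilon}c\circ\delta_i^\epsilon$ ($\delta_i^\epsilon$ inserts $\epsilon$ in the $i$-th place); $C_p(X)$ is its quotient by degenerate cubes (independent of some coordinate); and $C_n^{ord}(X)$ is the quotient of $C_n(X)$ by the subgroup generated by all $c-\pi c$, $\pi\in\Sigma_n$, where $(\pi c)(t_1,\dots,t_n)=\varepsilon(\pi)\,c(t_{\pi(1)},\dots,t_{\pi(n)})$ with $\varepsilon(\pi)$ the signature. Its Künneth morphism is induced by the cartesian product of cubes $c\times d:I^{p+q}=I^p\times I^q\to X\times Y$. *)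

theory Defs
  imports "HOL-Homology.Homology" "HOL-Combinatorics.Combinatorics"
begin

section \<open>Permutations of blocks\<close>

text \<open>
  The symmetric group on l letters consists of the permutations of \<open>{..<l}\<close>, with product
  \<open>\<circ>\<close>. The number k, with \<open>k < sum_list ms\<close>, lies in a unique one of the consecutive blocks of
  lengths \<open>ms ! 0, ms ! 1, \<dots>\<close>.
\<close>

definition block_of :: "nat list \<Rightarrow> nat \<Rightarrow> nat" where
  "block_of ms k = (LEAST i. k < sum_list (take (Suc i) ms))"

definition offset_in :: "nat list \<Rightarrow> nat \<Rightarrow> nat" where
  "offset_in ms k = k - sum_list (take (block_of ms k) ms)"

text \<open>\<open>block_perm ms \<sigma>\<close> moves the i-th block rigidly to the place \<open>\<sigma> i\<close> among the blocks.\<close>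

definition block_perm :: "nat list \<Rightarrow> (nat \<Rightarrow> nat) \<Rightarrow> nat \<Rightarrow> nat" where
  "block_perm ms \<sigma> k =
     (if k < sum_list ms
      then (\<Sum>j | j < length ms \<and> \<sigma> j < \<sigma> (block_of ms k). ms ! j) + offset_in ms k
      else k)"

text \<open>\<open>block_sum ms \<tau>s\<close> is the direct sum of the permutations \<open>\<tau>s ! i\<close> of the i-th block.\<close>

definition block_sum :: "nat list \<Rightarrow> (nat \<Rightarrow> nat) list \<Rightarrow> nat \<Rightarrow> nat" where
  "block_sum ms \<tau>s k =
     (if k < sum_list ms
      then sum_list (take (block_of ms k) ms) + (\<tau>s ! block_of ms k) (offset_in ms k)
      else k)"

definition arity_list :: "nat list \<Rightarrow> bool" where
  "arity_list ms \<longleftrightarrow> ms \<noteq> [] \<and> (\<forall>m\<in>set ms. 1 \<le> m)"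


section \<open>Topological operads\<close>

text \<open>
  \<open>tcomp P ms x ys\<close> is the composite of \<open>x\<close>, of arity \<open>length ms\<close>, with the
  \<open>ys ! i\<close>, of respective arity \<open>ms ! i\<close>. The values of the fields in arity 0 and outside
  the spaces are irrelevant.
\<close>

record 'a top_operad_data =
  tspace :: "nat \<Rightarrow> 'a topology"
  tact :: "nat \<Rightarrow> (nat \<Rightarrow> nat) \<Rightarrow> 'a \<Rightarrow> 'a"
  tcomp :: "nat list \<Rightarrow> 'a \<Rightarrow> 'a list \<Rightarrow> 'a"
  tunit :: 'a

definition tpoints :: "'a top_operad_data \<Rightarrow> nat list \<Rightarrow> 'a list \<Rightarrow> bool" where
  "tpoints P ms ys \<longleftrightarrow> list_all2 (\<lambda>m y. y \<in> topspace (tspace P m)) ms ys"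

text \<open>
  In the associativity axiom the i-th entry of \<open>ys\<close> is composed with the list
  \<open>zss ! i\<close>, whose entries have arity \<open>nss ! i\<close>.
\<close>

definition top_operad :: "'a top_operad_data \<Rightarrow> bool" where
  "top_operad P \<longleftrightarrow>
     (\<forall>l\<ge>1. \<forall>\<sigma>. \<sigma> permutes {..<l} \<longrightarrow> continuous_map (tspace P l) (tspace P l) (tact P l \<sigma>)) \<and>
     (\<forall>l\<ge>1. \<forall>x\<in>topspace (tspace P l). tact P l id x = x) \<and>
     (\<forall>l\<ge>1. \<forall>\<sigma> \<tau>. \<forall>x\<in>topspace (tspace P l). \<sigma> permutes {..<l} \<longrightarrow> \<tau> permutes {..<l} \<longrightarrow>
        tact P l (\<sigma> \<circ> \<tau>) x = tact P l \<tau> (tact P l \<sigma> x)) \<and>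
     (\<forall>ms. arity_list ms \<longrightarrow>
        continuous_map
          (prod_topology (tspace P (length ms))
             (product_topology (\<lambda>i. tspace P (ms ! i)) {..<length ms}))
          (tspace P (sum_list ms))
          (\<lambda>(x, y). tcomp P ms x (map y [0..<length ms]))) \<and>
     tunit P \<in> topspace (tspace P 1) \<and>
     (\<forall>l\<ge>1. \<forall>x\<in>topspace (tspace P l).
        tcomp P [l] (tunit P) [x] = x \<and>
        tcomp P (replicate l 1) x (replicate l (tunit P)) = x) \<and>
     (\<forall>ms \<sigma> x ys. arity_list ms \<longrightarrow> \<sigma> permutes {..<length ms} \<longrightarrow>
        x \<in> topspace (tspace P (length ms)) \<longrightarrow> tpoints P ms ys \<longrightarrow>
        tcomp P ms (tact P (length ms) \<sigma> x) ys =
        tact P (sum_list ms) (block_perm ms \<sigma>)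
          (tcomp P (permute_list (inv_into UNIV \<sigma>) ms) x (permute_list (inv_into UNIV \<sigma>) ys))) \<and>
     (\<forall>ms \<tau>s x ys. arity_list ms \<longrightarrow> length \<tau>s = length ms \<longrightarrow>
        (\<forall>i<length ms. (\<tau>s ! i) permutes {..<ms ! i}) \<longrightarrow>
        x \<in> topspace (tspace P (length ms)) \<longrightarrow> tpoints P ms ys \<longrightarrow>
        tcomp P ms x (map (\<lambda>i. tact P (ms ! i) (\<tau>s ! i) (ys ! i)) [0..<length ms]) =
        tact P (sum_list ms) (block_sum ms \<tau>s) (tcomp P ms x ys)) \<and>
     (\<forall>nss x ys zss. nss \<noteq> [] \<longrightarrow> (\<forall>ns\<in>set nss. arity_list ns) \<longrightarrow>
        x \<in> topspace (tspace P (length nss)) \<longrightarrow> tpoints P (map length nss) ys \<longrightarrow>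
        list_all2 (tpoints P) nss zss \<longrightarrow>
        tcomp P (concat nss) (tcomp P (map length nss) x ys) (concat zss) =
        tcomp P (map sum_list nss) x
          (map (\<lambda>i. tcomp P (nss ! i) (ys ! i) (zss ! i)) [0..<length nss]))"

definition top_operad_mor ::
  "'a top_operad_data \<Rightarrow> 'b top_operad_data \<Rightarrow> (nat \<Rightarrow> 'a \<Rightarrow> 'b) \<Rightarrow> bool" where
  "top_operad_mor P Q f \<longleftrightarrow> top_operad P \<and> top_operad Q \<and>
     (\<forall>l\<ge>1. continuous_map (tspace P l) (tspace Q l) (f l)) \<and>
     (\<forall>l\<ge>1. \<forall>\<sigma>. \<forall>x\<in>topspace (tspace P l). \<sigma> permutes {..<l} \<longrightarrow>
        f l (tact P l \<sigma> x) = tact Q l \<sigma> (f l x)) \<and>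
     f 1 (tunit P) = tunit Q \<and>
     (\<forall>ms x ys. arity_list ms \<longrightarrow> x \<in> topspace (tspace P (length ms)) \<longrightarrow> tpoints P ms ys \<longrightarrow>
        f (sum_list ms) (tcomp P ms x ys) = tcomp Q ms (f (length ms) x) (map2 f ms ys))"

definition top_mor_eq :: "'a top_operad_data \<Rightarrow> (nat \<Rightarrow> 'a \<Rightarrow> 'b) \<Rightarrow> (nat \<Rightarrow> 'a \<Rightarrow> 'b) \<Rightarrow> bool" where
  "top_mor_eq P f g \<longleftrightarrow> (\<forall>l\<ge>1. \<forall>x\<in>topspace (tspace P l). f l x = g l x)"


section \<open>Chain complexes of abelian groups\<close>

text \<open>
  As for the singular chain groups of the library, abelian groups are commutative
  groups in multiplicative notation, and \<open>x [^] k\<close> is the integral multiple by k.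
\<close>

record 'b complex_data =
  cgrp :: "int \<Rightarrow> 'b monoid"
  cdiff :: "int \<Rightarrow> 'b \<Rightarrow> 'b"

definition chain_complex :: "'b complex_data \<Rightarrow> bool" where
  "chain_complex C \<longleftrightarrow>
     (\<forall>n. comm_group (cgrp C n)) \<and>
     (\<forall>n. cdiff C n \<in> hom (cgrp C n) (cgrp C (n - 1))) \<and>
     (\<forall>n. \<forall>x\<in>carrier (cgrp C n). cdiff C (n - 1) (cdiff C n x) = \<one>\<^bsub>cgrp C (n - 2)\<^esub>) \<and>
     (\<exists>N. \<forall>n<N. carrier (cgrp C n) = {\<one>\<^bsub>cgrp C n\<^esub>})"

definition complex_mor :: "'b complex_data \<Rightarrow> 'c complex_data \<Rightarrow> (int \<Rightarrow> 'b \<Rightarrow> 'c) \<Rightarrow> bool" where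
  "complex_mor C D f \<longleftrightarrow> chain_complex C \<and> chain_complex D \<and>
     (\<forall>n. f n \<in> hom (cgrp C n) (cgrp D n)) \<and>
     (\<forall>n. \<forall>x\<in>carrier (cgrp C n). cdiff D n (f n x) = f (n - 1) (cdiff C n x))"

definition cycles :: "'b complex_data \<Rightarrow> int \<Rightarrow> 'b set" where
  "cycles C n = kernel (cgrp C n) (cgrp C (n - 1)) (cdiff C n)"

definition boundaries :: "'b complex_data \<Rightarrow> int \<Rightarrow> 'b set" where
  "boundaries C n = cdiff C (n + 1) ` carrier (cgrp C (n + 1))"

definition complex_homology :: "'b complex_data \<Rightarrow> int \<Rightarrow> 'b set monoid" where
  "complex_homology C n = subgroup_generated (cgrp C n) (cycles C n) Mod boundaries C n"

definition homology_induced :: "'c complex_data \<Rightarrow> (int \<Rightarrow> 'b \<Rightarrow> 'c) \<Rightarrow> int \<Rightarrow> 'b set \<Rightarrow> 'c set" where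
  "homology_induced D f n A = (\<Union>a\<in>A. boundaries D n #>\<^bsub>cgrp D n\<^esub> f n a)"

definition quasi_iso :: "'b complex_data \<Rightarrow> 'c complex_data \<Rightarrow> (int \<Rightarrow> 'b \<Rightarrow> 'c) \<Rightarrow> bool" where
  "quasi_iso C D f \<longleftrightarrow> complex_mor C D f \<and>
     (\<forall>n. homology_induced D f n \<in> iso (complex_homology C n) (complex_homology D n))"


section \<open>Differential graded operads\<close>

definition sign_pow :: "int \<Rightarrow> int" where
  "sign_pow k = (if even k then 1 else - 1)"

text \<open>
  A morphism from a tensor product of complexes is given, through the universal property of the
  tensor product, as a family of maps on homogeneous elements that are additive in each argument
  and compatible with the differential of the tensor product. Thus \<open>dcomp P ms p qs x ys\<close> is
  the composite of \<open>x\<close>, of arity \<open>length ms\<close> and degree \<open>p\<close>, with the \<open>ys ! i\<close>,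
  of respective arity \<open>ms ! i\<close> and degree \<open>qs ! i\<close>.
\<close>

record 'b dg_operad_data =
  dcx :: "nat \<Rightarrow> 'b complex_data"
  dact :: "nat \<Rightarrow> int \<Rightarrow> (nat \<Rightarrow> nat) \<Rightarrow> 'b \<Rightarrow> 'b"
  dcomp :: "nat list \<Rightarrow> int \<Rightarrow> int list \<Rightarrow> 'b \<Rightarrow> 'b list \<Rightarrow> 'b"
  dunit :: 'b

abbreviation dgrp :: "'b dg_operad_data \<Rightarrow> nat \<Rightarrow> int \<Rightarrow> 'b monoid" where
  "dgrp P l n \<equiv> cgrp (dcx P l) n"

abbreviation ddiff :: "'b dg_operad_data \<Rightarrow> nat \<Rightarrow> int \<Rightarrow> 'b \<Rightarrow> 'b" where
  "ddiff P l n \<equiv> cdiff (dcx P l) n"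

definition delems :: "'b dg_operad_data \<Rightarrow> nat list \<Rightarrow> int list \<Rightarrow> 'b list \<Rightarrow> bool" where
  "delems P ms qs ys \<longleftrightarrow> length qs = length ms \<and> length ys = length ms \<and>
     (\<forall>i<length ms. ys ! i \<in> carrier (dgrp P (ms ! i) (qs ! i)))"

definition dcomp_multilinear :: "'b dg_operad_data \<Rightarrow> bool" where
  "dcomp_multilinear P \<longleftrightarrow>
     (\<forall>ms p qs x ys. arity_list ms \<longrightarrow> x \<in> carrier (dgrp P (length ms) p) \<longrightarrow> delems P ms qs ys \<longrightarrow>
        (\<lambda>a. dcomp P ms p qs a ys)
          \<in> hom (dgrp P (length ms) p) (dgrp P (sum_list ms) (p + sum_list qs)) \<and>
        (\<forall>i<length ms. (\<lambda>a. dcomp P ms p qs x (ys[i := a]))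
          \<in> hom (dgrp P (ms ! i) (qs ! i)) (dgrp P (sum_list ms) (p + sum_list qs))))"

definition dcomp_leibniz :: "'b dg_operad_data \<Rightarrow> bool" where
  "dcomp_leibniz P \<longleftrightarrow>
     (\<forall>ms p qs x ys. arity_list ms \<longrightarrow> x \<in> carrier (dgrp P (length ms) p) \<longrightarrow> delems P ms qs ys \<longrightarrow>
        (let G = dgrp P (sum_list ms) (p + sum_list qs - 1) in
         ddiff P (sum_list ms) (p + sum_list qs) (dcomp P ms p qs x ys) =
         dcomp P ms (p - 1) qs (ddiff P (length ms) p x) ys \<otimes>\<^bsub>G\<^esub>
         (\<Otimes>\<^bsub>G\<^esub>i\<in>{..<length ms}.
            dcomp P ms p (qs[i := qs ! i - 1]) x (ys[i := ddiff P (ms ! i) (qs ! i) (ys ! i)])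
              [^]\<^bsub>G\<^esub> sign_pow (p + sum_list (take i qs)))))"

text \<open>
  The sign in the first equivariance axiom is the one of the permutation of the tensor factors
  \<open>ys\<close>; the sign in the associativity axiom comes from moving each \<open>ys ! j\<close> past the factors of
  \<open>zss ! i\<close> with \<open>i < j\<close>.
\<close>

definition dg_operad :: "'b dg_operad_data \<Rightarrow> bool" where
  "dg_operad P \<longleftrightarrow>
     (\<forall>l\<ge>1. chain_complex (dcx P l)) \<and>
     (\<forall>l\<ge>1. \<forall>\<sigma>. \<sigma> permutes {..<l} \<longrightarrow> complex_mor (dcx P l) (dcx P l) (\<lambda>n. dact P l n \<sigma>)) \<and>
     (\<forall>l\<ge>1. \<forall>n. \<forall>x\<in>carrier (dgrp P l n). dact P l n id x = x) \<and>
     (\<forall>l\<ge>1. \<forall>n \<sigma> \<tau>. \<forall>x\<in>carrier (dgrp P l n). \<sigma> permutes {..<l} \<longrightarrow> \<tau> permutes {..<l} \<longrightarrow>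
        dact P l n (\<sigma> \<circ> \<tau>) x = dact P l n \<tau> (dact P l n \<sigma> x)) \<and>
     dcomp_multilinear P \<and> dcomp_leibniz P \<and>
     dunit P \<in> carrier (dgrp P 1 0) \<and> ddiff P 1 0 (dunit P) = \<one>\<^bsub>dgrp P 1 (- 1)\<^esub> \<and>
     (\<forall>l\<ge>1. \<forall>n. \<forall>x\<in>carrier (dgrp P l n).
        dcomp P [l] 0 [n] (dunit P) [x] = x \<and>
        dcomp P (replicate l 1) n (replicate l 0) x (replicate l (dunit P)) = x) \<and>
     (\<forall>ms \<sigma> p qs x ys. arity_list ms \<longrightarrow> \<sigma> permutes {..<length ms} \<longrightarrow>
        x \<in> carrier (dgrp P (length ms) p) \<longrightarrow> delems P ms qs ys \<longrightarrow>
        dcomp P ms p qs (dact P (length ms) p \<sigma> x) ys =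
        dact P (sum_list ms) (p + sum_list qs) (block_perm ms \<sigma>)
          (dcomp P (permute_list (inv_into UNIV \<sigma>) ms) p (permute_list (inv_into UNIV \<sigma>) qs)
             x (permute_list (inv_into UNIV \<sigma>) ys))
          [^]\<^bsub>dgrp P (sum_list ms) (p + sum_list qs)\<^esub>
          sign_pow (\<Sum>j<length ms. \<Sum>i | i < j \<and> \<sigma> j < \<sigma> i. qs ! i * qs ! j)) \<and>
     (\<forall>ms \<tau>s p qs x ys. arity_list ms \<longrightarrow> length \<tau>s = length ms \<longrightarrow>
        (\<forall>i<length ms. (\<tau>s ! i) permutes {..<ms ! i}) \<longrightarrow>
        x \<in> carrier (dgrp P (length ms) p) \<longrightarrow> delems P ms qs ys \<longrightarrow>
        dcomp P ms p qs x
          (map (\<lambda>i. dact P (ms ! i) (qs ! i) (\<tau>s ! i) (ys ! i)) [0..<length ms]) =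
        dact P (sum_list ms) (p + sum_list qs) (block_sum ms \<tau>s) (dcomp P ms p qs x ys)) \<and>
     (\<forall>nss p qs rss x ys zss. nss \<noteq> [] \<longrightarrow> (\<forall>ns\<in>set nss. arity_list ns) \<longrightarrow>
        x \<in> carrier (dgrp P (length nss) p) \<longrightarrow> delems P (map length nss) qs ys \<longrightarrow>
        length rss = length nss \<longrightarrow> length zss = length nss \<longrightarrow>
        (\<forall>i<length nss. delems P (nss ! i) (rss ! i) (zss ! i)) \<longrightarrow>
        dcomp P (concat nss) (p + sum_list qs) (concat rss)
          (dcomp P (map length nss) p qs x ys) (concat zss) =
        dcomp P (map sum_list nss) p (map (\<lambda>i. qs ! i + sum_list (rss ! i)) [0..<length nss]) x
          (map (\<lambda>i. dcomp P (nss ! i) (qs ! i) (rss ! i) (ys ! i) (zss ! i)) [0..<length nss])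
          [^]\<^bsub>dgrp P (sum_list (concat nss)) (p + sum_list qs + sum_list (concat rss))\<^esub>
          sign_pow (\<Sum>j<length nss. \<Sum>i<j. qs ! j * sum_list (rss ! i)))"

definition dg_operad_mor ::
  "'b dg_operad_data \<Rightarrow> 'c dg_operad_data \<Rightarrow> (nat \<Rightarrow> int \<Rightarrow> 'b \<Rightarrow> 'c) \<Rightarrow> bool" where
  "dg_operad_mor P Q f \<longleftrightarrow> dg_operad P \<and> dg_operad Q \<and>
     (\<forall>l\<ge>1. complex_mor (dcx P l) (dcx Q l) (f l)) \<and>
     (\<forall>l\<ge>1. \<forall>n \<sigma>. \<forall>x\<in>carrier (dgrp P l n). \<sigma> permutes {..<l} \<longrightarrow>
        f l n (dact P l n \<sigma> x) = dact Q l n \<sigma> (f l n x)) \<and>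
     f 1 0 (dunit P) = dunit Q \<and>
     (\<forall>ms p qs x ys. arity_list ms \<longrightarrow> x \<in> carrier (dgrp P (length ms) p) \<longrightarrow> delems P ms qs ys \<longrightarrow>
        f (sum_list ms) (p + sum_list qs) (dcomp P ms p qs x ys) =
        dcomp Q ms p qs (f (length ms) p x)
          (map (\<lambda>i. f (ms ! i) (qs ! i) (ys ! i)) [0..<length ms]))"

definition dg_mor_eq ::
  "'b dg_operad_data \<Rightarrow> (nat \<Rightarrow> int \<Rightarrow> 'b \<Rightarrow> 'c) \<Rightarrow> (nat \<Rightarrow> int \<Rightarrow> 'b \<Rightarrow> 'c) \<Rightarrow> bool" where
  "dg_mor_eq P f g \<longleftrightarrow> (\<forall>l\<ge>1. \<forall>n. \<forall>x\<in>carrier (dgrp P l n). f l n x = g l n x)"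

definition dg_weak_eq ::
  "'b dg_operad_data \<Rightarrow> 'c dg_operad_data \<Rightarrow> (nat \<Rightarrow> int \<Rightarrow> 'b \<Rightarrow> 'c) \<Rightarrow> bool" where
  "dg_weak_eq P Q f \<longleftrightarrow> dg_operad_mor P Q f \<and> (\<forall>l\<ge>1. quasi_iso (dcx P l) (dcx Q l) (f l))"

text \<open>
  The two operads may have elements of different types; the type argument \<open>'u\<close> is the universe
  from which the intermediate operads of the zigzag are taken.
\<close>

definition dg_weakly_equivalent ::
  "'u itself \<Rightarrow> 'b dg_operad_data \<Rightarrow> 'c dg_operad_data \<Rightarrow> bool" where
  "dg_weakly_equivalent U P Q \<longleftrightarrow>
     (\<exists>R R' :: 'u dg_operad_data.
        (Ex (dg_weak_eq P R) \<or> Ex (dg_weak_eq R P)) \<and>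
        equivclp (\<lambda>S T. Ex (dg_weak_eq S T)) R R' \<and>
        (Ex (dg_weak_eq Q R') \<or> Ex (dg_weak_eq R' Q)))"


section \<open>Functors from topological operads to dg operads\<close>

text \<open>
  \<open>'a\<close> is the universe of points of the topological operads.
  Morphisms that agree on all elements are identified.
\<close>

record ('a, 'b) op_functor =
  fobj :: "'a top_operad_data \<Rightarrow> 'b dg_operad_data"
  fmor :: "'a top_operad_data \<Rightarrow> 'a top_operad_data \<Rightarrow> (nat \<Rightarrow> 'a \<Rightarrow> 'a) \<Rightarrow> nat \<Rightarrow> int \<Rightarrow> 'b \<Rightarrow> 'b"

definition is_op_functor :: "('a, 'b) op_functor \<Rightarrow> bool" where
  "is_op_functor F \<longleftrightarrow>
     (\<forall>P. top_operad P \<longrightarrow> dg_operad (fobj F P)) \<and>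
     (\<forall>P Q f. top_operad_mor P Q f \<longrightarrow> dg_operad_mor (fobj F P) (fobj F Q) (fmor F P Q f)) \<and>
     (\<forall>P Q f g. top_operad_mor P Q f \<longrightarrow> top_operad_mor P Q g \<longrightarrow> top_mor_eq P f g \<longrightarrow>
        dg_mor_eq (fobj F P) (fmor F P Q f) (fmor F P Q g)) \<and>
     (\<forall>P. top_operad P \<longrightarrow> dg_mor_eq (fobj F P) (fmor F P P (\<lambda>l x. x)) (\<lambda>l n x. x)) \<and>
     (\<forall>P Q R f g. top_operad_mor P Q f \<longrightarrow> top_operad_mor Q R g \<longrightarrow>
        dg_mor_eq (fobj F P) (fmor F P R (\<lambda>l x. g l (f l x)))
          (\<lambda>l n x. fmor F Q R g l n (fmor F P Q f l n x)))"

definition nat_transformation ::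
  "('a, 'b) op_functor \<Rightarrow> ('a, 'c) op_functor \<Rightarrow>
   ('a top_operad_data \<Rightarrow> nat \<Rightarrow> int \<Rightarrow> 'b \<Rightarrow> 'c) \<Rightarrow> bool" where
  "nat_transformation F G \<eta> \<longleftrightarrow> is_op_functor F \<and> is_op_functor G \<and>
     (\<forall>P. top_operad P \<longrightarrow> dg_operad_mor (fobj F P) (fobj G P) (\<eta> P)) \<and>
     (\<forall>P Q f. top_operad_mor P Q f \<longrightarrow>
        dg_mor_eq (fobj F P) (\<lambda>l n x. \<eta> Q l n (fmor F P Q f l n x))
          (\<lambda>l n x. fmor G P Q f l n (\<eta> P l n x)))"

definition nat_weak_eq ::
  "('a, 'b) op_functor \<Rightarrow> ('a, 'c) op_functor \<Rightarrow>
   ('a top_operad_data \<Rightarrow> nat \<Rightarrow> int \<Rightarrow> 'b \<Rightarrow> 'c) \<Rightarrow> bool" where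
  "nat_weak_eq F G \<eta> \<longleftrightarrow> nat_transformation F G \<eta> \<and>
     (\<forall>P. top_operad P \<longrightarrow> dg_weak_eq (fobj F P) (fobj G P) (\<eta> P))"

definition functors_weakly_equivalent ::
  "'u itself \<Rightarrow> ('a, 'b) op_functor \<Rightarrow> ('a, 'c) op_functor \<Rightarrow> bool" where
  "functors_weakly_equivalent U F G \<longleftrightarrow>
     (\<exists>H H' :: ('a, 'u) op_functor.
        (Ex (nat_weak_eq F H) \<or> Ex (nat_weak_eq H F)) \<and>
        equivclp (\<lambda>K L. Ex (nat_weak_eq K L)) H H' \<and>
        (Ex (nat_weak_eq G H') \<or> Ex (nat_weak_eq H' G)))"


section \<open>Singular chains of topological operads\<close>

definition sing_group :: "int \<Rightarrow> 'a topology \<Rightarrow> 'a chain monoid" where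
  "sing_group n X = (if n < 0 then free_Abelian_group {} else chain_group (nat n) X)"

definition collapse_map :: "nat \<Rightarrow> (nat \<Rightarrow> real) \<Rightarrow> nat \<Rightarrow> real" where
  "collapse_map j t = (\<lambda>i. if i < j then t i else if i = j then t j + t (Suc j) else t (Suc i))"

definition degeneracy :: "nat \<Rightarrow> nat \<Rightarrow> ((nat \<Rightarrow> real) \<Rightarrow> 'a) \<Rightarrow> (nat \<Rightarrow> real) \<Rightarrow> 'a" where
  "degeneracy p j \<sigma> = restrict (\<sigma> \<circ> collapse_map j) (standard_simplex (Suc p))"

text \<open>The head of the list is applied first.\<close>

primrec degeneracies :: "nat \<Rightarrow> nat list \<Rightarrow> ((nat \<Rightarrow> real) \<Rightarrow> 'a) \<Rightarrow> (nat \<Rightarrow> real) \<Rightarrow> 'a" where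
  "degeneracies p [] \<sigma> = \<sigma>"
| "degeneracies p (j # js) \<sigma> = degeneracies (Suc p) js (degeneracy p j \<sigma>)"

text \<open>
  A shuffle \<open>(\<mu>, \<nu>)\<close> is the permutation \<open>\<pi>\<close> of \<open>{..<p + q}\<close> with values
  \<open>\<mu>\<^sub>1 < \<dots> < \<mu>\<^sub>p\<close> followed by \<open>\<nu>\<^sub>1 < \<dots> < \<nu>\<^sub>q\<close>.
\<close>

definition shuffle_perms :: "nat \<Rightarrow> nat \<Rightarrow> (nat \<Rightarrow> nat) set" where
  "shuffle_perms p q =
     {\<pi>. \<pi> permutes {..<p + q} \<and> strict_mono_on {..<p} \<pi> \<and> strict_mono_on {p..<p + q} \<pi>}"

definition shuffle_simplex ::
  "nat \<Rightarrow> nat \<Rightarrow> (nat \<Rightarrow> nat) \<Rightarrow> ((nat \<Rightarrow> real) \<Rightarrow> 'a) \<Rightarrow> ((nat \<Rightarrow> real) \<Rightarrow> 'b) \<Rightarrow>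
   (nat \<Rightarrow> real) \<Rightarrow> 'a \<times> 'b" where
  "shuffle_simplex p q \<pi> \<sigma> \<tau> = (\<lambda>t\<in>standard_simplex (p + q).
     (degeneracies p (map \<pi> [p..<p + q]) \<sigma> t, degeneracies q (map \<pi> [0..<p]) \<tau> t))"

definition shuffle_product :: "nat \<Rightarrow> nat \<Rightarrow> 'a chain \<Rightarrow> 'b chain \<Rightarrow> ('a \<times> 'b) chain" where
  "shuffle_product p q c d =
     frag_extend (\<lambda>\<sigma>. frag_extend (\<lambda>\<tau>. \<Sum>\<pi>\<in>shuffle_perms p q.
        frag_cmul (sign \<pi>) (frag_of (shuffle_simplex p q \<pi> \<sigma> \<tau>))) d) c"

text \<open>
  Iterated Kuenneth morphism: points of a product of \<open>k\<close> spaces with points in \<open>'a\<close> are lists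
  of length \<open>k\<close>, and a factor is added on the right in each step.
\<close>

fun shuffle_products ::
  "nat \<Rightarrow> nat list \<Rightarrow> 'a list chain \<Rightarrow> 'a chain list \<Rightarrow> 'a list chain" where
  "shuffle_products p (q # qs) c (d # ds) =
     shuffle_products (p + q) qs
       (chain_map (p + q) (\<lambda>(as, a). as @ [a]) (shuffle_product p q c d)) ds"
| "shuffle_products p _ c _ = c"

definition sing_complex :: "'a topology \<Rightarrow> 'a chain complex_data" where
  "sing_complex X = \<lparr>cgrp = (\<lambda>n. sing_group n X), cdiff = (\<lambda>n. chain_boundary (nat n))\<rparr>"

definition sing_operad :: "'a top_operad_data \<Rightarrow> 'a chain dg_operad_data" where
  "sing_operad P =
     \<lparr>dcx = (\<lambda>l. sing_complex (tspace P l)),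
      dact = (\<lambda>l n \<sigma>. chain_map (nat n) (tact P l \<sigma>)),
      dcomp = (\<lambda>ms p qs c ds.
        chain_map (nat p + sum_list (map nat qs)) (\<lambda>as. tcomp P ms (hd as) (tl as))
          (shuffle_products (nat p) (map nat qs) (chain_map (nat p) (\<lambda>a. [a]) c) ds)),
      dunit = frag_of (\<lambda>t\<in>standard_simplex 0. tunit P)\<rparr>"

definition sing_functor :: "('a, 'a chain) op_functor" where
  "sing_functor = \<lparr>fobj = sing_operad, fmor = (\<lambda>P Q f l n. chain_map (nat n) (f l))\<rparr>"


section \<open>Ordered cubical chains of topological operads\<close>

definition unit_cube :: "nat \<Rightarrow> (nat \<Rightarrow> real) set" where
  "unit_cube p = {t. (\<forall>i. 0 \<le> t i \<and> t i \<le> 1) \<and> (\<forall>i\<ge>p. t i = 0)}"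

definition singular_cube :: "nat \<Rightarrow> 'a topology \<Rightarrow> ((nat \<Rightarrow> real) \<Rightarrow> 'a) \<Rightarrow> bool" where
  "singular_cube p X c \<longleftrightarrow>
     continuous_map (subtopology (powertop_real UNIV) (unit_cube p)) X c \<and>
     c \<in> extensional (unit_cube p)"

definition cube_set :: "int \<Rightarrow> 'a topology \<Rightarrow> ((nat \<Rightarrow> real) \<Rightarrow> 'a) set" where
  "cube_set n X = {c. 0 \<le> n \<and> singular_cube (nat n) X c}"

definition cube_group :: "int \<Rightarrow> 'a topology \<Rightarrow> 'a chain monoid" where
  "cube_group n X = free_Abelian_group (cube_set n X)"

text \<open>
  Coordinates are numbered from 0, whence the exponent \<open>Suc i + e\<close> of the sign.
\<close>

definition cube_face ::
  "nat \<Rightarrow> nat \<Rightarrow> nat \<Rightarrow> ((nat \<Rightarrow> real) \<Rightarrow> 'a) \<Rightarrow> (nat \<Rightarrow> real) \<Rightarrow> 'a" where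
  "cube_face p i e c = (\<lambda>t\<in>unit_cube (p - 1).
     c (\<lambda>j. if j < i then t j else if j = i then real e else t (j - 1)))"

definition cube_boundary :: "nat \<Rightarrow> 'a chain \<Rightarrow> 'a chain" where
  "cube_boundary p = frag_extend (\<lambda>c. \<Sum>i<p. \<Sum>e\<in>{0, 1}.
     frag_cmul ((- 1) ^ (Suc i + e)) (frag_of (cube_face p i e c)))"

definition degenerate_cube :: "nat \<Rightarrow> ((nat \<Rightarrow> real) \<Rightarrow> 'a) \<Rightarrow> bool" where
  "degenerate_cube p c \<longleftrightarrow>
     (\<exists>i<p. \<forall>s\<in>unit_cube p. \<forall>t\<in>unit_cube p. (\<forall>j. j \<noteq> i \<longrightarrow> s j = t j) \<longrightarrow> c s = c t)"

definition degenerate_subgroup :: "int \<Rightarrow> 'a topology \<Rightarrow> 'a chain set" where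
  "degenerate_subgroup n X =
     generate (cube_group n X) (frag_of ` {c \<in> cube_set n X. degenerate_cube (nat n) c})"

definition cubical_group :: "int \<Rightarrow> 'a topology \<Rightarrow> 'a chain set monoid" where
  "cubical_group n X = cube_group n X Mod degenerate_subgroup n X"

definition cubical_class :: "int \<Rightarrow> 'a topology \<Rightarrow> 'a chain \<Rightarrow> 'a chain set" where
  "cubical_class n X x = degenerate_subgroup n X #>\<^bsub>cube_group n X\<^esub> x"

definition permuted_cube ::
  "nat \<Rightarrow> (nat \<Rightarrow> nat) \<Rightarrow> ((nat \<Rightarrow> real) \<Rightarrow> 'a) \<Rightarrow> 'a chain" where
  "permuted_cube p \<pi> c = frag_cmul (sign \<pi>) (frag_of (\<lambda>t\<in>unit_cube p. c (\<lambda>i. t (\<pi> i))))"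

definition order_subgroup :: "int \<Rightarrow> 'a topology \<Rightarrow> 'a chain set set" where
  "order_subgroup n X = generate (cubical_group n X)
     {cubical_class n X (frag_of c) \<otimes>\<^bsub>cubical_group n X\<^esub>
        inv\<^bsub>cubical_group n X\<^esub> cubical_class n X (permuted_cube (nat n) \<pi> c)
      | c \<pi>. c \<in> cube_set n X \<and> \<pi> permutes {..<nat n}}"

definition ord_group :: "int \<Rightarrow> 'a topology \<Rightarrow> 'a chain set set monoid" where
  "ord_group n X = cubical_group n X Mod order_subgroup n X"

text \<open>
  Maps are induced on the ordered chains by applying them to representatives in the
  group of all cubes.
\<close>

definition ord_class :: "int \<Rightarrow> 'a topology \<Rightarrow> 'a chain \<Rightarrow> 'a chain set set" where
  "ord_class n X x = order_subgroup n X #>\<^bsub>cubical_group n X\<^esub> cubical_class n X x"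

definition ord_rep :: "int \<Rightarrow> 'a topology \<Rightarrow> 'a chain set set \<Rightarrow> 'a chain" where
  "ord_rep n X A = (SOME x. x \<in> carrier (cube_group n X) \<and> ord_class n X x = A)"

definition cube_map :: "nat \<Rightarrow> ('a \<Rightarrow> 'b) \<Rightarrow> 'a chain \<Rightarrow> 'b chain" where
  "cube_map p g = frag_extend (\<lambda>c. frag_of (restrict (g \<circ> c) (unit_cube p)))"

definition cube_product :: "nat \<Rightarrow> nat \<Rightarrow> 'a chain \<Rightarrow> 'b chain \<Rightarrow> ('a \<times> 'b) chain" where
  "cube_product p q x y = frag_extend (\<lambda>c. frag_extend (\<lambda>d. frag_of (\<lambda>t\<in>unit_cube (p + q).
     (c (\<lambda>i. if i < p then t i else 0), d (\<lambda>i. if i < q then t (p + i) else 0)))) y) x"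

fun cube_products ::
  "nat \<Rightarrow> nat list \<Rightarrow> 'a list chain \<Rightarrow> 'a chain list \<Rightarrow> 'a list chain" where
  "cube_products p (q # qs) x (y # ys) =
     cube_products (p + q) qs
       (cube_map (p + q) (\<lambda>(as, a). as @ [a]) (cube_product p q x y)) ys"
| "cube_products p _ x _ = x"

definition ord_complex :: "'a topology \<Rightarrow> 'a chain set set complex_data" where
  "ord_complex X =
     \<lparr>cgrp = (\<lambda>n. ord_group n X),
      cdiff = (\<lambda>n A. ord_class (n - 1) X (cube_boundary (nat n) (ord_rep n X A)))\<rparr>"

definition ord_operad :: "'a top_operad_data \<Rightarrow> 'a chain set set dg_operad_data" where
  "ord_operad P =
     \<lparr>dcx = (\<lambda>l. ord_complex (tspace P l)),
      dact = (\<lambda>l n \<sigma> A. ord_class n (tspace P l)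
        (cube_map (nat n) (tact P l \<sigma>) (ord_rep n (tspace P l) A))),
      dcomp = (\<lambda>ms p qs A Bs. ord_class (p + sum_list qs) (tspace P (sum_list ms))
        (cube_map (nat p + sum_list (map nat qs)) (\<lambda>as. tcomp P ms (hd as) (tl as))
          (cube_products (nat p) (map nat qs)
            (cube_map (nat p) (\<lambda>a. [a]) (ord_rep p (tspace P (length ms)) A))
            (map (\<lambda>i. ord_rep (qs ! i) (tspace P (ms ! i)) (Bs ! i)) [0..<length ms])))),
      dunit = ord_class 0 (tspace P 1) (frag_of (\<lambda>t\<in>unit_cube 0. tunit P))\<rparr>"

definition ord_functor :: "('a, 'a chain set set) op_functor" where
  "ord_functor =
     \<lparr>fobj = ord_operad,
      fmor = (\<lambda>P Q f l n A. ord_class n (tspace Q l)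
        (cube_map (nat n) (f l) (ord_rep n (tspace P l) A)))\<rparr>"

end

theory Submission
  imports Defs "HOL-Computational_Algebra.Group_Closure"
begin

text \<open>
  A direct natural transformation from the ordered cubical chains to the singular chains is a weak
  equivalence. A cube is normalised by applying \<open>1 - s\<^sub>i \<partial>\<^sub>i\<close> for all coordinates, with
  \<open>\<partial>\<^sub>i\<close> the face at 0, and then triangulated by the chambers of the symmetric group. This
  annihilates the degenerate cubes and the elements \<open>c - \<pi> c\<close>, and it takes products of cubes
  to shuffle products already on the chain level, since a permutation of \<open>p + q\<close> letters is
  uniquely a shuffle times a pair of permutations. An inverse up to homotopy sends a
  singular simplex to a cube, along \<open>x\<^sub>k = a\<^sub>0 \<cdots> a\<^sub>k\<close> in chamber coordinates.
  Both homotopies come from acyclic models; on the side of the cubes the models are contracted by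
  cones, which are compatible with permuting the coordinates and with degeneracies.

  That both constructions are operads is proved once, for chains on arbitrary models with products
  modulo natural relations: by naturality each axiom reduces to an identity between the
  universal chains of the models.
\<close>

text \<open>Singular chains are not normalised, so a morphism out of the ordered cubes has to kill
  degenerate cubes exactly, not just up to degenerate simplices. Triangulation alone does not do
  that: a constant path is a nonzero 1-simplex. Hence the normalisation before it. Both operations
  have to be multiplicative on the nose, since a morphism of operads leaves no room for homotopies.

  Being a quasi-isomorphism is tested in each arity separately. The inverse therefore need not
  respect products or the operad structure; it only has to be a chain map modulo relations. The map
  along products of coordinates is chosen because each of its cubical faces is either a simplicial
  face or degenerate.

  The homotopy on the cubes has to descend to the quotient by the relations. Filling cycles by
  arbitrary choice gives no control over the action of the symmetric group, so an explicit filling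
  is required there. On the simplicial side there are no relations, and arbitrary choices
  suffice.\<close>

type_synonym point = "nat => real"

abbreviation splx :: "nat => point set" where "splx == standard_simplex"

abbreviation cube :: "nat => point set" where "cube == unit_cube"

section \<open>Chains on arbitrary model domains\<close>

text \<open>Simplices and cubes of all dimensions are subspaces of one space of real sequences, so
  that a single type serves for all models.\<close>

abbreviation rsub :: "point set => point topology" where
 "rsub S \<equiv> subtopology (powertop_real UNIV) S"

text \<open>Extensionality makes two functions equal as soon as they agree on \<open>S\<close>;
  otherwise the free group on them would count one map several times.\<close>

definition maps_on :: "point set => 'a topology => (point => 'a) set" where
 "maps_on S X = {c. continuous_map (rsub S) X c & c : extensional S}"

definition chains_on :: "point set => 'a topology => 'a chain set" where
 "chains_on S X = {x. Poly_Mapping.keys x \<subseteq> maps_on S X}"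

definition push :: "point set => ('a => 'b) => 'a chain => 'b chain" where
 "push S f = frag_extend (%c. frag_of (restrict (f o c) S))"

text \<open>
 By the Yoneda lemma a natural operator on chains, or a natural bilinear one, is given by its
 value on the identities of the domains; identities between such operators are therefore only
 checked on these universal chains.
\<close>

definition nop :: "point set => point chain => 'a chain => 'a chain" where
 "nop S u = frag_extend (%c. push S c u)"

definition nop2 :: "point set => (point \<times> point) chain =>
 'a chain => 'b chain => ('a \<times> 'b) chain" where
 "nop2 S w x y = frag_extend (%c. frag_extend (%d. push S (map_prod c d) w) y) x"

definition universal :: "point set => point chain" where
 "universal S = frag_of (restrict id S)"

section \<open>Additive extension on free abelian groups\<close>

lemma frag_cmul_diff_distrib2: "frag_cmul k (a - b) = frag_cmul k a - frag_cmul k b"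
 by (rule poly_mapping_eqI) (simp add: lookup_minus algebra_simps)

lemma frag_extend_diff_fun:
 "frag_extend (%c. f c - g c) x = frag_extend f x - frag_extend g x"
 by (simp add: frag_extend_def sum_subtractf frag_cmul_diff_distrib2)

lemma frag_extend_zero_fun [simp]: "frag_extend (%c. 0) x = 0"
 by (simp add: frag_extend_def)

lemma frag_extend_minus_fun: "frag_extend (%c. - f c) x = - frag_extend f x"
 using frag_extend_diff_fun[of "%c. 0" f x] by simp

lemma frag_extend_add_fun:
 "frag_extend (%c. f c + g c) x = frag_extend f x + frag_extend g x"
 using frag_extend_diff_fun[of f "%c. - g c" x] by (simp add: frag_extend_minus_fun)

lemma frag_extend_cmul_fun: "frag_extend (%c. frag_cmul k (f c)) x = frag_cmul k (frag_extend f x)"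
 by (simp add: frag_extend_def frag_cmul_sum mult.commute)

lemma frag_extend_sum_fun:
 "frag_extend (%c. \<Sum>i\<in>I. f i c) x = (\<Sum>i\<in>I. frag_extend (f i) x)"
 by (induction I rule: infinite_finite_induct) (simp_all add: frag_extend_add_fun)

lemma frag_extend_sum_any: "frag_extend f (\<Sum>i\<in>I. g i) = (\<Sum>i\<in>I. frag_extend f (g i))"
 by (induction I rule: infinite_finite_induct) (simp_all add: frag_extend_add)

text \<open>Differences cover sums and inverses at once, so an identity between additive operators
  needs one closure case besides 0 and generators.\<close>

lemma frag_induct [case_names zero one diff]:
 "[|P 0; !!c. P (frag_of c); !!a b. [|P a; P b|] ==> P (a - b)|] ==> P x"
 using frag_induction[of x UNIV P] by simp

lemma frag_extend_fun_commute:
 assumes "!!a b. h (a - b) = h a - h b" "h 0 = 0"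
 shows "h (frag_extend f x) = frag_extend (%c. h (f c)) x"
 by (induction x rule: frag_induct) (auto simp: assms frag_extend_diff)

lemma push_0 [simp]: "push S f 0 = 0"
 and push_of [simp]: "push S f (frag_of c) = frag_of (restrict (f o c) S)"
 and push_diff: "push S f (x - y) = push S f x - push S f y"
 and push_add: "push S f (x + y) = push S f x + push S f y"
 and push_minus: "push S f (- x) = - push S f x"
 and push_cmul: "push S f (frag_cmul k x) = frag_cmul k (push S f x)"
 and push_sum: "push S f (\<Sum>i\<in>I. g i) = (\<Sum>i\<in>I. push S f (g i))"
 by (simp_all add: push_def frag_extend_diff frag_extend_add frag_extend_minus frag_extend_cmul
 frag_extend_sum_any)

lemma nop_0 [simp]: "nop S u 0 = 0"
 and nop_of: "nop S u (frag_of c) = push S c u"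
 and nop_diff: "nop S u (x - y) = nop S u x - nop S u y"
 and nop_add: "nop S u (x + y) = nop S u x + nop S u y"
 and nop_minus: "nop S u (- x) = - nop S u x"
 and nop_cmul: "nop S u (frag_cmul k x) = frag_cmul k (nop S u x)"
 and nop_sum: "nop S u (\<Sum>i\<in>I. g i) = (\<Sum>i\<in>I. nop S u (g i))"
 by (simp_all add: nop_def frag_extend_diff frag_extend_add frag_extend_minus frag_extend_cmul
 frag_extend_sum_any)

lemma nop_0_left [simp]: "nop S 0 x = 0"
 and nop_diff_left: "nop S (u - v) x = nop S u x - nop S v x"
 and nop_add_left: "nop S (u + v) x = nop S u x + nop S v x"
 and nop_minus_left: "nop S (- u) x = - nop S u x"
 and nop_cmul_left: "nop S (frag_cmul k u) x = frag_cmul k (nop S u x)"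
 and nop_sum_left: "nop S (\<Sum>i\<in>I. g i) x = (\<Sum>i\<in>I. nop S (g i) x)"
 by (simp_all add: nop_def push_diff push_add push_minus push_cmul push_sum frag_extend_diff_fun
 frag_extend_add_fun frag_extend_minus_fun frag_extend_cmul_fun frag_extend_sum_fun)

lemma nop2_0_left [simp]: "nop2 S w 0 y = 0"
 and nop2_0_right [simp]: "nop2 S w x 0 = 0"
 and nop2_of: "nop2 S w (frag_of c) (frag_of d) = push S (map_prod c d) w"
 and nop2_diff_left: "nop2 S w (x - x') y = nop2 S w x y - nop2 S w x' y"
 and nop2_diff_right: "nop2 S w x (y - y') = nop2 S w x y - nop2 S w x y'"
 and nop2_add_left: "nop2 S w (x + x') y = nop2 S w x y + nop2 S w x' y"
 and nop2_add_right: "nop2 S w x (y + y') = nop2 S w x y + nop2 S w x y'"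
 and nop2_cmul_left: "nop2 S w (frag_cmul k x) y = frag_cmul k (nop2 S w x y)"
 and nop2_cmul_right: "nop2 S w x (frag_cmul k y) = frag_cmul k (nop2 S w x y)"
 and nop2_sum_left: "nop2 S w (\<Sum>i\<in>I. g i) y = (\<Sum>i\<in>I. nop2 S w (g i) y)"
 and nop2_sum_right: "nop2 S w x (\<Sum>i\<in>I. h i) = (\<Sum>i\<in>I. nop2 S w x (h i))"
 by (simp_all add: nop2_def frag_extend_diff frag_extend_add frag_extend_minus frag_extend_cmul
 frag_extend_sum_any frag_extend_diff_fun frag_extend_add_fun frag_extend_cmul_fun
 frag_extend_sum_fun)

lemma nop2_0_universal [simp]: "nop2 S 0 x y = 0"
 and nop2_diff_universal: "nop2 S (w - w') x y = nop2 S w x y - nop2 S w' x y"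
 and nop2_add_universal: "nop2 S (w + w') x y = nop2 S w x y + nop2 S w' x y"
 and nop2_cmul_universal: "nop2 S (frag_cmul k w) x y = frag_cmul k (nop2 S w x y)"
 by (simp_all add: nop2_def push_diff push_add push_minus push_cmul push_sum frag_extend_diff_fun
 frag_extend_add_fun frag_extend_minus_fun frag_extend_cmul_fun)

lemma push_push: "push S g (push S f x) = push S (%a. g (f a)) x"
proof -
 have "restrict (g o restrict (f o c) S) S = restrict ((%a. g (f a)) o c) S" for c :: "point => 'c"
 by (auto simp: restrict_def)
 then show ?thesis
 by (induction x rule: frag_induct) (auto simp: push_diff)
qed

section \<open>Maps from a model into a space and their chains\<close>

lemma maps_on_restrict:
 "continuous_map (rsub S) X c ==> restrict c S : maps_on S X"
 by (auto simp: maps_on_def intro: continuous_map_eq)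

lemma maps_on_compose:
 "c : maps_on S X ==> continuous_map X Y f ==> restrict (f o c) S : maps_on S Y"
 by (intro maps_on_restrict) (auto simp: maps_on_def intro: continuous_map_compose)

lemma maps_on_continuous: "c : maps_on S X ==> continuous_map (rsub S) X c"
 by (simp add: maps_on_def)

lemma maps_on_in: "c : maps_on S X ==> t : S ==> c t : topspace X"
 by (auto simp: maps_on_def continuous_map_def)

lemma maps_on_prod:
 "c : maps_on S X ==> d : maps_on T Y ==>
 continuous_map (prod_topology (rsub S) (rsub T)) (prod_topology X Y) (map_prod c d)"
 using continuous_map_compose[OF continuous_map_fst maps_on_continuous, of c S X "rsub T"]
 continuous_map_compose[OF continuous_map_snd maps_on_continuous, of d T Y "rsub S"]
 unfolding map_prod_def case_prod_unfold by (intro continuous_map_pairedI) (auto simp: o_def)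

lemma chains_0 [simp]: "0 : chains_on S X"
 and chains_of [simp]: "frag_of c : chains_on S X \<longleftrightarrow> c : maps_on S X"
 and chains_cmul: "x : chains_on S X ==> frag_cmul k x : chains_on S X"
 and chains_minus [simp]: "- x : chains_on S X \<longleftrightarrow> x : chains_on S X"
 by (auto simp: chains_on_def)

lemma chains_diff: "x : chains_on S X ==> y : chains_on S X ==> x - y : chains_on S X"
 using keys_diff[of x y] by (auto simp: chains_on_def)

lemma chains_add: "x : chains_on S X ==> y : chains_on S X ==> x + y : chains_on S X"
 using chains_diff[of x S X "- y"] by simp

lemma chains_sum: "(!!i. i : I ==> g i : chains_on S X) ==> (\<Sum>i\<in>I. g i) : chains_on S X"
 by (induction I rule: infinite_finite_induct) (auto simp: chains_add)

lemma chains_induct [consumes 1, case_names zero one diff]: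
 assumes "x : chains_on S X" "P 0" "!!c. c : maps_on S X ==> P (frag_of c)"
 "!!a b. [|a : chains_on S X; b : chains_on S X; P a; P b|] ==> P (a - b)"
 shows "P x"
proof -
 \<comment> \<open>Membership is carried through the induction because the case of differences in
   \<open>P\<close> may assume it.\<close>
 have "x : chains_on S X & P x"
 using assms(1)[unfolded chains_on_def mem_Collect_eq]
 by (induction x rule: frag_induction) (auto intro: assms chains_diff)
 then show ?thesis ..
qed

lemma chains_frag_extend:
 "x : chains_on S X ==> (!!c. c : maps_on S X ==> f c : chains_on T Y) ==> frag_extend f x : chains_on T Y"
 by (induction x rule: chains_induct) (auto simp: frag_extend_diff chains_diff)

lemma push_in_chains:
 "x : chains_on S X ==> continuous_map X Y f ==> push S f x : chains_on S Y"
 unfolding push_def by (erule chains_frag_extend) (simp add: maps_on_compose)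

lemma push_cong:
 assumes "x : chains_on S X" "!!a. a : topspace X ==> f a = g a"
 shows "push S f x = push S g x"
 using assms(1)
proof (induction x rule: chains_induct)
 case (one c)
 then have "restrict (f o c) S = restrict (g o c) S"
 using assms(2) by (auto simp: restrict_def maps_on_in)
 then show ?case by simp
qed (simp_all add: push_diff)

lemma push_id: 
 assumes "x : chains_on S X" "!!a. a : topspace X ==> f a = a"
 shows "push S f x = x"
 using assms(1)
proof (induction x rule: chains_induct)
 case (one c)
 then have "restrict (f o c) S = c"
 using assms(2) maps_on_in[OF one] by (auto simp: restrict_def maps_on_def extensional_def)
 then show ?case by simp
qed (simp_all add: push_diff)

lemma universal_in_chains [simp]: "universal S : chains_on S (rsub S)"
 by (auto simp: universal_def intro!: maps_on_restrict)

lemma nop_in_chains: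
 "u : chains_on T (rsub S) ==> x : chains_on S X ==> nop T u x : chains_on T X"
 unfolding nop_def by (erule chains_frag_extend) (auto intro: push_in_chains maps_on_continuous)

lemma nop2_in_chains:
 assumes "w : chains_on T (prod_topology (rsub A) (rsub B))" "x : chains_on A X" "y : chains_on B Y"
 shows "nop2 T w x y : chains_on T (prod_topology X Y)"
 unfolding nop2_def
 by (intro chains_frag_extend[OF assms(2)] chains_frag_extend[OF assms(3)]
 push_in_chains[OF assms(1)] maps_on_prod)

section \<open>Calculus of universal chains\<close>

lemma push_restrict:
 "u : chains_on T (rsub S) ==> push T (restrict f S) u = push T f u"
 by (erule push_cong) auto

text \<open>Naturality: pushing forward and substituting a universal chain act on opposite sides of
  a map. The terms of \<open>u\<close> take values in \<open>S\<close>, so the restriction to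
  \<open>S\<close> inside \<open>push S f\<close> goes unnoticed.\<close>

lemma nop_push:
 assumes "u : chains_on T (rsub S)"
 shows "nop T u (push S f x) = push T f (nop T u x)"
 by (induction x rule: frag_induct)
 (simp_all add: nop_of nop_diff push_diff push_push push_restrict[OF assms] o_def)

text \<open>Composing natural operators means substituting one universal chain into the other. This
  turns equations between composites into equations between chains on a model.\<close>

lemma nop_nop:
 assumes "v : chains_on T (rsub S)"
 shows "nop T v (nop S u x) = nop T (nop T v u) x"
 by (induction x rule: frag_induct) (simp_all add: nop_of nop_diff nop_push[OF assms])

text \<open>Evaluation at the identity recovers the universal chain, so an operator determines
  it.\<close>

lemma nop_universal:
 assumes "u : chains_on T (rsub S)"
 shows "nop T u (universal S) = u"
 unfolding universal_def nop_of push_restrict[OF assms] by (rule push_id[OF assms]) auto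

lemma universal_nop: "x : chains_on S X ==> nop S (universal S) x = x"
proof (induction x rule: chains_induct)
 case (one c)
 then have "restrict (c o restrict id S) S = c"
 by (auto simp: restrict_def maps_on_def extensional_def)
 then show ?case
 by (simp add: universal_def nop_of)
qed (simp_all add: nop_diff)

lemma nop2_push:
 assumes "w : chains_on T (prod_topology (rsub A) (rsub B))"
 shows "nop2 T w (push A f x) (push B g y) = push T (map_prod f g) (nop2 T w x y)"
proof -
 have *: "push T (map_prod (restrict (f o c) A) (restrict (g o d) B)) w =
 push T (%a. map_prod f g (map_prod c d a)) w" for c d
 by (rule push_cong[OF assms]) auto
 \<comment> \<open>Bilinear identities take two inductions; in the inner one the first argument is a
   generator.\<close>
 have first: "nop2 T w (push A f (frag_of c)) (push B g y) = push T (map_prod f g) (nop2 T w (frag_of c) y)"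
 for c
 by (induction y rule: frag_induct)
 (simp_all add: nop2_of nop2_diff_right push_diff push_push * del: o_apply)
 show ?thesis
 by (induction x rule: frag_induct) (simp_all add: first[simplified] nop2_diff_left push_diff)
qed

lemma nop_nop2:
 assumes "v : chains_on T (rsub S)"
 shows "nop T v (nop2 S w x y) = nop2 T (nop T v w) x y"
proof -
 have first: "nop T v (nop2 S w (frag_of c) y) = nop2 T (nop T v w) (frag_of c) y" for c
 by (induction y rule: frag_induct)
 (simp_all add: nop2_of nop2_diff_right nop_diff nop_push[OF assms])
 show ?thesis
 by (induction x rule: frag_induct) (simp_all add: first nop2_diff_left nop_diff)
qed

lemma nop2_nop:
 assumes "w : chains_on T (prod_topology (rsub A) (rsub B))"
 shows "nop2 T w (nop A u x) (nop B v y) = nop2 T (nop2 T w u v) x y"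
proof -
 have first: "nop2 T w (nop A u (frag_of c)) (nop B v y) = nop2 T (nop2 T w u v) (frag_of c) y" for c
 by (induction y rule: frag_induct)
 (simp_all add: nop_of nop2_of nop2_diff_right nop_diff nop2_push[OF assms])
 show ?thesis
 by (induction x rule: frag_induct) (simp_all add: first nop2_diff_left nop_diff)
qed

lemma nop2_universal:
 assumes "w : chains_on T (prod_topology (rsub A) (rsub B))"
 shows "nop2 T w (universal A) (universal B) = w"
proof -
 have "push T (map_prod (restrict id A) (restrict id B)) w = w"
 by (rule push_id[OF assms]) auto
 then show ?thesis
 by (simp add: universal_def nop2_of)
qed

text \<open>By naturality, associativity has to be checked on the three identity maps only. That
  instance is \<open>eq\<close>, and trilinearity does the rest.\<close>

lemma nop2_assoc:
 assumes w: "w : chains_on T (prod_topology (rsub S) (rsub C))"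
 and w': "w' : chains_on S (prod_topology (rsub A) (rsub B))"
 and v: "v : chains_on T (prod_topology (rsub A) (rsub S'))"
 and v': "v' : chains_on S' (prod_topology (rsub B) (rsub C))"
 and eq: "push T (%((a, b), c). (a, (b, c))) (nop2 T w w' (universal C)) =
 nop2 T v (universal A) v'"
 and xyz: "x : chains_on A X" "y : chains_on B Y" "z : chains_on C Z"
 shows "push T (%((a, b), c). (a, (b, c))) (nop2 T w (nop2 S w' x y) z) =
 nop2 T v x (nop2 S' v' y z)"
proof -
 have base: "push T (%((a, b), c). (a, (b, c))) (nop2 T w (nop2 S w' (frag_of c) (frag_of d)) (frag_of e)) =
 nop2 T v (frag_of c) (nop2 S' v' (frag_of d) (frag_of e))"
 if "c : maps_on A X" "d : maps_on B Y" "e : maps_on C Z" for c d e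
 proof -
 \<comment> \<open>In \<open>eq\<close> an identity occurs as third factor on the left and as first
   factor on the right, hence these two generators are written as images of identities.\<close>
 have 1: "frag_of e = push C e (universal C)" "frag_of c = push A c (universal A)"
 using universal_nop[of "frag_of e" C Z] universal_nop[of "frag_of c" A X] that
 by (simp_all add: nop_of)
 have "push T (%((a, b), c). (a, (b, c))) (nop2 T w (nop2 S w' (frag_of c) (frag_of d)) (frag_of e)) =
 push T (%a. (%((a, b), c). (a, (b, c))) (map_prod (map_prod c d) e a)) (nop2 T w w' (universal C))"
 unfolding nop2_of by (subst 1(1)) (simp add: nop2_push[OF w] push_push)
 also have "(%a. (%((a, b), c). (a, (b, c))) (map_prod (map_prod c d) e a)) =
 (%a. map_prod c (map_prod d e) ((%((a, b), c). (a, (b, c))) a))"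
 by auto
 also have "push T ... (nop2 T w w' (universal C)) =
 push T (map_prod c (map_prod d e)) (nop2 T v (universal A) v')"
 by (subst push_push[symmetric]) (simp add: eq)
 also have "... = nop2 T v (frag_of c) (nop2 S' v' (frag_of d) (frag_of e))"
 unfolding nop2_of by (subst 1(2)) (simp add: nop2_push[OF v])
 finally show ?thesis .
 qed
 have 2: "push T (%((a, b), c). (a, (b, c))) (nop2 T w (nop2 S w' (frag_of c) (frag_of d)) z) =
 nop2 T v (frag_of c) (nop2 S' v' (frag_of d) z)"
 if "c : maps_on A X" "d : maps_on B Y" for c d
 using xyz(3) by (induction z rule: chains_induct)
 (simp_all add: that base nop2_diff_right push_diff)
 have 3: "push T (%((a, b), c). (a, (b, c))) (nop2 T w (nop2 S w' (frag_of c) y) z) =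
 nop2 T v (frag_of c) (nop2 S' v' y z)"
 if "c : maps_on A X" for c
 using xyz(2) by (induction y rule: chains_induct)
 (simp_all add: that 2 nop2_diff_right nop2_diff_left push_diff)
 show ?thesis
 using xyz(1) by (induction x rule: chains_induct)
 (simp_all add: 3 nop2_diff_right nop2_diff_left push_diff)
qed

lemma nop2_swap:
 "push T prod.swap (nop2 T w x y) = nop2 T (push T prod.swap w) y x"
proof -
 have first: "push T prod.swap (nop2 T w (frag_of c) y) = nop2 T (push T prod.swap w) y (frag_of c)" for c
 proof (induction y rule: frag_induct)
 case (one d)
 show ?case
 by (simp add: nop2_of push_push prod.swap_def)
 qed (simp_all add: nop2_diff_right nop2_diff_left push_diff)
 show ?thesis
 by (induction x rule: frag_induct)
 (simp_all add: first nop2_diff_right nop2_diff_left push_diff)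
qed


section \<open>Natural relations\<close>

lemma group_closure_add: "x : group_closure S ==> y : group_closure S ==> x + y : group_closure S"
 by (rule group_closure.intros(2)[of x S "- y", simplified])
 (auto intro: group_closure.intros(2)[of 0 S y, simplified] group_closure.intros)

lemma group_closure_additive:
 assumes "x : group_closure S" "!!a b. h (a - b) = h a - h b"
 "!!s. s : S ==> h s : group_closure T"
 shows "h x : group_closure T"
proof -
 have "h 0 = 0" using assms(2)[of 0 0] by simp
 from assms(1) show ?thesis
 proof induction
 \<comment> \<open>The base rule of \<open>group_closure\<close> admits 0 along with the
   generators.\<close>
 case (base s)
 then show ?case
 using assms(3) \<open>h 0 = 0\<close> group_closure.base[of 0 T] by auto
 qed (auto simp: assms(2) intro: group_closure.diff)
qed

text \<open>An empty \<open>E\<close> is allowed, so singular chains, which have no relations, and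
  ordered cubes share the whole theory.\<close>

definition relations :: "point set => point chain set => 'a topology => 'a chain set" where
 "relations S E X = group_closure {push S c r | c r. c : maps_on S X & r : E}"

lemma relations_gen: "c : maps_on S X ==> r : E ==> push S c r : relations S E X"
 unfolding relations_def by (intro group_closure.intros) auto

lemma relations_0 [simp]: "0 : relations S E X"
 unfolding relations_def by (intro group_closure.intros) auto

lemma relations_diff: "x : relations S E X ==> y : relations S E X ==> x - y : relations S E X"
 unfolding relations_def by (rule group_closure.diff)

lemma relations_minus: "x : relations S E X ==> - x : relations S E X"
 using relations_diff[of 0 S E X x] by simp

lemma relations_add: "x : relations S E X ==> y : relations S E X ==> x + y : relations S E X"
 unfolding relations_def by (rule group_closure_add)

lemma relations_sum: "(!!i. i : I ==> g i : relations S E X) ==> (\<Sum>i\<in>I. g i) : relations S E X"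
 by (induction I rule: infinite_finite_induct) (auto simp: relations_add)

lemma relations_cmul: "x : relations S E X ==> frag_cmul k x : relations S E X"
 by (rule frag_closure_minus_cmul) (auto intro: relations_diff)

lemma relations_empty [simp]: "relations S {} X = {0}"
proof -
 have "x = 0" if "x : group_closure {}" for x :: "'a chain"
 using that by induction auto
 then show ?thesis
 by (auto simp: relations_def intro: group_closure.intros)
qed

lemma relations_additive:
 assumes "x : relations S E X" "!!a b. h (a - b) = h a - h b"
 "!!c r. c : maps_on S X ==> r : E ==> h (push S c r) : relations T F Y"
 shows "h x : relations T F Y"
 using assms(1) unfolding relations_def
 by (rule group_closure_additive) (use assms(2,3) in \<open>auto simp: relations_def\<close>)

lemma relations_in_chains:
 assumes "x : relations S E X" "E \<subseteq> chains_on S (rsub S)"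
 shows "x : chains_on S X"
 using assms(1) unfolding relations_def
proof induction
 case (base s)
 then show ?case
 using assms(2) by (auto intro!: push_in_chains maps_on_continuous)
qed (auto intro: chains_diff)

lemma relations_push:
 assumes "x : relations S E X" "continuous_map X Y f" "E \<subseteq> chains_on S (rsub S)"
 shows "push S f x : relations S E Y"
 using assms(1) push_diff
proof (rule relations_additive)
 fix c r assume c: "c : maps_on S X" and r: "r : E"
 have "push S f (push S c r) = push S (restrict (f o c) S) r"
 using r assms(3) by (subst push_restrict) (auto simp: push_push o_def)
 also have "... : relations S E Y"
 using c r assms(2) by (intro relations_gen maps_on_compose)
 finally show "push S f (push S c r) : relations S E Y" .
qed

lemma relations_universal: "r : E ==> E \<subseteq> chains_on S (rsub S) ==> r : relations S E (rsub S)"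
 using relations_gen[of "restrict id S" S "rsub S" r E] push_id[of r S "rsub S" "restrict id S"]
 maps_on_restrict[of S "rsub S" id]
 by auto

text \<open>Here the universal chain itself is a relation, so the operator vanishes modulo relations
  on every chain. In \<open>nop_relations\<close> it is the argument that is a relation.\<close>

lemma nop_in_relations:
 assumes "u : relations T F (rsub S)" "F \<subseteq> chains_on T (rsub T)" "x : chains_on S X"
 shows "nop T u x : relations T F X"
 using assms(3)
 by (induction x rule: chains_induct)
 (auto simp: nop_of nop_diff
 intro: relations_diff relations_push[OF assms(1) maps_on_continuous assms(2)])

lemma nop2_in_relations:
 assumes "w : relations T F (prod_topology (rsub A) (rsub B))" "F \<subseteq> chains_on T (rsub T)"
 "x : chains_on A X" "y : chains_on B Y"
 shows "nop2 T w x y : relations T F (prod_topology X Y)"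
proof -
 have "nop2 T w (frag_of c) y : relations T F (prod_topology X Y)" if "c : maps_on A X" for c
 using assms(4)
 by (induction y rule: chains_induct)
 (auto simp: nop2_of nop2_diff_right
 intro!: relations_diff relations_push[OF assms(1) _ assms(2)] maps_on_prod that)
 with assms(3) show ?thesis
 by (induction x rule: chains_induct) (auto simp: nop2_diff_left intro!: relations_diff)
qed


text \<open>A general relation is the image of some \<open>r\<close> on the model, and naturality
  transports the test on \<open>r\<close> along that map.\<close>

lemma nop_relations:
 assumes "x : relations S E X" "u : chains_on T (rsub S)" "F \<subseteq> chains_on T (rsub T)"
 "!!r. r : E ==> nop T u r : relations T F (rsub S)"
 shows "nop T u x : relations T F X"
 using assms(1) nop_diff
proof (rule relations_additive)
 fix c r assume c: "c : maps_on S X" and r: "r : E"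
 show "nop T u (push S c r) : relations T F X"
 using relations_push[OF assms(4)[OF r] maps_on_continuous[OF c] assms(3)]
 by (simp add: nop_push[OF assms(2)])
qed

text \<open>A generator in the second argument is the image of the identity of \<open>B\<close>, so
  testing against \<open>universal B\<close> is enough.\<close>

lemma nop2_relations_left:
 assumes "x : relations A E X" "y : chains_on B Y"
 and w: "w : chains_on T (prod_topology (rsub A) (rsub B))" and "F \<subseteq> chains_on T (rsub T)"
 and E: "!!r. r : E ==> nop2 T w r (universal B) : relations T F (prod_topology (rsub A) (rsub B))"
 shows "nop2 T w x y : relations T F (prod_topology X Y)"
 using assms(1) nop2_diff_left
proof (rule relations_additive)
 fix c r assume c: "c : maps_on A X" and r: "r : E"
 show "nop2 T w (push A c r) y : relations T F (prod_topology X Y)"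
 using assms(2)
 proof (induction y rule: chains_induct)
 case (one d)
 then have "frag_of d = push B d (universal B)"
 using universal_nop[of "frag_of d" B Y] by (simp add: nop_of)
 then show ?case
 using c one by (auto simp: nop2_push[OF w] intro!: relations_push[OF E[OF r] _ assms(4)] maps_on_prod)
 qed (auto simp: nop2_diff_right intro: relations_diff)
qed

lemma nop2_relations_right:
 assumes "y : relations B E Y" "x : chains_on A X"
 and w: "w : chains_on T (prod_topology (rsub A) (rsub B))" and "F \<subseteq> chains_on T (rsub T)"
 and E: "!!r. r : E ==> nop2 T w (universal A) r : relations T F (prod_topology (rsub A) (rsub B))"
 shows "nop2 T w x y : relations T F (prod_topology X Y)"
 using assms(1) nop2_diff_right
proof (rule relations_additive)
 fix c r assume c: "c : maps_on B Y" and r: "r : E"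
 show "nop2 T w x (push B c r) : relations T F (prod_topology X Y)"
 using assms(2)
 proof (induction x rule: chains_induct)
 case (one d)
 then have "frag_of d = push A d (universal A)"
 using universal_nop[of "frag_of d" A X] by (simp add: nop_of)
 then show ?case
 using c one by (auto simp: nop2_push[OF w] intro!: relations_push[OF E[OF r] _ assms(4)] maps_on_prod)
 qed (auto simp: nop2_diff_left intro: relations_diff)
qed

section \<open>Models of chains with products\<close>

text \<open>Every function into such a space is continuous. List surgery and arbitrary functions
  thereby fall under the lemmas on push-forward along continuous maps; \<open>Rel_coarse\<close>
  leads back to the given topology.\<close>

definition coarse :: "'a set => 'a topology" where
 "coarse U = topology (%V. V = {} \<or> V = U)"

lemma openin_coarse: "openin (coarse U) V \<longleftrightarrow> V = {} \<or> V = U"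
proof -
 have "istopology (%V. V = {} \<or> V = U)"
 by (auto simp: istopology_def)
 then show ?thesis
 by (simp add: coarse_def)
qed

lemma topspace_coarse [simp]: "topspace (coarse U) = U"
 by (auto simp: topspace_def openin_coarse)

lemma continuous_map_coarse [simp]: "continuous_map X (coarse U) f \<longleftrightarrow> f : topspace X \<rightarrow> U"
proof -
 have "{x : topspace X. f x : U} = topspace X" if "f : topspace X \<rightarrow> U"
 using that by auto
 then show ?thesis
 by (auto simp: continuous_map_def openin_coarse)
qed

lemma chains_on_coarse: "x : chains_on S X ==> topspace X \<subseteq> U ==> x : chains_on S (coarse U)"
 by (fastforce simp: chains_on_def maps_on_def continuous_map_def[of _ X])

abbreviation lists_of_length :: "nat => 'a list topology" where
 "lists_of_length n \<equiv> coarse {as. length as = n}"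

text \<open>Degrees are carried beside the chains, because a formal sum of functions does not record
  its degree; 0 has every degree.\<close>

definition sdeg :: "(nat \<times> 'c) list => nat" where
 "sdeg r = sum_list (map fst r)"

lemma sdeg_simps [simp]:
 "sdeg [] = 0" "sdeg (e # r) = fst e + sdeg r"
 "sdeg (r @ r') = sdeg r + sdeg r'"
 by (simp_all add: sdeg_def)

text \<open>Exponent of the Koszul sign for bringing factors of degrees \<open>q\<close> into the
  order \<open>js\<close>: every pair whose order is reversed contributes the product of its
  degrees.\<close>

fun inversion_weight :: "(nat => nat) => nat list => nat" where
 "inversion_weight q [] = 0"
| "inversion_weight q (j # js) = (\<Sum>i\<in>set js \<inter> {..<j}. q j * q i) + inversion_weight q js"

text \<open>A largest index is inverted with precisely the entries behind it. This is the sign in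
  the induction step of \<open>sprod_permute\<close>.\<close>

lemma inversion_weight_insert:
 assumes "\<forall>i\<in>set (u @ v). i < k"
 shows "inversion_weight q (u @ k # v) = inversion_weight q (u @ v) + q k * (\<Sum>i\<in>set v. q i)"
 using assms
proof (induction u)
 case Nil
 then have "set v \<inter> {..<k} = set v" by auto
 then show ?case by (simp add: sum_distrib_left)
next
 case (Cons j u)
 then have "set (u @ k # v) \<inter> {..<j} = set (u @ v) \<inter> {..<j}" by auto
 with Cons show ?case
 by (simp only: append_Cons inversion_weight.simps) simp
qed

text \<open>The product topology, transported to lists because the composition of an operad takes
  its arguments as a list.\<close>

definition ltop :: "'a topology list => 'a list topology" where
 "ltop Xs = pullback_topology {as. length as = length Xs}
 (%as. \<lambda>i\<in>{..<length Xs}. as ! i) (product_topology (%i. Xs ! i) {..<length Xs})"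

lemma topspace_ltop:
 "topspace (ltop Xs) =
 {as. length as = length Xs & (\<forall>i<length Xs. as ! i : topspace (Xs ! i))}"
proof (rule Set.set_eqI)
 fix as
 have "as : topspace (ltop Xs) \<longleftrightarrow> length as = length Xs \<and>
 (\<lambda>i\<in>{..<length Xs}. as ! i) : (\<Pi>\<^sub>E i\<in>{..<length Xs}. topspace (Xs ! i))"
 by (simp add: ltop_def topspace_pullback_topology conj_commute)
 also have "... \<longleftrightarrow> length as = length Xs & (\<forall>i<length Xs. as ! i : topspace (Xs ! i))"
 by (simp add: PiE_iff Ball_def)
 finally show "as : topspace (ltop Xs) \<longleftrightarrow>
 as : {as. length as = length Xs & (\<forall>i<length Xs. as ! i : topspace (Xs ! i))}"
 by simp
qed

lemma continuous_map_into_ltop: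
 assumes "!!z. z : topspace Z ==> length (f z) = length Xs"
 and "!!i. i < length Xs ==> continuous_map Z (Xs ! i) (%z. f z ! i)"
 shows "continuous_map Z (ltop Xs) f"
 unfolding ltop_def using assms
 by (intro continuous_map_pullback') (auto simp: continuous_map_componentwise o_def)

lemma continuous_map_nth_ltop:
 assumes "i < length Xs"
 shows "continuous_map (ltop Xs) (Xs ! i) (%as. as ! i)"
proof -
 have "continuous_map (ltop Xs) (Xs ! i) ((%x. x i) o (%as. \<lambda>i\<in>{..<length Xs}. as ! i))"
 unfolding ltop_def using assms
 by (intro continuous_map_pullback continuous_map_product_projection) auto
 then show ?thesis
 using assms by (simp add: o_def)
qed

lemma continuous_map_append:
 "continuous_map (prod_topology (ltop Xs) (ltop Ys)) (ltop (Xs @ Ys))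
 (%(as, bs). as @ bs)"
proof (rule continuous_map_into_ltop)
 fix i assume i: "i < length (Xs @ Ys)"
 let ?P = "prod_topology (ltop Xs) (ltop Ys)"
 show "continuous_map ?P ((Xs @ Ys) ! i) (%z. (case z of (as, bs) => as @ bs) ! i)"
 proof (cases "i < length Xs")
 case True
 have "continuous_map ?P (Xs ! i) ((%as. as ! i) o fst)"
 using True by (rule continuous_map_compose[OF continuous_map_fst continuous_map_nth_ltop])
 then show ?thesis
 using True by (auto simp: nth_append topspace_ltop elim!: continuous_map_eq)
 next
 case False
 have "continuous_map ?P (Ys ! (i - length Xs)) ((%as. as ! (i - length Xs)) o snd)"
 using False i by (intro continuous_map_compose[OF continuous_map_snd continuous_map_nth_ltop]) auto
 then show ?thesis
 using False by (auto simp: nth_append topspace_ltop elim!: continuous_map_eq)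
 qed
qed (auto simp: topspace_ltop)

text \<open>
 The faces, the decompositions of products and the relations of a model are given by the
 universal chains \<open>bd\<close>, \<open>pr\<close> and \<open>rel\<close>. By \<open>rel_keys\<close> a relation between maps that are
 merely functions into a space is a relation of the space as soon as it involves one
 continuous map.
\<close>

locale chain_model =
 fixes dom :: "nat => point set"
 and pt :: "point"
 and bd :: "nat => point chain"
 and pr :: "nat => nat => (point \<times> point) chain"
 and rel :: "nat => point chain set"
 assumes dom_0: "dom 0 = {pt}"
 and bd_in: "bd p : chains_on (dom (p - 1)) (rsub (dom p))"
 and bd_0: "bd 0 = 0"
 and bd_bd: "nop (dom (p - 1 - 1)) (bd (p - 1)) (bd p) = 0"
 and pr_in: "pr p q : chains_on (dom (p + q)) (prod_topology (rsub (dom p)) (rsub (dom q)))"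
 and bd_pr: "nop (dom (p + q - 1)) (bd (p + q)) (pr p q) =
 nop2 (dom (p + q - 1)) (pr (p - 1) q) (bd p) (universal (dom q)) +
 frag_cmul ((- 1) ^ p) (nop2 (dom (p + q - 1)) (pr p (q - 1)) (universal (dom p)) (bd q))"
 and pr_assoc: "push (dom (p + q + s)) (%((a, b), c). (a, (b, c)))
 (nop2 (dom (p + q + s)) (pr (p + q) s) (pr p q) (universal (dom s))) =
 nop2 (dom (p + q + s)) (pr p (q + s)) (universal (dom p)) (pr q s)"
 and pr_swap: "push (dom (p + q)) prod.swap (pr p q) - frag_cmul ((- 1) ^ (p * q)) (pr q p)
 : relations (dom (p + q)) (rel (p + q)) (prod_topology (rsub (dom q)) (rsub (dom p)))"
 and pr_0: "pr p 0 = frag_of (\<lambda>t\<in>dom p. (t, pt))" "pr 0 p = frag_of (\<lambda>t\<in>dom p. (pt, t))"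
 and rel_in: "rel p \<subseteq> chains_on (dom p) (rsub (dom p))"
 and rel_bd: "r : rel p ==>
 nop (dom (p - 1)) (bd p) r : relations (dom (p - 1)) (rel (p - 1)) (rsub (dom p))"
 and rel_pr: "r : rel p ==> nop2 (dom (p + q)) (pr p q) r (universal (dom q))
 : relations (dom (p + q)) (rel (p + q)) (prod_topology (rsub (dom p)) (rsub (dom q)))"
 "r : rel p ==> nop2 (dom (q + p)) (pr q p) (universal (dom q)) r
 : relations (dom (q + p)) (rel (q + p)) (prod_topology (rsub (dom q)) (rsub (dom p)))"
 and rel_keys: "r : rel p ==> k : Poly_Mapping.keys r ==>
 \<exists>e\<in>maps_on (dom p) (rsub (dom p)). push (dom p) (k o e) r = r"
begin

abbreviation Ch :: "nat => 'a topology => 'a chain set" where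
 "Ch n X \<equiv> chains_on (dom n) X"

abbreviation Rel :: "nat => 'a topology => 'a chain set" where
 "Rel n X \<equiv> relations (dom n) (rel n) X"

abbreviation mp :: "nat => ('a => 'b) => 'a chain => 'b chain" where
 "mp n \<equiv> push (dom n)"

abbreviation any_chain :: "nat => 'a chain => bool" where
 "any_chain n x \<equiv> x : Ch n (coarse UNIV)"

definition bdry :: "nat => 'a chain => 'a chain" where
 "bdry p x = nop (dom (p - 1)) (bd p) x"

definition prd :: "nat => nat => 'a chain => 'b chain => ('a \<times> 'b) chain" where
 "prd p q x y = nop2 (dom (p + q)) (pr p q) x y"

definition pnt :: "'a => 'a chain" where
 "pnt a = frag_of (\<lambda>t\<in>dom 0. a)"

text \<open>Concatenation absorbs the rebracketing of tuples, so this product is strictly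
  associative, with the point chain of the empty list as strict unit.\<close>

definition star :: "nat => nat => 'a list chain => 'a list chain => 'a list chain" where
 "star p q x y = mp (p + q) (%(as, bs). as @ bs) (prd p q x y)"

abbreviation sgl :: "nat => 'a chain => 'a list chain" where
 "sgl q \<equiv> mp q (%a. [a])"

text \<open>Nested to the right, unlike the recursions in the definitions of the operads;
  \<open>iterated_product_eq_sprod\<close> compares the two.\<close>

fun sprod :: "(nat \<times> 'a chain) list => 'a list chain" where
 "sprod [] = pnt []"
| "sprod ((q, y) # r) = star q (sdeg r) (sgl q y) (sprod r)"

text \<open>Taken over a coarse space, so that lists may be rearranged by any function; continuity
  is recovered once and for all in \<open>Rel_coarse\<close>.\<close>

definition cong :: "nat => nat => 'a list chain => 'a list chain => bool" where
 "cong n k x y \<longleftrightarrow> x - y : Rel n (lists_of_length k)"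

section \<open>Boundaries, products and relations of a model\<close>

lemma any_chain_of: "x : Ch n X ==> any_chain n x"
 by (erule chains_on_coarse) simp

lemma bdry_in: "x : Ch p X ==> bdry p x : Ch (p - 1) X"
 unfolding bdry_def by (rule nop_in_chains[OF bd_in])

lemma bdry_mp: "bdry p (mp p f x) = mp (p - 1) f (bdry p x)"
 unfolding bdry_def by (rule nop_push[OF bd_in])

lemma bdry_0 [simp]: "bdry 0 x = 0"
 by (simp add: bdry_def bd_0)

lemma bdry_zero [simp]: "bdry p 0 = 0"
 by (simp add: bdry_def)

lemma bdry_bdry: "bdry (p - 1) (bdry p x) = 0"
 unfolding bdry_def nop_nop[OF bd_in] bd_bd nop_0_left ..

lemma bdry_diff: "bdry p (x - y) = bdry p x - bdry p y"
 by (simp add: bdry_def nop_diff)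

lemma Rel_in_Ch: "x : Rel n X ==> x : Ch n X"
 by (erule relations_in_chains[OF _ rel_in])

lemma mp_Rel: "x : Rel n X ==> continuous_map X Y f ==> mp n f x : Rel n Y"
 by (erule (1) relations_push[OF _ _ rel_in])

lemma bdry_Rel: "x : Rel n X ==> bdry n x : Rel (n - 1) X"
 unfolding bdry_def by (erule nop_relations[OF _ bd_in rel_in rel_bd])

text \<open>The projection \<open>proj\<close> onto the generators that are continuous maps into
  \<open>X\<close> fixes \<open>x\<close>. An image of a relation is either kept or sent to 0 by it:
  one continuous term makes the whole of it a relation of \<open>X\<close>, by
  \<open>rel_keys\<close>.\<close>

lemma Rel_coarse:
 assumes "x : Rel n (coarse UNIV)" "x : Ch n X"
 shows "x : Rel n X"
proof -
 define proj where "proj = frag_extend (%c. if c : maps_on (dom n) X then frag_of c else 0)"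
 have "proj x : Rel n X"
 using assms(1)
 proof (rule relations_additive)
 fix c r assume r: "r : rel n"
 show "proj (mp n c r) : Rel n X"
 proof (cases "\<exists>k\<in>Poly_Mapping.keys r. restrict (c o k) (dom n) : maps_on (dom n) X")
 case True
 then obtain k where k: "k : Poly_Mapping.keys r" "restrict (c o k) (dom n) : maps_on (dom n) X"
 by blast
 \<comment> \<open>Since \<open>k o e\<close> leaves \<open>r\<close> unchanged, \<open>c\<close>
   can be replaced by the composite of \<open>c\<close>, \<open>k\<close> and \<open>e\<close>,
   which is continuous because \<open>c o k\<close> is.\<close>
 obtain e where e: "e : maps_on (dom n) (rsub (dom n))" "mp n (k o e) r = r"
 using rel_keys[OF r k(1)] by blast
 have "restrict (restrict (c o k) (dom n) o e) (dom n) : maps_on (dom n) X"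
 using e(1) k(2) by (intro maps_on_compose) (auto dest: maps_on_continuous)
 then have "mp n (restrict (restrict (c o k) (dom n) o e) (dom n)) r : Rel n X"
 using r by (rule relations_gen)
 moreover have "mp n (restrict (restrict (c o k) (dom n) o e) (dom n)) r = mp n c (mp n (k o e) r)"
 unfolding push_push using r rel_in maps_on_in[OF e(1)] by (intro push_cong[of _ _ "rsub (dom n)"]) auto
 ultimately have *: "mp n c r : Rel n X"
 by (simp add: e)
 have "proj y = y" if "y : Ch n X" for y
 using that unfolding proj_def by (induction y rule: chains_induct) (auto simp: frag_extend_diff)
 with * show ?thesis
 by (simp add: Rel_in_Ch)
 next
 case False
 have "proj (mp n c r) = frag_extend (%k. proj (frag_of (restrict (c o k) (dom n)))) r"
 unfolding push_def by (rule frag_extend_fun_commute) (simp_all add: proj_def frag_extend_diff)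
 also have "... = 0"
 using False by (intro frag_extend_eq_0) (auto simp: proj_def)
 finally show ?thesis by simp
 qed
 qed (simp add: proj_def frag_extend_diff)
 moreover have "proj x = x"
 using assms(2) unfolding proj_def by (induction x rule: chains_induct) (auto simp: frag_extend_diff)
 ultimately show ?thesis by simp
qed

lemma prd_in: "x : Ch p X ==> y : Ch q Y ==> prd p q x y : Ch (p + q) (prod_topology X Y)"
 unfolding prd_def by (rule nop2_in_chains[OF pr_in])

lemma prd_mp: "prd p q (mp p f x) (mp q g y) = mp (p + q) (map_prod f g) (prd p q x y)"
 unfolding prd_def by (rule nop2_push[OF pr_in])

lemma bdry_prd:
 assumes "any_chain p x" "any_chain q y"
 shows "bdry (p + q) (prd p q x y) =
 prd (p - 1) q (bdry p x) y + frag_cmul ((- 1) ^ p) (prd p (q - 1) x (bdry q y))"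
proof -
 \<comment> \<open>For \<open>p = 0\<close> the truncated \<open>p - 1\<close> yields the wrong
   domain, but then \<open>bd 0 = 0\<close> makes both sides vanish. The same happens for
   \<open>q\<close> below.\<close>
 have "prd (p - 1) q (bdry p x) y = nop2 (dom (p + q - 1)) (pr (p - 1) q) (nop (dom (p - 1)) (bd p) x) y"
 by (cases p) (simp_all add: prd_def bdry_def bd_0)
 also have "... = nop2 (dom (p + q - 1)) (nop2 (dom (p + q - 1)) (pr (p - 1) q) (bd p) (universal (dom q))) x y"
 proof (cases p)
 case (Suc p')
 show ?thesis
 using nop2_nop[OF pr_in, of "p - 1" q "bd p" x "universal (dom q)" y] Suc
 by (simp add: universal_nop[OF assms(2)])
 qed (simp add: bd_0)
 finally have 1: "prd (p - 1) q (bdry p x) y = ..." .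
 have "prd p (q - 1) x (bdry q y) = nop2 (dom (p + q - 1)) (pr p (q - 1)) x (nop (dom (q - 1)) (bd q) y)"
 by (cases q) (simp_all add: prd_def bdry_def bd_0)
 also have "... = nop2 (dom (p + q - 1)) (nop2 (dom (p + q - 1)) (pr p (q - 1)) (universal (dom p)) (bd q)) x y"
 proof (cases q)
 case (Suc q')
 show ?thesis
 using nop2_nop[OF pr_in, of p "q - 1" "universal (dom p)" x "bd q" y] Suc
 by (simp add: universal_nop[OF assms(1)])
 qed (simp add: bd_0)
 finally have 2: "prd p (q - 1) x (bdry q y) = ..." .
 have "bdry (p + q) (prd p q x y) = nop2 (dom (p + q - 1)) (nop (dom (p + q - 1)) (bd (p + q)) (pr p q)) x y"
 unfolding bdry_def prd_def by (rule nop_nop2[OF bd_in])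
 then show ?thesis
 unfolding 1 2 bd_pr by (simp only: nop2_add_universal nop2_cmul_universal)
qed

lemma prd_assoc:
 assumes "any_chain p x" "any_chain q y" "any_chain s z"
 shows "mp (p + q + s) (%((a, b), c). (a, (b, c))) (prd (p + q) s (prd p q x y) z) =
 prd p (q + s) x (prd q s y z)"
proof -
 have "pr p (q + s) : chains_on (dom (p + q + s)) (prod_topology (rsub (dom p)) (rsub (dom (q + s))))"
 using pr_in[of p "q + s"] by (simp add: add.assoc)
 from nop2_assoc[OF pr_in pr_in this pr_in pr_assoc assms] show ?thesis
 by (simp add: prd_def add.assoc)
qed

lemma prd_diff:
 "prd p q (x - x') y = prd p q x y - prd p q x' y" "prd p q x (y - y') = prd p q x y - prd p q x y'"
 by (simp_all add: prd_def nop2_diff_left nop2_diff_right)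

lemma prd_Rel:
 "x : Rel p X ==> y : Ch q Y ==> prd p q x y : Rel (p + q) (prod_topology X Y)"
 "x : Ch p X ==> y : Rel q Y ==> prd p q x y : Rel (p + q) (prod_topology X Y)"
 unfolding prd_def
 by (erule (1) nop2_relations_left[OF _ _ pr_in rel_in rel_pr(1)], assumption)
 (erule nop2_relations_right[OF _ _ pr_in rel_in rel_pr(2)], assumption+)

lemma prd_swap:
 assumes "x : Ch p X" "y : Ch q Y"
 shows "mp (p + q) prod.swap (prd p q x y) - frag_cmul ((- 1) ^ (p * q)) (prd q p y x)
 : Rel (p + q) (prod_topology Y X)"
proof -
 have "mp (p + q) prod.swap (prd p q x y) - frag_cmul ((- 1) ^ (p * q)) (prd q p y x) =
 nop2 (dom (p + q)) (mp (p + q) prod.swap (pr p q) - frag_cmul ((- 1) ^ (p * q)) (pr q p)) y x"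
 by (simp add: prd_def nop2_swap nop2_diff_universal nop2_cmul_universal add.commute)
 also have "... : Rel (p + q) (prod_topology Y X)"
 by (rule nop2_in_relations[OF pr_swap rel_in assms(2,1)])
 finally show ?thesis .
qed

lemma pnt_in: "a : topspace X ==> pnt a : Ch 0 X"
 by (auto simp: pnt_def intro!: maps_on_restrict)

lemma mp_pnt: "mp 0 f (pnt a) = pnt (f a)"
 by (simp add: pnt_def restrict_def o_def) (auto intro!: arg_cong[of _ _ frag_of])

lemma prd_pnt:
 assumes "any_chain p x"
 shows "prd p 0 x (pnt a) = mp p (%b. (b, a)) x" "prd 0 p (pnt a) x = mp p (%b. (a, b)) x"
proof -
 have "nop2 (dom p) (pr p 0) x (pnt a) = mp p (%b. (b, a)) x \<and>
 nop2 (dom p) (pr 0 p) (pnt a) x = mp p (%b. (a, b)) x"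
 using assms
 proof (induction x rule: chains_induct)
 case (one c)
 have "restrict (map_prod c (\<lambda>t\<in>dom 0. a) o (\<lambda>t\<in>dom p. (t, pt))) (dom p) =
 restrict ((%b. (b, a)) o c) (dom p)"
 "restrict (map_prod (\<lambda>t\<in>dom 0. a) c o (\<lambda>t\<in>dom p. (pt, t))) (dom p) =
 restrict ((%b. (a, b)) o c) (dom p)"
 by (auto simp: dom_0 restrict_def)
 then show ?case
 by (simp add: pnt_def nop2_of pr_0)
 qed (simp_all add: nop2_diff_left nop2_diff_right push_diff)
 then show "prd p 0 x (pnt a) = mp p (%b. (b, a)) x" "prd 0 p (pnt a) x = mp p (%b. (a, b)) x"
 by (simp_all add: prd_def)
qed


subsection \<open>Iterated products\<close>

lemma star_in:
 assumes "x : Ch p (lists_of_length m)" "y : Ch q (lists_of_length n)"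
 shows "star p q x y : Ch (p + q) (lists_of_length (m + n))"
 unfolding star_def by (rule push_in_chains[OF prd_in[OF assms]]) auto

lemma star_assoc:
 assumes "any_chain p x" "any_chain q y" "any_chain s z"
 shows "star (p + q) s (star p q x y) z = star p (q + s) x (star q s y z)"
proof -
 have "star (p + q) s (star p q x y) z = mp (p + q + s) (%(as, bs). as @ bs)
 (prd (p + q) s (mp (p + q) (%(as, bs). as @ bs) (prd p q x y)) (mp s (%b. b) z))"
 unfolding star_def using push_id[OF assms(3), of "%b. b"] by simp
 also have "... = mp (p + q + s) (%(as, bs, cs). as @ bs @ cs)
 (mp (p + q + s) (%((a, b), c). (a, (b, c))) (prd (p + q) s (prd p q x y) z))"
 by (simp add: prd_mp push_push case_prod_unfold)
 also have "... = mp (p + (q + s)) (%(as, bs, cs). as @ bs @ cs) (prd p (q + s) x (prd q s y z))"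
 by (simp add: prd_assoc[OF assms, unfolded add.assoc] add.assoc)
 also have "... = mp (p + (q + s)) (%(as, bs). as @ bs)
 (prd p (q + s) (mp p (%b. b) x) (mp (q + s) (%(as, bs). as @ bs) (prd q s y z)))"
 by (simp add: prd_mp push_push case_prod_unfold)
 also have "... = star p (q + s) x (star q s y z)"
 unfolding star_def using push_id[OF assms(1), of "%b. b"] by simp
 finally show ?thesis .
qed

lemma star_pnt:
 assumes "any_chain p x"
 shows "star p 0 x (pnt []) = x" "star 0 p (pnt []) x = x"
 by (simp_all add: star_def prd_pnt[OF assms] push_push push_id[OF assms])

text \<open>The condition on \<open>h\<close> concerns only concatenations of points of the two
  spaces, so \<open>h\<close> may cut a list at a known length.\<close>

lemma star_mp:
 assumes "x : Ch p X" "y : Ch q Y"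
 and "!!as bs. as : topspace X ==> bs : topspace Y ==> h (as @ bs) = f as @ g bs"
 shows "star p q (mp p f x) (mp q g y) = mp (p + q) h (star p q x y)"
 unfolding star_def prd_mp push_push
 by (rule push_cong[OF prd_in[OF assms(1,2)]]) (auto simp: assms(3))

lemma star_0 [simp]: "star p q 0 y = 0" "star p q x 0 = 0"
 by (simp_all add: star_def prd_def)

lemma star_diff:
 "star p q (x - x') y = star p q x y - star p q x' y"
 "star p q x (y - y') = star p q x y - star p q x y'"
 by (simp_all add: star_def prd_diff push_diff)

lemma star_cmul:
 "star p q (frag_cmul k x) y = frag_cmul k (star p q x y)"
 "star p q x (frag_cmul k y) = frag_cmul k (star p q x y)"
 by (simp_all add: star_def prd_def nop2_cmul_left nop2_cmul_right push_cmul)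

lemma star_sum: "star p q x (\<Sum>i\<in>I. h i) = (\<Sum>i\<in>I. star p q x (h i))"
 by (simp add: star_def prd_def nop2_sum_right push_sum)

lemma star_bdry:
 assumes "any_chain p x" "any_chain q y"
 shows "bdry (p + q) (star p q x y) =
 star (p - 1) q (bdry p x) y + frag_cmul ((- 1) ^ p) (star p (q - 1) x (bdry q y))"
proof -
 have 1: "mp (p + q - 1) (%(as, bs). as @ bs) (prd (p - 1) q (bdry p x) y) = star (p - 1) q (bdry p x) y"
 by (cases p) (simp_all add: star_def prd_def)
 have 2: "mp (p + q - 1) (%(as, bs). as @ bs) (prd p (q - 1) x (bdry q y)) = star p (q - 1) x (bdry q y)"
 by (cases q) (simp_all add: star_def prd_def)
 show ?thesis
 by (subst star_def) (simp only: bdry_mp bdry_prd[OF assms] push_add push_cmul 1 2)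
qed

section \<open>Congruence modulo relations\<close>

lemma cong_refl [simp]: "cong n k x x"
 by (simp add: cong_def)

lemma cong_trans [trans]: "cong n k x y ==> cong n k y z ==> cong n k x z"
 using relations_add[of "x - y" _ _ _ "y - z"] by (simp add: cong_def)

lemma cong_sym: "cong n k x y ==> cong n k y x"
 using relations_minus[of "x - y"] by (simp add: cong_def)

lemma cong_cmul: "cong n k x y ==> cong n k (frag_cmul a x) (frag_cmul a y)"
 using relations_cmul[of "x - y" _ _ _ a] by (simp add: cong_def frag_cmul_diff_distrib2)

lemma cong_mp: 
 assumes "cong n k x y" "!!as. length as = k ==> length (f as) = l"
 shows "cong n l (mp n f x) (mp n f y)"
 using mp_Rel[of "x - y" n "lists_of_length k" "lists_of_length l" f] assms
 by (simp add: cong_def push_diff Pi_iff)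

lemma cong_star:
 assumes "cong p k x x'" "y : Ch q (lists_of_length l)"
 shows "cong (p + q) (k + l) (star p q x y) (star p q x' y)"
proof -
 have "star p q (x - x') y : Rel (p + q) (lists_of_length (k + l))"
 unfolding star_def using assms by (intro mp_Rel[OF prd_Rel(1)]) (auto simp: cong_def)
 then show ?thesis by (simp add: cong_def star_diff)
qed

lemma cong_star':
 assumes "cong q l y y'" "x : Ch p (lists_of_length k)"
 shows "cong (p + q) (k + l) (star p q x y) (star p q x y')"
proof -
 have "star p q x (y - y') : Rel (p + q) (lists_of_length (k + l))"
 unfolding star_def using assms by (intro mp_Rel[OF prd_Rel(2)]) (auto simp: cong_def)
 then show ?thesis by (simp add: cong_def star_diff)
qed

text \<open>The swap axiom of a model is only required modulo relations. Exchanging the factors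
  exchanges two stretches of the list, and the cut is at the length \<open>l\<close> of the one that
  comes first.\<close>

lemma star_swap:
 assumes "x : Ch p (lists_of_length k)" "y : Ch q (lists_of_length l)"
 shows "cong (p + q) (k + l) (star p q x y)
 (frag_cmul ((- 1) ^ (p * q)) (mp (p + q) (%as. drop l as @ take l as) (star q p y x)))"
proof -
 have "mp (q + p) (%(bs, as). as @ bs) (prd q p y x) =
 mp (q + p) (%as. drop l as @ take l as) (star q p y x)"
 unfolding star_def push_push
 by (rule push_cong[OF prd_in[OF assms(2,1)]]) auto
 moreover have "star p q x y = mp (p + q) (%(bs, as). as @ bs) (mp (p + q) prod.swap (prd p q x y))"
 unfolding star_def push_push by (simp add: case_prod_unfold)
 ultimately have "star p q x y - frag_cmul ((- 1) ^ (p * q)) (mp (p + q) (%as. drop l as @ take l as) (star q p y x))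
 = mp (p + q) (%(bs, as). as @ bs)
 (mp (p + q) prod.swap (prd p q x y) - frag_cmul ((- 1) ^ (p * q)) (prd q p y x))"
 by (simp add: push_diff push_cmul add.commute)
 also have "... : Rel (p + q) (lists_of_length (k + l))"
 by (rule mp_Rel[OF prd_swap[OF assms]]) auto
 finally show ?thesis by (simp add: cong_def)
qed

section \<open>Products of lists of chains\<close>

definition entries :: "(nat \<times> 'a chain) list => bool" where
 "entries r \<longleftrightarrow> (\<forall>(q, y)\<in>set r. any_chain q y)"

lemma entries_simps [simp]:
 "entries []" "entries ((q, y) # r) \<longleftrightarrow> any_chain q y & entries r"
 "entries (r @ r') \<longleftrightarrow> entries r & entries r'"
 by (auto simp: entries_def)

lemma sgl_in: "any_chain q y ==> sgl q y : Ch q (lists_of_length (Suc 0))"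
 by (erule push_in_chains) auto

lemma sprod_in: "entries r ==> sprod r : Ch (sdeg r) (lists_of_length (length r))"
proof (induction r)
 case (Cons e r)
 then show ?case
 using star_in[OF sgl_in, of "snd e" "fst e" "sprod r"] by (cases e) auto
qed (auto intro: pnt_in)

lemma sprod_any: "entries r ==> any_chain (sdeg r) (sprod r)"
 by (rule any_chain_of[OF sprod_in])

lemma sprod_append:
 "entries r ==> entries r' ==>
 sprod (r @ r') = star (sdeg r) (sdeg r') (sprod r) (sprod r')"
proof (induction r)
 case Nil
 then show ?case by (simp add: star_pnt sprod_any)
next
 case (Cons e r)
 obtain q y where e: "e = (q, y)" by force
 with Cons show ?case
 by (simp add: star_assoc any_chain_of[OF sgl_in] sprod_any)
qed

lemma sprod_single: "any_chain q y ==> sprod [(q, y)] = sgl q y"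
 by (simp add: star_pnt any_chain_of[OF sgl_in])

lemma sprod_mp:
 "length fs = length r ==> entries r ==>
 sprod (map2 (%f (q, y). (q, mp q f y)) fs r) =
 mp (sdeg r) (%as. map2 (%f a. f a) fs as) (sprod r)"
proof (induction fs r rule: list_induct2)
 case Nil
 then show ?case by (simp add: mp_pnt)
next
 case (Cons f fs e r)
 obtain q y where e: "e = (q, y)" by force
 have "sdeg (map2 (%f (q, y). (q, mp q f y)) fs r) = sdeg r"
 using Cons(1) by (induction fs r rule: list_induct2) auto
 moreover have "star q (sdeg r) (mp q (%as. [f (hd as)]) (sgl q y))
 (mp (sdeg r) (%as. map2 (%f a. f a) fs as) (sprod r)) =
 mp (q + sdeg r) (%as. map2 (%f a. f a) (f # fs) as)
 (star q (sdeg r) (sgl q y) (sprod r))"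
 using Cons.prems e by (intro star_mp[OF sgl_in sprod_in]) (auto simp: length_Suc_conv)
 ultimately show ?case
 using Cons by (simp add: e push_push)
qed

lemma sprod_zero: "(q, 0) : set r ==> sprod r = 0"
proof (induction r)
 case (Cons e r)
 then show ?case by (cases e) auto
qed simp

text \<open>The iterated Leibniz rule: passing the boundary over the factors before \<open>i\<close>
  costs the sign of their total degree.\<close>

lemma sprod_bdry:
 "entries r ==> bdry (sdeg r) (sprod r) =
 (\<Sum>i<length r. frag_cmul ((- 1) ^ sdeg (take i r))
 (sprod (r[i := (fst (r ! i) - 1, bdry (fst (r ! i)) (snd (r ! i)))])))"
proof (induction r)
 case (Cons e r)
 obtain q y where e: "e = (q, y)" by force
 with Cons.prems have *: "any_chain q y" "entries r" by simp_all
 let ?r = "%i. r[i := (fst (r ! i) - 1, bdry (fst (r ! i)) (snd (r ! i)))]"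
 \<comment> \<open>The update lowers the total degree by 1, except for a factor of degree 0, where
   truncated subtraction leaves it unchanged; then the new entry and with it both sides are
   0.\<close>
 have 1: "star q (sdeg r - 1) (sgl q y) (sprod (?r i)) = sprod ((q, y) # ?r i)"
 if i: "i < length r" for i
 proof (cases "fst (r ! i)")
 case 0
 then have "(0, 0) : set (?r i)"
 using i by (simp add: set_update_memI)
 then have "sprod (?r i) = 0" by (rule sprod_zero)
 then show ?thesis by simp
 next
 case (Suc d)
 have "r = take i r @ r ! i # drop (Suc i) r" using i by (rule id_take_nth_drop)
 then have "sdeg r = sdeg (take i r) + fst (r ! i) + sdeg (drop (Suc i) r)"
 by (metis add.assoc sdeg_simps(2,3))
 moreover have "sdeg (?r i) = sdeg (take i r) + (fst (r ! i) - 1) + sdeg (drop (Suc i) r)"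
 using i by (simp add: upd_conv_take_nth_drop)
 ultimately have "sdeg (?r i) = sdeg r - 1"
 using Suc by simp
 then show ?thesis by simp
 qed
 have "bdry (q + sdeg r) (star q (sdeg r) (sgl q y) (sprod r)) =
 star (q - 1) (sdeg r) (bdry q (sgl q y)) (sprod r) +
 frag_cmul ((- 1) ^ q) (star q (sdeg r - 1) (sgl q y) (bdry (sdeg r) (sprod r)))"
 using * by (intro star_bdry sprod_any any_chain_of[OF sgl_in])
 also have "... = sprod ((q - 1, bdry q y) # r) +
 frag_cmul ((- 1) ^ q) (\<Sum>i<length r. frag_cmul ((- 1) ^ sdeg (take i r))
 (star q (sdeg r - 1) (sgl q y) (sprod (?r i))))"
 by (simp only: Cons.IH[OF *(2)] star_sum star_cmul bdry_mp sprod.simps)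
 also have "(\<Sum>i<length r. frag_cmul ((- 1) ^ sdeg (take i r))
 (star q (sdeg r - 1) (sgl q y) (sprod (?r i)))) =
 (\<Sum>i<length r. frag_cmul ((- 1) ^ sdeg (take i r)) (sprod ((q, y) # ?r i)))"
 using 1 by (intro sum.cong) auto
 finally show ?case
 by (simp add: e sum.lessThan_Suc_shift frag_cmul_sum power_add del: sum.lessThan_Suc sprod.simps)
 (simp add: sprod.simps)
qed (simp add: bdry_def bd_0)

lemma entries_upd: "entries r ==> any_chain q y ==> entries (r[i := (q, y)])"
 using set_update_subset_insert[of r i "(q, y)"] by (auto simp: entries_def)

lemma sprod_diff:
 assumes "i < length r" "entries r" "any_chain q a" "any_chain q b"
 shows "sprod (r[i := (q, a - b)]) = sprod (r[i := (q, a)]) - sprod (r[i := (q, b)])"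
 using assms
proof (induction r arbitrary: i)
 case (Cons e r)
 have "sdeg (r[j := (q, u)]) = sum_list ((map fst r)[j := q])" for j and u :: "'a chain"
 by (simp add: sdeg_def map_update)
 with Cons show ?case
 by (cases e; cases i) (auto simp: push_diff star_diff)
qed simp

text \<open>Factors are exchanged one at a time, so both the old and the new ones have to be chains:
  each multiplies a difference at some stage.\<close>

lemma sprod_cong:
 assumes "list_all2 (%(q, y) (q', y'). q = q' & y - y' : Rel q (coarse UNIV) & any_chain q y) r r'"
 "entries r'"
 shows "cong (sdeg r) (length r) (sprod r) (sprod r')"
 using assms
proof (induction r r' rule: list_all2_induct)
 case (Cons e r e' r')
 obtain q y y' where e: "e = (q, y)" "e' = (q, y')" using Cons(1) by (cases e, cases e') auto
 have deg: "sdeg r = sdeg r'" "length r = length r'"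
 using Cons(2) by (induction r r' rule: list_all2_induct) auto
 have r: "entries r"
 using Cons(2) by (induction r r' rule: list_all2_induct) auto
 have 1: "cong q 1 (sgl q y) (sgl q y')"
 using mp_Rel[of "y - y'" q "coarse UNIV" "lists_of_length 1" "%a. [a]"] Cons(1)
 by (simp add: e cong_def push_diff)
 have "cong (q + sdeg r) (1 + length r) (sprod (e # r)) (star q (sdeg r) (sgl q y') (sprod r))"
 unfolding e sprod.simps using 1 sprod_in[OF r] by (rule cong_star)
 moreover have "cong (q + sdeg r) (1 + length r) (star q (sdeg r) (sgl q y') (sprod r))
 (sprod (e' # r'))"
 unfolding e sprod.simps deg(1)[symmetric] using Cons e sgl_in[of y' q]
 by (intro cong_star') (auto simp: deg)
 ultimately show ?case
 by (auto simp: e dest: cong_trans)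
qed simp

text \<open>Induction on the last factor. Its index splits \<open>js\<close> as
  \<open>u @ ?k # v\<close>; one exchange moves the factor past those of \<open>v\<close>, which
  adds \<open>q * sdeg V\<close> to the weight, and the rest is the induction hypothesis for
  \<open>u @ v\<close>.\<close>

lemma sprod_permute:
 assumes "distinct js" "set js = {..<length r}" "entries r"
 shows "cong (sdeg r) (length r) (sprod (map ((!) r) js))
 (frag_cmul ((- 1) ^ inversion_weight (%i. fst (r ! i)) js)
 (mp (sdeg r) (%as. map ((!) as) js) (sprod r)))"
 using assms
proof (induction r arbitrary: js rule: rev_induct)
 case Nil
 then show ?case by (simp add: mp_pnt)
next
 case (snoc e r)
 let ?k = "length r" and ?q = "%i. fst ((r @ [e]) ! i)"
 have "?k : set js" using snoc.prems by simp
 then obtain u v where js: "js = u @ ?k # v" by (meson split_list)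
 have uv: "distinct (u @ v)" "set (u @ v) = {..<?k}"
 proof -
 show "distinct (u @ v)" using snoc.prems(1) unfolding js by simp
 have "set (u @ v) = set js - {?k}" using snoc.prems(1) unfolding js by auto
 also have "... = {..<?k}" unfolding snoc.prems(2) by auto
 finally show "set (u @ v) = {..<?k}" .
 qed
 have fst_uv: "set u \<subseteq> {..<?k}" "set v \<subseteq> {..<?k}" using uv by auto
 obtain q y where e: "e = (q, y)" by force
 have ent: "entries r" "any_chain q y" using snoc.prems by (simp_all add: e)
 define U V E where "U = map ((!) r) u" and "V = map ((!) r) v" and "E = [(q, y)]"
 have nth: "map ((!) (r @ [e])) js = U @ E @ V"
 using fst_uv by (auto simp: js U_def V_def E_def e nth_append)
 have sub: "entries (map ((!) r) w)" if "set w \<subseteq> {..<?k}" for w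
 using ent(1) that by (auto simp: entries_def) (metis (mono_tags, lifting) case_prodD lessThan_iff nth_mem prod.collapse subsetD)
 have entUV: "entries U" "entries V" "entries E"
 using fst_uv ent by (auto simp: U_def V_def E_def intro: sub)
 have len: "length u + length v = ?k"
 using distinct_card[OF uv(1)] uv(2) by simp
 have degv: "sdeg V = (\<Sum>i\<in>set v. fst (r ! i))" "sdeg U = (\<Sum>i\<in>set u. fst (r ! i))"
 using uv(1) by (simp_all add: U_def V_def sdeg_def sum_list_distinct_conv_sum_set o_def)
 have degr: "sdeg U + sdeg V = sdeg r"
 proof -
 have "sdeg r = (\<Sum>i<?k. fst (r ! i))"
 unfolding sdeg_def by (simp add: sum_list_sum_nth atLeast0LessThan)
 also have "... = (\<Sum>i\<in>set u. fst (r ! i)) + (\<Sum>i\<in>set v. fst (r ! i))"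
 unfolding uv(2)[symmetric] using uv(1) by (simp add: sum.union_disjoint)
 finally show ?thesis by (simp add: degv)
 qed
 let ?dU = "sdeg U" and ?dV = "sdeg V" and ?d = "sdeg r"
 \<comment> \<open>Brings the last entry to place \<open>length u\<close>: the exchange of the last
   factor with those of \<open>v\<close>, seen on the whole list.\<close>
 define rot :: "'a list => 'a list" where
 "rot = (%as. take (length u) as @ as ! ?k # drop (length u) (take ?k as))"
 have V: "sprod V : Ch ?dV (lists_of_length (length v))"
 and U: "sprod U : Ch ?dU (lists_of_length (length u))"
 and E: "sprod E : Ch q (lists_of_length 1)"
 using sprod_in[OF entUV(2)] sprod_in[OF entUV(1)] sprod_in[OF entUV(3)]
 by (simp_all add: V_def U_def E_def)
 let ?VE = "star ?dV q (sprod V) (sprod E)"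
 let ?S = "star ?d q (sprod (map ((!) r) (u @ v))) (sprod E)"
 have split: "sprod (map ((!) (r @ [e])) js) = star ?dU (q + ?dV) (sprod U) (star q ?dV (sprod E) (sprod V))"
 unfolding nth using entUV by (simp add: sprod_append) (simp add: E_def)
 have rotate: "star ?dU (q + ?dV) (sprod U)
 (mp (q + ?dV) (%as. drop (length v) as @ take (length v) as) ?VE) =
 mp (?dU + (q + ?dV)) rot (star ?dU (q + ?dV) (sprod U) ?VE)"
 proof -
 have "?VE : Ch (q + ?dV) (lists_of_length (length v + 1))"
 using star_in[OF V E] by (simp add: add.commute)
 moreover have "rot (as @ bs) = as @ drop (length v) bs @ take (length v) bs"
 if "length as = length u" "length bs = length v + 1" for as bs :: "'a list"
 using that by (cases bs rule: rev_cases) (auto simp: rot_def nth_append simp flip: len)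
 ultimately have "star ?dU (q + ?dV) (mp ?dU (%as. as) (sprod U))
 (mp (q + ?dV) (%as. drop (length v) as @ take (length v) as) ?VE) =
 mp (?dU + (q + ?dV)) rot (star ?dU (q + ?dV) (sprod U) ?VE)"
 by (intro star_mp[OF U]) auto
 then show ?thesis
 by (simp only: push_id[OF U, of "%as. as", OF refl])
 qed
 have "?S = star (?dU + ?dV) q (star ?dU ?dV (sprod U) (sprod V)) (sprod E)"
 using entUV degr by (simp add: sprod_append U_def V_def)
 also have "... = star ?dU (q + ?dV) (sprod U) ?VE"
 using star_assoc[OF any_chain_of[OF U] any_chain_of[OF V] any_chain_of[OF E]]
 by (simp add: add.commute)
 finally have assoc: "star ?dU (q + ?dV) (sprod U) ?VE = ?S" ..
 have total: "?dU + (q + ?dV) = ?d + q" "length u + (1 + length v) = ?k + 1"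
 using degr len by simp_all
 have 1: "cong (?d + q) (?k + 1) (sprod (map ((!) (r @ [e])) js))
 (frag_cmul ((- 1) ^ (q * ?dV)) (mp (?d + q) rot ?S))"
 using cong_star'[OF star_swap[OF E V] U] unfolding star_cmul rotate assoc split total .
 let ?w = "inversion_weight (%i. fst (r ! i)) (u @ v)"
 let ?T = "mp ?d (%as. map ((!) as) (u @ v)) (sprod r)"
 have "star ?d q ?T (mp q (%as. as) (sprod E)) =
 mp (?d + q) (%as. map ((!) as) (u @ v) @ drop ?k as) (star ?d q (sprod r) (sprod E))"
 using fst_uv by (intro star_mp[OF sprod_in[OF ent(1)] E]) (auto simp: nth_append)
 then have T: "star ?d q ?T (sprod E) =
 mp (?d + q) (%as. map ((!) as) (u @ v) @ drop ?k as) (star ?d q (sprod r) (sprod E))"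
 by (simp only: push_id[OF E, of "%as. as", OF refl])
 have reorder: "mp (?d + q) rot (star ?d q ?T (sprod E)) =
 mp (?d + q) (%as. map ((!) as) js) (star ?d q (sprod r) (sprod E))"
 unfolding T push_push
 proof (rule push_cong[OF star_in[OF sprod_in[OF ent(1)] E]])
 fix as :: "'a list" assume "as : topspace (lists_of_length (?k + 1))"
 then obtain bs b where as: "as = bs @ [b]" "length bs = ?k"
 by (cases as rule: rev_cases) auto
 show "rot (map ((!) as) (u @ v) @ drop ?k as) = map ((!) as) js"
 by (auto simp: rot_def as js nth_append simp flip: len)
 qed
 have "cong (?d + q) (?k + 1) ?S (star ?d q (frag_cmul ((- 1) ^ ?w) ?T) (sprod E))"
 by (rule cong_star[OF snoc.IH[OF uv ent(1)] E])
 then have "cong (?d + q) (?k + 1) (mp (?d + q) rot ?S)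
 (mp (?d + q) rot (star ?d q (frag_cmul ((- 1) ^ ?w) ?T) (sprod E)))"
 by (rule cong_mp) (auto simp: rot_def simp flip: len)
 then have 2: "cong (?d + q) (?k + 1) (mp (?d + q) rot ?S)
 (frag_cmul ((- 1) ^ ?w) (mp (?d + q) (%as. map ((!) as) js) (star ?d q (sprod r) (sprod E))))"
 unfolding star_cmul push_cmul reorder .
 have "inversion_weight ?q js = inversion_weight ?q (u @ v) + q * ?dV"
 unfolding js using fst_uv
 by (subst inversion_weight_insert) (auto simp: degv e nth_append intro!: sum.cong)
 moreover have "inversion_weight ?q w = inversion_weight (%i. fst (r ! i)) w" if "set w \<subseteq> {..<?k}" for w
 using that by (induction w) (auto simp: nth_append intro!: sum.cong)
 ultimately have w: "inversion_weight ?q js = ?w + q * ?dV"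
 using uv(2) by simp
 have app: "sprod (r @ [e]) = star ?d q (sprod r) (sprod E)" "sdeg (r @ [e]) = ?d + q"
 "length (r @ [e]) = ?k + 1"
 using ent by (simp_all add: sprod_append e E_def del: sprod.simps)
 have sgn: "(- 1 :: int) ^ inversion_weight ?q js = (- 1) ^ (q * ?dV) * (- 1) ^ ?w"
 by (simp add: w power_add mult.commute)
 show ?case
 unfolding app sgn using cong_trans[OF 1 cong_cmul[OF 2]] unfolding frag_cmul_cmul .
qed

text \<open>Operad composition is continuous on the product of the given spaces, so the coarse
  target of \<open>sprod_in\<close> is too weak for it.\<close>

lemma sprod_in_ltop:
 "list_all2 (%(q, y) X. y : Ch q X) r Xs ==> sprod r : Ch (sdeg r) (ltop Xs)"
proof (induction r Xs rule: list_all2_induct)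
 case Nil
 then show ?case by (auto intro!: pnt_in simp: topspace_ltop)
next
 case (Cons e r X Xs)
 obtain q y where e: "e = (q, y)" by force
 have "sgl q y : Ch q (ltop [X])"
 using Cons(1) by (auto simp: e intro!: push_in_chains continuous_map_into_ltop)
 from push_in_chains[OF prd_in[OF this Cons.IH] continuous_map_append] show ?case
 by (simp add: e star_def)
qed

text \<open>Exponent of the sign in the associativity axiom: the head of block \<open>j\<close>
  moves past the tails of the blocks before it.\<close>

definition block_weight :: "((nat \<times> 'a chain) \<times> (nat \<times> 'a chain) list) list => nat" where
 "block_weight B = (\<Sum>j<length B. \<Sum>i<j. fst (fst (B ! j)) * sdeg (snd (B ! i)))"

text \<open>On the left all heads precede all tails, on the right each head stands before its own
  tail. In the induction the head \<open>E\<close> of the last block passes the earlier tails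
  \<open>W\<close> by one exchange; everything else is strict associativity.\<close>

lemma sprod_blocks:
 fixes B :: "((nat \<times> 'a chain) \<times> (nat \<times> 'a chain) list) list"
 assumes "!!e zs. (e, zs) : set B ==> entries (e # zs)"
 shows "cong (sdeg (map fst B) + sdeg (concat (map snd B)))
 (length (map fst B) + length (concat (map snd B)))
 (star (sdeg (map fst B)) (sdeg (concat (map snd B)))
 (sprod (map fst B)) (sprod (concat (map snd B))))
 (frag_cmul ((- 1) ^ block_weight B)
 (mp (sdeg (map fst B) + sdeg (concat (map snd B)))
 (%bs. map hd bs @ concat (map tl bs))
 (sprod (map (%(e, zs). (fst e + sdeg zs, sprod (e # zs))) B))))"
 using assms
proof (induction B rule: rev_induct)
 case Nil
 then show ?case by (simp add: mp_pnt star_pnt[OF any_chain_of[OF pnt_in[of _ "coarse UNIV"]]] block_weight_def)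
next
 case (snoc b B)
 obtain q y zl where b: "b = ((q, y), zl)" by (metis prod.collapse)
 have ent: "!!e zs. (e, zs) : set B ==> entries (e # zs)" "any_chain q y" "entries zl"
 using snoc.prems[of "(q, y)" zl] snoc.prems by (auto simp: b)
 define hs zs where "hs = map fst B" and "zs = concat (map snd B)"
 have enth: "entries hs" and entz: "entries zs"
 using ent(1) by (fastforce simp: hs_def zs_def entries_def)+
 let ?Y = "sprod hs" and ?W = "sprod zs" and ?E = "sprod [(q, y)]" and ?Z = "sprod zl"
 let ?a = "sdeg hs" and ?w = "sdeg zs" and ?z = "sdeg zl"
 let ?n = "length hs" and ?m = "length zs" and ?k = "length zl"
 let ?EZ = "sprod ((q, y) # zl)"
 have Y: "?Y : Ch ?a (lists_of_length ?n)" and W: "?W : Ch ?w (lists_of_length ?m)"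
 and E: "?E : Ch q (lists_of_length 1)" and Z: "?Z : Ch ?z (lists_of_length ?k)"
 and EZ: "?EZ : Ch (q + ?z) (lists_of_length (1 + ?k))"
 using sprod_in[OF enth] sprod_in[OF entz] sprod_in[OF ent(3)] sprod_in[of "[(q, y)]"]
 sprod_in[of "(q, y) # zl"] ent(2,3) by simp_all
 note any = any_chain_of[OF Y] any_chain_of[OF W] any_chain_of[OF E] any_chain_of[OF Z]
 have EZ_eq: "?EZ = star q ?z ?E ?Z"
 using sprod_append[of "[(q, y)]" zl] ent by simp
 \<comment> \<open>One rotation in three frames: on the entries of \<open>W E\<close>, on those of
   \<open>W E Z\<close>, and on those of \<open>Y W E Z\<close>, where the first \<open>?n\<close>
   stay fixed.\<close>
 define rot :: "'a list => 'a list" where "rot = (%as. drop ?m as @ take ?m as)"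
 define rot' :: "'a list => 'a list" where "rot' = (%as. as ! ?m # take ?m as @ drop (?m + 1) as)"
 define h :: "'a list => 'a list" where "h = (%as. take ?n as @ rot' (drop ?n as))"
 have WE: "star ?w q ?W ?E : Ch (q + ?w) (lists_of_length (?m + 1))"
 using star_in[OF W E] by (simp add: add.commute)
 have EW: "star q ?w ?E ?W : Ch (q + ?w) (lists_of_length (1 + ?m))"
 by (rule star_in[OF E W])
 have WEZ: "star (q + ?w) ?z (star ?w q ?W ?E) ?Z : Ch (q + ?w + ?z) (lists_of_length (?m + 1 + ?k))"
 by (rule star_in[OF WE Z])
 have r1: "star (q + ?w) ?z (mp (q + ?w) rot (star ?w q ?W ?E)) ?Z =
 mp (q + ?w + ?z) rot' (star (q + ?w) ?z (star ?w q ?W ?E) ?Z)"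
 proof -
 have "star (q + ?w) ?z (mp (q + ?w) rot (star ?w q ?W ?E)) (mp ?z (%as. as) ?Z) =
 mp (q + ?w + ?z) rot' (star (q + ?w) ?z (star ?w q ?W ?E) ?Z)"
 proof (rule star_mp[OF WE Z])
 fix as bs :: "'a list" assume "as : topspace (lists_of_length (?m + 1))"
 then obtain cs c where "as = cs @ [c]" "length cs = ?m"
 by (cases as rule: rev_cases) auto
 then show "rot' (as @ bs) = rot as @ bs"
 by (simp add: rot_def rot'_def nth_append)
 qed
 then show ?thesis by (simp only: push_id[OF Z, of "%as. as", OF refl])
 qed
 have r2: "star ?a (q + ?w + ?z) ?Y (mp (q + ?w + ?z) rot' (star (q + ?w) ?z (star ?w q ?W ?E) ?Z)) =
 mp (?a + (q + ?w + ?z)) h (star ?a (q + ?w + ?z) ?Y (star (q + ?w) ?z (star ?w q ?W ?E) ?Z))"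
 proof -
 have "star ?a (q + ?w + ?z) (mp ?a (%as. as) ?Y) (mp (q + ?w + ?z) rot' (star (q + ?w) ?z (star ?w q ?W ?E) ?Z)) =
 mp (?a + (q + ?w + ?z)) h (star ?a (q + ?w + ?z) ?Y (star (q + ?w) ?z (star ?w q ?W ?E) ?Z))"
 by (rule star_mp[OF Y WEZ]) (simp add: h_def)
 then show ?thesis by (simp only: push_id[OF Y, of "%as. as", OF refl])
 qed
 have "star (?a + ?w) (q + ?z) (star ?a ?w ?Y ?W) ?EZ =
 star ?a (?w + (q + ?z)) ?Y (star ?w (q + ?z) ?W (star q ?z ?E ?Z))"
 unfolding EZ_eq using star_assoc[OF any(1,2) any_chain_of[OF star_in[OF E Z]]] by simp
 also have "... = star ?a (q + ?w + ?z) ?Y (star (q + ?w) ?z (star ?w q ?W ?E) ?Z)"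
 using star_assoc[OF any(2,3,4)] by (simp add: ac_simps)
 finally have r3: "star ?a (q + ?w + ?z) ?Y (star (q + ?w) ?z (star ?w q ?W ?E) ?Z) =
 star (?a + ?w) (q + ?z) (star ?a ?w ?Y ?W) ?EZ" ..
 have "star (?a + q) (?w + ?z) (star ?a q ?Y ?E) (star ?w ?z ?W ?Z) =
 star ?a (q + (?w + ?z)) ?Y (star q (?w + ?z) ?E (star ?w ?z ?W ?Z))"
 by (rule star_assoc[OF any(1,3) any_chain_of[OF star_in[OF W Z]]])
 also have "... = star ?a (q + ?w + ?z) ?Y (star (q + ?w) ?z (star q ?w ?E ?W) ?Z)"
 using star_assoc[OF any(3,2,4)] by (simp add: add.assoc)
 finally have r4: "star (?a + q) (?w + ?z) (star ?a q ?Y ?E) (star ?w ?z ?W ?Z) = ..." .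
 let ?N = "?a + (q + ?w + ?z)" and ?l = "?n + (1 + ?m + ?k)"
 have "cong ?N ?l (star ?a (q + ?w + ?z) ?Y (star (q + ?w) ?z (star q ?w ?E ?W) ?Z))
 (star ?a (q + ?w + ?z) ?Y (star (q + ?w) ?z (frag_cmul ((- 1) ^ (q * ?w)) (mp (q + ?w) rot (star ?w q ?W ?E))) ?Z))"
 unfolding rot_def by (rule cong_star'[OF cong_star[OF star_swap[OF E W] Z] Y])
 then have c1: "cong ?N ?l (star (?a + q) (?w + ?z) (star ?a q ?Y ?E) (star ?w ?z ?W ?Z))
 (frag_cmul ((- 1) ^ (q * ?w)) (mp ?N h (star (?a + ?w) (q + ?z) (star ?a ?w ?Y ?W) ?EZ)))"
 unfolding star_cmul r1 r2 r3 r4 .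
 define bl where "bl = map (%(e, zs). (fst e + sdeg zs, sprod (e # zs))) B"
 let ?f = "%bs. map hd bs @ concat (map tl bs)"
 have deg: "sdeg bl = ?a + ?w"
 unfolding bl_def hs_def zs_def by (induction B) (auto simp: case_prod_unfold)
 have IH: "cong (?a + ?w) (?n + ?m) (star ?a ?w ?Y ?W)
 (frag_cmul ((- 1) ^ block_weight B) (mp (?a + ?w) ?f (sprod bl)))"
 using snoc.IH[OF ent(1)] by (simp only: hs_def zs_def bl_def)
 \<comment> \<open>Each block is placed in a space of lists of its exact length, because comparing
   \<open>h\<close> with \<open>?f\<close> below requires counting the entries of the tails.\<close>
 have bl: "list_all2 (%(q, y) X. y : Ch q X) bl (map (%(e, zs). lists_of_length (1 + length zs)) B)"
 unfolding bl_def list_all2_map1 list_all2_map2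
 proof (intro list_all2_same[THEN iffD2], clarsimp simp del: sprod.simps)
 fix q y zs assume "((q, y), zs) : set B"
 from sprod_in[OF ent(1)[OF this]]
 show "sprod ((q, y) # zs) : Ch (q + sdeg zs) (lists_of_length (Suc (length zs)))"
 by simp
 qed
 have SP: "sprod bl : Ch (?a + ?w) (ltop (map (%(e, zs). lists_of_length (1 + length zs)) B))"
 using sprod_in_ltop[OF bl] by (simp add: deg)
 have entbl: "entries bl"
 using sprod_any[OF ent(1)] unfolding bl_def entries_def by fastforce
 have "mp ?N h (star (?a + ?w) (q + ?z) (mp (?a + ?w) ?f (sprod bl)) ?EZ) =
 mp ?N (%(bs, c). h (?f bs @ c)) (prd (?a + ?w) (q + ?z) (sprod bl) ?EZ)"
 proof -
 have "star (?a + ?w) (q + ?z) (mp (?a + ?w) ?f (sprod bl)) (mp (q + ?z) (%c. c) ?EZ) =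
 mp (?a + ?w + (q + ?z)) (%(bs, c). ?f bs @ c) (prd (?a + ?w) (q + ?z) (sprod bl) ?EZ)"
 unfolding star_def prd_mp push_push by (simp add: case_prod_unfold)
 then have "star (?a + ?w) (q + ?z) (mp (?a + ?w) ?f (sprod bl)) ?EZ =
 mp (?a + ?w + (q + ?z)) (%(bs, c). ?f bs @ c) (prd (?a + ?w) (q + ?z) (sprod bl) ?EZ)"
 by (simp only: push_id[OF EZ, of "%as. as", OF refl])
 moreover have "?N = ?a + ?w + (q + ?z)" by simp
 ultimately show ?thesis
 by (simp only: push_push case_prod_unfold)
 qed
 also have "... = mp ?N (%(bs, c). ?f (bs @ [c])) (prd (?a + ?w) (q + ?z) (sprod bl) ?EZ)"
 proof -
 have "?N = ?a + ?w + (q + ?z)" by simp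
 moreover have "mp (?a + ?w + (q + ?z)) (%(bs, c). h (?f bs @ c)) (prd (?a + ?w) (q + ?z) (sprod bl) ?EZ) =
 mp (?a + ?w + (q + ?z)) (%(bs, c). ?f (bs @ [c])) (prd (?a + ?w) (q + ?z) (sprod bl) ?EZ)"
 proof (rule push_cong[OF prd_in[OF SP EZ]], clarsimp simp: topspace_ltop)
 fix bs :: "'a list list" and c :: "'a list"
 assume bs: "length bs = length B"
 "\<forall>i<length B. bs ! i : topspace ((case B ! i of (e, zs) => lists_of_length (Suc (length zs))))"
 and c: "length c = Suc ?k"
 have "length (concat (map tl bs)) = sum_list (map (%b. length (snd b)) B)"
 using bs unfolding length_concat map_map
 by (intro arg_cong[of _ _ sum_list] nth_equalityI) (auto simp: case_prod_unfold)
 then have len: "length (concat (map tl bs)) = ?m"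
 by (simp add: zs_def length_concat o_def)
 obtain c0 cs where "c = c0 # cs" using c by (cases c) auto
 moreover have "?n = length (map hd bs)" by (simp add: hs_def bs)
 ultimately show "h (map hd bs @ concat (map tl bs) @ c) = map hd bs @ hd c # concat (map tl bs) @ tl c"
 by (simp add: h_def rot'_def nth_append flip: len)
 qed
 ultimately show ?thesis by (simp only:)
 qed
 also have "... = mp ?N ?f (sprod (bl @ [(q + ?z, ?EZ)]))"
 proof -
 have "sprod (bl @ [(q + ?z, ?EZ)]) = star (?a + ?w) (q + ?z) (sprod bl) (sgl (q + ?z) ?EZ)"
 using sprod_append[OF entbl, of "[(q + ?z, ?EZ)]"] sprod_single[OF any_chain_of[OF EZ]]
 any_chain_of[OF EZ] by (simp add: deg)
 also have "... = star (?a + ?w) (q + ?z) (mp (?a + ?w) (%bs. bs) (sprod bl)) (sgl (q + ?z) ?EZ)"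
 by (simp only: push_id[OF SP, of "%as. as", OF refl])
 also have "... = mp ?N (%(bs, c). bs @ [c]) (prd (?a + ?w) (q + ?z) (sprod bl) ?EZ)"
 unfolding star_def prd_mp push_push by (simp add: case_prod_unfold ac_simps)
 finally show ?thesis
 by (simp add: push_push case_prod_unfold)
 qed
 finally have r5: "mp ?N h (star (?a + ?w) (q + ?z) (mp (?a + ?w) ?f (sprod bl)) ?EZ) =
 mp ?N ?f (sprod (bl @ [(q + ?z, ?EZ)]))" .
 have "cong (?a + ?w + (q + ?z)) (?n + ?m + (1 + ?k)) (star (?a + ?w) (q + ?z) (star ?a ?w ?Y ?W) ?EZ)
 (star (?a + ?w) (q + ?z) (frag_cmul ((- 1) ^ block_weight B) (mp (?a + ?w) ?f (sprod bl))) ?EZ)"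
 by (rule cong_star[OF IH EZ])
 moreover have "?a + ?w + (q + ?z) = ?N" "?n + ?m + (1 + ?k) = ?l" by simp_all
 ultimately have "cong ?N ?l (star (?a + ?w) (q + ?z) (star ?a ?w ?Y ?W) ?EZ)
 (star (?a + ?w) (q + ?z) (frag_cmul ((- 1) ^ block_weight B) (mp (?a + ?w) ?f (sprod bl))) ?EZ)"
 by (simp only:)
 then have "cong ?N ?l (mp ?N h (star (?a + ?w) (q + ?z) (star ?a ?w ?Y ?W) ?EZ))
 (mp ?N h (star (?a + ?w) (q + ?z) (frag_cmul ((- 1) ^ block_weight B) (mp (?a + ?w) ?f (sprod bl))) ?EZ))"
 by (rule cong_mp) (simp add: h_def rot'_def)
 then have c2: "cong ?N ?l (mp ?N h (star (?a + ?w) (q + ?z) (star ?a ?w ?Y ?W) ?EZ))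
 (frag_cmul ((- 1) ^ block_weight B) (mp ?N ?f (sprod (bl @ [(q + ?z, ?EZ)]))))"
 unfolding star_cmul push_cmul r5 .
 have "block_weight (B @ [b]) = q * ?w + block_weight B"
 proof -
 have "?w = (\<Sum>i<length B. sdeg (snd (B ! i)))"
 proof -
 have "?w = sum_list (map (%b. sdeg (snd b)) B)"
 unfolding zs_def by (induction B) auto
 then show ?thesis by (simp add: sum_list_sum_nth atLeast0LessThan)
 qed
 then show ?thesis
 by (simp add: block_weight_def b nth_append sum_distrib_left)
 qed
 moreover have "sdeg (map fst (B @ [b])) + sdeg (concat (map snd (B @ [b]))) = ?N"
 "length (map fst (B @ [b])) + length (concat (map snd (B @ [b]))) = ?l"
 "sdeg (map fst (B @ [b])) = ?a + q" "sdeg (concat (map snd (B @ [b]))) = ?w + ?z"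
 "sprod (map fst (B @ [b])) = star ?a q ?Y ?E" "sprod (concat (map snd (B @ [b]))) = star ?w ?z ?W ?Z"
 "map (%(e, zs). (fst e + sdeg zs, sprod (e # zs))) (B @ [b]) = bl @ [(q + ?z, ?EZ)]"
 using enth entz ent sprod_append[of hs "[(q, y)]"] sprod_append[of zs zl]
 by (simp_all add: b hs_def zs_def bl_def del: sprod.simps)
 ultimately show ?case
 using cong_trans[OF c1 cong_cmul[OF c2]] by (simp only: frag_cmul_cmul power_add)
qed

end

section \<open>Chains on a topological operad\<close>

lemma inversion_weight_Suc: "inversion_weight q (map Suc js) = inversion_weight (%i. q (Suc i)) js"
proof (induction js)
 case (Cons j js)
 have "set (map Suc js) \<inter> {..<Suc j} = Suc ` (set js \<inter> {..<j})" by auto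
 with Cons show ?case by (simp add: sum.reindex)
qed simp

text \<open>In a list sorted by \<open>s\<close>, standing further back means having a larger value
  of \<open>s\<close>; counting by position becomes counting by \<open>s\<close>.\<close>

lemma inversion_weight_sorted_wrt:
 "sorted_wrt (%i j. s i < s j) js ==>
 inversion_weight q js = (\<Sum>j\<in>set js. \<Sum>i\<in>{i : set js. i < j & s j < s i}. q i * q j)"
 for s :: "nat => nat"
proof (induction js)
 case (Cons j js)
 have j: "j \<notin> set js" using Cons.prems by auto
 have 1: "{i : set (j # js). i < j & s j < s i} = set js \<inter> {..<j}" using Cons.prems by auto
 have 2: "{i : set (j # js). i < k & s k < s i} = {i : set js. i < k & s k < s i}" if "k : set js" for k
 using Cons.prems that by auto
 have "(\<Sum>k\<in>set (j # js). \<Sum>i\<in>{i : set (j # js). i < k & s k < s i}. q i * q k) =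
 (\<Sum>i\<in>set js \<inter> {..<j}. q i * q j) + (\<Sum>k\<in>set js. \<Sum>i\<in>{i : set js. i < k & s k < s i}. q i * q k)"
 using j 2 unfolding 1[symmetric] by simp
 with Cons show ?case by (simp add: mult.commute)
qed simp

text \<open>The inverse permutation lists the indices in increasing order of \<open>sgg\<close>. The
  result is the exponent in the first equivariance axiom.\<close>

lemma inversion_weight_inv_perm:
 assumes "sgg permutes {..<k}"
 shows "inversion_weight q (map (inv_into UNIV sgg) [0..<k]) =
 (\<Sum>j<k. \<Sum>i | i < j & sgg j < sgg i. q i * q j)"
proof -
 let ?js = "map (inv_into UNIV sgg) [0..<k]"
 have "sorted_wrt (%i j. sgg i < sgg j) ?js"
 by (simp add: sorted_wrt_map permutes_inverses[OF assms])
 moreover have set: "set ?js = {..<k}"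
 using permutes_image[OF permutes_inv[OF assms]] by (simp add: atLeast0LessThan)
 moreover have "{i. i < j & sgg j < sgg i} = {i : set ?js. i < j & sgg j < sgg i}" if "j < k" for j
 using that unfolding set by auto
 ultimately show ?thesis
 by (subst inversion_weight_sorted_wrt[of sgg]) auto
qed

lemma sign_pow_int: "sign_pow (int n) = (- 1) ^ n"
 by (simp add: sign_pow_def)

lemma int_sum_list_nat: "(!!q. q : set qs ==> 0 <= q) ==> int (sum_list (map nat qs)) = sum_list qs"
 by (induction qs) auto

lemma sum_list_update_int: "i < length qs ==> sum_list (qs[i := a]) = sum_list qs - qs ! i + a" for qs :: "int list"
 by (induction qs arbitrary: i) (auto split: nat.splits)

lemma sum_list_concat: "sum_list (concat xss) = sum_list (map sum_list xss)"
 by (induction xss) auto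

lemma map_tl_sublists: "length bs = n ==> map2 (%f a. f a) (replicate n (%x. x)) bs = bs"
 by (induction bs arbitrary: n) auto

locale operad_chains = chain_model dom pt bd pr rel for dom pt bd pr rel +
 fixes P :: "'a top_operad_data"
 assumes top_operad: "top_operad P"
begin

abbreviation sp :: "nat => 'a topology" where "sp l \<equiv> tspace P l"

text \<open>Chains in an integral degree. Negative degrees have to be separated, as
  \<open>nat\<close> would send them to degree 0.\<close>

definition chz :: "int => 'b topology => 'b chain set" where
 "chz n X = (if n < 0 then {0} else Ch (nat n) X)"

definition valid :: "nat list => int list => 'a chain list => bool" where
 "valid ms qs ys \<longleftrightarrow> length qs = length ms & length ys = length ms \<and>
 (\<forall>i<length ms. ys ! i : chz (qs ! i) (sp (ms ! i)))"

abbreviation tc :: "nat list => 'a list => 'a" where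
 "tc ms as \<equiv> tcomp P ms (hd as) (tl as)"

definition args :: "int => int list => 'a chain => 'a chain list => (nat \<times> 'a chain) list" where
 "args p qs x ys = (nat p, x) # zip (map nat qs) ys"

text \<open>Composition on representatives. The outer chain is treated as the first factor, so that
  operad composition is a single map on lists.\<close>

definition rcomp :: "nat list => int => int list => 'a chain => 'a chain list => 'a chain" where
 "rcomp ms p qs x ys = mp (sdeg (args p qs x ys)) (tc ms) (sprod (args p qs x ys))"

lemma act_continuous: "1 <= l ==> sgg permutes {..<l} ==> continuous_map (sp l) (sp l) (tact P l sgg)"
 and act_id: "1 <= l ==> a : topspace (sp l) ==> tact P l id a = a"
 and act_compose: "1 <= l ==> a : topspace (sp l) ==> sgg permutes {..<l} ==> ta permutes {..<l} ==>
 tact P l (sgg o ta) a = tact P l ta (tact P l sgg a)"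
 and tcomp_continuous: "arity_list ms ==> continuous_map
 (prod_topology (sp (length ms)) (product_topology (%i. sp (ms ! i)) {..<length ms}))
 (sp (sum_list ms)) (%(x, y). tcomp P ms x (map y [0..<length ms]))"
 and unit_in: "tunit P : topspace (sp 1)"
 and tcomp_unit: "1 <= l ==> a : topspace (sp l) ==> tcomp P [l] (tunit P) [a] = a"
 "1 <= l ==> a : topspace (sp l) ==> tcomp P (replicate l 1) a (replicate l (tunit P)) = a"
 and tcomp_act: "arity_list ms ==> sgg permutes {..<length ms} ==>
 a : topspace (sp (length ms)) ==> tpoints P ms bs ==>
 tcomp P ms (tact P (length ms) sgg a) bs = tact P (sum_list ms) (block_perm ms sgg)
 (tcomp P (permute_list (inv_into UNIV sgg) ms) a (permute_list (inv_into UNIV sgg) bs))"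
 and tcomp_acts: "arity_list ms ==> length tas = length ms ==>
 (\<forall>i<length ms. (tas ! i) permutes {..<ms ! i}) ==>
 a : topspace (sp (length ms)) ==> tpoints P ms bs ==>
 tcomp P ms a (map (%i. tact P (ms ! i) (tas ! i) (bs ! i)) [0..<length ms]) =
 tact P (sum_list ms) (block_sum ms tas) (tcomp P ms a bs)"
 and tcomp_assoc: "nss ~= [] ==> (\<forall>ns\<in>set nss. arity_list ns) ==>
 a : topspace (sp (length nss)) ==> tpoints P (map length nss) bs ==>
 list_all2 (tpoints P) nss css ==>
 tcomp P (concat nss) (tcomp P (map length nss) a bs) (concat css) =
 tcomp P (map sum_list nss) a
 (map (%i. tcomp P (nss ! i) (bs ! i) (css ! i)) [0..<length nss])"
proof -
 note ax = top_operad[unfolded top_operad_def]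
 note ax1 = ax[THEN conjunct1] and ax = ax[THEN conjunct2]
 note ax2 = ax[THEN conjunct1] and ax = ax[THEN conjunct2]
 note ax3 = ax[THEN conjunct1] and ax = ax[THEN conjunct2]
 note ax4 = ax[THEN conjunct1] and ax = ax[THEN conjunct2]
 note ax5 = ax[THEN conjunct1] and ax = ax[THEN conjunct2]
 note ax6 = ax[THEN conjunct1] and ax = ax[THEN conjunct2]
 note ax7 = ax[THEN conjunct1] and ax = ax[THEN conjunct2]
 note ax8 = ax[THEN conjunct1] and ax9 = ax[THEN conjunct2]
 show "1 <= l ==> sgg permutes {..<l} ==> continuous_map (sp l) (sp l) (tact P l sgg)"
 using ax1 by blast
 show "1 <= l ==> a : topspace (sp l) ==> tact P l id a = a"
 using ax2 by blast
 show "1 <= l ==> a : topspace (sp l) ==> sgg permutes {..<l} ==> ta permutes {..<l} ==>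
 tact P l (sgg o ta) a = tact P l ta (tact P l sgg a)"
 using ax3 by blast
 show "arity_list ms ==> continuous_map
 (prod_topology (sp (length ms)) (product_topology (%i. sp (ms ! i)) {..<length ms}))
 (sp (sum_list ms)) (%(x, y). tcomp P ms x (map y [0..<length ms]))"
 using ax4[rule_format, of ms] .
 show "tunit P : topspace (sp 1)"
 by (rule ax5)
 show "1 <= l ==> a : topspace (sp l) ==> tcomp P [l] (tunit P) [a] = a"
 "1 <= l ==> a : topspace (sp l) ==> tcomp P (replicate l 1) a (replicate l (tunit P)) = a"
 using ax6 by blast+
 show "arity_list ms ==> sgg permutes {..<length ms} ==>
 a : topspace (sp (length ms)) ==> tpoints P ms bs ==>
 tcomp P ms (tact P (length ms) sgg a) bs = tact P (sum_list ms) (block_perm ms sgg)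
 (tcomp P (permute_list (inv_into UNIV sgg) ms) a (permute_list (inv_into UNIV sgg) bs))"
 using ax7[rule_format, of ms sgg a bs] .
 show "arity_list ms ==> length tas = length ms ==>
 (\<forall>i<length ms. (tas ! i) permutes {..<ms ! i}) ==>
 a : topspace (sp (length ms)) ==> tpoints P ms bs ==>
 tcomp P ms a (map (%i. tact P (ms ! i) (tas ! i) (bs ! i)) [0..<length ms]) =
 tact P (sum_list ms) (block_sum ms tas) (tcomp P ms a bs)"
 using ax8[rule_format, of ms tas a bs] by blast
 show "nss ~= [] ==> (\<forall>ns\<in>set nss. arity_list ns) ==>
 a : topspace (sp (length nss)) ==> tpoints P (map length nss) bs ==>
 list_all2 (tpoints P) nss css ==>
 tcomp P (concat nss) (tcomp P (map length nss) a bs) (concat css) =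
 tcomp P (map sum_list nss) a
 (map (%i. tcomp P (nss ! i) (bs ! i) (css ! i)) [0..<length nss])"
 using ax9[rule_format, of nss a bs css] by blast
qed

lemma sdeg_map2:
 "length fs = length r ==> sdeg (map2 (%f (q, y). (q, mp q f y)) fs r) = sdeg r"
 by (induction fs r rule: list_induct2) auto

section \<open>Chains in integral degrees\<close>

lemma chz_0 [simp]: "0 : chz n X"
 by (simp add: chz_def)

lemma chz_diff: "x : chz n X ==> y : chz n X ==> x - y : chz n X"
 by (auto simp: chz_def chains_diff split: if_splits)

lemma chz_minus: "x : chz n X ==> - x : chz n X"
 using chz_diff[of 0 n X x] by simp

lemma chz_add: "x : chz n X ==> y : chz n X ==> x + y : chz n X"
 using chz_diff[of x n X "- y"] by (simp add: chz_minus)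

lemma chz_cmul: "x : chz n X ==> frag_cmul k x : chz n X"
 by (auto simp: chz_def chains_cmul split: if_splits)

lemma chz_sum: "(!!i. i : I ==> f i : chz n X) ==> (\<Sum>i\<in>I. f i) : chz n X"
 by (induction I rule: infinite_finite_induct) (auto simp: chz_add)

lemma chz_mp: "x : chz n X ==> continuous_map X Y f ==> mp (nat n) f x : chz n Y"
 by (auto simp: chz_def split: if_splits intro: push_in_chains)

lemma chz_bdry: "x : chz n X ==> bdry (nat n) x : chz (n - 1) X"
 using bdry_in[of x "nat n" X] by (cases "n <= 0") (auto simp: chz_def nat_diff_distrib split: if_splits)

lemma chz_cong: "x : chz n X ==> (!!a. a : topspace X ==> f a = g a) ==> mp (nat n) f x = mp (nat n) g x"
 by (auto simp: chz_def split: if_splits intro: push_cong)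

lemma arity_listD: "arity_list ms ==> 1 <= length ms" "arity_list ms ==> i < length ms ==> 1 <= ms ! i"
 by (auto simp: arity_list_def Suc_le_eq)

lemma arity_list_sum: "arity_list ms ==> 1 <= sum_list ms"
 by (cases ms) (auto simp: arity_list_def)

lemma tc_continuous:
 assumes "arity_list ms"
 shows "continuous_map (ltop (sp (length ms) # map sp ms)) (sp (sum_list ms)) (tc ms)"
proof -
 let ?L = "ltop (sp (length ms) # map sp ms)"
 have "continuous_map ?L (product_topology (%i. sp (ms ! i)) {..<length ms}) (%as. \<lambda>i\<in>{..<length ms}. as ! Suc i)"
 using continuous_map_nth_ltop[of "Suc _" "sp (length ms) # map sp ms"]
 by (auto simp: continuous_map_componentwise)
 moreover have "continuous_map ?L (sp (length ms)) (%as. as ! 0)"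
 using continuous_map_nth_ltop[of 0 "sp (length ms) # map sp ms"] by simp
 ultimately have "continuous_map ?L (prod_topology (sp (length ms)) (product_topology (%i. sp (ms ! i)) {..<length ms}))
 (%as. (as ! 0, \<lambda>i\<in>{..<length ms}. as ! Suc i))"
 by (intro continuous_map_pairedI)
 from continuous_map_compose[OF this tcomp_continuous[OF assms]] show ?thesis
 proof (rule continuous_map_eq)
 fix as assume "as : topspace ?L"
 then obtain b bs where "as = b # bs" "length bs = length ms"
 by (auto simp: topspace_ltop length_Suc_conv)
 moreover from this have "map (\<lambda>i\<in>{..<length ms}. bs ! i) [0..<length ms] = bs"
 by (intro nth_equalityI) auto
 ultimately show "((%(x, y). tcomp P ms x (map y [0..<length ms])) o (%as. (as ! 0, \<lambda>i\<in>{..<length ms}. as ! Suc i))) as =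
 tc ms as"
 by (simp cong: restrict_cong)
 qed
qed

lemma valid_zero: "valid ms qs ys ==> i < length ms ==> qs ! i < 0 ==> 0 : set ys"
proof -
 assume "valid ms qs ys" "i < length ms" "qs ! i < 0"
 then have "i < length ys" "ys ! i = 0" by (auto simp: valid_def chz_def)
 then show ?thesis by (metis nth_mem)
qed

lemma rcomp_zero: "length qs = length ys ==> 0 : set (x # ys) ==> rcomp ms p qs x ys = 0"
proof -
 assume *: "length qs = length ys" "0 : set (x # ys)"
 have "\<exists>q. (q, 0) : set (args p qs x ys)"
 proof (cases "x = 0")
 case False
 then obtain i where i: "i < length ys" "ys ! i = 0"
 using *(2) by (auto simp: in_set_conv_nth)
 then have "(nat (qs ! i), 0) : set (zip (map nat qs) ys)"
 using *(1) by (force simp: in_set_zip)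
 then show ?thesis by (auto simp: args_def)
 qed (auto simp: args_def)
 then obtain q where "(q, 0) : set (args p qs x ys)" ..
 then show ?thesis by (simp add: rcomp_def sprod_zero)
qed

text \<open>A nonzero chain has nonnegative degree. Every statement on composites therefore splits
  into one with a zero argument, where both sides vanish, and one in which \<open>nat\<close> loses
  nothing.\<close>

lemma negative_degree_cases:
 assumes "valid ms qs ys" "x : chz p (sp (length ms))"
 obtains "0 : set (x # ys)" | "0 <= p" "!!i. i < length ms ==> 0 <= qs ! i"
 using valid_zero[OF assms(1)] assms(2) by (force simp: chz_def not_less split: if_splits)

lemma entries_list_all2: "list_all2 (%(q, y) X. y : Ch q X) r Xs ==> entries r"
 by (induction r Xs rule: list_all2_induct) (auto intro: any_chain_of)

lemma args_in:
 assumes "valid ms qs ys" "x : chz p (sp (length ms))" "0 <= p" "!!i. i < length ms ==> 0 <= qs ! i"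
 shows "list_all2 (%(q, y) X. y : Ch q X) (args p qs x ys) (sp (length ms) # map sp ms)"
 and "entries (args p qs x ys)"
 and "int (sdeg (args p qs x ys)) = p + sum_list qs"
 and "length (args p qs x ys) = Suc (length ms)"
proof -
 have y: "ys ! i : Ch (nat (qs ! i)) (sp (ms ! i))" if "i < length ms" for i
 using assms(1) assms(4)[OF that] that by (auto simp: valid_def chz_def)
 have len: "length qs = length ms" "length ys = length ms"
 using assms(1) by (simp_all add: valid_def)
 have x: "x : Ch (nat p) (sp (length ms))"
 using assms(2,3) by (simp add: chz_def)
 show all2: "list_all2 (%(q, y) X. y : Ch q X) (args p qs x ys) (sp (length ms) # map sp ms)"
 using x y len by (simp add: args_def) (simp add: list_all2_conv_all_nth)
 then show "entries (args p qs x ys)"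
 by (rule entries_list_all2)
 show "length (args p qs x ys) = Suc (length ms)"
 by (simp add: args_def len)
 have "int (sum_list (map nat qs)) = sum_list qs"
 using assms(4) len by (intro int_sum_list_nat) (auto simp: in_set_conv_nth)
 then show "int (sdeg (args p qs x ys)) = p + sum_list qs"
 using assms(3) len by (simp add: args_def sdeg_def)
qed

lemma rcomp_in:
 assumes "arity_list ms" "valid ms qs ys" "x : chz p (sp (length ms))"
 shows "rcomp ms p qs x ys : chz (p + sum_list qs) (sp (sum_list ms))"
proof (rule negative_degree_cases[OF assms(2,3)])
 assume "0 : set (x # ys)"
 then show ?thesis
 using assms(2) by (simp add: rcomp_zero valid_def del: list.set)
next
 assume nn: "0 <= p" "!!i. i < length ms ==> 0 <= qs ! i"
 note args = args_in[OF assms(2,3) nn]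
 have "rcomp ms p qs x ys : Ch (sdeg (args p qs x ys)) (sp (sum_list ms))"
 unfolding rcomp_def by (rule push_in_chains[OF sprod_in_ltop[OF args(1)] tc_continuous[OF assms(1)]])
 moreover have "0 <= p + sum_list qs" "nat (p + sum_list qs) = sdeg (args p qs x ys)"
 using args(3) by linarith+
 ultimately show ?thesis
 by (simp add: chz_def)
qed

lemma rcomp_diff_left: "rcomp ms p qs (x - x') ys = rcomp ms p qs x ys - rcomp ms p qs x' ys"
 by (simp add: rcomp_def args_def push_diff star_diff)

lemma rcomp_diff_right:
 assumes "valid ms qs ys" "x : chz p (sp (length ms))" "i < length ms"
 "a : chz (qs ! i) (sp (ms ! i))" "b : chz (qs ! i) (sp (ms ! i))"
 shows "rcomp ms p qs x (ys[i := a - b]) = rcomp ms p qs x (ys[i := a]) - rcomp ms p qs x (ys[i := b])"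
proof -
 have any: "any_chain (nat (qs ! j)) c" if "c : chz (qs ! j) X" for c j and X :: "'a topology"
 using that by (auto simp: chz_def split: if_splits intro: any_chain_of)
 have len: "length qs = length ms" "length ys = length ms" using assms(1) by (auto simp: valid_def)
 have arg: "args p qs x (ys[i := c]) = (args p qs x ys)[Suc i := (nat (qs ! i), c)]" for c
 using assms(3) len by (simp add: args_def zip_update[symmetric]) (metis list_update_id map_update)
 have y: "any_chain (nat (qs ! j)) (ys ! j)" if "j < length ms" for j
 using assms(1) that by (intro any[of _ _ "sp (ms ! j)"]) (simp add: valid_def)
 have "any_chain (nat p) x"
 using assms(2) by (auto simp: chz_def split: if_splits intro: any_chain_of)
 then have "entries (args p qs x ys)"
 using y len by (auto simp: args_def entries_def in_set_zip)
 then have "sprod (args p qs x (ys[i := a - b])) = sprod (args p qs x (ys[i := a])) - sprod (args p qs x (ys[i := b]))"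
 unfolding arg using assms(3-5) len by (intro sprod_diff any) (auto simp: args_def)
 moreover have "sdeg (args p qs x (ys[i := c])) = sdeg (args p qs x ys)" for c
 using len by (simp add: args_def sdeg_def)
 ultimately show ?thesis
 by (simp add: rcomp_def push_diff)
qed

lemma rcomp_bdry:
 assumes "valid ms qs ys" "x : chz p (sp (length ms))"
 shows "bdry (nat (p + sum_list qs)) (rcomp ms p qs x ys) =
 rcomp ms (p - 1) qs (bdry (nat p) x) ys +
 (\<Sum>i<length ms. frag_cmul (sign_pow (p + sum_list (take i qs)))
 (rcomp ms p (qs[i := qs ! i - 1]) x (ys[i := bdry (nat (qs ! i)) (ys ! i)])))"
proof (rule negative_degree_cases[OF assms])
 have len: "length qs = length ms" "length ys = length ms" using assms(1) by (auto simp: valid_def)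
 assume 0: "0 : set (x # ys)"
 have "rcomp ms (p - 1) qs (bdry (nat p) x) ys = 0"
 using 0 len by (intro rcomp_zero) auto
 moreover have "rcomp ms p (qs[i := qs ! i - 1]) x (ys[i := bdry (nat (qs ! i)) (ys ! i)]) = 0"
 if i: "i < length ms" for i
 proof (rule rcomp_zero)
 show "0 : set (x # ys[i := bdry (nat (qs ! i)) (ys ! i)])"
 proof (cases "x = 0")
 case False
 then obtain j where j: "j < length ms" "ys ! j = 0"
 using 0 len by (auto simp: in_set_conv_nth)
 then have "ys[i := bdry (nat (qs ! i)) (ys ! i)] ! j = 0"
 using i len by (cases "i = j") auto
 then show ?thesis
 using j len by (metis length_list_update list.set_intros(2) nth_mem)
 qed simp
 qed (use len in simp)
 ultimately show ?thesis
 using 0 len by (simp add: rcomp_zero del: list.set)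
next
 have len: "length qs = length ms" "length ys = length ms" using assms(1) by (auto simp: valid_def)
 assume nn: "0 <= p" "!!i. i < length ms ==> 0 <= qs ! i"
 note args = args_in[OF assms nn]
 let ?r = "args p qs x ys"
 let ?N = "sdeg ?r"
 have N: "nat (p + sum_list qs) = ?N" using args(3) by linarith
 have "bdry ?N (rcomp ms p qs x ys) = mp (?N - 1) (tc ms) (bdry ?N (sprod ?r))"
 unfolding rcomp_def by (rule bdry_mp)
 also have "... = (\<Sum>i<Suc (length ms). frag_cmul ((- 1) ^ sdeg (take i ?r))
 (mp (?N - 1) (tc ms) (sprod (?r[i := (fst (?r ! i) - 1, bdry (fst (?r ! i)) (snd (?r ! i)))]))))"
 by (simp only: sprod_bdry[OF args(2)] push_sum push_cmul args(4))
 also have "... = mp (?N - 1) (tc ms) (sprod ((nat p - 1, bdry (nat p) x) # zip (map nat qs) ys)) +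
 (\<Sum>i<length ms. frag_cmul ((- 1) ^ sdeg (take (Suc i) ?r))
 (mp (?N - 1) (tc ms) (sprod (?r[Suc i := (nat (qs ! i) - 1, bdry (nat (qs ! i)) (ys ! i))]))))"
 using len by (simp add: sum.lessThan_Suc_shift args_def del: sum.lessThan_Suc sprod.simps)
 also have "mp (?N - 1) (tc ms) (sprod ((nat p - 1, bdry (nat p) x) # zip (map nat qs) ys)) =
 rcomp ms (p - 1) qs (bdry (nat p) x) ys"
 \<comment> \<open>In degree 0 the degree cannot be lowered by truncated subtraction, but then the
   first factor is 0.\<close>
 proof (cases "p = 0")
 case True
 then show ?thesis using len by (simp add: rcomp_zero)
 next
 case False
 then have "?N - 1 = sdeg (args (p - 1) qs (bdry (nat p) x) ys)"
 using nn(1) by (simp add: args_def)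
 moreover have "nat (p - 1) = nat p - 1" by simp
 ultimately show ?thesis
 by (simp add: rcomp_def args_def del: sprod.simps)
 qed
 also have "(\<Sum>i<length ms. frag_cmul ((- 1) ^ sdeg (take (Suc i) ?r))
 (mp (?N - 1) (tc ms) (sprod (?r[Suc i := (nat (qs ! i) - 1, bdry (nat (qs ! i)) (ys ! i))])))) =
 (\<Sum>i<length ms. frag_cmul (sign_pow (p + sum_list (take i qs)))
 (rcomp ms p (qs[i := qs ! i - 1]) x (ys[i := bdry (nat (qs ! i)) (ys ! i)])))"
 proof (intro sum.cong refl arg_cong2[of _ _ _ _ frag_cmul])
 fix i assume "i : {..<length ms}"
 then have i: "i < length ms" by simp
 have "int (sdeg (take (Suc i) ?r)) = p + sum_list (take i qs)"
 proof -
 have "sdeg (take (Suc i) ?r) = nat p + sum_list (map nat (take i qs))"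
 using i len by (simp add: args_def sdeg_def take_zip take_map)
 moreover have "int (sum_list (map nat (take i qs))) = sum_list (take i qs)"
 using nn(2) len i by (intro int_sum_list_nat) (auto simp: in_set_conv_nth)
 ultimately show ?thesis
 using nn(1) by simp
 qed
 then show "(- 1) ^ sdeg (take (Suc i) ?r) = sign_pow (p + sum_list (take i qs))"
 by (metis sign_pow_int)
 let ?r' = "args p (qs[i := qs ! i - 1]) x (ys[i := bdry (nat (qs ! i)) (ys ! i)])"
 show "mp (?N - 1) (tc ms) (sprod (?r[Suc i := (nat (qs ! i) - 1, bdry (nat (qs ! i)) (ys ! i))])) =
 rcomp ms p (qs[i := qs ! i - 1]) x (ys[i := bdry (nat (qs ! i)) (ys ! i)])"
 proof (cases "qs ! i = 0")
 case True
 have "(0, 0) : set (?r[Suc i := (0, 0)])" using i len by (intro set_update_memI) (simp add: args_def)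
 then show ?thesis
 using True i len by (simp add: sprod_zero rcomp_zero set_update_memI)
 next
 case False
 have r': "?r' = ?r[Suc i := (nat (qs ! i) - 1, bdry (nat (qs ! i)) (ys ! i))]"
 proof -
 have "nat (qs ! i - 1) = nat (qs ! i) - 1" by simp
 then show ?thesis
 by (simp only: args_def zip_update map_update list_update.simps nat.case)
 qed
 have "int (sdeg ?r') = p + sum_list (qs[i := qs ! i - 1])"
 proof (rule args_in(3))
 show "valid ms (qs[i := qs ! i - 1]) (ys[i := bdry (nat (qs ! i)) (ys ! i)])"
 using assms(1) i by (auto simp: valid_def nth_list_update chz_bdry)
 show "0 <= qs[i := qs ! i - 1] ! j" if "j < length ms" for j
 using nn(2)[OF that] False len that i by (auto simp: nth_list_update)
 qed (use assms nn in auto)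
 also have "sum_list (qs[i := qs ! i - 1]) = sum_list qs - 1"
 using i len by (simp add: sum_list_update_int)
 finally have "sdeg ?r' = ?N - 1"
 using args(3) by linarith
 then show ?thesis
 by (simp add: rcomp_def r')
 qed
 qed
 finally show ?thesis by (simp only: N)
qed

text \<open>Multiplying with a point chain is push-forward along the insertion of that point, which
  leaves the unit axioms of the topological operad on points.\<close>

lemma rcomp_unit:
 assumes "1 <= l" "x : chz n (sp l)"
 shows "rcomp [l] 0 [n] (pnt (tunit P)) [x] = x"
 and "rcomp (replicate l 1) n (replicate l 0) x (replicate l (pnt (tunit P))) = x"
proof -
 have any: "any_chain (nat n) x"
 using assms(2) by (auto simp: chz_def split: if_splits intro: any_chain_of)
 have id: "mp (nat n) f x = x" if "!!a. a : topspace (sp l) ==> f a = a" for f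
 using assms(2) that by (auto simp: chz_def split: if_splits intro: push_id)
 have "star 0 (nat n) (pnt [tunit P]) (sgl (nat n) x) = mp (nat n) (%a. [tunit P, a]) x"
 by (simp add: star_def prd_pnt any_chain_of[OF sgl_in[OF any]] push_push)
 then show "rcomp [l] 0 [n] (pnt (tunit P)) [x] = x"
 using tcomp_unit(1)[OF assms(1)]
 by (simp add: rcomp_def args_def mp_pnt star_pnt any_chain_of[OF sgl_in[OF any]] push_push id)
 have "sprod (replicate l (0, pnt (tunit P))) = pnt (replicate l (tunit P)) \<and>
 sdeg (replicate l (0, pnt (tunit P))) = 0"
 proof (induction l)
 case (Suc l)
 have "any_chain 0 (pnt as)" for as :: "'a list" by (rule pnt_in) simp
 with Suc show ?case
 by (simp add: mp_pnt) (simp add: star_def prd_pnt mp_pnt)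
 qed simp
 then show "rcomp (replicate l 1) n (replicate l 0) x (replicate l (pnt (tunit P))) = x"
 using tcomp_unit(2)[OF assms(1)]
 by (simp add: rcomp_def args_def star_def prd_pnt any_chain_of[OF sgl_in[OF any]] push_push id)
qed

lemma tpoints_ltop:
 "a # bs : topspace (ltop (sp (length ms) # map sp ms)) \<longleftrightarrow>
 a : topspace (sp (length ms)) & tpoints P ms bs"
 by (auto simp: topspace_ltop tpoints_def list_all2_conv_all_nth nth_Cons split: nat.splits)

lemma topspace_ltop_ConsE:
 assumes "as : topspace (ltop (sp (length ms) # map sp ms))"
 obtains a bs where "as = a # bs" "a : topspace (sp (length ms))" "tpoints P ms bs" "length bs = length ms"
proof -
 obtain a bs where as: "as = a # bs" "length bs = length ms"
 using assms by (auto simp: topspace_ltop length_Suc_conv)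
 with assms show ?thesis
 by (intro that[of a bs]) (auto simp: tpoints_ltop)
qed

text \<open>The permutations act on the factors without reordering them, so there is no sign, and
  the axiom already holds for representatives.\<close>

lemma rcomp_acts:
 assumes "arity_list ms" "length tas = length ms" "\<forall>i<length ms. (tas ! i) permutes {..<ms ! i}"
 "valid ms qs ys" "x : chz p (sp (length ms))"
 shows "rcomp ms p qs x (map (%i. mp (nat (qs ! i)) (tact P (ms ! i) (tas ! i)) (ys ! i)) [0..<length ms]) =
 mp (nat (p + sum_list qs)) (tact P (sum_list ms) (block_sum ms tas)) (rcomp ms p qs x ys)"
proof (rule negative_degree_cases[OF assms(4,5)])
 have len: "length qs = length ms" "length ys = length ms" using assms(4) by (auto simp: valid_def)
 assume 0: "0 : set (x # ys)"
 moreover from this have "0 : set (x # map (%i. mp (nat (qs ! i)) (tact P (ms ! i) (tas ! i)) (ys ! i)) [0..<length ms])"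
 using len by (auto simp: in_set_conv_nth image_iff) force
 ultimately show ?thesis
 using len by (simp add: rcomp_zero del: list.set)
next
 have len: "length qs = length ms" "length ys = length ms" using assms(4) by (auto simp: valid_def)
 assume nn: "0 <= p" "!!i. i < length ms ==> 0 <= qs ! i"
 note args = args_in[OF assms(4,5) nn]
 let ?r = "args p qs x ys" and ?fs = "(%a. a) # map (%i. tact P (ms ! i) (tas ! i)) [0..<length ms]"
 let ?N = "sdeg ?r"
 have any: "any_chain (nat p) x" using args(2) by (simp add: args_def)
 have r': "args p qs x (map (%i. mp (nat (qs ! i)) (tact P (ms ! i) (tas ! i)) (ys ! i)) [0..<length ms]) =
 map2 (%f (q, y). (q, mp q f y)) ?fs ?r"
 using len push_id[OF any, of "%a. a"] by (auto simp: args_def intro!: nth_equalityI)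
 have N: "sdeg (map2 (%f (q, y). (q, mp q f y)) ?fs ?r) = ?N" "nat (p + sum_list qs) = ?N"
 using args(3,4) by (auto intro!: sdeg_map2 simp del: sdeg_simps)
 have "rcomp ms p qs x (map (%i. mp (nat (qs ! i)) (tact P (ms ! i) (tas ! i)) (ys ! i)) [0..<length ms]) =
 mp ?N (tc ms) (mp ?N (%as. map2 (%f a. f a) ?fs as) (sprod ?r))"
 unfolding rcomp_def r' N using args(2,4) by (subst sprod_mp) auto
 also have "... = mp ?N (%as. tact P (sum_list ms) (block_sum ms tas) (tc ms as)) (sprod ?r)"
 unfolding push_push
 proof (rule push_cong[OF sprod_in_ltop[OF args(1)]])
 fix as assume "as : topspace (ltop (sp (length ms) # map sp ms))"
 then obtain a bs where as: "as = a # bs" "a : topspace (sp (length ms))" "tpoints P ms bs" "length bs = length ms"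
 by (rule topspace_ltop_ConsE)
 have "map2 (%f a. f a) (map (%i. tact P (ms ! i) (tas ! i)) [0..<length ms]) bs =
 map (%i. tact P (ms ! i) (tas ! i) (bs ! i)) [0..<length ms]"
 using as(4) by (intro nth_equalityI) auto
 then show "tc ms (map2 (%f a. f a) ?fs as) = tact P (sum_list ms) (block_sum ms tas) (tc ms as)"
 using tcomp_acts[OF assms(1-3) as(2,3)] by (simp add: as(1))
 qed
 also have "... = mp (nat (p + sum_list qs)) (tact P (sum_list ms) (block_sum ms tas)) (rcomp ms p qs x ys)"
 by (simp add: rcomp_def push_push N)
 finally show ?thesis .
qed

lemma star_prd:
 "star p q (mp p f x) (mp q g y) = mp (p + q) (%(a, b). f a @ g b) (prd p q x y)"
 by (simp add: star_def prd_mp push_push case_prod_unfold)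

lemma cong_mp_coarse: "cong n k x y ==> mp n f x - mp n f y : Rel n (coarse UNIV)"
 unfolding push_diff[symmetric] by (rule mp_Rel[of _ _ "lists_of_length k"]) (auto simp: cong_def)

text \<open>On points this is \<open>tcomp_act\<close>. The sign and the relation come from
  reordering the arguments, by \<open>sprod_permute\<close>, while the outer chain stays in
  front.\<close>

lemma rcomp_act:
 assumes ms: "arity_list ms" and sgg: "sgg permutes {..<length ms}"
 and v: "valid ms qs ys" and x: "x : chz p (sp (length ms))"
 shows "rcomp ms p qs (mp (nat p) (tact P (length ms) sgg) x) ys -
 frag_cmul (sign_pow (\<Sum>j<length ms. \<Sum>i | i < j & sgg j < sgg i. qs ! i * qs ! j))
 (mp (nat (p + sum_list qs)) (tact P (sum_list ms) (block_perm ms sgg))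
 (rcomp (permute_list (inv_into UNIV sgg) ms) p (permute_list (inv_into UNIV sgg) qs)
 x (permute_list (inv_into UNIV sgg) ys)))
 : Rel (nat (p + sum_list qs)) (coarse UNIV)"
proof (rule negative_degree_cases[OF v x])
 have len: "length qs = length ms" "length ys = length ms" using v by (auto simp: valid_def)
 assume 0: "0 : set (x # ys)"
 have "set (permute_list (inv_into UNIV sgg) ys) = set ys"
 using permutes_inv[OF sgg] len by (intro set_permute_list) simp
 with 0 show ?thesis
 using len by (subst (1 2) rcomp_zero) auto
next
 have len: "length qs = length ms" "length ys = length ms" using v by (auto simp: valid_def)
 assume nn: "0 <= p" "!!i. i < length ms ==> 0 <= qs ! i"
 note args = args_in[OF v x nn]
 let ?ta = "inv_into UNIV sgg"
 have ta: "?ta permutes {..<length ms}" by (rule permutes_inv[OF sgg])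
 let ?r = "args p qs x ys" and ?N = "sdeg (args p qs x ys)"
 \<comment> \<open>Index 0 is the outer chain, which stays in place; the arguments are shifted by
   one.\<close>
 let ?js = "0 # map Suc (map ?ta [0..<length ms])"
 let ?ms' = "permute_list ?ta ms"
 let ?act = "tact P (sum_list ms) (block_perm ms sgg)"
 have N: "nat (p + sum_list qs) = ?N" using args(3) by linarith
 have less: "?ta i < length ms" if "i < length ms" for i
 using permutes_in_image[OF ta, of i] that by simp
 have r': "map ((!) ?r) ?js = args p (permute_list ?ta qs) x (permute_list ?ta ys)"
 using len ta by (auto simp: args_def permute_list_def less intro!: nth_equalityI)
 have N': "sdeg (args p (permute_list ?ta qs) x (permute_list ?ta ys)) = ?N"
 using len ta by (simp add: args_def sdeg_def permute_list_map[symmetric] flip: sum_mset_sum_list)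
 have inj: "inj_on ?ta A" for A using permutes_inj[OF ta] by (rule inj_on_subset) simp
 have js: "distinct ?js" "set ?js = {..<length ?r}"
 proof -
 have "?ta ` {0..<length ms} = {..<length ms}"
 using permutes_image[OF ta] by (simp add: atLeast0LessThan)
 moreover have "set ?js = insert 0 (Suc ` ?ta ` {0..<length ms})"
 by (simp add: image_image)
 ultimately show "set ?js = {..<length ?r}"
 by (simp only: args(4) lessThan_Suc_eq_insert_0)
 show "distinct ?js"
 using injD[OF permutes_inj[OF ta]] by (auto simp: distinct_map inj_on_def)
 qed
 have weight: "int (inversion_weight (%i. fst (?r ! i)) ?js) =
 (\<Sum>j<length ms. \<Sum>i | i < j & sgg j < sgg i. qs ! i * qs ! j)"
 proof -
 have "inversion_weight (%i. fst (?r ! i)) ?js =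
 inversion_weight (%i. fst (?r ! Suc i)) (map ?ta [0..<length ms])"
 by (simp add: inversion_weight_Suc del: map_map)
 also have "int ... = (\<Sum>j<length ms. \<Sum>i | i < j & sgg j < sgg i. int (fst (?r ! Suc i)) * int (fst (?r ! Suc j)))"
 by (simp add: inversion_weight_inv_perm[OF sgg])
 also have "... = (\<Sum>j<length ms. \<Sum>i | i < j & sgg j < sgg i. qs ! i * qs ! j)"
 using len nn(2) by (intro sum.cong refl) (auto simp: args_def)
 finally show ?thesis .
 qed
 define w where "w = inversion_weight (%i. fst (?r ! i)) ?js"
 have sgn: "sign_pow (\<Sum>j<length ms. \<Sum>i | i < j & sgg j < sgg i. qs ! i * qs ! j) = (- 1) ^ w"
 unfolding weight[symmetric] w_def by (rule sign_pow_int)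
 let ?fs = "tact P (length ms) sgg # replicate (length ms) (%a. a)"
 have any: "any_chain (nat (qs ! i)) (ys ! i)" if "i < length ms" for i
 using v that nn(2)[OF that] any_chain_of[of "ys ! i" "nat (qs ! i)" "sp (ms ! i)"]
 by (auto simp: valid_def chz_def split: if_splits)
 have r2: "args p qs (mp (nat p) (tact P (length ms) sgg) x) ys = map2 (%f (q, y). (q, mp q f y)) ?fs ?r"
 using len push_id[OF any, of _ "%a. a"] by (auto simp: args_def intro!: nth_equalityI)
 have N2: "sdeg (map2 (%f (q, y). (q, mp q f y)) ?fs ?r) = ?N"
 using args(4) by (intro sdeg_map2) simp
 have "rcomp ms p qs (mp (nat p) (tact P (length ms) sgg) x) ys =
 mp ?N (tc ms) (mp ?N (%as. map2 (%f a. f a) ?fs as) (sprod ?r))"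
 unfolding rcomp_def r2 N2 using args(2,4) by (subst sprod_mp) auto
 also have "... = mp ?N (%as. ?act (tc ?ms' (map ((!) as) ?js))) (sprod ?r)"
 unfolding push_push
 proof (rule push_cong[OF sprod_in_ltop[OF args(1)]])
 fix as assume "as : topspace (ltop (sp (length ms) # map sp ms))"
 then obtain a bs where as: "as = a # bs" "a : topspace (sp (length ms))" "tpoints P ms bs" "length bs = length ms"
 by (rule topspace_ltop_ConsE)
 have "map ((!) as) ?js = a # permute_list ?ta bs"
 using as(4) by (simp add: as(1) permute_list_def)
 then show "tc ms (map2 (%f a. f a) ?fs as) = ?act (tc ?ms' (map ((!) as) ?js))"
 using tcomp_act[OF ms sgg as(2,3)] as(4) by (simp add: as(1) map_tl_sublists)
 qed
 finally have lhs: "rcomp ms p qs (mp (nat p) (tact P (length ms) sgg) x) ys =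
 mp ?N (%as. ?act (tc ?ms' (map ((!) as) ?js))) (sprod ?r)" .
 \<comment> \<open>A sign is its own inverse, so multiplying by it once more moves it to the other
   side of the congruence.\<close>
 have "cong ?N (length ?r) (frag_cmul ((- 1) ^ w) (sprod (map ((!) ?r) ?js)))
 (frag_cmul ((- 1) ^ w) (frag_cmul ((- 1) ^ w) (mp ?N (%as. map ((!) as) ?js) (sprod ?r))))"
 unfolding w_def by (rule cong_cmul[OF sprod_permute[OF js args(2)]])
 moreover have "(- 1 :: int) ^ w * (- 1) ^ w = 1"
 by (simp add: power_mult_distrib[symmetric])
 ultimately have "cong ?N (length ?r) (frag_cmul ((- 1) ^ w) (sprod (map ((!) ?r) ?js)))
 (mp ?N (%as. map ((!) as) ?js) (sprod ?r))"
 by (simp only: frag_cmul_cmul frag_cmul_one)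
 from cong_mp_coarse[OF cong_sym[OF this], of "%as. ?act (tc ?ms' as)"]
 show ?thesis
 unfolding lhs sgn N r' rcomp_def[of ?ms'] N' push_cmul push_push .
qed

text \<open>
 After the relation on iterated products, both composites are the image of the product of
 \<open>x\<close> with the product of the blocks under maps that agree by associativity on points.
\<close>

lemma rcomp_assoc:
 assumes nss: "nss ~= []" "\<forall>ns\<in>set nss. arity_list ns"
 and x: "x : chz p (sp (length nss))" and v: "valid (map length nss) qs ys"
 and len': "length rss = length nss" "length zss = length nss"
 and vz: "\<forall>i<length nss. valid (nss ! i) (rss ! i) (zss ! i)"
 shows "rcomp (concat nss) (p + sum_list qs) (concat rss) (rcomp (map length nss) p qs x ys) (concat zss) -
 frag_cmul (sign_pow (\<Sum>j<length nss. \<Sum>i<j. qs ! j * sum_list (rss ! i)))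
 (rcomp (map sum_list nss) p (map (%i. qs ! i + sum_list (rss ! i)) [0..<length nss]) x
 (map (%i. rcomp (nss ! i) (qs ! i) (rss ! i) (ys ! i) (zss ! i)) [0..<length nss]))
 : Rel (nat (p + sum_list qs + sum_list (concat rss))) (coarse UNIV)"
proof -
 have len: "length qs = length nss" "length ys = length nss" using v by (auto simp: valid_def)
 have leni: "length (rss ! i) = length (nss ! i)" "length (zss ! i) = length (nss ! i)" if "i < length nss" for i
 using vz that by (auto simp: valid_def)
 have lenc: "length (concat rss) = length (concat nss)" "length (concat zss) = length (concat nss)"
 using leni len' by (auto simp: length_concat sum_list_sum_nth atLeast0LessThan intro!: sum.cong)
 let ?x' = "rcomp (map length nss) p qs x ys"
 let ?ys' = "map (%i. rcomp (nss ! i) (qs ! i) (rss ! i) (ys ! i) (zss ! i)) [0..<length nss]"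
 show ?thesis
 \<comment> \<open>A zero anywhere makes both composites 0. Otherwise all degrees are nonnegative,
   and \<open>nat\<close> is harmless.\<close>
 proof (cases "0 : set (x # ys) \<or> 0 : set (concat zss)")
 case True
 then have "rcomp (concat nss) (p + sum_list qs) (concat rss) ?x' (concat zss) = 0"
 proof
 assume "0 : set (x # ys)"
 then have "?x' = 0" using len by (intro rcomp_zero) auto
 then show ?thesis using lenc by (intro rcomp_zero) auto
 qed (use lenc in \<open>auto intro!: rcomp_zero\<close>)
 moreover have "0 : set (x # ?ys')"
 using True
 proof
 assume 0: "0 : set (x # ys)"
 show ?thesis
 proof (cases "x = 0")
 case False
 then obtain j where j: "j < length nss" "ys ! j = 0"
 using 0 len by (auto simp: in_set_conv_nth)
 then have "rcomp (nss ! j) (qs ! j) (rss ! j) (ys ! j) (zss ! j) = 0"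
 using leni by (intro rcomp_zero) auto
 then show ?thesis using j by force
 qed simp
 next
 assume "0 : set (concat zss)"
 then obtain z where "z : set zss" "0 : set z" by auto
 then obtain j where j: "j < length nss" "0 : set (zss ! j)"
 using len' by (metis in_set_conv_nth)
 then have "rcomp (nss ! j) (qs ! j) (rss ! j) (ys ! j) (zss ! j) = 0"
 using leni by (intro rcomp_zero) auto
 then show ?thesis using j by force
 qed
 ultimately show ?thesis
 using len by (simp add: rcomp_zero del: list.set)
 next
 case False
 have nn: "0 <= p" "!!i. i < length (map length nss) ==> 0 <= qs ! i"
 using negative_degree_cases[OF v, of x p] x False by auto
 have nnz: "0 <= rss ! i ! j" if "i < length nss" "j < length (nss ! i)" for i j
 proof (rule ccontr)
 assume "~ 0 <= rss ! i ! j"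
 then have "0 : set (zss ! i)" using vz that by (intro valid_zero) auto
 then show False using False that(1) len' by auto
 qed
 have x': "x : chz p (sp (length (map length nss)))" using x by simp
 note args = args_in[OF v x' nn]
 define e where "e = (%i. (nat (qs ! i), ys ! i))"
 define zs where "zs = (%i. zip (map nat (rss ! i)) (zss ! i))"
 define B where "B = map (%i. (e i, zs i)) [0..<length nss]"
 let ?hs = "zip (map nat qs) ys" and ?cz = "zip (map nat (concat rss)) (concat zss)"
 have hs: "map fst B = ?hs"
 using len by (auto simp: B_def e_def intro!: nth_equalityI)
 have cz: "concat (map snd B) = ?cz"
 proof -
 have "\<forall>i<length nss. length (rss ! i) = length (zss ! i)" using leni by auto
 then have "zip (map nat (concat rss)) (concat zss) = concat (map2 (%r z. zip (map nat r) z) rss zss)"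
 using len'
 proof (induction nss arbitrary: rss zss)
 case (Cons n nss)
 then obtain r rs z zs where "rss = r # rs" "zss = z # zs" by (metis length_Suc_conv)
 with Cons show ?case by (force simp: nth_Cons')
 qed auto
 moreover have "map2 (%r z. zip (map nat r) z) rss zss = map snd B"
 using len' by (auto simp: B_def zs_def intro!: nth_equalityI)
 ultimately show ?thesis by simp
 qed
 have vi: "ys ! i : Ch (nat (qs ! i)) (sp (length (nss ! i)))" if "i < length nss" for i
 using v nn(2)[of i] that by (auto simp: valid_def chz_def)
 have xi: "ys ! i : chz (qs ! i) (sp (length (nss ! i)))" if "i < length nss" for i
 using v that by (auto simp: valid_def)
 have ei: "e i # zs i = args (qs ! i) (rss ! i) (ys ! i) (zss ! i)" for i
 by (simp add: e_def zs_def args_def)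
 have argsi: "list_all2 (%(q, y) X. y : Ch q X) (e i # zs i) (sp (length (nss ! i)) # map sp (nss ! i))"
 "entries (e i # zs i)" "int (sdeg (e i # zs i)) = qs ! i + sum_list (rss ! i)"
 if i: "i < length nss" for i
 proof -
 have *: "valid (nss ! i) (rss ! i) (zss ! i)" using vz i by simp
 have **: "0 <= qs ! i" "!!j. j < length (nss ! i) ==> 0 <= rss ! i ! j"
 using nn(2)[of i] nnz i by auto
 show "list_all2 (%(q, y) X. y : Ch q X) (e i # zs i) (sp (length (nss ! i)) # map sp (nss ! i))"
 "entries (e i # zs i)" "int (sdeg (e i # zs i)) = qs ! i + sum_list (rss ! i)"
 unfolding ei by (rule args_in[OF * xi[OF i] **]; assumption)+
 qed
 have entB: "!!e zs. (e, zs) : set B ==> entries (e # zs)"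
 using argsi(2) by (auto simp: B_def)
 have enth: "entries ?hs" using args(2) by (simp add: args_def)
 have entz: "entries ?cz"
 unfolding cz[symmetric] using argsi(2) by (auto simp: B_def entries_def)
 define bl where "bl = map (%i. (sdeg (e i # zs i), sprod (e i # zs i))) [0..<length nss]"
 have bl: "map (%(e, zs). (fst e + sdeg zs, sprod (e # zs))) B = bl"
 by (simp add: bl_def B_def e_def)
 let ?a = "sdeg ?hs" and ?c = "sdeg ?cz"
 let ?n = "length nss" and ?m = "length (concat nss)"
 let ?f = "%bs. map hd bs @ concat (map tl bs)"
 have lenhs: "length ?hs = ?n" "length ?cz = ?m" using len lenc by simp_all
 have blocks: "cong (?a + ?c) (?n + ?m) (star ?a ?c (sprod ?hs) (sprod ?cz))
 (frag_cmul ((- 1) ^ block_weight B) (mp (?a + ?c) ?f (sprod bl)))"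
 using sprod_blocks[of B, OF entB] unfolding hs cz bl lenhs .
 have degbl: "sdeg bl = ?a + ?c"
 unfolding hs[symmetric] cz[symmetric] bl[symmetric] by (induction B) auto
 let ?Ls = "map (%i. ltop (sp (length (nss ! i)) # map sp (nss ! i))) [0..<length nss]"
 have SP: "sprod bl : Ch (?a + ?c) (ltop ?Ls)"
 unfolding degbl[symmetric] using sprod_in_ltop[OF argsi(1)]
 by (intro sprod_in_ltop) (auto simp: bl_def list_all2_conv_all_nth)
 have entbl: "entries bl"
 using sprod_any[OF argsi(2)] by (fastforce simp: bl_def entries_def)
 have anyx: "any_chain (nat p) x" and X: "x : Ch (nat p) (sp (length nss))"
 using x nn(1) by (auto simp: chz_def intro: any_chain_of)
 let ?sx = "sgl (nat p) x"
 have SX: "?sx : Ch (nat p) (ltop [sp (length nss)])"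
 using X by (auto intro!: push_in_chains continuous_map_into_ltop)
 let ?N = "nat p + (?a + ?c)"
 let ?F = "%cs. tcomp P (concat nss) (tcomp P (map length nss) (hd cs) (take ?n (tl cs))) (drop ?n (tl cs))"
 have degp: "int (nat p + ?a) = p + sum_list qs"
 using args(3) by (simp only: args_def sdeg_simps fst_conv)
 then have deg1: "nat (p + sum_list qs) = nat p + ?a"
 by linarith
 have "rcomp (concat nss) (p + sum_list qs) (concat rss) ?x' (concat zss) =
 mp (nat p + ?a + ?c) (tc (concat nss)) (star (nat p + ?a) ?c
 (mp (nat p + ?a) (%as. [tc (map length nss) as]) (sprod ((nat p, x) # ?hs))) (mp ?c (%as. as) (sprod ?cz)))"
 using push_id[OF sprod_any[OF entz], of "%as. as"]
 by (simp add: rcomp_def[of "concat nss"] args_def deg1 rcomp_def[of "map length nss"] push_push del: sprod.simps)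
 (simp add: push_push)
 also have "star (nat p + ?a) ?c
 (mp (nat p + ?a) (%as. [tc (map length nss) as]) (sprod ((nat p, x) # ?hs))) (mp ?c (%as. as) (sprod ?cz)) =
 mp (nat p + ?a + ?c) (%cs. tcomp P (map length nss) (hd cs) (take ?n (tl cs)) # drop ?n (tl cs))
 (star (nat p + ?a) ?c (sprod ((nat p, x) # ?hs)) (sprod ?cz))"
 using sprod_in[of "(nat p, x) # ?hs"] sprod_in[OF entz] anyx enth lenhs
 by (intro star_mp) (auto simp: length_Suc_conv)
 also have "star (nat p + ?a) ?c (sprod ((nat p, x) # ?hs)) (sprod ?cz) =
 star (nat p) (?a + ?c) ?sx (star ?a ?c (sprod ?hs) (sprod ?cz))"
 using star_assoc[OF any_chain_of[OF SX] sprod_any[OF enth] sprod_any[OF entz]] by simp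
 finally have lhs: "rcomp (concat nss) (p + sum_list qs) (concat rss) ?x' (concat zss) =
 mp ?N ?F (star (nat p) (?a + ?c) ?sx (star ?a ?c (sprod ?hs) (sprod ?cz)))"
 by (simp add: push_push add.assoc)
 let ?gs = "map (%i. tc (nss ! i)) [0..<length nss]"
 let ?ds = "map (%i. qs ! i + sum_list (rss ! i)) [0..<length nss]"
 have bly: "zip (map nat ?ds) ?ys' = map2 (%g (d, b). (d, mp d g b)) ?gs bl"
 proof (rule nth_equalityI)
 fix i assume "i < length (zip (map nat ?ds) ?ys')"
 then have i: "i < length nss" by simp
 have "nat (qs ! i + sum_list (rss ! i)) = sdeg (e i # zs i)"
 using argsi(3)[OF i] by linarith
 then show "zip (map nat ?ds) ?ys' ! i = map2 (%g (d, b). (d, mp d g b)) ?gs bl ! i"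
 using i by (simp add: bl_def rcomp_def ei[symmetric] del: sprod.simps sdeg_simps)
 qed (simp add: bl_def)
 have degy: "sdeg (zip (map nat ?ds) ?ys') = ?a + ?c"
 unfolding bly degbl[symmetric] by (rule sdeg_map2) (simp add: bl_def)
 have "sprod (zip (map nat ?ds) ?ys') = mp (?a + ?c) (%bs. map2 (%g b. g b) ?gs bs) (sprod bl)"
 unfolding bly degbl[symmetric] using entbl by (intro sprod_mp) (simp_all add: bl_def)
 then have "rcomp (map sum_list nss) p ?ds x ?ys' =
 mp ?N (tc (map sum_list nss)) (star (nat p) (?a + ?c) ?sx
 (mp (?a + ?c) (%bs. map2 (%g b. g b) ?gs bs) (sprod bl)))"
 by (simp only: rcomp_def[of "map sum_list nss"] args_def[of p ?ds] sprod.simps sdeg_simps degy fst_conv)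
 also have "... = mp ?N (tc (map sum_list nss)) (star (nat p) (?a + ?c) (mp (nat p) (%as. as) ?sx)
 (mp (?a + ?c) (%bs. map2 (%g b. g b) ?gs bs) (sprod bl)))"
 by (simp only: push_id[OF SX, of "%as. as", OF refl])
 also have "... = mp ?N (%(as, bs). tc (map sum_list nss) (as @ map2 (%g b. g b) ?gs bs))
 (prd (nat p) (?a + ?c) ?sx (sprod bl))"
 by (subst star_prd) (simp only: push_push case_prod_unfold)
 \<comment> \<open>Associativity of the topological operad enters here, point by point.\<close>
 also have "... = mp ?N (%(as, bs). ?F (as @ ?f bs)) (prd (nat p) (?a + ?c) ?sx (sprod bl))"
 proof (rule push_cong[OF prd_in[OF SX SP]], clarify)
 fix as bs assume "(as, bs) : topspace (prod_topology (ltop [sp (length nss)]) (ltop ?Ls))"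
 then obtain a where as: "as = [a]" "a : topspace (sp (length nss))" and bs: "length bs = length nss"
 "!!i. i < length nss ==> bs ! i : topspace (ltop (sp (length (nss ! i)) # map sp (nss ! i)))"
 by (auto simp: topspace_ltop[of "[_]"] topspace_ltop[of ?Ls] length_Suc_conv)
 have bi: "hd (bs ! i) : topspace (sp (length (nss ! i)))" "tpoints P (nss ! i) (tl (bs ! i))"
 if "i < length nss" for i
 using bs(2)[OF that] by (auto elim: topspace_ltop_ConsE)
 have "tcomp P (concat nss) (tcomp P (map length nss) a (map hd bs)) (concat (map tl bs)) =
 tcomp P (map sum_list nss) a (map (%i. tcomp P (nss ! i) (map hd bs ! i) (map tl bs ! i)) [0..<length nss])"
 using bi bs(1) by (intro tcomp_assoc[OF nss as(2)]) (auto simp: tpoints_def list_all2_conv_all_nth)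
 moreover have "map (%i. tcomp P (nss ! i) (map hd bs ! i) (map tl bs ! i)) [0..<length nss] =
 map2 (%g b. g b) ?gs bs"
 using bs(1) by (intro nth_equalityI) auto
 ultimately show "tc (map sum_list nss) (as @ map2 (%g b. g b) ?gs bs) = ?F (as @ ?f bs)"
 using bs(1) by (simp add: as(1))
 qed
 also have "... = mp ?N ?F (star (nat p) (?a + ?c) (mp (nat p) (%as. as) ?sx) (mp (?a + ?c) ?f (sprod bl)))"
 by (subst star_prd) (simp only: push_push case_prod_unfold)
 finally have rhs: "rcomp (map sum_list nss) p ?ds x ?ys' =
 mp ?N ?F (star (nat p) (?a + ?c) ?sx (mp (?a + ?c) ?f (sprod bl)))"
 by (simp only: push_id[OF SX, of "%as. as", OF refl])
 have "int (block_weight B) = (\<Sum>j<length nss. \<Sum>i<j. qs ! j * sum_list (rss ! i))"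
 proof -
 have "int (sdeg (zs i)) = sum_list (rss ! i)" if "i < length nss" for i
 using argsi(3)[OF that] nn(2)[of i] that by (simp add: e_def)
 then show ?thesis
 using nn(2) unfolding block_weight_def
 by (simp add: B_def e_def)
 qed
 then have sgn: "sign_pow (\<Sum>j<length nss. \<Sum>i<j. qs ! j * sum_list (rss ! i)) = (- 1) ^ block_weight B"
 by (metis sign_pow_int)
 have "?sx : Ch (nat p) (lists_of_length 1)" using sgl_in[OF anyx] by simp
 from cong_star'[OF blocks this]
 have "cong ?N (1 + (?n + ?m)) (star (nat p) (?a + ?c) ?sx (star ?a ?c (sprod ?hs) (sprod ?cz)))
 (frag_cmul ((- 1) ^ block_weight B) (star (nat p) (?a + ?c) ?sx (mp (?a + ?c) ?f (sprod bl))))"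
 unfolding star_cmul .
 from cong_mp_coarse[OF this, of ?F]
 have "rcomp (concat nss) (p + sum_list qs) (concat rss) ?x' (concat zss) -
 frag_cmul ((- 1) ^ block_weight B) (rcomp (map sum_list nss) p ?ds x ?ys') : Rel ?N (coarse UNIV)"
 unfolding push_cmul lhs rhs .
 moreover have "nat (p + sum_list qs + sum_list (concat rss)) = ?N"
 proof -
 have "int ?c = sum_list (concat rss)"
 proof -
 have "int (sdeg (zs i)) = sum_list (rss ! i)" if "i < length nss" for i
 using argsi(3)[OF that] nn(2)[of i] that by (simp add: e_def)
 then have "int (sum_list (map (%i. sdeg (zs i)) [0..<length nss])) = sum_list (map sum_list rss)"
 using len' by (simp add: sum_list_sum_nth atLeast0LessThan)
 moreover have "?c = sum_list (map (%i. sdeg (zs i)) [0..<length nss])"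
 unfolding cz[symmetric] B_def by (induction nss) (auto simp: sdeg_def sum_list_concat o_def map_concat)
 ultimately show ?thesis by (simp add: sum_list_concat)
 qed
 with degp show ?thesis by linarith
 qed
 ultimately show ?thesis
 unfolding sgn by (simp only:)
 qed
qed

end

section \<open>Block permutations\<close>

lemma block_of_offset_in:
 assumes "k < sum_list ms"
 shows "block_of ms k < length ms" "sum_list (take (block_of ms k) ms) + offset_in ms k = k"
 "offset_in ms k < ms ! block_of ms k"
proof -
 let ?b = "block_of ms k"
 have ex: "k < sum_list (take (Suc (length ms - 1)) ms)"
 using assms by (cases ms) auto
 have b: "k < sum_list (take (Suc ?b) ms)"
 unfolding block_of_def using ex by (rule LeastI)
 have "?b <= length ms - 1"
 unfolding block_of_def using ex by (rule Least_le)
 moreover have "ms ~= []" using assms by auto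
 ultimately show len: "?b < length ms" by (cases ms) auto
 have le: "sum_list (take ?b ms) <= k"
 proof (cases ?b)
 case (Suc b)
 then have "~ k < sum_list (take (Suc b) ms)"
 using not_less_Least[of b "%i. k < sum_list (take (Suc i) ms)"] by (simp add: block_of_def)
 with Suc show ?thesis by simp
 qed simp
 then show "sum_list (take ?b ms) + offset_in ms k = k"
 by (simp add: offset_in_def)
 show "offset_in ms k < ms ! ?b"
 using b len le by (simp add: offset_in_def take_Suc_conv_app_nth)
qed


text \<open>Common form of both kinds of block permutation: block \<open>b\<close> is placed at
  \<open>S b\<close>, with \<open>g b\<close> acting inside it. Disjointness of the places gives
  injectivity, and finiteness the rest.\<close>

lemma block_map_permutes:
 fixes S :: "nat => nat" and g :: "nat => nat => nat"
 assumes f: "!!k. k < sum_list ms ==> f k = S (block_of ms k) + g (block_of ms k) (offset_in ms k)"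
 and out: "!!k. ~ k < sum_list ms ==> f k = k"
 and g: "!!b. b < length ms ==> g b permutes {..<ms ! b}"
 and S: "!!b. b < length ms ==> S b + ms ! b <= sum_list ms"
 and disj: "!!b c. b < length ms ==> c < length ms ==> b ~= c ==> S b + ms ! b <= S c \<or> S c + ms ! c <= S b"
 shows "f permutes {..<sum_list ms}"
proof (rule bij_imp_permutes)
 let ?N = "sum_list ms"
 have g_less: "g (block_of ms k) (offset_in ms k) < ms ! block_of ms k" if "k < ?N" for k
 using permutes_in_image[OF g] block_of_offset_in[OF that] by (metis lessThan_iff)
 have "inj_on f {..<?N}"
 proof (rule inj_onI)
 fix k l assume kl: "k : {..<?N}" "l : {..<?N}" "f k = f l"
 then have k: "k < ?N" and l: "l < ?N" by auto
 note bk = block_of_offset_in[OF k] and bl = block_of_offset_in[OF l]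
 have same: "block_of ms k = block_of ms l"
 using disj[OF bk(1) bl(1)] kl(3) g_less[OF k] g_less[OF l] unfolding f[OF k] f[OF l] by fastforce
 then have "g (block_of ms l) (offset_in ms k) = g (block_of ms l) (offset_in ms l)"
 using kl(3) unfolding f[OF k] f[OF l] by simp
 then have "offset_in ms k = offset_in ms l"
 using permutes_inj[OF g[OF bl(1)]] by (simp add: inj_eq)
 then show "k = l"
 using bk(2) bl(2) same by metis
 qed
 moreover have "f ` {..<?N} \<subseteq> {..<?N}"
 proof (rule image_subsetI)
 fix k assume "k : {..<?N}"
 then have k: "k < ?N" by simp
 show "f k : {..<?N}"
 using f[OF k] g_less[OF k] S[OF block_of_offset_in(1)[OF k]] by simp
 qed
 ultimately show "bij_betw f {..<?N} {..<?N}"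
 by (simp add: bij_betw_def endo_inj_surj)
qed (use out in auto)

lemma block_perm_permutes:
 assumes "sgg permutes {..<length ms}"
 shows "block_perm ms sgg permutes {..<sum_list ms}"
proof (rule block_map_permutes[where S = "%b. \<Sum>j | j < length ms & sgg j < sgg b. ms ! j" and g = "%b. id"])
 have "(\<Sum>j | j < length ms & sgg j < sgg b. ms ! j) + ms ! b = sum ((!) ms) (insert b {j. j < length ms & sgg j < sgg b})"
 for b by simp
 note * = this
 fix b c assume b: "b < length ms"
 show "(\<Sum>j | j < length ms & sgg j < sgg b. ms ! j) + ms ! b <= sum_list ms"
 unfolding * sum_list_sum_nth using b by (intro sum_mono2) auto
 \<comment> \<open>If \<open>b\<close> is placed before \<open>c\<close>, then \<open>b\<close> and
   all blocks before it lie before \<open>c\<close>; hence the two places do not meet.\<close>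
 have mono: "(\<Sum>j | j < length ms & sgg j < sgg b. ms ! j) + ms ! b <= (\<Sum>j | j < length ms & sgg j < sgg c. ms ! j)"
 if "b < length ms" "sgg b < sgg c" for b c
 unfolding * using that by (intro sum_mono2) auto
 assume c: "c < length ms" "b ~= c"
 then have "sgg b < sgg c \<or> sgg c < sgg b"
 using permutes_inj[OF assms] by (metis injD linorder_neqE_nat)
 then show "(\<Sum>j | j < length ms & sgg j < sgg b. ms ! j) + ms ! b <= (\<Sum>j | j < length ms & sgg j < sgg c. ms ! j) \<or>
 (\<Sum>j | j < length ms & sgg j < sgg c. ms ! j) + ms ! c <= (\<Sum>j | j < length ms & sgg j < sgg b. ms ! j)"
 using mono b c(1) by blast
qed (auto simp: block_perm_def permutes_id)

lemma block_sum_permutes: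
 assumes "\<forall>i<length ms. (tas ! i) permutes {..<ms ! i}"
 shows "block_sum ms tas permutes {..<sum_list ms}"
proof (rule block_map_permutes[where S = "%b. sum_list (take b ms)" and g = "%b. tas ! b"])
 have step: "sum_list (take b ms) + ms ! b = sum_list (take (Suc b) ms)" if "b < length ms" for b
 using that by (simp add: take_Suc_conv_app_nth)
 have mono: "sum_list (take a ms) <= sum_list (take b ms)" if "a <= b" for a b
 using that by (metis le_add1 le_Suc_ex sum_list_append take_add)
 fix b c assume b: "b < length ms"
 show "sum_list (take b ms) + ms ! b <= sum_list ms"
 unfolding step[OF b] using mono[of "Suc b" "length ms"] b by simp
 assume c: "c < length ms" "b ~= c"
 then show "sum_list (take b ms) + ms ! b <= sum_list (take c ms) \<or>
 sum_list (take c ms) + ms ! c <= sum_list (take b ms)"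
 unfolding step[OF b] step[OF c(1)] using mono[of "Suc b" c] mono[of "Suc c" b] by linarith
qed (use assms in \<open>auto simp: block_sum_def\<close>)


section \<open>Operads presented by chains modulo relations\<close>

lemma nat_minus_one: "nat (n - 1) = nat n - 1"
 by linarith

text \<open>Describes a dg operad by representatives: \<open>cls\<close> is additive and onto with
  the relations as kernel, and the structure is known on classes. In \<open>cls_one\<close> the
  disjunct \<open>x = 0\<close> serves the negative degrees.\<close>

locale presented_operad = operad_chains dom pt bd pr rel P for dom pt bd pr rel and P :: "'a top_operad_data" +
 fixes D :: "'c dg_operad_data" and cls :: "nat => int => 'a chain => 'c"
 assumes grp: "1 <= l ==> comm_group (dgrp D l n)"
 and carr: "1 <= l ==> carrier (dgrp D l n) = cls l n ` chz n (sp l)"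
 and cls_add: "1 <= l ==> x : chz n (sp l) ==> y : chz n (sp l) ==>
 cls l n (x + y) = cls l n x \<otimes>\<^bsub>dgrp D l n\<^esub> cls l n y"
 and cls_one: "1 <= l ==> x : chz n (sp l) ==>
 cls l n x = \<one>\<^bsub>dgrp D l n\<^esub> \<longleftrightarrow> x = 0 \<or> 0 <= n & x : Rel (nat n) (sp l)"
 and cls_diff: "1 <= l ==> x : chz n (sp l) ==> ddiff D l n (cls l n x) = cls l (n - 1) (bdry (nat n) x)"
 and cls_act: "1 <= l ==> sgg permutes {..<l} ==> x : chz n (sp l) ==>
 dact D l n sgg (cls l n x) = cls l n (mp (nat n) (tact P l sgg) x)"
 and cls_comp: "arity_list ms ==> x : chz p (sp (length ms)) ==> valid ms qs ys ==>
 dcomp D ms p qs (cls (length ms) p x) (map (%i. cls (ms ! i) (qs ! i) (ys ! i)) [0..<length ms]) =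
 cls (sum_list ms) (p + sum_list qs) (rcomp ms p qs x ys)"
 and cls_unit: "dunit D = cls 1 0 (pnt (tunit P))"
begin

abbreviation CL :: "nat list => int list => 'a chain list => 'c list" where
 "CL ms qs ys \<equiv> map (%i. cls (ms ! i) (qs ! i) (ys ! i)) [0..<length ms]"

lemma cls_in: "1 <= l ==> x : chz n (sp l) ==> cls l n x : carrier (dgrp D l n)"
 by (simp add: carr)

lemma cls_0: "1 <= l ==> cls l n 0 = \<one>\<^bsub>dgrp D l n\<^esub>"
 by (simp add: cls_one)

text \<open>Relations in the coarse space suffice, because both chains consist of maps into the
  space of the operad and \<open>Rel_coarse\<close> applies to their difference.\<close>

lemma cls_eqI:
 assumes "1 <= l" "x : chz n (sp l)" "y : chz n (sp l)" "x - y : Rel (nat n) (coarse UNIV)"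
 shows "cls l n x = cls l n y"
proof -
 interpret G: comm_group "dgrp D l n" by (rule grp[OF assms(1)])
 have diff: "x - y : chz n (sp l)" by (rule chz_diff[OF assms(2,3)])
 have "x - y = 0 \<or> 0 <= n & x - y : Rel (nat n) (sp l)"
 using diff Rel_coarse[OF assms(4), of "sp l"] by (auto simp: chz_def split: if_splits)
 then have "cls l n (x - y) = \<one>\<^bsub>dgrp D l n\<^esub>"
 using cls_one[OF assms(1) diff] by simp
 then show ?thesis
 using cls_add[OF assms(1) diff assms(3)] cls_in[OF assms(1,3)] by simp
qed

lemma cls_minus:
 assumes "1 <= l" "x : chz n (sp l)"
 shows "cls l n (- x) = inv\<^bsub>dgrp D l n\<^esub> cls l n x"
proof -
 interpret G: comm_group "dgrp D l n" by (rule grp[OF assms(1)])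
 have "cls l n (- x) \<otimes>\<^bsub>dgrp D l n\<^esub> cls l n x = \<one>\<^bsub>dgrp D l n\<^esub>"
 using cls_add[OF assms(1) chz_minus[OF assms(2)] assms(2)] by (simp add: cls_0[OF assms(1)])
 then show ?thesis
 using cls_in[OF assms] cls_in[OF assms(1) chz_minus[OF assms(2)]] by (metis G.inv_equality)
qed

lemma cls_sign:
 assumes "1 <= l" "x : chz n (sp l)"
 shows "cls l n (frag_cmul (sign_pow k) x) = cls l n x [^]\<^bsub>dgrp D l n\<^esub> sign_pow k"
proof -
 interpret G: comm_group "dgrp D l n" by (rule grp[OF assms(1)])
 show ?thesis
 using cls_in[OF assms] by (simp add: sign_pow_def cls_minus[OF assms] G.int_pow_neg)
qed

lemma cls_sum:
 assumes "1 <= l" "finite I" "!!i. i : I ==> f i : chz n (sp l)"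
 shows "cls l n (\<Sum>i\<in>I. f i) = (\<Otimes>\<^bsub>dgrp D l n\<^esub>i\<in>I. cls l n (f i))"
proof -
 interpret G: comm_group "dgrp D l n" by (rule grp[OF assms(1)])
 show ?thesis
 using assms(2,3)
 by (induction I rule: finite_induct)
 (auto simp: cls_0[OF assms(1)] cls_add[OF assms(1)] chz_sum cls_in[OF assms(1)])
qed

lemma carrE:
 assumes "1 <= l" "X : carrier (dgrp D l n)"
 obtains x where "x : chz n (sp l)" "X = cls l n x"
 using assms by (auto simp: carr)

lemma delemsE:
 assumes "arity_list ms" "delems D ms qs Ys"
 obtains ys where "valid ms qs ys" "Ys = CL ms qs ys"
proof -
 have *: "length qs = length ms" "length Ys = length ms"
 "\<forall>i<length ms. Ys ! i : carrier (dgrp D (ms ! i) (qs ! i))"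
 using assms(2) by (auto simp: delems_def)
 have "\<exists>y. y : chz (qs ! i) (sp (ms ! i)) & Ys ! i = cls (ms ! i) (qs ! i) y" if "i < length ms" for i
 proof -
 have "Ys ! i : cls (ms ! i) (qs ! i) ` chz (qs ! i) (sp (ms ! i))"
 unfolding carr[OF arity_listD(2)[OF assms(1) that], symmetric] using *(3) that by blast
 then show ?thesis by blast
 qed
 then obtain y where y: "!!i. i < length ms ==> y i : chz (qs ! i) (sp (ms ! i)) & Ys ! i = cls (ms ! i) (qs ! i) (y i)"
 by metis
 show ?thesis
 using y * by (intro that[of "map y [0..<length ms]"]) (auto simp: valid_def intro!: nth_equalityI)
qed

lemma CL_nth: "i < length ms ==> CL ms qs ys ! i = cls (ms ! i) (qs ! i) (ys ! i)"
 by simp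

lemma CL_update:
 assumes "valid ms qs ys" "i < length ms"
 shows "(CL ms qs ys)[i := cls (ms ! i) q a] = CL ms (qs[i := q]) (ys[i := a])"
 using assms by (intro nth_equalityI) (auto simp: valid_def nth_list_update)

lemma valid_update:
 "valid ms qs ys ==> a : chz q (sp (ms ! i)) ==> valid ms (qs[i := q]) (ys[i := a])"
 unfolding valid_def by (metis length_list_update nth_list_update_eq nth_list_update_neq)

lemma valid_nth: "valid ms qs ys ==> i < length ms ==> ys ! i : chz (qs ! i) (sp (ms ! i))"
 by (simp add: valid_def)

lemma presented_complex:
 assumes l: "1 <= l"
 shows "chain_complex (dcx D l)"
 unfolding chain_complex_def
proof (intro conjI allI ballI)
 fix n
 show "comm_group (dgrp D l n)" by (rule grp[OF l])
 show "ddiff D l n : hom (dgrp D l n) (dgrp D l (n - 1))"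
 proof (rule homI)
 fix X Y assume "X : carrier (dgrp D l n)" "Y : carrier (dgrp D l n)"
 then obtain x y where x: "x : chz n (sp l)" "X = cls l n x" and y: "y : chz n (sp l)" "Y = cls l n y"
 using carrE[OF l] by metis
 show "ddiff D l n X : carrier (dgrp D l (n - 1))"
 unfolding x(2) cls_diff[OF l x(1)] by (rule cls_in[OF l chz_bdry[OF x(1)]])
 have "bdry (nat n) (x + y) = bdry (nat n) x + bdry (nat n) y"
 by (simp add: bdry_def nop_add)
 then show "ddiff D l n (X \<otimes>\<^bsub>dgrp D l n\<^esub> Y) = ddiff D l n X \<otimes>\<^bsub>dgrp D l (n - 1)\<^esub> ddiff D l n Y"
 unfolding x(2) y(2) cls_add[OF l x(1) y(1), symmetric] cls_diff[OF l chz_add[OF x(1) y(1)]]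
 cls_diff[OF l x(1)] cls_diff[OF l y(1)]
 by (simp add: cls_add[OF l chz_bdry[OF x(1)] chz_bdry[OF y(1)]])
 qed
 fix X assume "X : carrier (dgrp D l n)"
 then obtain x where x: "x : chz n (sp l)" "X = cls l n x" by (rule carrE[OF l])
 have "bdry (nat (n - 1)) (bdry (nat n) x) = 0"
 using bdry_bdry[of "nat n" x] by (simp only: nat_minus_one)
 then show "ddiff D l (n - 1) (ddiff D l n X) = \<one>\<^bsub>dgrp D l (n - 2)\<^esub>"
 by (simp add: x(2) cls_diff[OF l x(1)] cls_diff[OF l chz_bdry[OF x(1)]] cls_0[OF l])
next
 show "\<exists>N. \<forall>n<N. carrier (dgrp D l n) = {\<one>\<^bsub>dgrp D l n\<^esub>}"
 by (intro exI[of _ 0]) (auto simp: carr[OF l] chz_def cls_0[OF l])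
qed

lemma presented_mor:
 assumes l: "1 <= l" and E: "presented_operad dom pt bd pr rel Q E cls'"
 and f: "continuous_map (tspace P l) (tspace Q k) f" and k: "1 <= k"
 and F: "!!n x. x : chz n (sp l) ==> F n (cls l n x) = cls' k n (mp (nat n) f x)"
 shows "complex_mor (dcx D l) (dcx E k) F"
proof -
 interpret E: presented_operad dom pt bd pr rel Q E cls' by (rule E)
 show ?thesis
 unfolding complex_mor_def
 proof (intro conjI allI ballI presented_complex[OF l] E.presented_complex[OF k])
 fix n
 show "F n : hom (dgrp D l n) (dgrp E k n)"
 proof (rule homI)
 fix X Y assume "X : carrier (dgrp D l n)" "Y : carrier (dgrp D l n)"
 then obtain x y where x: "x : chz n (sp l)" "X = cls l n x" and y: "y : chz n (sp l)" "Y = cls l n y"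
 using carrE[OF l] by metis
 show "F n X : carrier (dgrp E k n)"
 unfolding x(2) F[OF x(1)] by (rule E.cls_in[OF k chz_mp[OF x(1) f]])
 show "F n (X \<otimes>\<^bsub>dgrp D l n\<^esub> Y) = F n X \<otimes>\<^bsub>dgrp E k n\<^esub> F n Y"
 unfolding x(2) y(2) cls_add[OF l x(1) y(1), symmetric] F[OF chz_add[OF x(1) y(1)]] F[OF x(1)] F[OF y(1)]
 push_add by (rule E.cls_add[OF k chz_mp[OF x(1) f] chz_mp[OF y(1) f]])
 qed
 fix X assume "X : carrier (dgrp D l n)"
 then obtain x where x: "x : chz n (sp l)" "X = cls l n x" by (rule carrE[OF l])
 have "mp (nat n - 1) f (bdry (nat n) x) = mp (nat (n - 1)) f (bdry (nat n) x)"
 by (simp only: nat_minus_one)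
 then show "ddiff E k n (F n X) = F (n - 1) (ddiff D l n X)"
 unfolding x(2) F[OF x(1)] cls_diff[OF l x(1)] E.cls_diff[OF k chz_mp[OF x(1) f]]
 F[OF chz_bdry[OF x(1)]] bdry_mp by simp
 qed
qed

lemma permuted:
 assumes "ta permutes {..<length ms}" "valid ms qs ys"
 shows "permute_list ta (CL ms qs ys) = CL (permute_list ta ms) (permute_list ta qs) (permute_list ta ys)"
 and "valid (permute_list ta ms) (permute_list ta qs) (permute_list ta ys)"
 and "sum_list (permute_list ta ms) = sum_list ms" "sum_list (permute_list ta qs) = sum_list qs"
 and "arity_list ms ==> arity_list (permute_list ta ms)"
proof -
 have len: "length qs = length ms" "length ys = length ms" using assms(2) by (auto simp: valid_def)
 have less: "ta i < length ms" if "i < length ms" for i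
 using permutes_in_image[OF assms(1), of i] that by simp
 show "permute_list ta (CL ms qs ys) = CL (permute_list ta ms) (permute_list ta qs) (permute_list ta ys)"
 using len less by (auto simp: permute_list_def intro!: nth_equalityI)
 show "valid (permute_list ta ms) (permute_list ta qs) (permute_list ta ys)"
 using assms(2) len less by (auto simp: valid_def permute_list_def)
 have "mset (permute_list ta ms) = mset ms" "mset (permute_list ta qs) = mset qs"
 using assms(1) len by (simp_all add: mset_permute_list)
 then show "sum_list (permute_list ta ms) = sum_list ms" "sum_list (permute_list ta qs) = sum_list qs"
 by (metis sum_mset_sum_list)+
 assume "arity_list ms"
 moreover have "set (permute_list ta ms) = set ms" using assms(1) by (rule set_permute_list)
 moreover have "permute_list ta ms ~= [] \<longleftrightarrow> ms ~= []" by (metis length_0_conv length_permute_list)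
 ultimately show "arity_list (permute_list ta ms)"
 by (simp add: arity_list_def)
qed

text \<open>Most axioms are equalities of representatives. Only equivariance in the outer argument
  and associativity, the axioms in which factors change places, use relations, through
  \<open>cls_eqI\<close>.\<close>

theorem presented_dg_operad: "dg_operad D"
proof -
 have u: "pnt (tunit P) : chz 0 (sp 1)"
 using pnt_in[OF unit_in] by (simp add: chz_def)
 show ?thesis
 unfolding dg_operad_def
proof (intro conjI, goal_cases)
 case 1
 show ?case
 using presented_complex by blast
next
 case 2
 show ?case
 proof (intro allI impI)
 fix l :: nat and sgg assume l: "1 <= l" and sgg: "sgg permutes {..<l}"
 show "complex_mor (dcx D l) (dcx D l) (%n. dact D l n sgg)"
 by (rule presented_mor[OF l presented_operad_axioms act_continuous[OF l sgg] l]) (rule cls_act[OF l sgg])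
 qed
next
 case 3
 show ?case
 proof (intro allI impI ballI)
 fix l n X assume l: "1 <= l" and X: "X : carrier (dgrp D l n)"
 obtain x where x: "x : chz n (sp l)" "X = cls l n x" by (rule carrE[OF l X])
 have "mp (nat n) (tact P l id) x = x"
 using x(1) act_id[OF l] by (auto simp: chz_def split: if_splits intro: push_id)
 then show "dact D l n id X = X"
 by (simp add: x(2) cls_act[OF l permutes_id x(1)])
 qed
next
 case 4
 show ?case
 proof (intro allI impI ballI)
 fix l n sgg ta X assume l: "1 <= l" and X: "X : carrier (dgrp D l n)"
 and sgg: "sgg permutes {..<l}" and ta: "ta permutes {..<l}"
 obtain x where x: "x : chz n (sp l)" "X = cls l n x" by (rule carrE[OF l X])
 have "mp (nat n) (tact P l (sgg o ta)) x = mp (nat n) (%a. tact P l ta (tact P l sgg a)) x"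
 using x(1) by (rule chz_cong) (rule act_compose[OF l _ sgg ta])
 then show "dact D l n (sgg o ta) X = dact D l n ta (dact D l n sgg X)"
 by (simp add: x(2) cls_act[OF l sgg x(1)] cls_act[OF l permutes_compose[OF ta sgg] x(1)]
 cls_act[OF l ta chz_mp[OF x(1) act_continuous[OF l sgg]]] push_push)
 qed
next
 case 5
 show ?case
 unfolding dcomp_multilinear_def
 proof (intro allI impI conjI)
 fix ms p qs X Ys assume ms: "arity_list ms" and X: "X : carrier (dgrp D (length ms) p)" and Ys: "delems D ms qs Ys"
 have l: "1 <= length ms" and L: "1 <= sum_list ms" using arity_listD(1)[OF ms] arity_list_sum[OF ms] .
 obtain x where x: "x : chz p (sp (length ms))" "X = cls (length ms) p x" by (rule carrE[OF l X])
 obtain ys where v: "valid ms qs ys" and Y: "Ys = CL ms qs ys" by (rule delemsE[OF ms Ys])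
 show "(%a. dcomp D ms p qs a Ys) : hom (dgrp D (length ms) p) (dgrp D (sum_list ms) (p + sum_list qs))"
 proof (rule homI)
 fix A B assume "A : carrier (dgrp D (length ms) p)" "B : carrier (dgrp D (length ms) p)"
 then obtain a b where a: "a : chz p (sp (length ms))" "A = cls (length ms) p a"
 and b: "b : chz p (sp (length ms))" "B = cls (length ms) p b"
 using carrE[OF l] by metis
 show "dcomp D ms p qs A Ys : carrier (dgrp D (sum_list ms) (p + sum_list qs))"
 unfolding a(2) Y cls_comp[OF ms a(1) v] by (rule cls_in[OF L rcomp_in[OF ms v a(1)]])
 \<comment> \<open>Additivity is recovered from compatibility with differences by subtracting the
   negative.\<close>
 have "rcomp ms p qs (a + b) ys = rcomp ms p qs a ys + rcomp ms p qs b ys"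
 using rcomp_diff_left[of ms p qs a "- b" ys] rcomp_diff_left[of ms p qs 0 b ys] v
 by (simp add: valid_def rcomp_zero)
 then show "dcomp D ms p qs (A \<otimes>\<^bsub>dgrp D (length ms) p\<^esub> B) Ys =
 dcomp D ms p qs A Ys \<otimes>\<^bsub>dgrp D (sum_list ms) (p + sum_list qs)\<^esub> dcomp D ms p qs B Ys"
 unfolding a(2) b(2) Y cls_add[OF l a(1) b(1), symmetric] cls_comp[OF ms a(1) v]
 cls_comp[OF ms b(1) v] cls_comp[OF ms chz_add[OF a(1) b(1)] v]
 by (simp add: cls_add[OF L rcomp_in[OF ms v a(1)] rcomp_in[OF ms v b(1)]])
 qed
 fix i assume i: "i < length ms"
 have mi: "1 <= ms ! i" by (rule arity_listD(2)[OF ms i])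
 have upd: "Ys[i := cls (ms ! i) (qs ! i) a] = CL ms qs (ys[i := a])" for a
 unfolding Y CL_update[OF v i] by simp
 have vupd: "valid ms qs (ys[i := a])" if "a : chz (qs ! i) (sp (ms ! i))" for a
 using valid_update[OF v that] by simp
 show "(%a. dcomp D ms p qs X (Ys[i := a])) : hom (dgrp D (ms ! i) (qs ! i)) (dgrp D (sum_list ms) (p + sum_list qs))"
 proof (rule homI)
 fix A B assume "A : carrier (dgrp D (ms ! i) (qs ! i))" "B : carrier (dgrp D (ms ! i) (qs ! i))"
 then obtain a b where a: "a : chz (qs ! i) (sp (ms ! i))" "A = cls (ms ! i) (qs ! i) a"
 and b: "b : chz (qs ! i) (sp (ms ! i))" "B = cls (ms ! i) (qs ! i) b"
 using carrE[OF mi] by metis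
 note comp = cls_comp[OF ms x(1) vupd]
 show "dcomp D ms p qs X (Ys[i := A]) : carrier (dgrp D (sum_list ms) (p + sum_list qs))"
 unfolding a(2) upd x(2) comp[OF a(1)] by (rule cls_in[OF L rcomp_in[OF ms vupd[OF a(1)] x(1)]])
 have "rcomp ms p qs x (ys[i := 0]) = 0"
 proof (rule rcomp_zero)
 have "0 : set (ys[i := 0])" using v i by (intro set_update_memI) (simp add: valid_def)
 then show "0 : set (x # ys[i := 0])" by simp
 qed (use v in \<open>simp add: valid_def\<close>)
 then have "rcomp ms p qs x (ys[i := a + b]) = rcomp ms p qs x (ys[i := a]) + rcomp ms p qs x (ys[i := b])"
 using rcomp_diff_right[OF v x(1) i a(1) chz_minus[OF b(1)]] rcomp_diff_right[OF v x(1) i chz_0 b(1)]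
 by simp
 then show "dcomp D ms p qs X (Ys[i := A \<otimes>\<^bsub>dgrp D (ms ! i) (qs ! i)\<^esub> B]) =
 dcomp D ms p qs X (Ys[i := A]) \<otimes>\<^bsub>dgrp D (sum_list ms) (p + sum_list qs)\<^esub> dcomp D ms p qs X (Ys[i := B])"
 unfolding a(2) b(2) cls_add[OF mi a(1) b(1), symmetric] upd x(2) comp[OF a(1)] comp[OF b(1)]
 comp[OF chz_add[OF a(1) b(1)]]
 by (simp add: cls_add[OF L rcomp_in[OF ms vupd[OF a(1)] x(1)] rcomp_in[OF ms vupd[OF b(1)] x(1)]])
 qed
 qed
next
 case 6
 show ?case
 unfolding dcomp_leibniz_def Let_def
 proof (intro allI impI)
 fix ms p qs X Ys assume ms: "arity_list ms" and X: "X : carrier (dgrp D (length ms) p)" and Ys: "delems D ms qs Ys"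
 have l: "1 <= length ms" and L: "1 <= sum_list ms" using arity_listD(1)[OF ms] arity_list_sum[OF ms] .
 obtain x where x: "x : chz p (sp (length ms))" "X = cls (length ms) p x" by (rule carrE[OF l X])
 obtain ys where v: "valid ms qs ys" and Y: "Ys = CL ms qs ys" by (rule delemsE[OF ms Ys])
 let ?d = "p + sum_list qs - 1"
 let ?c = "%i. rcomp ms p (qs[i := qs ! i - 1]) x (ys[i := bdry (nat (qs ! i)) (ys ! i)])"
 let ?s = "%i. sign_pow (p + sum_list (take i qs))"
 have vi: "valid ms (qs[i := qs ! i - 1]) (ys[i := bdry (nat (qs ! i)) (ys ! i)])" if "i < length ms" for i
 using valid_update[OF v chz_bdry[OF valid_nth[OF v that]]] .
 have sumi: "p + sum_list (qs[i := qs ! i - 1]) = ?d" if "i < length ms" for i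
 using v that by (simp add: sum_list_update_int valid_def)
 have ci: "?c i : chz ?d (sp (sum_list ms))" if "i < length ms" for i
 using rcomp_in[OF ms vi[OF that] x(1)] unfolding sumi[OF that] .
 have comp_i: "dcomp D ms p (qs[i := qs ! i - 1]) X (Ys[i := ddiff D (ms ! i) (qs ! i) (Ys ! i)]) =
 cls (sum_list ms) ?d (?c i)" if i: "i < length ms" for i
 unfolding Y CL_nth[OF i] cls_diff[OF arity_listD(2)[OF ms i] valid_nth[OF v i]] CL_update[OF v i] x(2)
 cls_comp[OF ms x(1) vi[OF i]] sumi[OF i] ..
 have first: "rcomp ms (p - 1) qs (bdry (nat p) x) ys : chz ?d (sp (sum_list ms))"
 using rcomp_in[OF ms v chz_bdry[OF x(1)]] by (simp add: algebra_simps)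
 have "dcomp D ms (p - 1) qs (ddiff D (length ms) p X) Ys =
 cls (sum_list ms) (p - 1 + sum_list qs) (rcomp ms (p - 1) qs (bdry (nat p) x) ys)"
 unfolding x(2) cls_diff[OF l x(1)] Y cls_comp[OF ms chz_bdry[OF x(1)] v] ..
 also have "p - 1 + sum_list qs = ?d" by simp
 finally have comp_x: "dcomp D ms (p - 1) qs (ddiff D (length ms) p X) Ys =
 cls (sum_list ms) ?d (rcomp ms (p - 1) qs (bdry (nat p) x) ys)" .
 have "ddiff D (sum_list ms) (p + sum_list qs) (dcomp D ms p qs X Ys) =
 cls (sum_list ms) ?d (rcomp ms (p - 1) qs (bdry (nat p) x) ys + (\<Sum>i<length ms. frag_cmul (?s i) (?c i)))"
 unfolding x(2) Y cls_comp[OF ms x(1) v] cls_diff[OF L rcomp_in[OF ms v x(1)]] rcomp_bdry[OF v x(1)] ..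
 also have "... = cls (sum_list ms) ?d (rcomp ms (p - 1) qs (bdry (nat p) x) ys) \<otimes>\<^bsub>dgrp D (sum_list ms) ?d\<^esub>
 cls (sum_list ms) ?d (\<Sum>i<length ms. frag_cmul (?s i) (?c i))"
 by (intro cls_add[OF L first] chz_sum chz_cmul ci) simp
 also have "cls (sum_list ms) ?d (\<Sum>i<length ms. frag_cmul (?s i) (?c i)) =
 (\<Otimes>\<^bsub>dgrp D (sum_list ms) ?d\<^esub>i\<in>{..<length ms}. cls (sum_list ms) ?d (frag_cmul (?s i) (?c i)))"
 by (intro cls_sum[OF L] chz_cmul ci) simp_all
 also have "... = (\<Otimes>\<^bsub>dgrp D (sum_list ms) ?d\<^esub>i\<in>{..<length ms}.
 dcomp D ms p (qs[i := qs ! i - 1]) X (Ys[i := ddiff D (ms ! i) (qs ! i) (Ys ! i)])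
 [^]\<^bsub>dgrp D (sum_list ms) ?d\<^esub> ?s i)"
 proof -
 interpret G: comm_group "dgrp D (sum_list ms) ?d" by (rule grp[OF L])
 show ?thesis
 by (intro G.finprod_cong) (auto simp: comp_i cls_sign[OF L ci] simp_implies_def intro!: G.int_pow_closed cls_in[OF L] chz_cmul ci)
 qed
 finally show "ddiff D (sum_list ms) (p + sum_list qs) (dcomp D ms p qs X Ys) =
 dcomp D ms (p - 1) qs (ddiff D (length ms) p X) Ys \<otimes>\<^bsub>dgrp D (sum_list ms) ?d\<^esub>
 (\<Otimes>\<^bsub>dgrp D (sum_list ms) ?d\<^esub>i\<in>{..<length ms}.
 dcomp D ms p (qs[i := qs ! i - 1]) X (Ys[i := ddiff D (ms ! i) (qs ! i) (Ys ! i)])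
 [^]\<^bsub>dgrp D (sum_list ms) ?d\<^esub> ?s i)"
 by (simp only: comp_x)
 qed
next
 case 7
 show ?case
 unfolding cls_unit by (rule cls_in[OF _ u]) simp
next
 case 8
 show ?case
 unfolding cls_unit using cls_diff[OF _ u] cls_0[of 1 "- 1"] by simp
next
 case 9
 show ?case
 proof (intro allI impI ballI conjI)
 fix l n X assume l: "1 <= l" and X: "X : carrier (dgrp D l n)"
 obtain x where x: "x : chz n (sp l)" "X = cls l n x" by (rule carrE[OF l X])
 have "dcomp D [l] 0 [n] (cls (length [l]) 0 (pnt (tunit P))) (CL [l] [n] [x]) =
 cls (sum_list [l]) (0 + sum_list [n]) (rcomp [l] 0 [n] (pnt (tunit P)) [x])"
 using l u x(1) by (intro cls_comp) (auto simp: arity_list_def valid_def)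
 then show "dcomp D [l] 0 [n] (dunit D) [X] = X"
 by (simp add: cls_unit x(2) rcomp_unit(1)[OF l x(1)])
 have "dcomp D (replicate l 1) n (replicate l 0) (cls (length (replicate l (1::nat))) n x)
 (CL (replicate l 1) (replicate l 0) (replicate l (pnt (tunit P)))) =
 cls (sum_list (replicate l 1)) (n + sum_list (replicate l 0)) (rcomp (replicate l 1) n (replicate l 0) x (replicate l (pnt (tunit P))))"
 using l u x(1) by (intro cls_comp) (auto simp: arity_list_def valid_def)
 moreover have "CL (replicate l 1) (replicate l 0) (replicate l (pnt (tunit P))) = replicate l (dunit D)"
 by (auto simp: cls_unit intro!: nth_equalityI)
 ultimately show "dcomp D (replicate l 1) n (replicate l 0) X (replicate l (dunit D)) = X"
 by (simp only: rcomp_unit(2)[OF l x(1)] x(2) length_replicate sum_list_replicate) simp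
 qed
next
 case 10
 show ?case
 proof (intro allI impI)
 fix ms sgg p qs X Ys assume ms: "arity_list ms" and sgg: "sgg permutes {..<length ms}"
 and X: "X : carrier (dgrp D (length ms) p)" and Ys: "delems D ms qs Ys"
 have l: "1 <= length ms" and L: "1 <= sum_list ms" using arity_listD(1)[OF ms] arity_list_sum[OF ms] .
 obtain x where x: "x : chz p (sp (length ms))" "X = cls (length ms) p x" by (rule carrE[OF l X])
 obtain ys where v: "valid ms qs ys" and Y: "Ys = CL ms qs ys" by (rule delemsE[OF ms Ys])
 let ?ta = "inv_into UNIV sgg"
 let ?ms' = "permute_list ?ta ms" and ?qs' = "permute_list ?ta qs" and ?ys' = "permute_list ?ta ys"
 let ?d = "p + sum_list qs" and ?s = "\<Sum>j<length ms. \<Sum>i | i < j & sgg j < sgg i. qs ! i * qs ! j"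
 note pm = permuted[OF permutes_inv[OF sgg] v]
 note ms' = pm(5)[OF ms]
 have x': "x : chz p (sp (length ?ms'))" "X = cls (length ?ms') p x" using x by simp_all
 have r': "rcomp ?ms' p ?qs' x ?ys' : chz ?d (sp (sum_list ms))"
 using rcomp_in[OF ms' pm(2) x'(1)] unfolding pm(3,4) .
 note act = act_continuous[OF l sgg] act_continuous[OF L block_perm_permutes[OF sgg]]
 note ar = chz_mp[OF r' act(2)]
 have "dact D (sum_list ms) ?d (block_perm ms sgg) (dcomp D ?ms' p ?qs' X (permute_list ?ta Ys)) =
 cls (sum_list ms) ?d (mp (nat ?d) (tact P (sum_list ms) (block_perm ms sgg)) (rcomp ?ms' p ?qs' x ?ys'))"
 unfolding Y pm(1) x'(2) cls_comp[OF ms' x'(1) pm(2)] pm(3,4)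
 by (rule cls_act[OF L block_perm_permutes[OF sgg] r'])
 moreover have "dcomp D ms p qs (dact D (length ms) p sgg X) Ys =
 cls (sum_list ms) ?d (rcomp ms p qs (mp (nat p) (tact P (length ms) sgg) x) ys)"
 unfolding Y x(2) cls_act[OF l sgg x(1)] by (rule cls_comp[OF ms chz_mp[OF x(1) act(1)] v])
 moreover have "... = cls (sum_list ms) ?d (frag_cmul (sign_pow ?s)
 (mp (nat ?d) (tact P (sum_list ms) (block_perm ms sgg)) (rcomp ?ms' p ?qs' x ?ys')))"
 by (rule cls_eqI[OF L rcomp_in[OF ms v chz_mp[OF x(1) act(1)]] chz_cmul[OF ar] rcomp_act[OF ms sgg v x(1)]])
 ultimately show "dcomp D ms p qs (dact D (length ms) p sgg X) Ys =
 dact D (sum_list ms) ?d (block_perm ms sgg) (dcomp D ?ms' p ?qs' X (permute_list ?ta Ys))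
 [^]\<^bsub>dgrp D (sum_list ms) ?d\<^esub> sign_pow ?s"
 by (simp only: cls_sign[OF L ar])
 qed
next
 case 11
 show ?case
 proof (intro allI impI)
 fix ms tas p qs X Ys assume ms: "arity_list ms" and len: "length tas = length ms"
 and ta: "\<forall>i<length ms. (tas ! i) permutes {..<ms ! i}"
 and X: "X : carrier (dgrp D (length ms) p)" and Ys: "delems D ms qs Ys"
 have l: "1 <= length ms" and L: "1 <= sum_list ms" using arity_listD(1)[OF ms] arity_list_sum[OF ms] .
 obtain x where x: "x : chz p (sp (length ms))" "X = cls (length ms) p x" by (rule carrE[OF l X])
 obtain ys where v: "valid ms qs ys" and Y: "Ys = CL ms qs ys" by (rule delemsE[OF ms Ys])
 let ?zs = "map (%i. mp (nat (qs ! i)) (tact P (ms ! i) (tas ! i)) (ys ! i)) [0..<length ms]"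
 have vz: "valid ms qs ?zs"
 using v ta arity_listD(2)[OF ms] by (auto simp: valid_def intro!: chz_mp act_continuous)
 have "map (%i. dact D (ms ! i) (qs ! i) (tas ! i) (Ys ! i)) [0..<length ms] = CL ms qs ?zs"
 using cls_act[OF arity_listD(2)[OF ms] _ valid_nth[OF v]] ta by (auto simp: Y)
 then have "dcomp D ms p qs X (map (%i. dact D (ms ! i) (qs ! i) (tas ! i) (Ys ! i)) [0..<length ms]) =
 cls (sum_list ms) (p + sum_list qs) (rcomp ms p qs x ?zs)"
 unfolding x(2) by (simp only: cls_comp[OF ms x(1) vz])
 then show "dcomp D ms p qs X (map (%i. dact D (ms ! i) (qs ! i) (tas ! i) (Ys ! i)) [0..<length ms]) =
 dact D (sum_list ms) (p + sum_list qs) (block_sum ms tas) (dcomp D ms p qs X Ys)"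
 unfolding x(2) Y cls_comp[OF ms x(1) v] cls_act[OF L block_sum_permutes[OF ta] rcomp_in[OF ms v x(1)]]
 rcomp_acts[OF ms len ta v x(1)] .
 qed
next
 case 12
 show ?case
 proof (intro allI impI)
 fix nss p qs rss X Ys Zss
 assume ne: "nss ~= []" and ns: "\<forall>ns\<in>set nss. arity_list ns"
 and X: "X : carrier (dgrp D (length nss) p)" and Ys: "delems D (map length nss) qs Ys"
 and len: "length rss = length nss" "length Zss = length nss"
 and Zs: "\<forall>i<length nss. delems D (nss ! i) (rss ! i) (Zss ! i)"
 have nsi: "arity_list (nss ! i)" if "i < length nss" for i using ns that by simp
 have ml: "arity_list (map length nss)" and mc: "arity_list (concat nss)" and ms: "arity_list (map sum_list nss)"
 using ne ns arity_listD(1) arity_list_sum by (fastforce simp: arity_list_def neq_Nil_conv)+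
 have l: "1 <= length nss" using ne by (simp add: Suc_le_eq)
 obtain x where x: "x : chz p (sp (length nss))" "X = cls (length nss) p x" by (rule carrE[OF l X])
 have x1: "x : chz p (sp (length (map length nss)))" "X = cls (length (map length nss)) p x"
 "x : chz p (sp (length (map sum_list nss)))" "X = cls (length (map sum_list nss)) p x" using x by simp_all
 obtain ys where v: "valid (map length nss) qs ys" and Y: "Ys = CL (map length nss) qs ys" by (rule delemsE[OF ml Ys])
 have "\<exists>zs. valid (nss ! i) (rss ! i) zs & Zss ! i = CL (nss ! i) (rss ! i) zs" if "i < length nss" for i
 using delemsE[OF nsi[OF that]] Zs that by metis
 then obtain z where z: "!!i. i < length nss ==> valid (nss ! i) (rss ! i) (z i) & Zss ! i = CL (nss ! i) (rss ! i) (z i)"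
 by metis
 define zss where "zss = map z [0..<length nss]"
 have zi: "valid (nss ! i) (rss ! i) (zss ! i)" "Zss ! i = CL (nss ! i) (rss ! i) (zss ! i)" if "i < length nss" for i
 using z[OF that] that by (simp_all add: zss_def)
 have lz: "length zss = length nss" by (simp add: zss_def)
 have conc: "valid (concat ns) (concat rs) (concat zs) & concat Zs = CL (concat ns) (concat rs) (concat zs)"
 if "length rs = length ns" "length zs = length ns" "length Zs = length ns"
 "!!i. i < length ns ==> valid (ns ! i) (rs ! i) (zs ! i) & Zs ! i = CL (ns ! i) (rs ! i) (zs ! i)" for ns rs zs Zs
 using that
 proof (induction ns arbitrary: rs zs Zs)
 case (Cons n ns)
 obtain r rs' z' zs' Z Zs' where eq: "rs = r # rs'" "zs = z' # zs'" "Zs = Z # Zs'"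
 using Cons.prems(1-3) by (metis length_Suc_conv)
 have IH: "valid (concat ns) (concat rs') (concat zs') & concat Zs' = CL (concat ns) (concat rs') (concat zs')"
 using Cons.prems(1-3) Cons.prems(4)[of "Suc _"] by (intro Cons.IH) (auto simp: eq)
 have h: "valid n r z'" "Z = CL n r z'" using Cons.prems(4)[of 0] by (auto simp: eq)
 have "CL (n @ concat ns) (r @ concat rs') (z' @ concat zs') = CL n r z' @ CL (concat ns) (concat rs') (concat zs')"
 using h(1) IH by (intro nth_equalityI) (auto simp: nth_append valid_def)
 moreover have "valid (n @ concat ns) (r @ concat rs') (z' @ concat zs')"
 using h(1) IH by (auto simp: valid_def nth_append)
 ultimately show ?case using h IH by (simp add: eq)
 qed (simp add: valid_def)
 have vc: "valid (concat nss) (concat rss) (concat zss)" and Zc: "concat Zss = CL (concat nss) (concat rss) (concat zss)"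
 using conc[of rss nss zss Zss] zi lz len by auto
 have L: "1 <= sum_list (concat nss)" by (rule arity_list_sum[OF mc])
 let ?d = "p + sum_list qs + sum_list (concat rss)"
 let ?x' = "rcomp (map length nss) p qs x ys"
 have lc: "sum_list (map length nss) = length (concat nss)" by (simp add: length_concat)
 have x': "?x' : chz (p + sum_list qs) (sp (length (concat nss)))"
 using rcomp_in[OF ml v x1(1)] unfolding lc .
 have lhs: "dcomp D (concat nss) (p + sum_list qs) (concat rss) (dcomp D (map length nss) p qs X Ys) (concat Zss) =
 cls (sum_list (concat nss)) ?d (rcomp (concat nss) (p + sum_list qs) (concat rss) ?x' (concat zss))"
 unfolding x1(2) Y cls_comp[OF ml x1(1) v] lc Zc by (rule cls_comp[OF mc x' vc])
 let ?ds = "map (%i. qs ! i + sum_list (rss ! i)) [0..<length nss]"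
 let ?ys' = "map (%i. rcomp (nss ! i) (qs ! i) (rss ! i) (ys ! i) (zss ! i)) [0..<length nss]"
 have yi: "ys ! i : chz (qs ! i) (sp (length (nss ! i)))" if "i < length nss" for i
 using v that by (simp add: valid_def)
 have vy: "valid (map sum_list nss) ?ds ?ys'"
 using rcomp_in[OF nsi zi(1) yi] by (auto simp: valid_def)
 have "map (%i. dcomp D (nss ! i) (qs ! i) (rss ! i) (Ys ! i) (Zss ! i)) [0..<length nss] = CL (map sum_list nss) ?ds ?ys'"
 using cls_comp[OF nsi yi zi(1)] zi(2) by (auto simp: Y)
 moreover have "sum_list (map sum_list nss) = sum_list (concat nss)" by (simp add: sum_list_concat)
 moreover have deg: "p + sum_list ?ds = ?d"
 proof -
 have "sum_list ?ds = (\<Sum>i<length nss. qs ! i) + (\<Sum>i<length nss. sum_list (rss ! i))"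
 by (simp add: sum_list_sum_nth atLeast0LessThan sum.distrib)
 also have "(\<Sum>i<length nss. qs ! i) = sum_list qs"
 using v by (simp add: valid_def sum_list_sum_nth atLeast0LessThan)
 also have "(\<Sum>i<length nss. sum_list (rss ! i)) = sum_list (concat rss)"
 using len by (simp add: sum_list_concat sum_list_sum_nth[of "map sum_list rss"] atLeast0LessThan)
 finally show ?thesis by simp
 qed
 ultimately have rhs: "dcomp D (map sum_list nss) p ?ds X
 (map (%i. dcomp D (nss ! i) (qs ! i) (rss ! i) (Ys ! i) (Zss ! i)) [0..<length nss]) =
 cls (sum_list (concat nss)) ?d (rcomp (map sum_list nss) p ?ds x ?ys')"
 using cls_comp[OF ms x1(3) vy] by (simp only: x1(4))
 have inr: "rcomp (map sum_list nss) p ?ds x ?ys' : chz ?d (sp (sum_list (concat nss)))"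
 using rcomp_in[OF ms vy x1(3)] unfolding deg by (simp add: sum_list_concat)
 have "cls (sum_list (concat nss)) ?d (rcomp (concat nss) (p + sum_list qs) (concat rss) ?x' (concat zss)) =
 cls (sum_list (concat nss)) ?d (frag_cmul (sign_pow (\<Sum>j<length nss. \<Sum>i<j. qs ! j * sum_list (rss ! i)))
 (rcomp (map sum_list nss) p ?ds x ?ys'))"
 using rcomp_assoc[OF ne ns x(1) v len(1) lz] zi(1)
 by (intro cls_eqI[OF L rcomp_in[OF mc vc x'] chz_cmul[OF inr]]) blast
 then show "dcomp D (concat nss) (p + sum_list qs) (concat rss) (dcomp D (map length nss) p qs X Ys) (concat Zss) =
 dcomp D (map sum_list nss) p ?ds X
 (map (%i. dcomp D (nss ! i) (qs ! i) (rss ! i) (Ys ! i) (Zss ! i)) [0..<length nss])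
 [^]\<^bsub>dgrp D (sum_list (concat nss)) ?d\<^esub> sign_pow (\<Sum>j<length nss. \<Sum>i<j. qs ! j * sum_list (rss ! i))"
 by (simp only: lhs rhs cls_sign[OF L inr])
 qed
qed
qed

end

section \<open>Morphisms and quasi-isomorphisms\<close>

text \<open>The two operads may be presented over different models. \<open>h\<close> acts on
  representatives and has to respect the structure strictly, as the triangulation will do.\<close>

lemma (in presented_operad) presented_dg_operad_mor:
 assumes E: "presented_operad dom' pt' bd' pr' rel' Q E cls'"
 and F: "!!l n x. 1 <= l ==> x : chz n (sp l) ==> F l n (cls l n x) = cls' l n (h l n x)"
 and h_in: "!!l n x. 1 <= l ==> x : chz n (sp l) ==> h l n x : operad_chains.chz dom' n (tspace Q l)"
 and h_add: "!!l n x y. 1 <= l ==> h l n (x + y) = h l n x + h l n y"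
 and h_bdry: "!!l n x. 1 <= l ==> x : chz n (sp l) ==>
 h l (n - 1) (bdry (nat n) x) = chain_model.bdry dom' bd' (nat n) (h l n x)"
 and h_act: "!!l n sgg x. 1 <= l ==> x : chz n (sp l) ==> sgg permutes {..<l} ==>
 h l n (mp (nat n) (tact P l sgg) x) = push (dom' (nat n)) (tact Q l sgg) (h l n x)"
 and h_comp: "!!ms p qs x ys. arity_list ms ==> x : chz p (sp (length ms)) ==> valid ms qs ys ==>
 h (sum_list ms) (p + sum_list qs) (rcomp ms p qs x ys) =
 operad_chains.rcomp dom' pr' Q ms p qs (h (length ms) p x) (map (%i. h (ms ! i) (qs ! i) (ys ! i)) [0..<length ms])"
 and h_unit: "h 1 0 (pnt (tunit P)) = chain_model.pnt dom' (tunit Q)"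
 shows "dg_operad_mor D E F"
proof -
 interpret E: presented_operad dom' pt' bd' pr' rel' Q E cls' by (rule E)
 have mor: "complex_mor (dcx D l) (dcx E l) (F l)" if l: "1 <= l" for l
 unfolding complex_mor_def
 proof (intro conjI allI ballI presented_complex[OF l] E.presented_complex[OF l])
 fix n
 show "F l n : hom (dgrp D l n) (dgrp E l n)"
 proof (rule homI)
 fix X Y assume "X : carrier (dgrp D l n)" "Y : carrier (dgrp D l n)"
 then obtain x y where x: "x : chz n (sp l)" "X = cls l n x" and y: "y : chz n (sp l)" "Y = cls l n y"
 using carrE[OF l] by metis
 show "F l n X : carrier (dgrp E l n)"
 unfolding x(2) F[OF l x(1)] by (rule E.cls_in[OF l h_in[OF l x(1)]])
 show "F l n (X \<otimes>\<^bsub>dgrp D l n\<^esub> Y) = F l n X \<otimes>\<^bsub>dgrp E l n\<^esub> F l n Y"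
 unfolding x(2) y(2) cls_add[OF l x(1) y(1), symmetric] F[OF l chz_add[OF x(1) y(1)]] F[OF l x(1)]
 F[OF l y(1)] h_add[OF l] by (rule E.cls_add[OF l h_in[OF l x(1)] h_in[OF l y(1)]])
 qed
 fix X assume "X : carrier (dgrp D l n)"
 then obtain x where x: "x : chz n (sp l)" "X = cls l n x" by (rule carrE[OF l])
 show "ddiff E l n (F l n X) = F l (n - 1) (ddiff D l n X)"
 unfolding x(2) F[OF l x(1)] cls_diff[OF l x(1)] E.cls_diff[OF l h_in[OF l x(1)]]
 F[OF l chz_bdry[OF x(1)]] h_bdry[OF l x(1)] ..
 qed
 show ?thesis
 unfolding dg_operad_mor_def
 proof (intro conjI allI impI ballI presented_dg_operad E.presented_dg_operad mor)
 fix l n sgg X assume l: "1 <= l" and X: "X : carrier (dgrp D l n)" and sgg: "sgg permutes {..<l}"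
 obtain x where x: "x : chz n (sp l)" "X = cls l n x" by (rule carrE[OF l X])
 show "F l n (dact D l n sgg X) = dact E l n sgg (F l n X)"
 unfolding x(2) cls_act[OF l sgg x(1)] F[OF l x(1)] F[OF l chz_mp[OF x(1) act_continuous[OF l sgg]]]
 E.cls_act[OF l sgg h_in[OF l x(1)]] h_act[OF l x(1) sgg] ..
 next
 have "pnt (tunit P) : chz 0 (sp 1)"
 using pnt_in[OF unit_in] by (simp add: chz_def)
 then show "F 1 0 (dunit D) = dunit E"
 unfolding cls_unit E.cls_unit h_unit[symmetric] by (intro F) simp_all
 next
 fix ms p qs X Ys assume ms: "arity_list ms" and X: "X : carrier (dgrp D (length ms) p)" and Ys: "delems D ms qs Ys"
 have l: "1 <= length ms" and L: "1 <= sum_list ms" using arity_listD(1)[OF ms] arity_list_sum[OF ms] .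
 obtain x where x: "x : chz p (sp (length ms))" "X = cls (length ms) p x" by (rule carrE[OF l X])
 obtain ys where v: "valid ms qs ys" and Y: "Ys = CL ms qs ys" by (rule delemsE[OF ms Ys])
 let ?hs = "map (%i. h (ms ! i) (qs ! i) (ys ! i)) [0..<length ms]"
 have vh: "E.valid ms qs ?hs"
 using v h_in[OF arity_listD(2)[OF ms] valid_nth[OF v]] by (auto simp: E.valid_def valid_def)
 have "map (%i. F (ms ! i) (qs ! i) (Ys ! i)) [0..<length ms] = E.CL ms qs ?hs"
 using F[OF arity_listD(2)[OF ms] valid_nth[OF v]] by (auto simp: Y)
 moreover have "F (length ms) p X = cls' (length ms) p (h (length ms) p x)"
 unfolding x(2) by (rule F[OF l x(1)])
 ultimately have "dcomp E ms p qs (F (length ms) p X) (map (%i. F (ms ! i) (qs ! i) (Ys ! i)) [0..<length ms]) =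
 cls' (sum_list ms) (p + sum_list qs) (E.rcomp ms p qs (h (length ms) p x) ?hs)"
 by (simp only: E.cls_comp[OF ms h_in[OF l x(1)] vh])
 moreover have "F (sum_list ms) (p + sum_list qs) (dcomp D ms p qs X Ys) =
 cls' (sum_list ms) (p + sum_list qs) (h (sum_list ms) (p + sum_list qs) (rcomp ms p qs x ys))"
 unfolding x(2) Y cls_comp[OF ms x(1) v] by (rule F[OF L rcomp_in[OF ms v x(1)]])
 ultimately show "F (sum_list ms) (p + sum_list qs) (dcomp D ms p qs X Ys) =
 dcomp E ms p qs (F (length ms) p X) (map (%i. F (ms ! i) (qs ! i) (Ys ! i)) [0..<length ms])"
 by (simp only: h_comp[OF ms x(1) v])
 qed
qed

text \<open>A morphism of topological operads acts factor by factor on the lists of points, so it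
  preserves composites of representatives without relations.\<close>

lemma (in operad_chains) rcomp_operad_mor:
 assumes f: "top_operad_mor P Q f" and ms: "arity_list ms" and x: "x : chz p (sp (length ms))"
 and v: "valid ms qs ys"
 shows "mp (nat (p + sum_list qs)) (f (sum_list ms)) (rcomp ms p qs x ys) =
 operad_chains.rcomp dom pr Q ms p qs (mp (nat p) (f (length ms)) x)
 (map (%i. mp (nat (qs ! i)) (f (ms ! i)) (ys ! i)) [0..<length ms])"
proof -
 interpret Q: operad_chains dom pt bd pr rel Q
 using f by unfold_locales (simp add: top_operad_mor_def)
 have len: "length qs = length ms" "length ys = length ms" using v by (auto simp: valid_def)
 let ?zs = "map (%i. mp (nat (qs ! i)) (f (ms ! i)) (ys ! i)) [0..<length ms]"
 let ?x = "mp (nat p) (f (length ms)) x"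
 show ?thesis
 proof (rule negative_degree_cases[OF v x])
 assume 0: "0 : set (x # ys)"
 have "0 : set (?x # ?zs)"
 proof (cases "x = 0")
 case False
 then obtain j where "j < length ms" "ys ! j = 0"
 using 0 len by (auto simp: in_set_conv_nth)
 then show ?thesis by force
 qed simp
 then have "Q.rcomp ms p qs ?x ?zs = 0"
 using len by (intro Q.rcomp_zero) simp_all
 then show ?thesis
 using 0 len by (simp add: rcomp_zero del: list.set)
 next
 assume nn: "0 <= p" "!!i. i < length ms ==> 0 <= qs ! i"
 note args = args_in[OF v x nn]
 let ?r = "args p qs x ys" and ?fs = "f (length ms) # map f ms"
 let ?N = "sdeg ?r"
 have r': "Q.args p qs ?x ?zs = map2 (%f (q, y). (q, mp q f y)) ?fs ?r"
 using len by (auto simp: args_def Q.args_def intro!: nth_equalityI)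
 have N: "sdeg (map2 (%f (q, y). (q, mp q f y)) ?fs ?r) = ?N" "nat (p + sum_list qs) = ?N"
 using args(3,4) by (auto intro!: sdeg_map2 simp del: sdeg_simps)
 have "Q.rcomp ms p qs ?x ?zs = mp ?N (Q.tc ms) (mp ?N (%as. map2 (%f a. f a) ?fs as) (sprod ?r))"
 unfolding Q.rcomp_def r' N using args(2,4) by (subst sprod_mp) auto
 also have "... = mp ?N (%as. f (sum_list ms) (tc ms as)) (sprod ?r)"
 unfolding push_push
 proof (rule push_cong[OF sprod_in_ltop[OF args(1)]])
 fix as assume "as : topspace (ltop (sp (length ms) # map sp ms))"
 then obtain a bs where as: "as = a # bs" "a : topspace (sp (length ms))" "tpoints P ms bs" "length bs = length ms"
 by (rule topspace_ltop_ConsE)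
 have "map2 (%f a. f a) (map f ms) bs = map2 f ms bs"
 using as(4) by (intro nth_equalityI) auto
 then show "Q.tc ms (map2 (%f a. f a) ?fs as) = f (sum_list ms) (tc ms as)"
 using f ms as by (simp add: top_operad_mor_def)
 qed
 finally show ?thesis
 by (simp add: rcomp_def push_push N)
 qed
qed

lemma (in presented_operad) presented_dg_operad_mor_top:
 assumes E: "presented_operad dom pt bd pr rel Q E cls'" and f: "top_operad_mor P Q f"
 and F: "!!l n x. 1 <= l ==> x : chz n (sp l) ==> F l n (cls l n x) = cls' l n (mp (nat n) (f l) x)"
 shows "dg_operad_mor D E F"
proof (rule presented_dg_operad_mor[OF E, where h = "%l n. mp (nat n) (f l)"])
 have cont: "continuous_map (sp l) (tspace Q l) (f l)" if "1 <= l" for l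
 using f that unfolding top_operad_mor_def by blast
 show "mp (nat n) (f l) x : chz n (tspace Q l)" if "1 <= l" "x : chz n (sp l)" for l n x
 by (rule chz_mp[OF that(2) cont[OF that(1)]])
 show "mp (nat n) (f l) (mp (nat n) (tact P l sgg) x) = mp (nat n) (tact Q l sgg) (mp (nat n) (f l) x)"
 if "1 <= l" "x : chz n (sp l)" "sgg permutes {..<l}" for l n sgg x
 unfolding push_push using that f by (intro chz_cong[OF that(2)]) (auto simp: top_operad_mor_def)
 show "mp (nat 0) (f 1) (pnt (tunit P)) = pnt (tunit Q)"
 using f by (simp add: mp_pnt top_operad_mor_def)
qed (auto simp: F push_add bdry_mp nat_minus_one rcomp_operad_mor[OF f])

section \<open>A criterion for quasi-isomorphisms\<close>

lemma r_coset_subgroup_generated [simp]: "H #>\<^bsub>subgroup_generated G S\<^esub> a = H #>\<^bsub>G\<^esub> a"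
 by (simp add: r_coset_def)

text \<open>Bijectivity on homology in terms of cycles and boundaries, so that from here on only
  equations between chains have to be produced.\<close>

lemma quasi_isoI:
 assumes mor: "complex_mor C D f"
 and inj: "!!n x. x : cycles C n ==> f n x : boundaries D n ==> x : boundaries C n"
 and surj: "!!n y. y : cycles D n ==> \<exists>x\<in>cycles C n. \<exists>b\<in>boundaries D n. y = b \<otimes>\<^bsub>cgrp D n\<^esub> f n x"
 shows "quasi_iso C D f"
 unfolding quasi_iso_def
proof (intro conjI allI mor)
 fix n
 have CC: "chain_complex C" and DD: "chain_complex D" and fh: "!!n. f n : hom (cgrp C n) (cgrp D n)"
 and fd: "!!n x. x : carrier (cgrp C n) ==> cdiff D n (f n x) = f (n - 1) (cdiff C n x)"
 using mor by (auto simp: complex_mor_def)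
 have sub: "subgroup (cycles K n) (cgrp K n)" "subgroup (boundaries K n) (cgrp K n)" "boundaries K n \<subseteq> cycles K n"
 "comm_group (cgrp K n)"
 if K: "chain_complex K" for K :: "'e complex_data" and n
 proof -
 have G: "comm_group (cgrp K n)" for n using K by (simp add: chain_complex_def)
 have h: "cdiff K n : hom (cgrp K n) (cgrp K (n - 1))" for n using K by (simp add: chain_complex_def)
 have gh: "group_hom (cgrp K n) (cgrp K (n - 1)) (cdiff K n)" for n
 using G h by (simp add: group_hom_def group_hom_axioms_def comm_group.axioms)
 show "subgroup (cycles K n) (cgrp K n)"
 unfolding cycles_def by (rule group_hom.subgroup_kernel[OF gh])
 have eq: "n + 1 - 1 = n" by simp
 have "subgroup (cdiff K (n + 1) ` carrier (cgrp K (n + 1))) (cgrp K (n + 1 - 1))"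
 by (rule group_hom.img_is_subgroup[OF gh])
 then show "subgroup (boundaries K n) (cgrp K n)"
 unfolding boundaries_def eq .
 have "cdiff K n (cdiff K (n + 1) x) = \<one>\<^bsub>cgrp K (n - 1)\<^esub>" if "x : carrier (cgrp K (n + 1))" for x
 proof -
 have "cdiff K (n + 1 - 1) (cdiff K (n + 1) x) = \<one>\<^bsub>cgrp K (n + 1 - 2)\<^esub>"
 using K that unfolding chain_complex_def by blast
 then show ?thesis by simp
 qed
 moreover have "cdiff K (n + 1) x : carrier (cgrp K n)" if "x : carrier (cgrp K (n + 1))" for x
 using h[of "n + 1"] that unfolding eq by (rule hom_in_carrier)
 ultimately show "boundaries K n \<subseteq> cycles K n"
 by (auto simp: boundaries_def cycles_def kernel_def)
 show "comm_group (cgrp K n)" by (rule G)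
 qed
 interpret C: comm_group "cgrp C n" by (rule sub(4)[OF CC])
 interpret D: comm_group "cgrp D n" by (rule sub(4)[OF DD])
 let ?ZC = "subgroup_generated (cgrp C n) (cycles C n)" and ?ZD = "subgroup_generated (cgrp D n) (cycles D n)"
 let ?BC = "boundaries C n" and ?BD = "boundaries D n"
 have cZC: "carrier ?ZC = cycles C n" and cZD: "carrier ?ZD = cycles D n"
 using subgroup.carrier_subgroup_generated_subgroup[OF sub(1)[OF CC]]
 subgroup.carrier_subgroup_generated_subgroup[OF sub(1)[OF DD]] by simp_all
 have nC: "normal ?BC ?ZC" and nD: "normal ?BD ?ZD"
 using comm_group.subgroup_imp_normal[OF C.abelian_subgroup_generated[OF sub(4)[OF CC]] C.subgroup_of_subgroup_generated[OF sub(3,2)[OF CC]]]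
 comm_group.subgroup_imp_normal[OF D.abelian_subgroup_generated[OF sub(4)[OF DD]] D.subgroup_of_subgroup_generated[OF sub(3,2)[OF DD]]] .
 interpret NC: normal ?BC ?ZC by (rule nC)
 interpret ND: normal ?BD ?ZD by (rule nD)
 have cycf: "f n z : cycles D n" if "z : cycles C n" for z
 proof -
 have z: "z : carrier (cgrp C n)" "cdiff C n z = \<one>\<^bsub>cgrp C (n - 1)\<^esub>"
 using that by (auto simp: cycles_def kernel_def)
 have "f (n - 1) \<one>\<^bsub>cgrp C (n - 1)\<^esub> = \<one>\<^bsub>cgrp D (n - 1)\<^esub>"
 using hom_one[OF fh[of "n - 1"]] sub(4)[OF CC] sub(4)[OF DD] by (simp add: comm_group.axioms)
 then show ?thesis
 using z fd[OF z(1)] hom_in_carrier[OF fh z(1)] by (simp add: cycles_def kernel_def)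
 qed
 have bdf: "f n b : ?BD" if b: "b : ?BC" for b
 proof -
 obtain c where c: "c : carrier (cgrp C (n + 1))" "b = cdiff C (n + 1) c"
 using b by (auto simp: boundaries_def)
 have "f n b = cdiff D (n + 1) (f (n + 1) c)" using fd[OF c(1)] by (simp add: c(2))
 then show ?thesis using hom_in_carrier[OF fh c(1)] by (auto simp: boundaries_def)
 qed
 have carZ: "z : carrier (cgrp C n)" if "z : cycles C n" for z using that by (auto simp: cycles_def kernel_def)
 have carD: "z : carrier (cgrp D n)" if "z : cycles D n" for z using that by (auto simp: cycles_def kernel_def)
 have BDsub: "?BD \<subseteq> carrier (cgrp D n)" and BCsub: "?BC \<subseteq> carrier (cgrp C n)"
 using subgroup.subset[OF sub(2)[OF DD]] subgroup.subset[OF sub(2)[OF CC]] .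
 \<comment> \<open>The union in \<open>homology_induced\<close> is a single coset because boundaries
   are mapped to boundaries.\<close>
 have ind: "homology_induced D f n (?BC #>\<^bsub>cgrp C n\<^esub> z) = ?BD #>\<^bsub>cgrp D n\<^esub> f n z" if z: "z : cycles C n" for z
 proof -
 have "?BD #>\<^bsub>cgrp D n\<^esub> f n (b \<otimes>\<^bsub>cgrp C n\<^esub> z) = ?BD #>\<^bsub>cgrp D n\<^esub> f n z" if b: "b : ?BC" for b
 proof -
 have "f n (b \<otimes>\<^bsub>cgrp C n\<^esub> z) = f n b \<otimes>\<^bsub>cgrp D n\<^esub> f n z"
 using hom_mult[OF fh] b BCsub carZ[OF z] by blast
 then show ?thesis
 using D.coset_mult_assoc[OF BDsub, of "f n b" "f n z"] D.coset_join2[OF _ sub(2)[OF DD] bdf[OF b]]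
 bdf[OF b] BDsub carD[OF cycf[OF z]] by auto
 qed
 moreover have "?BC ~= {}" using subgroup.one_closed[OF sub(2)[OF CC]] by auto
 ultimately show ?thesis
 unfolding homology_induced_def r_coset_def[of "cgrp C n"] by auto
 qed
 have cosC: "carrier (complex_homology C n) = {?BC #>\<^bsub>cgrp C n\<^esub> z | z. z : cycles C n}"
 and cosD: "carrier (complex_homology D n) = {?BD #>\<^bsub>cgrp D n\<^esub> z | z. z : cycles D n}"
 by (auto simp: complex_homology_def FactGroup_def RCOSETS_def cZC cZD)
 have multC: "(?BC #>\<^bsub>cgrp C n\<^esub> z) \<otimes>\<^bsub>complex_homology C n\<^esub> (?BC #>\<^bsub>cgrp C n\<^esub> z') = ?BC #>\<^bsub>cgrp C n\<^esub> (z \<otimes>\<^bsub>cgrp C n\<^esub> z')"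
 if "z : cycles C n" "z' : cycles C n" for z z'
 using NC.rcos_sum[of z z'] that by (simp add: complex_homology_def FactGroup_def cZC)
 have multD: "(?BD #>\<^bsub>cgrp D n\<^esub> z) \<otimes>\<^bsub>complex_homology D n\<^esub> (?BD #>\<^bsub>cgrp D n\<^esub> z') = ?BD #>\<^bsub>cgrp D n\<^esub> (z \<otimes>\<^bsub>cgrp D n\<^esub> z')"
 if "z : cycles D n" "z' : cycles D n" for z z'
 using ND.rcos_sum[of z z'] that by (simp add: complex_homology_def FactGroup_def cZD)
 have hom: "homology_induced D f n : hom (complex_homology C n) (complex_homology D n)"
 proof (rule homI)
 fix A B assume "A : carrier (complex_homology C n)" "B : carrier (complex_homology C n)"
 then obtain z z' where z: "A = ?BC #>\<^bsub>cgrp C n\<^esub> z" "z : cycles C n" and z': "B = ?BC #>\<^bsub>cgrp C n\<^esub> z'" "z' : cycles C n"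
 unfolding cosC by blast
 show "homology_induced D f n A : carrier (complex_homology D n)"
 unfolding z(1) ind[OF z(2)] cosD using cycf[OF z(2)] by blast
 have zz: "z \<otimes>\<^bsub>cgrp C n\<^esub> z' : cycles C n" by (rule subgroup.m_closed[OF sub(1)[OF CC] z(2) z'(2)])
 show "homology_induced D f n (A \<otimes>\<^bsub>complex_homology C n\<^esub> B) =
 homology_induced D f n A \<otimes>\<^bsub>complex_homology D n\<^esub> homology_induced D f n B"
 unfolding z(1) z'(1) multC[OF z(2) z'(2)] ind[OF z(2)] ind[OF z'(2)] ind[OF zz] multD[OF cycf[OF z(2)] cycf[OF z'(2)]]
 hom_mult[OF fh carZ[OF z(2)] carZ[OF z'(2)]] ..
 qed
 have "inj_on (homology_induced D f n) (carrier (complex_homology C n))"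
 proof (rule inj_onI)
 fix A B assume "A : carrier (complex_homology C n)" "B : carrier (complex_homology C n)"
 and eq: "homology_induced D f n A = homology_induced D f n B"
 then obtain z z' where z: "A = ?BC #>\<^bsub>cgrp C n\<^esub> z" "z : cycles C n" and z': "B = ?BC #>\<^bsub>cgrp C n\<^esub> z'" "z' : cycles C n"
 unfolding cosC by blast
 \<comment> \<open>Two classes with the same image differ by a cycle whose image is a
   boundary.\<close>
 let ?w = "z \<otimes>\<^bsub>cgrp C n\<^esub> inv\<^bsub>cgrp C n\<^esub> z'"
 have w: "?w : cycles C n"
 using subgroup.m_closed[OF sub(1)[OF CC] z(2)] subgroup.m_inv_closed[OF sub(1)[OF CC] z'(2)] by blast
 have fz: "f n z : carrier (cgrp D n)" "f n z' : carrier (cgrp D n)"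
 using carD cycf z z' by auto
 have "f n z : ?BD #>\<^bsub>cgrp D n\<^esub> f n z"
 by (rule D.rcos_self[OF fz(1) sub(2)[OF DD]])
 then have "f n z : ?BD #>\<^bsub>cgrp D n\<^esub> f n z'"
 using eq unfolding z(1) z'(1) ind[OF z(2)] ind[OF z'(2)] by simp
 then obtain b where b: "b : ?BD" "f n z = b \<otimes>\<^bsub>cgrp D n\<^esub> f n z'"
 by (auto simp: r_coset_def)
 have fi: "f n (inv\<^bsub>cgrp C n\<^esub> z') = inv\<^bsub>cgrp D n\<^esub> f n z'"
 using group_hom.hom_inv[of "cgrp C n" "cgrp D n" "f n" z'] fh carZ[OF z'(2)]
 by (simp add: group_hom_def group_hom_axioms_def)
 have "f n ?w = f n z \<otimes>\<^bsub>cgrp D n\<^esub> inv\<^bsub>cgrp D n\<^esub> f n z'"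
 using hom_mult[OF fh carZ[OF z(2)] C.inv_closed[OF carZ[OF z'(2)]]] fi by simp
 also have "... = b"
 using b fz BDsub by (auto simp: D.m_assoc)
 finally have "?w : ?BC"
 using inj[OF w] b(1) by simp
 then show "A = B"
 unfolding z(1) z'(1)
 using C.coset_join2[OF _ sub(2)[OF CC], of ?w] C.coset_mult_assoc[OF BCsub, of ?w z'] carZ[OF z(2)] carZ[OF z'(2)] carZ[OF w]
 by (simp add: C.m_assoc)
 qed
 moreover have "carrier (complex_homology D n) \<subseteq> homology_induced D f n ` carrier (complex_homology C n)"
 proof
 fix A assume "A : carrier (complex_homology D n)"
 then obtain y where y: "A = ?BD #>\<^bsub>cgrp D n\<^esub> y" "y : cycles D n"
 unfolding cosD by blast
 obtain x b where x: "x : cycles C n" "b : ?BD" "y = b \<otimes>\<^bsub>cgrp D n\<^esub> f n x" using surj[OF y(2)] by blast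
 have "A = ?BD #>\<^bsub>cgrp D n\<^esub> f n x"
 unfolding y(1) x(3)
 using D.coset_join2[OF _ sub(2)[OF DD] x(2)] D.coset_mult_assoc[OF BDsub, of b "f n x"] x(2) BDsub carD[OF cycf[OF x(1)]]
 by auto
 then have "A = homology_induced D f n (?BC #>\<^bsub>cgrp C n\<^esub> x)"
 using ind[OF x(1)] by simp
 moreover have "?BC #>\<^bsub>cgrp C n\<^esub> x : carrier (complex_homology C n)"
 unfolding cosC using x(1) by blast
 ultimately show "A : homology_induced D f n ` carrier (complex_homology C n)" by blast
 qed
 moreover have "homology_induced D f n ` carrier (complex_homology C n) \<subseteq> carrier (complex_homology D n)"
 using hom_carrier[OF hom] .
 ultimately have "bij_betw (homology_induced D f n) (carrier (complex_homology C n)) (carrier (complex_homology D n))"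
 unfolding bij_betw_def by blast
 with hom show "homology_induced D f n : iso (complex_homology C n) (complex_homology D n)"
 by (simp add: iso_def)
qed

lemma one_in_boundaries:
 assumes K: "chain_complex K"
 shows "\<one>\<^bsub>cgrp K n\<^esub> : boundaries K n"
proof -
 have "group (cgrp K n)" "group (cgrp K (n + 1))" using K by (auto simp: chain_complex_def comm_group.axioms)
 moreover have "cdiff K (n + 1) : hom (cgrp K (n + 1)) (cgrp K (n + 1 - 1))"
 using K unfolding chain_complex_def by blast
 ultimately have "\<one>\<^bsub>cgrp K n\<^esub> = cdiff K (n + 1) \<one>\<^bsub>cgrp K (n + 1)\<^esub>" "\<one>\<^bsub>cgrp K (n + 1)\<^esub> : carrier (cgrp K (n + 1))"
 using hom_one[of "cdiff K (n + 1)" "cgrp K (n + 1)" "cgrp K n"] by (simp_all add: group.is_monoid)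
 then show ?thesis unfolding boundaries_def by blast
qed

lemma quasi_iso_id:
 assumes "chain_complex C"
 shows "quasi_iso C C (%n x. x)"
proof (rule quasi_isoI)
 show "complex_mor C C (%n x. x)"
 using assms by (auto simp: complex_mor_def hom_def)
 fix n y assume y: "y : cycles C n"
 interpret G: comm_group "cgrp C n" using assms by (simp add: chain_complex_def)
 show "\<exists>x\<in>cycles C n. \<exists>b\<in>boundaries C n. y = b \<otimes>\<^bsub>cgrp C n\<^esub> x"
 using y one_in_boundaries[OF assms] by (intro bexI[of _ y] bexI[of _ "\<one>\<^bsub>cgrp C n\<^esub>"]) (auto simp: cycles_def kernel_def)
qed

context presented_operad
begin

lemma cycles_iff:
 assumes l: "1 <= l" and n: "0 <= n"
 shows "x : cycles (dcx D l) n \<longleftrightarrow> (\<exists>a. x = cls l n a & a : Ch (nat n) (sp l) & bdry (nat n) a : Rel (nat n - 1) (sp l))"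
proof -
 \<comment> \<open>For \<open>n = 0\<close> the boundary is 0, which is a relation in every degree,
   so the truncated \<open>nat n - 1\<close> does no harm.\<close>
 have "cls l (n - 1) (bdry (nat n) a) = \<one>\<^bsub>dgrp D l (n - 1)\<^esub> \<longleftrightarrow> bdry (nat n) a : Rel (nat n - 1) (sp l)"
 if a: "a : chz n (sp l)" for a
 using cls_one[OF l chz_bdry[OF a]] n by (cases "n = 0") (auto simp: nat_minus_one)
 then show ?thesis
 using n cls_diff[OF l, of _ n] by (auto simp: cycles_def kernel_def carr[OF l] chz_def)
qed

lemma boundaries_eq:
 assumes l: "1 <= l" and n: "0 <= n"
 shows "boundaries (dcx D l) n = {cls l n (bdry (Suc (nat n)) a) | a. a : Ch (Suc (nat n)) (sp l)}"
proof -
 have natS: "nat (n + 1) = Suc (nat n)" using n by simp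
 have "chz (n + 1) (sp l) = Ch (Suc (nat n)) (sp l)" using n by (simp add: chz_def natS)
 moreover from this have "ddiff D l (n + 1) (cls l (n + 1) a) = cls l n (bdry (Suc (nat n)) a)"
 if "a : Ch (Suc (nat n)) (sp l)" for a
 using cls_diff[OF l, of a "n + 1"] that n by (simp add: natS)
 ultimately show ?thesis unfolding boundaries_def carr[OF l] by force
qed

lemma cls_eq_iff:
 assumes l: "1 <= l" and n: "0 <= n" and xy: "x : Ch (nat n) (sp l)" "y : Ch (nat n) (sp l)"
 shows "cls l n x = cls l n y \<longleftrightarrow> x - y : Rel (nat n) (sp l)"
proof -
 interpret G: comm_group "dgrp D l n" by (rule grp[OF l])
 have xy': "x : chz n (sp l)" "y : chz n (sp l)" "x - y : chz n (sp l)" using n xy by (auto simp: chz_def chains_diff)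
 have "cls l n x = cls l n (x - y) \<otimes>\<^bsub>dgrp D l n\<^esub> cls l n y"
 using cls_add[OF l xy'(3,2)] by simp
 then have "cls l n x = cls l n y \<longleftrightarrow> cls l n (x - y) = \<one>\<^bsub>dgrp D l n\<^esub>"
 using cls_in[OF l xy'(2)] cls_in[OF l xy'(3)] by (metis G.l_one G.one_closed G.right_cancel)
 then show ?thesis
 using cls_one[OF l xy'(3)] n by auto
qed

end


text \<open>For representatives a cycle is a chain whose boundary is a relation, and equality holds
  up to relations. Negative degrees are separated in the proof, both groups being trivial
  there.\<close>

lemma (in presented_operad) presented_quasi_iso:
 assumes E: "presented_operad dom' pt' bd' pr' rel' Q E cls'" and l: "1 <= l"
 and mor: "complex_mor (dcx D l) (dcx E l) F"
 and F: "!!n x. x : chz n (sp l) ==> F n (cls l n x) = cls' l n (h n x)"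
 and h_in: "!!n x. x : chz n (sp l) ==> h n x : operad_chains.chz dom' n (tspace Q l)"
 and inj: "!!n x w. x : Ch n (sp l) ==> bdry n x : Rel (n - 1) (sp l) ==>
 w : chains_on (dom' (Suc n)) (tspace Q l) ==>
 h (int n) x - chain_model.bdry dom' bd' (Suc n) w : relations (dom' n) (rel' n) (tspace Q l) ==>
 \<exists>v\<in>Ch (Suc n) (sp l). x - bdry (Suc n) v : Rel n (sp l)"
 and surj: "!!n y. y : chains_on (dom' n) (tspace Q l) ==>
 chain_model.bdry dom' bd' n y : relations (dom' (n - 1)) (rel' (n - 1)) (tspace Q l) ==>
 \<exists>x\<in>Ch n (sp l). bdry n x : Rel (n - 1) (sp l) & (\<exists>w\<in>chains_on (dom' (Suc n)) (tspace Q l).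
 y - (chain_model.bdry dom' bd' (Suc n) w + h (int n) x) : relations (dom' n) (rel' n) (tspace Q l))"
 shows "quasi_iso (dcx D l) (dcx E l) F"
proof -
 interpret E: presented_operad dom' pt' bd' pr' rel' Q E cls' by (rule E)
 have negC: "x = \<one>\<^bsub>dgrp D l n\<^esub>" if "n < 0" "x : carrier (dgrp D l n)" for x n
 using that by (auto simp: carr[OF l] chz_def cls_0[OF l])
 have negE: "x = \<one>\<^bsub>dgrp E l n\<^esub>" if "n < 0" "x : carrier (dgrp E l n)" for x n
 using that by (auto simp: E.carr[OF l] E.chz_def E.cls_0[OF l])
 note cyc = cycles_iff[OF l] and cycE = E.cycles_iff[OF l] and bd = boundaries_eq[OF l] and bdE = E.boundaries_eq[OF l]
 note eqC = cls_eq_iff[OF l] and eqE = E.cls_eq_iff[OF l] and one_bd = one_in_boundaries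
 show ?thesis
 proof (rule quasi_isoI[OF mor])
 fix n x assume x: "x : cycles (dcx D l) n" and fx: "F n x : boundaries (dcx E l) n"
 show "x : boundaries (dcx D l) n"
 proof (cases "n < 0")
 case True
 then show ?thesis
 using negC[OF True, of x] x one_bd[OF presented_complex[OF l]] by (auto simp: cycles_def kernel_def)
 next
 case False
 then have n: "0 <= n" "int (nat n) = n" by auto
 obtain a where a: "x = cls l n a" "a : Ch (nat n) (sp l)" "bdry (nat n) a : Rel (nat n - 1) (sp l)"
 using x cyc[OF n(1)] by blast
 have az: "a : chz n (sp l)" using a(2) n(1) by (simp add: chz_def)
 have ha: "h n a : E.Ch (nat n) (tspace Q l)" using h_in[OF az] n by (simp add: E.chz_def)
 obtain w where w: "w : E.Ch (Suc (nat n)) (tspace Q l)" "cls' l n (h n a) = cls' l n (E.bdry (Suc (nat n)) w)"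
 using fx unfolding a(1) F[OF az] bdE[OF n(1)] by blast
 have bw: "E.bdry (Suc (nat n)) w : E.Ch (nat n) (tspace Q l)" using E.bdry_in[OF w(1)] by simp
 obtain v where v: "v : Ch (Suc (nat n)) (sp l)" "a - bdry (Suc (nat n)) v : Rel (nat n) (sp l)"
 using inj[OF a(2,3) w(1)] eqE[OF n(1) ha bw] w(2) n(2) by auto
 have bv: "bdry (Suc (nat n)) v : Ch (nat n) (sp l)" using bdry_in[OF v(1)] by simp
 have "x = cls l n (bdry (Suc (nat n)) v)"
 unfolding a(1) using eqC[OF n(1) a(2) bv] v(2) by simp
 then show ?thesis unfolding bd[OF n(1)] using v(1) by blast
 qed
 next
 fix n y assume y: "y : cycles (dcx E l) n"
 show "\<exists>x\<in>cycles (dcx D l) n. \<exists>b\<in>boundaries (dcx E l) n. y = b \<otimes>\<^bsub>dgrp E l n\<^esub> F n x"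
 proof (cases "n < 0")
 case True
 interpret G: comm_group "dgrp E l n" by (rule E.grp[OF l])
 have y1: "y = \<one>\<^bsub>dgrp E l n\<^esub>" using negE[OF True] y by (auto simp: cycles_def kernel_def)
 have c0: "cls l n 0 : cycles (dcx D l) n"
 using cls_diff[OF l chz_0, of n] cls_in[OF l chz_0] by (simp add: cycles_def kernel_def cls_0[OF l])
 have h0: "h n 0 = 0" using h_in[OF chz_0, of n] True by (simp add: E.chz_def)
 have "F n (cls l n 0) = \<one>\<^bsub>dgrp E l n\<^esub>"
 using F[OF chz_0, of n] by (simp add: h0 E.cls_0[OF l])
 then have "y = \<one>\<^bsub>dgrp E l n\<^esub> \<otimes>\<^bsub>dgrp E l n\<^esub> F n (cls l n 0)"
 by (simp add: y1)
 then show ?thesis using c0 one_bd[OF E.presented_complex[OF l]] by blast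
 next
 case False
 then have n: "0 <= n" "int (nat n) = n" by auto
 obtain a where a: "y = cls' l n a" "a : E.Ch (nat n) (tspace Q l)" "E.bdry (nat n) a : E.Rel (nat n - 1) (tspace Q l)"
 using y cycE[OF n(1)] by blast
 obtain x w where x: "x : Ch (nat n) (sp l)" "bdry (nat n) x : Rel (nat n - 1) (sp l)"
 and w: "w : E.Ch (Suc (nat n)) (tspace Q l)" "a - (E.bdry (Suc (nat n)) w + h n x) : E.Rel (nat n) (tspace Q l)"
 using surj[OF a(2,3)] unfolding n(2) by blast
 have xz: "x : chz n (sp l)" using x(1) n(1) by (simp add: chz_def)
 have hx: "h n x : E.Ch (nat n) (tspace Q l)" using h_in[OF xz] n by (simp add: E.chz_def)
 have bw: "E.bdry (Suc (nat n)) w : E.Ch (nat n) (tspace Q l)" using E.bdry_in[OF w(1)] by simp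
 have "y = cls' l n (E.bdry (Suc (nat n)) w + h n x)"
 unfolding a(1) using eqE[OF n(1) a(2) chains_add[OF bw hx]] w(2) by simp
 also have "... = cls' l n (E.bdry (Suc (nat n)) w) \<otimes>\<^bsub>dgrp E l n\<^esub> F n (cls l n x)"
 unfolding F[OF xz] using bw hx n(1) by (intro E.cls_add[OF l]) (simp_all add: E.chz_def)
 finally have y': "y = cls' l n (E.bdry (Suc (nat n)) w) \<otimes>\<^bsub>dgrp E l n\<^esub> F n (cls l n x)" .
 have "cls l n x : cycles (dcx D l) n" using cyc[OF n(1)] x by blast
 moreover have "cls' l n (E.bdry (Suc (nat n)) w) : boundaries (dcx E l) n" unfolding bdE[OF n(1)] using w(1) by blast
 ultimately show ?thesis using y' by blast
 qed
 qed
qed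

section \<open>Permutations and shuffles\<close>

lemma permutation_of_permutes: "pp permutes {..<n::nat} ==> permutation pp"
 by (auto simp: permutation_permutes)

lemma inj_imp_bij_betw: "inj f ==> f ` {..<n} \<subseteq> {..<n} ==> bij_betw f {..<n} {..<n::nat}"
 using inj_on_subset[of f UNIV "{..<n}"] by (simp add: bij_betw_def endo_inj_surj)

text \<open>The coface map: increasing, with \<open>k\<close> as the only value left out.\<close>

definition skip :: "nat => nat => nat" where
 "skip k y = (if y < k then y else Suc y)"

text \<open>On permutation matrices this adds a row and a column that meet in a 1, as in a Laplace
  expansion.\<close>

definition pins :: "nat => nat => (nat => nat) => nat => nat" where
 "pins i k pp x = (if x = i then k else skip k (pp (if x < i then x else x - 1)))"

lemma skip_neq [simp]: "skip k y ~= k" "k ~= skip k y"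
 by (auto simp: skip_def)

lemma skip_inj [simp]: "skip k x = skip k y \<longleftrightarrow> x = y"
 by (auto simp: skip_def)

lemma skip_less_iff [simp]: "skip k x < skip k y \<longleftrightarrow> x < y"
 by (auto simp: skip_def)

lemma skip_cases: obtains "x = k" | y where "x = skip k y"
 by (cases "x = k"; cases "x < k") (auto simp: skip_def intro: that(2)[of x] that(2)[of "x - 1"])

lemma pins_at [simp]: "pins i k pp i = k"
 and pins_skip [simp]: "pins i k pp (skip i x) = skip k (pp x)"
 by (auto simp: pins_def skip_def)

lemma skip_less: "k <= n ==> skip k x < Suc n \<longleftrightarrow> x < n"
 by (auto simp: skip_def)

lemma pins_permutes:
 assumes "pp permutes {..<n}" "i <= n" "k <= n"
 shows "pins i k pp permutes {..<Suc n}"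
proof (rule bij_imp_permutes)
 have inj: "inj (pins i k pp)"
 proof (rule injI)
 fix x y assume "pins i k pp x = pins i k pp y"
 then show "x = y"
 using permutes_inj[OF assms(1)]
 by (cases x i rule: skip_cases; cases y i rule: skip_cases) (auto simp: inj_eq)
 qed
 have "pins i k pp x < Suc n" if "x < Suc n" for x
 using that assms permutes_in_image[OF assms(1)]
 by (cases x i rule: skip_cases) (auto simp: skip_less)
 then have "pins i k pp ` {..<Suc n} \<subseteq> {..<Suc n}" by auto
 then show "bij_betw (pins i k pp) {..<Suc n} {..<Suc n}"
 by (rule inj_imp_bij_betw[OF inj])
 fix x assume "x \<notin> {..<Suc n}"
 then obtain y where "x = Suc y" "n <= y" by (cases x) auto
 then show "pins i k pp x = x"
 using assms permutes_not_in[OF assms(1), of y] by (simp add: pins_def skip_def)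
qed

lemma pins_row_step: "pins (Suc i) k pp o Transposition.transpose i (Suc i) = pins i k pp"
 by (rule ext) (auto simp: pins_def Transposition.transpose_def less_Suc_eq)

lemma pins_column_step: "Transposition.transpose k (Suc k) o pins i (Suc k) pp = pins i k pp"
 by (rule ext) (auto simp: pins_def Transposition.transpose_def skip_def less_Suc_eq)

text \<open>Adjacent transpositions move the new row and the new column one place at a time to the
  end, where the insertion gives back \<open>pp\<close>; each of them costs one sign.\<close>

lemma sign_pins:
 assumes "pp permutes {..<n}" "i <= n" "k <= n"
 shows "sign (pins i k pp) = (- 1) ^ (i + k) * sign pp"
proof -
 have perm: "permutation (pins i k pp)" if "i <= n" "k <= n" for i k
 by (rule permutation_of_permutes[OF pins_permutes[OF assms(1) that]])
 have nn: "pins n n pp = pp"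
 proof
 fix x
 consider "x < n" | "x = n" | "x > n" by linarith
 then show "pins n n pp x = pp x"
 proof cases
 case 1
 then have "pp x < n" using permutes_in_image[OF assms(1), of x] by simp
 with 1 show ?thesis by (simp add: pins_def skip_def)
 next
 case 2
 then show ?thesis using permutes_not_in[OF assms(1), of n] by simp
 next
 case 3
 then have "pp x = x" "pp (x - 1) = x - 1"
 using permutes_not_in[OF assms(1), of x] permutes_not_in[OF assms(1), of "x - 1"] by simp_all
 with 3 show ?thesis by (simp add: pins_def skip_def)
 qed
 qed
 have kn: "sign (pins n k pp) = (- 1) ^ (n + k) * sign pp" if "k <= n" for k
 using that
 proof (induction k rule: inc_induct)
 case base
 then show ?case by (simp add: nn mult_2[symmetric])
 next
 case (step k)
 then show ?case
 by (subst pins_column_step[symmetric])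
 (simp add: sign_compose perm permutation_swap_id sign_swap_id)
 qed
 show ?thesis
 using assms(2)
 proof (induction i rule: inc_induct)
 case base
 then show ?case by (rule kn[OF assms(3)])
 next
 case (step i)
 then show ?case
 using assms(3) by (subst pins_row_step[symmetric])
 (simp add: sign_compose perm permutation_swap_id sign_swap_id)
 qed
qed

lemma pins_inj: "pins i k pp = pins i k rh ==> pp = rh"
proof
 fix x assume "pins i k pp = pins i k rh"
 then show "pp x = rh x"
 using pins_skip[of i k pp x] pins_skip[of i k rh x] by simp
qed

lemma perm_insertE:
 assumes "rh permutes {..<Suc n}" "i <= n" "rh i = k"
 obtains pp where "pp permutes {..<n}" "rh = pins i k pp"
proof -
 have k: "k <= n" using permutes_in_image[OF assms(1), of i] assms(2,3) by auto
 define pp where "pp = (%x. THE y. rh (skip i x) = skip k y)"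
 have pp: "rh (skip i x) = skip k (pp x)" for x
 proof -
 have "rh (skip i x) ~= k"
 using permutes_inj[OF assms(1)] assms(3) by (metis injD skip_neq(1))
 then obtain y where y: "rh (skip i x) = skip k y"
 by (cases "rh (skip i x)" k rule: skip_cases) auto
 then have "pp x = y" unfolding pp_def by (intro the_equality) auto
 with y show ?thesis by simp
 qed
 have "pp permutes {..<n}"
 proof (rule bij_imp_permutes)
 have inj: "inj pp"
 proof (rule injI)
 fix x y assume "pp x = pp y"
 then have "rh (skip i x) = rh (skip i y)" by (simp add: pp)
 then show "x = y" using permutes_inj[OF assms(1)] by (simp add: inj_eq)
 qed
 have "pp x < n" if "x < n" for x
 using permutes_in_image[OF assms(1), of "skip i x"] that k assms(2) by (simp add: pp skip_less)
 then have "pp ` {..<n} \<subseteq> {..<n}" by auto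
 then show "bij_betw pp {..<n} {..<n}"
 by (rule inj_imp_bij_betw[OF inj])
 fix x assume "x \<notin> {..<n}"
 then have "skip i x = Suc x" "rh (Suc x) = Suc x"
 using assms(2) permutes_not_in[OF assms(1), of "Suc x"] by (auto simp: skip_def)
 then have "skip k (pp x) = Suc x" using pp[of x] by simp
 then show "pp x = x" using k \<open>x \<notin> {..<n}\<close> by (auto simp: skip_def split: if_splits)
 qed
 moreover have "rh = pins i k pp"
 proof
 fix x show "rh x = pins i k pp x"
 by (cases x i rule: skip_cases) (simp_all add: assms(3) pp)
 qed
 ultimately show ?thesis by (rule that)
qed

section \<open>Direct sums of permutations\<close>

definition perm_sum :: "nat => (nat => nat) => (nat => nat) => nat => nat" where
 "perm_sum p ka ka' i = (if i < p then ka i else p + ka' (i - p))"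

lemma perm_sum_permutes:
 assumes "ka permutes {..<p}" "ka' permutes {..<q}"
 shows "perm_sum p ka ka' permutes {..<p + q}"
proof (rule bij_imp_permutes)
 have less: "ka i < p" if "i < p" for i using permutes_in_image[OF assms(1), of i] that by simp
 have less': "ka' i < q" if "i < q" for i using permutes_in_image[OF assms(2), of i] that by simp
 have "inj (perm_sum p ka ka')"
 proof (rule injI)
 fix x y assume "perm_sum p ka ka' x = perm_sum p ka ka' y"
 then show "x = y"
 using less[of x] less[of y] permutes_inj[OF assms(1)] permutes_inj[OF assms(2)]
 by (auto simp: perm_sum_def inj_eq split: if_splits)
 qed
 moreover have "perm_sum p ka ka' ` {..<p + q} \<subseteq> {..<p + q}"
 using less less' by (auto simp: perm_sum_def trans_less_add1)
 ultimately show "bij_betw (perm_sum p ka ka') {..<p + q} {..<p + q}"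
 by (rule inj_imp_bij_betw)
 fix x assume "x \<notin> {..<p + q}"
 then show "perm_sum p ka ka' x = x"
 using permutes_not_in[OF assms(2), of "x - p"] by (auto simp: perm_sum_def)
qed

lemma sign_perm_sum:
 assumes "ka permutes {..<p}" "ka' permutes {..<q}"
 shows "sign (perm_sum p ka ka') = sign ka * sign ka'"
proof -
 have 1: "perm_sum p ka ka' = ka o perm_sum p id ka'"
 using permutes_not_in[OF assms(1)] by (auto simp: perm_sum_def fun_eq_iff)
 have inj: "inj_on ((+) p) {..<q}" by simp
 \<comment> \<open>Up to the shift by \<open>p\<close> this is \<open>ka'\<close>, and relabelling
   preserves the sign.\<close>
 have "perm_sum p id ka' = map_permutation {..<q} ((+) p) ka'"
 proof
 fix x
 consider "x < p" | y where "x = p + y" "y < q" | y where "x = p + y" "q <= y"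
 by (metis le_Suc_ex not_less)
 then show "perm_sum p id ka' x = map_permutation {..<q} ((+) p) ka' x"
 proof cases
 case 2
 then show ?thesis using map_permutation_apply[OF inj, of y ka'] by (simp add: perm_sum_def)
 qed (use permutes_not_in[OF assms(2)] in \<open>auto simp: perm_sum_def map_permutation_def restrict_id_def\<close>)
 qed
 then have "sign (perm_sum p id ka') = sign ka'"
 using sign_map_permutation[OF inj assms(2)] by simp
 moreover have "permutation (perm_sum p id ka')"
 by (rule permutation_of_permutes[OF perm_sum_permutes[OF permutes_id assms(2)]])
 ultimately show ?thesis
 unfolding 1 using permutation_of_permutes[OF assms(1)] by (simp add: sign_compose)
qed

text \<open>Increasing functions satisfy \<open>m <= ka m\<close>, and the two sides have the same
  sum over \<open>{..<n}\<close>, so all these inequalities are equalities.\<close>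

lemma strict_mono_permutes_id:
 assumes "ka permutes {..<n::nat}" "strict_mono_on {..<n} ka"
 shows "ka = id"
proof
 have "m < n ==> m <= ka m" for m
 proof (induction m)
 case (Suc m)
 then have "ka m < ka (Suc m)" using assms(2) by (auto simp: strict_mono_on_def)
 with Suc show ?case by simp
 qed simp
 then have "\<forall>m\<in>{..<n}. id m <= ka m" by simp
 moreover have "sum ka {..<n} = sum id {..<n}"
 using sum.permute[OF assms(1), of id] by (simp add: o_def)
 ultimately have eq: "ka m = m" if "m < n" for m
 using sum_mono_inv[of id "{..<n}" ka m] that by fastforce
 fix x show "ka x = id x"
 using eq permutes_not_in[OF assms(1), of x] by (cases "x < n") auto
qed

section \<open>Shuffles\<close>

lemma shuffle_perms_strict:
 assumes "pp : shuffle_perms p q"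
 shows "pp permutes {..<p + q}" "!!i j. i < j ==> j < p ==> pp i < pp j"
 "!!i j. i < j ==> j < q ==> pp (p + i) < pp (p + j)"
 using assms by (auto simp: shuffle_perms_def strict_mono_on_def)

lemma shuffle_permsI:
 assumes "pp permutes {..<p + q}" "!!i j. i < j ==> j < p ==> pp i < pp j"
 "!!i j. i < j ==> j < q ==> pp (p + i) < pp (p + j)"
 shows "pp : shuffle_perms p q"
proof -
 have "pp i < pp j" if "p <= i" "i < j" "j < p + q" for i j
 using assms(3)[of "i - p" "j - p"] that by simp
 then show ?thesis
 using assms(1,2) by (auto simp: shuffle_perms_def strict_mono_on_def)
qed

lemma finite_shuffle_perms [simp]: "finite (shuffle_perms p q)"
 by (rule finite_subset[of _ "{pp. pp permutes {..<p + q}}"])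
 (auto simp: shuffle_perms_def finite_permutations)

lemma shuffle_perms_0 [simp]: "shuffle_perms p 0 = {id}" "shuffle_perms 0 q = {id}"
 by (auto simp: shuffle_perms_def strict_mono_permutes_id permutes_id strict_mono_on_def)


text \<open>The quotient of the two permutations on each block carries one increasing sequence into
  another. It is thus an increasing permutation, that is, the identity.\<close>

lemma shuffle_decomposition_unique:
 assumes pp: "pp : shuffle_perms p q" "rh : shuffle_perms p q"
 and ka: "ka permutes {..<p}" "ka' permutes {..<q}" "\<mu> permutes {..<p}" "\<mu>' permutes {..<q}"
 and eq: "pp o perm_sum p ka ka' = rh o perm_sum p \<mu> \<mu>'"
 shows "pp = rh" "ka = \<mu>" "ka' = \<mu>'"
proof -
 note s_pp = shuffle_perms_strict[OF pp(1)] and s_rh = shuffle_perms_strict[OF pp(2)]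
 let ?g = "\<mu> o inv_into UNIV ka" and ?g' = "\<mu>' o inv_into UNIV ka'"
 have g: "?g permutes {..<p}" and g': "?g' permutes {..<q}"
 using ka by (auto intro: permutes_compose permutes_inv)
 have pp1: "pp i = rh (?g i)" if "i < p" for i
 proof -
 have j: "inv_into UNIV ka i < p" using permutes_in_image[OF permutes_inv[OF ka(1)], of i] that by simp
 show ?thesis
 using fun_cong[OF eq, of "inv_into UNIV ka i"] j by (simp add: perm_sum_def permutes_inverses[OF ka(1)])
 qed
 have pp2: "pp (p + i) = rh (p + ?g' i)" for i
 using fun_cong[OF eq, of "p + inv_into UNIV ka' i"] by (simp add: perm_sum_def permutes_inverses[OF ka(2)])
 have "strict_mono_on {..<p} ?g"
 proof (rule strict_mono_onI)
 fix i j assume ij: "i : {..<p}" "j : {..<p}" "i < j"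
 then have "rh (?g i) < rh (?g j)" using pp1 s_pp(2) by simp
 moreover have "?g i < p" using permutes_in_image[OF g, of i] ij by simp
 ultimately show "?g i < ?g j"
 using s_rh(2)[of "?g j" "?g i"] by (metis less_asym linorder_neqE_nat)
 qed
 then have gid: "?g = id" by (rule strict_mono_permutes_id[OF g])
 have "strict_mono_on {..<q} ?g'"
 proof (rule strict_mono_onI)
 fix i j assume ij: "i : {..<q}" "j : {..<q}" "i < j"
 then have "rh (p + ?g' i) < rh (p + ?g' j)" using pp2 s_pp(3) by simp
 moreover have "?g' i < q" using permutes_in_image[OF g', of i] ij by simp
 ultimately show "?g' i < ?g' j"
 using s_rh(3)[of "?g' j" "?g' i"] by (metis less_asym linorder_neqE_nat)
 qed
 then have gid': "?g' = id" by (rule strict_mono_permutes_id[OF g'])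
 have "?g o ka = \<mu>" "?g' o ka' = \<mu>'"
 using permutes_inverses(2)[OF ka(1)] permutes_inverses(2)[OF ka(2)] by (auto simp: fun_eq_iff)
 then show "ka = \<mu>" "ka' = \<mu>'" by (simp_all add: gid gid')
 show "pp = rh"
 proof
 fix x show "pp x = rh x"
 using pp1[of x] pp2[of "x - p"] gid gid' by (cases "x < p") auto
 qed
qed

text \<open>Sorting the values of \<open>rh\<close> on each block separately gives the shuffle; what
  remains permutes within the blocks.\<close>

lemma shuffle_decomposition_exists:
 assumes rh: "rh permutes {..<p + q}"
 obtains pp ka ka' where "pp : shuffle_perms p q" "ka permutes {..<p}" "ka' permutes {..<q}"
 "rh = pp o perm_sum p ka ka'"
proof -
 let ?A = "rh ` {..<p}" and ?B = "rh ` {p..<p + q}"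
 have inj: "inj rh" by (rule permutes_inj[OF rh])
 have AB: "?A \<inter> ?B = {}" "?A \<union> ?B = {..<p + q}"
 proof -
 show "?A \<inter> ?B = {}" using inj by (auto simp: inj_eq)
 have "{..<p} \<union> {p..<p + q} = {..<p + q}" by auto
 then show "?A \<union> ?B = {..<p + q}" by (simp only: image_Un[symmetric] permutes_image[OF rh])
 qed
 have cA: "card ?A = p" and cB: "card ?B = q"
 by (simp_all add: card_image inj_on_subset[OF inj])
 define a b where "a = sorted_list_of_set ?A" and "b = sorted_list_of_set ?B"
 have la: "length a = p" "length b = q" by (simp_all add: a_def b_def cA cB)
 have sa: "sorted_wrt (<) a" "sorted_wrt (<) b" "set a = ?A" "set b = ?B"
 by (simp_all add: a_def b_def)
 define pp where "pp = (%i. if i < p + q then (a @ b) ! i else i)"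
 have pp: "pp permutes {..<p + q}"
 proof (rule bij_imp_permutes)
 have "distinct (a @ b)" "set (a @ b) = {..<p + q}"
 by (simp_all only: distinct_append set_append sa(3,4) AB) (simp add: a_def b_def)
 then have "bij_betw ((!) (a @ b)) {..<p + q} {..<p + q}"
 by (intro bij_betw_nth) (simp_all only: la length_append)
 moreover have "bij_betw pp {..<p + q} {..<p + q} \<longleftrightarrow> bij_betw ((!) (a @ b)) {..<p + q} {..<p + q}"
 by (rule bij_betw_cong) (simp add: pp_def)
 ultimately show "bij_betw pp {..<p + q} {..<p + q}"
 by blast
 qed (simp add: pp_def)
 have sh: "pp : shuffle_perms p q"
 proof (rule shuffle_permsI[OF pp])
 show "pp i < pp j" if "i < j" "j < p" for i j
 using sorted_wrt_nth_less[OF sa(1) that(1)] that la by (simp add: pp_def nth_append)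
 show "pp (p + i) < pp (p + j)" if "i < j" "j < q" for i j
 using sorted_wrt_nth_less[OF sa(2) that(1)] that la by (simp add: pp_def nth_append)
 qed
 have imA: "pp ` {..<p} = ?A"
 proof -
 have "pp ` {..<p} = (!) a ` {..<p}"
 using la by (intro image_cong) (auto simp: pp_def nth_append)
 also have "... = set a"
 using nth_image[of p a] la by (simp add: atLeast0LessThan)
 finally show ?thesis by (simp only: sa(3))
 qed
 \<comment> \<open>The remaining permutation. It preserves the first block because \<open>pp\<close>
   and \<open>rh\<close> take the same set of values there.\<close>
 let ?s = "inv_into UNIV pp o rh"
 have s: "?s permutes {..<p + q}" by (rule permutes_compose[OF rh permutes_inv[OF pp]])
 have sless: "?s i < p" if "i < p" for i
 proof -
 have "rh i : pp ` {..<p}" using that imA by simp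
 then show ?thesis by (auto simp: permutes_inverses[OF pp])
 qed
 have im: "?s ` {..<p} = {..<p}"
 using sless by (intro endo_inj_surj) (auto intro: inj_on_subset[OF permutes_inj[OF s]])
 have sge: "p <= ?s i" if "p <= i" for i
 proof (rule ccontr)
 assume "~ p <= ?s i"
 then have "?s i : ?s ` {..<p}" using im by simp
 then obtain x where "x < p" "?s i = ?s x" by blast
 then show False using that injD[OF permutes_inj[OF s], of i x] by simp
 qed
 define ka where "ka = (%i. if i < p then ?s i else i)"
 define ka' where "ka' = (%i. ?s (p + i) - p)"
 have "ka permutes {..<p}"
 proof (rule bij_imp_permutes)
 have "bij_betw ?s {..<p} {..<p}" using im by (intro inj_imp_bij_betw permutes_inj[OF s]) simp
 moreover have "bij_betw ka {..<p} {..<p} \<longleftrightarrow> bij_betw ?s {..<p} {..<p}"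
 by (rule bij_betw_cong) (simp add: ka_def)
 ultimately show "bij_betw ka {..<p} {..<p}"
 by blast
 qed (simp add: ka_def)
 moreover have "ka' permutes {..<q}"
 proof (rule bij_imp_permutes)
 have "inj ka'"
 proof (rule injI)
 fix x y assume "ka' x = ka' y"
 then have "?s (p + x) = ?s (p + y)" using sge[of "p + x"] sge[of "p + y"] by (simp add: ka'_def)
 then show "x = y" using permutes_inj[OF s] by (metis add_left_cancel injD)
 qed
 moreover have "ka' ` {..<q} \<subseteq> {..<q}"
 proof (rule image_subsetI)
 fix x assume "x : {..<q}"
 then have "?s (p + x) < p + q" using permutes_in_image[OF s, of "p + x"] by simp
 then show "ka' x : {..<q}" using sge[of "p + x"] by (simp add: ka'_def)
 qed
 ultimately show "bij_betw ka' {..<q} {..<q}"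
 by (rule inj_imp_bij_betw)
 fix x assume "x \<notin> {..<q}"
 then show "ka' x = x" using permutes_not_in[OF s, of "p + x"] by (simp add: ka'_def)
 qed
 moreover have "rh = pp o perm_sum p ka ka'"
 proof
 fix x
 have "perm_sum p ka ka' x = ?s x"
 using sge[of x] by (auto simp: perm_sum_def ka_def ka'_def)
 then show "rh x = (pp o perm_sum p ka ka') x"
 by (simp add: permutes_inverses[OF pp])
 qed
 ultimately show ?thesis using sh by (intro that)
qed

section \<open>Exchange of two blocks\<close>

definition bswap :: "nat => nat => nat => nat" where
 "bswap p q i = (if i < q then p + i else if i < p + q then i - q else i)"

lemma bswap_permutes: "bswap p q permutes {..<p + q}"
 by (rule bij_imp_permutes) (auto simp: bswap_def intro!: bij_betwI[where g = "bswap q p"])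

text \<open>Passing from \<open>q\<close> to \<open>Suc q\<close> inserts the value \<open>p\<close>
  at place 0, which contributes the sign \<open>(- 1) ^ p\<close>.\<close>

lemma sign_bswap: "sign (bswap p q) = (- 1) ^ (p * q)"
proof (induction q)
 case 0
 have "bswap p 0 = id" by (auto simp: bswap_def)
 then show ?case by simp
next
 case (Suc q)
 have "bswap p (Suc q) = pins 0 p (bswap p q)"
 by (rule ext) (auto simp: bswap_def pins_def skip_def)
 then show ?case
 using sign_pins[OF bswap_permutes[of p q], of 0 p] Suc by (simp add: power_add)
qed

lemma bswap_inverse: "bswap p q (bswap q p i) = i"
 by (auto simp: bswap_def)

lemma shuffle_bswap:
 assumes "pp : shuffle_perms p q"
 shows "pp o bswap p q : shuffle_perms q p"
 and "sign (pp o bswap p q) = (- 1) ^ (p * q) * sign pp"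
proof -
 note s = shuffle_perms_strict[OF assms]
 have "pp o bswap p q permutes {..<q + p}"
 using permutes_compose[OF bswap_permutes s(1)] by (simp add: add.commute)
 then show "pp o bswap p q : shuffle_perms q p"
 using s(2,3) by (intro shuffle_permsI) (auto simp: bswap_def)
 show "sign (pp o bswap p q) = (- 1) ^ (p * q) * sign pp"
 by (simp add: sign_compose permutation_of_permutes[OF s(1)] permutation_of_permutes[OF bswap_permutes] sign_bswap)
qed

lemma bij_betw_shuffle_swap:
 "bij_betw (%pp. pp o bswap p q) (shuffle_perms p q) (shuffle_perms q p)"
 by (rule bij_betwI[where g = "%pp. pp o bswap q p"])
 (auto simp: shuffle_bswap(1)[unfolded o_def] o_def bswap_inverse)


text \<open>Shuffles of three blocks; both bracketings of a triple shuffle product are indexed by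
  them.\<close>

definition shuffle_perms3 :: "nat => nat => nat => (nat => nat) set" where
 "shuffle_perms3 p q s = {rh. rh permutes {..<p + q + s} & strict_mono_on {..<p} rh \<and>
 strict_mono_on {p..<p + q} rh & strict_mono_on {p + q..<p + q + s} rh}"

text \<open>Injectivity is the uniqueness of the shuffle decomposition. Conversely, the
  decomposition of a triple shuffle has an increasing, hence trivial, permutation on the last block
  and a shuffle on the first two.\<close>

lemma bij_betw_shuffle_perms3_left:
 "bij_betw (%(pp, ka). pp o perm_sum (p + q) ka id) (shuffle_perms (p + q) s \<times> shuffle_perms p q)
 (shuffle_perms3 p q s)"
 unfolding bij_betw_def
proof (intro conjI equalityI subsetI)
 show "inj_on (%(pp, ka). pp o perm_sum (p + q) ka id) (shuffle_perms (p + q) s \<times> shuffle_perms p q)"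
 proof (rule inj_onI, clarify)
 fix pp ka rh \<mu>
 assume "pp : shuffle_perms (p + q) s" "ka : shuffle_perms p q" "rh : shuffle_perms (p + q) s"
 "\<mu> : shuffle_perms p q" "pp o perm_sum (p + q) ka id = rh o perm_sum (p + q) \<mu> id"
 then show "pp = rh & ka = \<mu>"
 using shuffle_decomposition_unique[of pp "p + q" s rh ka id \<mu> id] shuffle_perms_strict(1) permutes_id by blast
 qed
next
 fix rh assume "rh : (%(pp, ka). pp o perm_sum (p + q) ka id) ` (shuffle_perms (p + q) s \<times> shuffle_perms p q)"
 then obtain pp ka where pp: "pp : shuffle_perms (p + q) s" and ka: "ka : shuffle_perms p q"
 and rh: "rh = pp o perm_sum (p + q) ka id" by auto
 note s = shuffle_perms_strict[OF pp] and k = shuffle_perms_strict[OF ka]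
 have kl: "ka i < p + q" if "i < p + q" for i using permutes_in_image[OF k(1), of i] that by simp
 have "strict_mono_on {..<p} ka" "strict_mono_on {p..<p + q} ka"
 using ka by (auto simp: shuffle_perms_def)
 moreover have "strict_mono_on {p + q..<p + q + s} pp"
 using pp by (auto simp: shuffle_perms_def)
 ultimately show "rh : shuffle_perms3 p q s"
 using permutes_compose[OF perm_sum_permutes[OF k(1) permutes_id] s(1)] s(2) kl
 by (auto simp: shuffle_perms3_def rh perm_sum_def strict_mono_on_def)
next
 fix rh assume rh: "rh : shuffle_perms3 p q s"
 then obtain pp ka ka' where pp: "pp : shuffle_perms (p + q) s" and ka: "ka permutes {..<p + q}" "ka' permutes {..<s}"
 and eq: "rh = pp o perm_sum (p + q) ka ka'"
 using shuffle_decomposition_exists[of rh "p + q" s] by (auto simp: shuffle_perms3_def)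
 note s = shuffle_perms_strict[OF pp]
 have kl: "ka i < p + q" if "i < p + q" for i using permutes_in_image[OF ka(1), of i] that by simp
 have kl': "ka' i < s" if "i < s" for i using permutes_in_image[OF ka(2), of i] that by simp
 have r: "rh i = pp (ka i)" if "i < p + q" for i using that by (simp add: eq perm_sum_def)
 have r': "rh (p + q + i) = pp (p + q + ka' i)" for i by (simp add: eq perm_sum_def)
 have mono: "ka i < ka j" if "rh i < rh j" "i < p + q" "j < p + q" for i j
 using that s(2)[of "ka j" "ka i"] kl[of i] unfolding r[OF that(2)] r[OF that(3)]
 by (metis less_asym linorder_neqE_nat)
 have "ka : shuffle_perms p q"
 using rh mono by (intro shuffle_permsI[OF ka(1)]) (auto simp: shuffle_perms3_def strict_mono_on_def)
 moreover have "strict_mono_on {..<s} ka'"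
 proof (rule strict_mono_onI)
 fix i j assume ij: "i : {..<s}" "j : {..<s}" "i < j"
 then have "rh (p + q + i) < rh (p + q + j)" using rh by (auto simp: shuffle_perms3_def strict_mono_on_def)
 then show "ka' i < ka' j"
 using s(3)[of "ka' j" "ka' i"] kl'[of i] ij unfolding r' by (metis lessThan_iff less_asym linorder_neqE_nat)
 qed
 then have "ka' = id" by (rule strict_mono_permutes_id[OF ka(2)])
 ultimately show "rh : (%(pp, ka). pp o perm_sum (p + q) ka id) ` (shuffle_perms (p + q) s \<times> shuffle_perms p q)"
 using pp eq by auto
qed

lemma bij_betw_shuffle_perms3_right:
 "bij_betw (%(pp, ka). pp o perm_sum p id ka) (shuffle_perms p (q + s) \<times> shuffle_perms q s)
 (shuffle_perms3 p q s)"
 unfolding bij_betw_def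
proof (intro conjI equalityI subsetI)
 show "inj_on (%(pp, ka). pp o perm_sum p id ka) (shuffle_perms p (q + s) \<times> shuffle_perms q s)"
 proof (rule inj_onI, clarify)
 fix pp ka rh \<mu>
 assume "pp : shuffle_perms p (q + s)" "ka : shuffle_perms q s" "rh : shuffle_perms p (q + s)"
 "\<mu> : shuffle_perms q s" "pp o perm_sum p id ka = rh o perm_sum p id \<mu>"
 then show "pp = rh & ka = \<mu>"
 using shuffle_decomposition_unique[of pp p "q + s" rh id ka id \<mu>] shuffle_perms_strict(1) permutes_id by blast
 qed
next
 fix rh assume "rh : (%(pp, ka). pp o perm_sum p id ka) ` (shuffle_perms p (q + s) \<times> shuffle_perms q s)"
 then obtain pp ka where pp: "pp : shuffle_perms p (q + s)" and ka: "ka : shuffle_perms q s"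
 and rh: "rh = pp o perm_sum p id ka" by auto
 note s = shuffle_perms_strict[OF pp] and k = shuffle_perms_strict[OF ka]
 have kl: "ka i < q + s" if "i < q + s" for i using permutes_in_image[OF k(1), of i] that by simp
 have r: "rh (p + i) = pp (p + ka i)" for i by (simp add: rh perm_sum_def)
 have "strict_mono_on {p..<p + q} rh"
 proof (rule strict_mono_onI)
 fix i j assume "i : {p..<p + q}" "j : {p..<p + q}" "i < j"
 then show "rh i < rh j" using r[of "i - p"] r[of "j - p"] s(3) k(2)[of "i - p" "j - p"] kl[of "j - p"] by simp
 qed
 moreover have "strict_mono_on {p + q..<p + q + s} rh"
 proof (rule strict_mono_onI)
 fix i j assume "i : {p + q..<p + q + s}" "j : {p + q..<p + q + s}" "i < j"
 then show "rh i < rh j" using r[of "i - p"] r[of "j - p"] s(3) k(3)[of "i - p - q" "j - p - q"] kl[of "j - p"] by simp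
 qed
 moreover have "strict_mono_on {..<p} rh"
 using s(2) by (auto simp: rh perm_sum_def strict_mono_on_def)
 ultimately show "rh : shuffle_perms3 p q s"
 using permutes_compose[OF perm_sum_permutes[OF permutes_id k(1)] s(1)]
 by (simp add: shuffle_perms3_def rh add.assoc)
next
 fix rh assume rh: "rh : shuffle_perms3 p q s"
 then obtain pp ka ka' where pp: "pp : shuffle_perms p (q + s)" and ka: "ka permutes {..<p}" "ka' permutes {..<q + s}"
 and eq: "rh = pp o perm_sum p ka ka'"
 using shuffle_decomposition_exists[of rh p "q + s"] by (auto simp: shuffle_perms3_def add.assoc)
 note s = shuffle_perms_strict[OF pp]
 have kl: "ka i < p" if "i < p" for i using permutes_in_image[OF ka(1), of i] that by simp
 have kl': "ka' i < q + s" if "i < q + s" for i using permutes_in_image[OF ka(2), of i] that by simp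
 have r: "rh i = pp (ka i)" if "i < p" for i using that by (simp add: eq perm_sum_def)
 have r': "rh (p + i) = pp (p + ka' i)" for i by (simp add: eq perm_sum_def)
 have mono: "ka' i < ka' j" if "rh (p + i) < rh (p + j)" "i < q + s" "j < q + s" for i j
 using that s(3)[of "ka' j" "ka' i"] kl'[of i] unfolding r' by (metis less_asym linorder_neqE_nat)
 have "ka' : shuffle_perms q s"
 using rh mono by (intro shuffle_permsI[OF ka(2)]) (auto simp: shuffle_perms3_def strict_mono_on_def add.assoc)
 moreover have "strict_mono_on {..<p} ka"
 proof (rule strict_mono_onI)
 fix i j assume ij: "i : {..<p}" "j : {..<p}" "i < j"
 then have "pp (ka i) < pp (ka j)" using rh r by (auto simp: shuffle_perms3_def strict_mono_on_def)
 then show "ka i < ka j"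
 using s(2)[of "ka j" "ka i"] kl[of i] ij by (metis lessThan_iff less_asym linorder_neqE_nat)
 qed
 then have "ka = id" by (rule strict_mono_permutes_id[OF ka(1)])
 ultimately show "rh : (%(pp, ka). pp o perm_sum p id ka) ` (shuffle_perms p (q + s) \<times> shuffle_perms q s)"
 using pp eq by auto
qed

section \<open>The simplicial model\<close>

text \<open>
 A point \<open>t\<close> of the standard simplex is determined by the decreasing sequence of its upper sums
 \<open>crd n t 0 >= ... >= crd n t (n - 1)\<close>. In these coordinates a degeneracy forgets a coordinate,
 so that a shuffle distributes the coordinates to the two factors, and a face
 repeats a coordinate or inserts 1 at the front or 0 at the end.
\<close>

definition crd :: "nat => point => point" where
 "crd n t k = (\<Sum>j\<in>{Suc k..n}. t j)"

text \<open>Inverse to \<open>crd\<close> on the simplex: the successive differences of the sequence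
  1, \<open>x 0\<close>, ..., \<open>x (p - 1)\<close>, 0.\<close>

definition dfs :: "nat => point => point" where
 "dfs p x j = (if j <= p then (if j = 0 then 1 else x (j - 1)) - (if j < p then x j else 0) else 0)"

lemma dfs_cong: "(!!m. m < p ==> x m = y m) ==> dfs p x = dfs p y"
 by (rule ext) (auto simp: dfs_def)

lemma crd_dfs:
 assumes "k < p"
 shows "crd p (dfs p x) k = x k"
proof -
 let ?y = "%j. if j < p then x j else 0"
 have "crd p (dfs p x) k = (\<Sum>j\<in>{Suc k..p}. - (?y j - ?y (j - 1)))"
 unfolding crd_def by (intro sum.cong) (auto simp: dfs_def)
 also have "... = - (?y p - ?y k)"
 unfolding sum_negf using assms by (subst sum_telescope'') auto
 finally show ?thesis using assms by simp
qed

lemma crd_eq_0: "n <= k ==> crd n t k = 0"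
 by (simp add: crd_def)

lemma crd_step: "k < n ==> crd n t k = t (Suc k) + crd n t (Suc k)"
 by (simp add: crd_def sum.atLeast_Suc_atMost)

lemma simplex_crd_0:
 assumes "t : splx n"
 shows "t 0 + crd n t 0 = 1"
proof -
 have "(\<Sum>j\<le>n. t j) = t 0 + (\<Sum>j\<in>{Suc 0..n}. t j)"
 by (simp add: sum.atMost_shift sum.atLeast_Suc_atMost atMost_atLeast0)
 then show ?thesis
 using assms by (simp add: standard_simplex_def crd_def)
qed

lemma dfs_crd:
 assumes "t : splx n"
 shows "dfs n (crd n t) = t"
proof
 fix j
 have "t j = 0" if "j > n" using assms that by (simp add: standard_simplex_def)
 then show "dfs n (crd n t) j = t j"
 using simplex_crd_0[OF assms] crd_step[of "j - 1" n t] crd_eq_0[of n j t]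
 by (auto simp: dfs_def)
qed

lemma simplex_eqI:
 assumes "s : splx p" "t : splx p" "!!k. k < p ==> crd p s k = crd p t k"
 shows "s = t"
 using dfs_crd[OF assms(1)] dfs_crd[OF assms(2)] dfs_cong[of p "crd p s" "crd p t"] assms(3) by metis

lemma crd_antimono:
 assumes "t : splx n" "k <= l"
 shows "crd n t l <= crd n t k"
 using assms unfolding crd_def by (intro sum_mono2) (auto simp: standard_simplex_def)

lemma crd_bounds:
 assumes "t : splx n"
 shows "0 <= crd n t k" "crd n t k <= 1"
proof -
 show "0 <= crd n t k"
 using assms unfolding crd_def by (intro sum_nonneg) (auto simp: standard_simplex_def)
 have "crd n t k <= crd n t 0" by (rule crd_antimono[OF assms]) simp
 also have "... <= 1" using simplex_crd_0[OF assms] assms by (simp add: standard_simplex_def) (metis add.commute le_add_same_cancel1)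
 finally show "crd n t k <= 1" .
qed

lemma dfs_in_simplex:
 assumes b: "!!k. k < p ==> 0 <= x k" "!!k. k < p ==> x k <= 1"
 and mono: "!!k. Suc k < p ==> x (Suc k) <= x k"
 shows "dfs p x : splx p"
proof -
 have nn: "0 <= dfs p x j" for j
 proof (cases j)
 case (Suc i)
 then show ?thesis using b(1)[of i] mono[of i] by (auto simp: dfs_def)
 qed (use b(2)[of 0] in \<open>auto simp: dfs_def\<close>)
 have one: "(\<Sum>j\<le>p. dfs p x j) = 1"
 proof -
 have "(\<Sum>j\<le>p. dfs p x j) = dfs p x 0 + crd p (dfs p x) 0"
 unfolding crd_def by (metis One_nat_def atLeast0AtMost sum.atLeast_Suc_atMost zero_le)
 then show ?thesis
 by (cases "p = 0") (simp_all add: crd_dfs crd_eq_0 dfs_def)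
 qed
 have "dfs p x j <= 1" for j
 proof (cases "j <= p")
 case True
 then have "dfs p x j <= (\<Sum>j\<le>p. dfs p x j)" by (intro member_le_sum nn) auto
 then show ?thesis by (simp add: one)
 qed (simp add: dfs_def)
 then show ?thesis
 using nn one by (auto simp: standard_simplex_def dfs_def)
qed

text \<open>In the sums with \<open>m < k\<close> the zero put in at \<open>k\<close> only shifts
  the later terms; in the others the starting point is shifted by one as well. For
  \<open>m = 0\<close> the latter is the full sum 1.\<close>

lemma crd_face:
 assumes "1 <= n" "k <= n" "m < n" "t : splx (n - 1)"
 shows "crd n (simplical_face k t) m =
 (if m < k then crd (n - 1) t m else if m = 0 then 1 else crd (n - 1) t (m - 1))"
proof -
 have f: "simplical_face k t (skip k i) = t i" "simplical_face k t k = 0" for i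
 by (auto simp: simplical_face_def skip_def)
 have red: "(\<Sum>i\<in>skip k ` B. simplical_face k t i) = (\<Sum>i\<in>B. t i)" for B
 by (subst sum.reindex) (auto simp: inj_on_def f)
 have "crd n (simplical_face k t) m = (\<Sum>i\<in>{Suc m..n} - {k}. simplical_face k t i)"
 unfolding crd_def by (rule sum.mono_neutral_right) (auto simp: f)
 also have "{Suc m..n} - {k} = skip k ` (if m < k then {Suc m..n - 1} else {m..n - 1})"
 proof (intro equalityI subsetI)
 fix i assume i: "i : {Suc m..n} - {k}"
 then obtain y where "i = skip k y" by (cases i k rule: skip_cases) auto
 with i show "i : skip k ` (if m < k then {Suc m..n - 1} else {m..n - 1})"
 using assms(2) by (auto simp: skip_def split: if_splits)
 qed (use assms in \<open>auto simp: skip_def split: if_splits\<close>)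
 also have "(\<Sum>i\<in>.... simplical_face k t i) = (\<Sum>i\<in>(if m < k then {Suc m..n - 1} else {m..n - 1}). t i)"
 by (rule red)
 also have "... = (if m < k then crd (n - 1) t m else if m = 0 then 1 else crd (n - 1) t (m - 1))"
 using assms(4) by (auto simp: crd_def standard_simplex_def atMost_atLeast0)
 finally show ?thesis .
qed

lemma collapse_map_in_simplex:
 assumes "j <= p" "y : splx (Suc p)"
 shows "collapse_map j y : splx p"
 and "m < p ==> crd p (collapse_map j y) m = crd (Suc p) y (skip j m)"
proof -
 \<comment> \<open>A sum of collapsed coordinates is a sum over the preimage of the index set, in
   which \<open>j\<close> stands for both \<open>j\<close> and \<open>Suc j\<close>.\<close>
 have sum_eq: "(\<Sum>i\<in>A. collapse_map j y i) = (\<Sum>i\<in>B. y i)"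
 if "finite A" "B = skip (Suc j) ` A \<union> (if j : A then {Suc j} else {})" for A B
 proof -
 have "(\<Sum>i\<in>A. collapse_map j y i) = (\<Sum>i\<in>A. y (skip (Suc j) i) + (if i = j then y (Suc j) else 0))"
 by (intro sum.cong) (auto simp: collapse_map_def skip_def)
 also have "... = (\<Sum>i\<in>skip (Suc j) ` A. y i) + (if j : A then y (Suc j) else 0)"
 using that(1) by (simp add: sum.distrib sum.reindex inj_on_def)
 also have "... = (\<Sum>i\<in>B. y i)"
 proof -
 have "Suc j \<notin> skip (Suc j) ` A" by (auto simp: skip_def image_iff)
 then show ?thesis using that by (auto simp: add.commute)
 qed
 finally show ?thesis .
 qed
 have B: "{..Suc p} = skip (Suc j) ` {..p} \<union> (if j : {..p} then {Suc j} else {})"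
 proof (intro equalityI subsetI)
 fix i assume "i : {..Suc p}"
 then show "i : skip (Suc j) ` {..p} \<union> (if j : {..p} then {Suc j} else {})"
 using assms(1) by (cases i "Suc j" rule: skip_cases) (auto simp: skip_def split: if_splits)
 qed (use assms(1) in \<open>auto simp: skip_def split: if_splits\<close>)
 have one: "(\<Sum>i\<le>p. collapse_map j y i) = 1"
 using sum_eq[OF _ B] assms(2) by (simp add: standard_simplex_def)
 have y: "0 <= y i" "i > Suc p ==> y i = 0" for i using assms(2) by (auto simp: standard_simplex_def)
 have nn: "0 <= collapse_map j y i" for i using y(1) by (auto simp: collapse_map_def)
 have zero: "collapse_map j y i = 0" if "i > p" for i
 using that assms(1) y(2)[of "Suc i"] by (auto simp: collapse_map_def)
 have "collapse_map j y i <= 1" for i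
 proof (cases "i <= p")
 case True
 then have "collapse_map j y i <= (\<Sum>i\<le>p. collapse_map j y i)" by (intro member_le_sum nn) auto
 then show ?thesis by (simp add: one)
 qed (simp add: zero)
 then show "collapse_map j y : splx p"
 using nn zero one by (auto simp: standard_simplex_def)
 assume m: "m < p"
 have "{Suc (skip j m)..Suc p} = skip (Suc j) ` {Suc m..p} \<union> (if j : {Suc m..p} then {Suc j} else {})"
 proof (intro equalityI subsetI)
 fix i assume "i : {Suc (skip j m)..Suc p}"
 then show "i : skip (Suc j) ` {Suc m..p} \<union> (if j : {Suc m..p} then {Suc j} else {})"
 using assms(1) by (cases i "Suc j" rule: skip_cases) (auto simp: skip_def split: if_splits)
 qed (use assms(1) m in \<open>auto simp: skip_def split: if_splits\<close>)
 then show "crd p (collapse_map j y) m = crd (Suc p) y (skip j m)"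
 unfolding crd_def by (intro sum_eq) simp_all
qed

text \<open>For increasing \<open>e\<close>, the iterated degeneracy that forgets all coordinates
  outside the values of \<open>e\<close> on \<open>{..<p}\<close>. A subsequence of a decreasing
  sequence is decreasing, which keeps the point in the simplex.\<close>

definition block_map :: "nat => nat => (nat => nat) => point => point" where
 "block_map n p e t = dfs p (%m. crd n t (e m))"

lemma block_map_cong: "(!!m. m < p ==> e m = e' m) ==> block_map n p e = block_map n p e'"
 by (rule ext) (auto simp: block_map_def intro: dfs_cong)

lemma crd_block_map: "m < p ==> crd p (block_map n p e t) m = crd n t (e m)"
 by (simp add: block_map_def crd_dfs)

lemma block_map_in_simplex:
 assumes "t : splx n" "!!i j. i < j ==> j < p ==> e i < e j"
 shows "block_map n p e t : splx p"
 unfolding block_map_def using assms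
 by (intro dfs_in_simplex crd_bounds crd_antimono) (auto intro: less_imp_le)

lemma block_map_continuous:
 assumes "!!i j. i < j ==> j < p ==> e i < e j"
 shows "continuous_map (rsub (splx n)) (rsub (splx p)) (block_map n p e)"
proof -
 have "continuous_map (powertop_real UNIV) euclideanreal (%t. crd n t k)" for k
 unfolding crd_def by (intro continuous_map_sum continuous_map_product_projection) auto
 then have "continuous_map (powertop_real UNIV) euclideanreal (%t. block_map n p e t j)" for j
 unfolding block_map_def dfs_def
 by (cases "j <= p"; cases "j = 0"; cases "j < p")
 (auto intro!: continuous_map_diff continuous_map_minus)
 then show ?thesis
 using block_map_in_simplex[OF _ assms]
 by (auto simp: continuous_map_in_subtopology continuous_map_componentwise_UNIV
 intro: continuous_map_from_subtopology)
qed

lemma block_map_block_map: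
 "(!!m. m < q ==> f m < p) ==> block_map p q f (block_map n p e t) = block_map n q (%m. e (f m)) t"
 unfolding block_map_def by (rule dfs_cong) (simp add: crd_dfs)

lemma block_map_id: "t : splx n ==> block_map n n (%m. m) t = t"
 by (simp add: block_map_def dfs_crd)

definition shuffle_map :: "nat => nat => (nat => nat) => point => point \<times> point" where
 "shuffle_map p q pp t = (block_map (p + q) p pp t, block_map (p + q) q (%m. pp (p + m)) t)"

definition simp_bd :: "nat => point chain" where
 "simp_bd p = chain_boundary p (universal (splx p))"

text \<open>The Eilenberg-Zilber triangulation of the product of two simplices.\<close>

definition simp_pr :: "nat => nat => (point \<times> point) chain" where
 "simp_pr p q = (\<Sum>pp\<in>shuffle_perms p q.
 frag_cmul (sign pp) (frag_of (restrict (shuffle_map p q pp) (splx (p + q)))))"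

lemma chains_on_simplex: "x : chains_on (splx n) X \<longleftrightarrow> singular_chain n X x"
 by (auto simp: chains_on_def maps_on_def singular_chain_def singular_simplex_def)

lemma push_simplex: "push (splx n) f x = chain_map n f x"
 by (simp add: push_def chain_map_def simplex_map_def o_def)

lemma simp_bd_eq:
 "1 <= p ==> simp_bd p = (\<Sum>k\<le>p. frag_cmul ((- 1) ^ k)
 (frag_of (restrict (simplical_face k) (splx (p - 1)))))"
 unfolding simp_bd_def universal_def chain_boundary_of
 by (auto simp: singular_face_def o_def intro!: sum.cong arg_cong[of _ _ "frag_cmul _"]
 arg_cong[of _ _ frag_of] restrict_ext)
 (simp add: simplical_face_in_standard_simplex)

lemma nop_simp_bd: "nop (splx (p - 1)) (simp_bd p) x = chain_boundary p x"
proof (cases "p = 0")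
 case True
 then show ?thesis by (simp add: simp_bd_def chain_boundary_def)
next
 case False
 then have p: "1 <= p" by simp
 show ?thesis
 proof (induction x rule: frag_induct)
 case (one c)
 have "restrict (c o restrict (simplical_face k) (splx (p - 1))) (splx (p - 1)) =
 singular_face p k c" for k
 by (auto simp: singular_face_def)
 then show ?case
 using p by (simp add: nop_of simp_bd_eq[OF p] push_sum push_cmul chain_boundary_of)
 qed (simp_all add: nop_diff chain_boundary_diff)
qed

lemma simp_bd_in: "simp_bd p : chains_on (splx (p - 1)) (rsub (splx p))"
 using singular_chain_boundary[of p "rsub (splx p)" "universal (splx p)"]
 universal_in_chains[of "splx p"]
 by (simp add: simp_bd_def chains_on_simplex)

lemma shuffle_map_continuous:
 assumes "pp : shuffle_perms p q"
 shows "continuous_map (rsub (splx (p + q)))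
 (prod_topology (rsub (splx p)) (rsub (splx q))) (shuffle_map p q pp)"
 unfolding shuffle_map_def
 by (intro continuous_map_pairedI block_map_continuous shuffle_perms_strict[OF assms]; assumption)

lemma simp_pr_in:
 "simp_pr p q : chains_on (splx (p + q)) (prod_topology (rsub (splx p)) (rsub (splx q)))"
 unfolding simp_pr_def by (intro chains_sum chains_cmul) (simp add: maps_on_restrict shuffle_map_continuous)

text \<open>Composition with the exchange of blocks is a bijection between the two sets of shuffles
  and multiplies every sign by \<open>(- 1) ^ (p * q)\<close>, so commutativity is strict
  here.\<close>

lemma simp_pr_swap: "push (splx (p + q)) prod.swap (simp_pr p q) = frag_cmul ((- 1) ^ (p * q)) (simp_pr q p)"
proof -
 have "push (splx (p + q)) prod.swap (simp_pr p q) = (\<Sum>pp\<in>shuffle_perms p q.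
 frag_cmul ((- 1) ^ (p * q) * sign (pp o bswap p q))
 (frag_of (restrict (shuffle_map q p (pp o bswap p q)) (splx (q + p)))))"
 unfolding simp_pr_def push_sum push_cmul push_of
 proof (intro sum.cong refl arg_cong2[of _ _ _ _ frag_cmul] arg_cong[of _ _ frag_of])
 fix pp assume pp: "pp : shuffle_perms p q"
 have "(- 1 :: int) ^ (p * q) * (- 1) ^ (p * q) = 1"
 by (simp flip: power_mult_distrib)
 then show "sign pp = (- 1) ^ (p * q) * sign (pp o bswap p q)"
 using shuffle_bswap(2)[OF pp] by (simp add: mult.assoc[symmetric])
 have "block_map (q + p) q (pp o bswap p q) = block_map (q + p) q (%m. pp (p + m))"
 "block_map (q + p) p (%m. (pp o bswap p q) (q + m)) = block_map (q + p) p pp"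
 by (rule block_map_cong; simp add: bswap_def)+
 then show "restrict (prod.swap o restrict (shuffle_map p q pp) (splx (p + q))) (splx (p + q)) =
 restrict (shuffle_map q p (pp o bswap p q)) (splx (q + p))"
 by (auto simp: restrict_def shuffle_map_def add.commute)
 qed
 also have "... = (\<Sum>pp\<in>shuffle_perms q p. frag_cmul ((- 1) ^ (p * q) * sign pp)
 (frag_of (restrict (shuffle_map q p pp) (splx (q + p)))))"
 by (rule sum.reindex_bij_betw[OF bij_betw_shuffle_swap, of "%pp. frag_cmul ((- 1) ^ (p * q) * sign pp)
 (frag_of (restrict (shuffle_map q p pp) (splx (q + p))))"])
 finally show ?thesis
 by (simp add: simp_pr_def frag_cmul_sum)
qed

text \<open>Both bracketings equal the same sum over shuffles of three blocks.\<close>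

lemma simp_pr_assoc:
 "push (splx (p + q + s)) (%((a, b), c). (a, (b, c)))
 (nop2 (splx (p + q + s)) (simp_pr (p + q) s) (simp_pr p q) (universal (splx s))) =
 nop2 (splx (p + q + s)) (simp_pr p (q + s)) (universal (splx p)) (simp_pr q s)"
proof -
 let ?n = "p + q + s" and ?D = "splx (p + q + s)"
 define H where "H = (%rh t. (block_map ?n p rh t, block_map ?n q (%m. rh (p + m)) t, block_map ?n s (%m. rh (p + q + m)) t))"
 let ?S = "\<Sum>rh\<in>shuffle_perms3 p q s. frag_cmul (sign rh) (frag_of (restrict (H rh) ?D))"
 have "push ?D (%((a, b), c). (a, (b, c))) (nop2 ?D (simp_pr (p + q) s) (simp_pr p q) (universal (splx s))) =
 (\<Sum>ka\<in>shuffle_perms p q. \<Sum>pp\<in>shuffle_perms (p + q) s.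
 frag_cmul (sign (pp o perm_sum (p + q) ka id)) (frag_of (restrict (H (pp o perm_sum (p + q) ka id)) ?D)))"
 unfolding simp_pr_def[of p q] universal_def nop2_sum_left nop2_cmul_left nop2_of simp_pr_def[of "p + q" s]
 push_sum push_cmul push_of frag_cmul_sum frag_cmul_cmul
 proof (intro sum.cong refl arg_cong2[of _ _ _ _ frag_cmul] arg_cong[of _ _ frag_of])
 fix ka pp assume ka: "ka : shuffle_perms p q" and pp: "pp : shuffle_perms (p + q) s"
 note k = shuffle_perms_strict[OF ka] and r = shuffle_perms_strict[OF pp]
 have kl: "ka i < p + q" if "i < p + q" for i using permutes_in_image[OF k(1), of i] that by simp
 show "sign ka * sign pp = sign (pp o perm_sum (p + q) ka id)"
 using sign_perm_sum[OF k(1) permutes_id]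
 by (simp add: sign_compose permutation_of_permutes[OF r(1)] permutation_of_permutes[OF perm_sum_permutes[OF k(1) permutes_id, of s]])
 show "restrict ((%((a, b), c). (a, (b, c))) o restrict (map_prod (restrict (shuffle_map p q ka) (splx (p + q)))
 (restrict id (splx s)) o restrict (shuffle_map (p + q) s pp) ?D) ?D) ?D =
 restrict (H (pp o perm_sum (p + q) ka id)) ?D"
 proof (rule restrict_ext)
 fix t assume t: "t : ?D"
 have 1: "block_map ?n (p + q) pp t : splx (p + q)"
 "block_map ?n s (%m. pp (p + q + m)) t : splx s"
 using t r(2,3) by (intro block_map_in_simplex; simp)+
 have 2: "block_map (p + q) p ka (block_map ?n (p + q) pp t) = block_map ?n p (pp o perm_sum (p + q) ka id) t"
 "block_map (p + q) q (%m. ka (p + m)) (block_map ?n (p + q) pp t) =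
 block_map ?n q (%m. (pp o perm_sum (p + q) ka id) (p + m)) t"
 "block_map ?n s (%m. pp (p + q + m)) = block_map ?n s (%m. (pp o perm_sum (p + q) ka id) (p + q + m))"
 using kl by (auto simp: block_map_block_map perm_sum_def intro!: block_map_cong[THEN fun_cong] block_map_cong)
 show "((%((a, b), c). (a, (b, c))) o restrict (map_prod (restrict (shuffle_map p q ka) (splx (p + q)))
 (restrict id (splx s)) o restrict (shuffle_map (p + q) s pp) ?D) ?D) t = H (pp o perm_sum (p + q) ka id) t"
 using t 1 by (simp add: shuffle_map_def H_def 2)
 qed
 qed
 also have "... = (\<Sum>(pp, ka)\<in>shuffle_perms (p + q) s \<times> shuffle_perms p q.
 frag_cmul (sign (pp o perm_sum (p + q) ka id)) (frag_of (restrict (H (pp o perm_sum (p + q) ka id)) ?D)))"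
 by (subst sum.swap) (rule sum.cartesian_product)
 also have "... = ?S"
 by (subst sum.reindex_bij_betw[OF bij_betw_shuffle_perms3_left, symmetric]) (simp add: case_prod_unfold)
 finally have left: "push ?D (%((a, b), c). (a, (b, c))) (nop2 ?D (simp_pr (p + q) s) (simp_pr p q) (universal (splx s))) = ?S" .
 have D': "splx (p + (q + s)) = ?D" by (simp add: add.assoc)
 have "nop2 ?D (simp_pr p (q + s)) (universal (splx p)) (simp_pr q s) =
 (\<Sum>ka\<in>shuffle_perms q s. \<Sum>pp\<in>shuffle_perms p (q + s).
 frag_cmul (sign (pp o perm_sum p id ka)) (frag_of (restrict (H (pp o perm_sum p id ka)) ?D)))"
 unfolding simp_pr_def[of q s] universal_def nop2_sum_right nop2_cmul_right nop2_of simp_pr_def[of p "q + s"]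
 push_sum push_cmul push_of frag_cmul_sum frag_cmul_cmul
 proof (intro sum.cong refl arg_cong2[of _ _ _ _ frag_cmul] arg_cong[of _ _ frag_of])
 fix ka pp assume ka: "ka : shuffle_perms q s" and pp: "pp : shuffle_perms p (q + s)"
 note k = shuffle_perms_strict[OF ka] and r = shuffle_perms_strict[OF pp]
 have kl: "ka i < q + s" if "i < q + s" for i using permutes_in_image[OF k(1), of i] that by simp
 show "sign ka * sign pp = sign (pp o perm_sum p id ka)"
 using sign_perm_sum[OF permutes_id k(1)]
 by (simp add: sign_compose permutation_of_permutes[OF r(1)] permutation_of_permutes[OF perm_sum_permutes[OF permutes_id k(1), of p]])
 show "restrict (map_prod (restrict id (splx p)) (restrict (shuffle_map q s ka) (splx (q + s)))
 o restrict (shuffle_map p (q + s) pp) (splx (p + (q + s)))) ?D =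
 restrict (H (pp o perm_sum p id ka)) ?D"
 proof (rule restrict_ext)
 fix t assume t: "t : ?D"
 have 1: "block_map ?n p pp t : splx p"
 "block_map ?n (q + s) (%m. pp (p + m)) t : splx (q + s)"
 using t r(2,3) by (intro block_map_in_simplex; simp)+
 have 2: "block_map (q + s) q ka (block_map ?n (q + s) (%m. pp (p + m)) t) =
 block_map ?n q (%m. (pp o perm_sum p id ka) (p + m)) t"
 "block_map (q + s) s (%m. ka (q + m)) (block_map ?n (q + s) (%m. pp (p + m)) t) =
 block_map ?n s (%m. (pp o perm_sum p id ka) (p + q + m)) t"
 "block_map ?n p pp = block_map ?n p (pp o perm_sum p id ka)"
 using kl by (auto simp: block_map_block_map perm_sum_def intro!: block_map_cong[THEN fun_cong] block_map_cong)
 show "(map_prod (restrict id (splx p)) (restrict (shuffle_map q s ka) (splx (q + s)))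
 o restrict (shuffle_map p (q + s) pp) (splx (p + (q + s)))) t = H (pp o perm_sum p id ka) t"
 using t 1 by (simp add: shuffle_map_def H_def 2 D' add.assoc[symmetric])
 qed
 qed
 also have "... = (\<Sum>(pp, ka)\<in>shuffle_perms p (q + s) \<times> shuffle_perms q s.
 frag_cmul (sign (pp o perm_sum p id ka)) (frag_of (restrict (H (pp o perm_sum p id ka)) ?D)))"
 by (subst sum.swap) (rule sum.cartesian_product)
 also have "... = ?S"
 by (subst sum.reindex_bij_betw[OF bij_betw_shuffle_perms3_right, symmetric]) (simp add: case_prod_unfold)
 finally show ?thesis
 unfolding left ..
qed


subsection \<open>The boundary of a shuffle product\<close>

text \<open>
 The faces of a shuffle are indexed by the shuffle and the position of the face. The two
 coordinates next to the position belong to different factors, and then the term cancels against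
 the one in which they are exchanged, or to the same factor.
\<close>

definition face_first :: "nat => nat => (nat => nat) => nat => bool" where
 "face_first p q pp k \<longleftrightarrow> (k = 0 \<or> k - 1 : pp ` {..<p}) & (k = p + q \<or> k : pp ` {..<p})"

definition face_second :: "nat => nat => (nat => nat) => nat => bool" where
 "face_second p q pp k \<longleftrightarrow> (k = 0 \<or> k - 1 : pp ` {p..<p + q}) & (k = p + q \<or> k : pp ` {p..<p + q})"

definition shuffle_face :: "nat => nat => (nat => nat) => nat => point => point \<times> point" where
 "shuffle_face p q pp k = (\<lambda>t\<in>splx (p + q - 1). shuffle_map p q pp (simplical_face k t))"

abbreviation sface_term :: "nat => nat => (nat => nat) \<times> nat => (point \<times> point) chain" where
 "sface_term p q x \<equiv> frag_cmul (sign (fst x) * (- 1) ^ snd x) (frag_of (shuffle_face p q (fst x) (snd x)))"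

abbreviation shuffle_faces :: "nat => nat => ((nat => nat) \<times> nat) set" where
 "shuffle_faces p q \<equiv> shuffle_perms p q \<times> {..p + q}"

text \<open>On an inner face the coordinates \<open>k - 1\<close> and \<open>k\<close> agree, so
  exchanging them does not change the face. As they belong to different factors, both blocks stay
  increasing.\<close>

lemma shuffle_face_mixed:
 assumes pp: "pp : shuffle_perms p q" and k: "0 < k" "k < p + q"
 and mixed: "k - 1 : pp ` {..<p} \<longleftrightarrow> k \<notin> pp ` {..<p}"
 shows "Transposition.transpose (k - 1) k o pp : shuffle_perms p q"
 and "shuffle_face p q (Transposition.transpose (k - 1) k o pp) k = shuffle_face p q pp k"
proof -
 note s = shuffle_perms_strict[OF pp]
 let ?ta = "Transposition.transpose (k - 1) k"
 have ta: "?ta permutes {..<p + q}" using k by (intro permutes_swap_id) auto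
 have mono: "?ta a < ?ta b" if "a < b" "~ (a = k - 1 & b = k)" for a b
 using that k by (auto simp: Transposition.transpose_def)
 have first: "pp i : pp ` {..<p} \<longleftrightarrow> i < p" for i
 using permutes_inj[OF s(1)] by (auto simp: inj_eq image_iff)
 have no: "~ (pp i = k - 1 & pp j = k)" if "i < p \<longleftrightarrow> j < p" for i j
 using mixed first[of i] first[of j] that by metis
 show "?ta o pp : shuffle_perms p q"
 proof (rule shuffle_permsI[OF permutes_compose[OF s(1) ta]])
 show "(?ta o pp) i < (?ta o pp) j" if "i < j" "j < p" for i j
 unfolding o_apply using s(2)[OF that] no[of i j] that by (intro mono) auto
 show "(?ta o pp) (p + i) < (?ta o pp) (p + j)" if "i < j" "j < q" for i j
 unfolding o_apply using s(3)[OF that] no[of "p + i" "p + j"] that by (intro mono) auto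
 qed
 have "crd (p + q) (simplical_face k t) (?ta m) = crd (p + q) (simplical_face k t) m"
 if "t : splx (p + q - 1)" for t m
 proof -
 have "crd (p + q) (simplical_face k t) (k - 1) = crd (p + q) (simplical_face k t) k"
 using k that by (subst (1 2) crd_face) auto
 then show ?thesis by (auto simp: Transposition.transpose_def)
 qed
 then show "shuffle_face p q (?ta o pp) k = shuffle_face p q pp k"
 unfolding shuffle_face_def shuffle_map_def block_map_def by (intro restrict_ext) simp
qed

text \<open>The coordinate of the product that has to be added so that its face restricts to the
  \<open>i\<close>-th face of the first factor: in front for \<open>i = 0\<close>, at the end for
  \<open>i = Suc p\<close>, otherwise right behind the coordinate that the face repeats.\<close>

definition ipos :: "nat => nat => (nat => nat) => nat => nat" where
 "ipos p q pp i = (if i = Suc p then p + q else if i = 0 then 0 else Suc (pp (i - 1)))"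

text \<open>In general the face has the index of the added coordinate. For the last face the added
  coordinate is \<open>p + q\<close>, whereas the face has the index
  \<open>Suc (p + q)\<close>.\<close>

definition insert_face :: "nat => nat => (nat => nat) \<times> nat => (nat => nat) \<times> nat" where
 "insert_face p q = (%(pp, i). (pins (min i p) (ipos p q pp i) pp,
 if i = Suc p then Suc (p + q) else ipos p q pp i))"

lemma ipos_le:
 assumes "pp : shuffle_perms p q" "i <= Suc p"
 shows "ipos p q pp i <= p + q"
 using permutes_in_image[OF shuffle_perms_strict(1)[OF assms(1)], of "i - 1"] assms(2)
 by (auto simp: ipos_def)

lemma insert_face_shuffle:
 assumes pp: "pp : shuffle_perms p q" and i: "i <= Suc p"
 defines "k \<equiv> ipos p q pp i"
 shows "pins (min i p) k pp : shuffle_perms (Suc p) q"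
 and "face_first (Suc p) q (pins (min i p) k pp) (if i = Suc p then Suc (p + q) else k)"
proof -
 note s = shuffle_perms_strict[OF pp]
 let ?c = "min i p" and ?rh = "pins (min i p) k pp"
 have k: "k <= p + q" unfolding k_def by (rule ipos_le[OF pp i])
 have less: "pp a < p + q" if "a < p + q" for a using permutes_in_image[OF s(1), of a] that by simp
 \<comment> \<open>Values at earlier places of the first factor lie below \<open>k\<close>, those at
   later places do not; hence inserting \<open>k\<close> keeps the first block increasing.\<close>
 have below: "pp a < k" if "a < ?c" for a
 proof (cases "i = Suc p")
 case True
 then show ?thesis using less[of a] that by (simp add: k_def ipos_def)
 next
 case False
 then have "a <= i - 1" "i - 1 < p" "0 < i" using that i by auto
 then have "pp a <= pp (i - 1)" using s(2)[of a "i - 1"] by (cases "a = i - 1") auto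
 then show ?thesis using False \<open>0 < i\<close> by (simp add: k_def ipos_def)
 qed
 have above: "k <= pp b" if "?c <= b" "b < p" for b
 proof -
 have "i <= b" "i < Suc p" using that by auto
 then show ?thesis using s(2)[of "i - 1" b] that by (auto simp: k_def ipos_def Suc_le_eq)
 qed
 have perm: "?rh permutes {..<Suc (p + q)}"
 by (rule pins_permutes[OF s(1) _ k]) simp
 show "?rh : shuffle_perms (Suc p) q"
 proof (rule shuffle_permsI)
 show "?rh permutes {..<Suc p + q}" using perm by simp
 fix a b :: nat assume ab: "a < b"
 show "?rh a < ?rh b" if b: "b < Suc p"
 proof (cases a ?c rule: skip_cases)
 case 1
 then obtain b' where b': "b = skip ?c b'" using ab by (cases b ?c rule: skip_cases) auto
 then have "?c <= b'" "b' < p" using 1 ab b by (auto simp: skip_def split: if_splits)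
 then have "k <= pp b'" by (rule above)
 then have "k < skip k (pp b')" by (simp add: skip_def)
 then show ?thesis by (simp add: 1 b')
 next
 case (2 a')
 show ?thesis
 proof (cases b ?c rule: skip_cases)
 case 1
 then have "a' < ?c" using 2 ab by (auto simp: skip_def split: if_splits)
 then have "pp a' < k" by (rule below)
 then have "skip k (pp a') < k" by (simp add: skip_def)
 then show ?thesis by (simp add: 1 2)
 next
 case (2 b')
 note b' = this
 have "a' < b'" "b' < p"
 using ab b b' \<open>a = skip ?c a'\<close> by (auto simp: skip_def split: if_splits)
 then show ?thesis using s(2) by (simp add: b' \<open>a = skip ?c a'\<close>)
 qed
 qed
 have sk: "Suc p + x = skip ?c (p + x)" for x by (simp add: skip_def)
 show "?rh (Suc p + a) < ?rh (Suc p + b)" if "b < q"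
 unfolding sk pins_skip using s(3)[OF ab that] by simp
 qed
 have "k : ?rh ` {..<Suc p}"
 by (intro image_eqI[of _ _ ?c]) auto
 moreover have "k - 1 : ?rh ` {..<Suc p}" if "i ~= Suc p" "i ~= 0"
 proof -
 have c: "?c = i" "i - 1 < i" "skip i (i - 1) = i - 1" "k = Suc (pp (i - 1))"
 using that i by (auto simp: skip_def k_def ipos_def)
 then have "?rh (i - 1) = k - 1"
 using pins_skip[of i k pp "i - 1"] by (simp add: skip_def)
 then show ?thesis using i that by (intro image_eqI[of _ _ "i - 1"]) auto
 qed
 ultimately show "face_first (Suc p) q ?rh (if i = Suc p then Suc (p + q) else k)"
 by (auto simp: face_first_def k_def ipos_def)
qed

text \<open>The inverse deletes from the shuffle the place with value \<open>k\<close>, or the last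
  place of the first factor when \<open>k\<close> is the last face. That the coordinates next to the
  face belong to the first factor identifies \<open>i\<close>.\<close>

lemma bij_betw_insert_face:
 "bij_betw (insert_face p q) (shuffle_perms p q \<times> {..Suc p})
 {x : shuffle_faces (Suc p) q. face_first (Suc p) q (fst x) (snd x)}"
 unfolding bij_betw_def
proof (intro conjI equalityI subsetI)
 show "inj_on (insert_face p q) (shuffle_perms p q \<times> {..Suc p})"
 proof (rule inj_onI, clarify)
 fix pp i rh j assume pp: "pp : shuffle_perms p q" "i <= Suc p" and rh: "rh : shuffle_perms p q" "j <= Suc p"
 and eq: "insert_face p q (pp, i) = insert_face p q (rh, j)"
 let ?k = "ipos p q pp i" and ?l = "ipos p q rh j"
 have le: "?k <= p + q" "?l <= p + q" by (rule ipos_le[OF pp] ipos_le[OF rh])+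
 have e1: "pins (min i p) ?k pp = pins (min j p) ?l rh"
 and e2: "(if i = Suc p then Suc (p + q) else ?k) = (if j = Suc p then Suc (p + q) else ?l)"
 using eq by (auto simp: insert_face_def)
 have ij: "i = Suc p \<longleftrightarrow> j = Suc p" using e2 le by (auto split: if_splits)
 have kl: "?k = ?l" using e2 ij by (auto simp: ipos_def split: if_splits)
 have "min i p = min j p"
 proof (cases "min i p" "min j p" rule: skip_cases)
 case (2 y)
 then have "pins (min j p) ?l rh (min i p) = skip ?l (rh y)" by simp
 moreover have "pins (min j p) ?l rh (min i p) = ?l" using e1 kl by (metis pins_at)
 ultimately show ?thesis by simp
 qed
 moreover from this have "pp = rh" using e1 kl pins_inj by metis
 ultimately show "pp = rh & i = j" using ij pp(2) rh(2) by (auto simp: min_def split: if_splits)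
 qed
next
 fix x assume "x : insert_face p q ` (shuffle_perms p q \<times> {..Suc p})"
 then show "x : {x : shuffle_faces (Suc p) q. face_first (Suc p) q (fst x) (snd x)}"
 using insert_face_shuffle ipos_le by (fastforce simp: insert_face_def)
next
 fix x assume "x : {x : shuffle_faces (Suc p) q. face_first (Suc p) q (fst x) (snd x)}"
 then obtain rh k where x: "x = (rh, k)" and rh: "rh : shuffle_perms (Suc p) q" and k: "k <= Suc (p + q)"
 and ff: "face_first (Suc p) q rh k" by (cases x) auto
 note s = shuffle_perms_strict[OF rh]
 have s1: "rh permutes {..<Suc (p + q)}" using s(1) by simp
 have delete: "\<exists>pp\<in>shuffle_perms p q. rh = pins c l pp" if c: "c <= p" "rh c = l" for c l
 proof -
 have "c <= p + q" using c(1) by simp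
 then obtain pp where pp: "pp permutes {..<p + q}" "rh = pins c l pp"
 using perm_insertE[OF s1 _ c(2)] by blast
 have "pp : shuffle_perms p q"
 proof (rule shuffle_permsI[OF pp(1)])
 fix a b :: nat assume ab: "a < b"
 show "pp a < pp b" if "b < p"
 proof -
 have "rh (skip c a) < rh (skip c b)"
 using ab that c(1) by (intro s(2)) (auto simp: skip_less)
 then show ?thesis by (simp add: pp(2))
 qed
 have sk: "skip c (p + y) = Suc p + y" for y using c(1) by (simp add: skip_def)
 show "pp (p + a) < pp (p + b)" if "b < q"
 proof -
 have "rh (skip c (p + a)) < rh (skip c (p + b))" unfolding sk by (rule s(3)[OF ab that])
 then show ?thesis by (simp add: pp(2))
 qed
 qed
 with pp(2) show ?thesis by blast
 qed
 show "x : insert_face p q ` (shuffle_perms p q \<times> {..Suc p})"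
 proof (cases "k = Suc (p + q)")
 case True
 then obtain j where j: "j < Suc p" "rh j = p + q" using ff by (auto simp: face_first_def)
 have "~ j < p"
 proof
 assume "j < p"
 then have "p + q < rh p" using s(2)[of j p] j by simp
 moreover have "rh p < Suc (p + q)" using permutes_in_image[OF s1, of p] by simp
 ultimately show False by simp
 qed
 then have "rh p = p + q" using j by (metis less_antisym)
 then obtain pp where "pp : shuffle_perms p q" "rh = pins p (p + q) pp" using delete[of p] by auto
 then show ?thesis
 using True by (intro image_eqI[of _ _ "(pp, Suc p)"]) (auto simp: x insert_face_def ipos_def min_def)
 next
 case False
 then obtain c where c: "c < Suc p" "rh c = k" using ff by (auto simp: face_first_def)
 then obtain pp where pp: "pp : shuffle_perms p q" "rh = pins c k pp" using delete[of c k] by auto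
 \<comment> \<open>For \<open>c ~= 0\<close> monotonicity forces \<open>k - 1\<close> to be the
   value at place \<open>c - 1\<close>. Deleting \<open>k\<close> leaves it there, so
   \<open>ipos\<close> returns \<open>k\<close>.\<close>
 have "ipos p q pp c = k"
 proof (cases "c = 0")
 case True
 have "k = 0"
 proof (rule ccontr)
 assume "k ~= 0"
 then obtain j where j: "j < Suc p" "rh j = k - 1" using ff by (auto simp: face_first_def)
 then have "j ~= 0" using c True \<open>k ~= 0\<close> by (metis diff_less less_irrefl less_numeral_extra(1) not_gr_zero)
 then have "rh 0 < rh j" using s(2)[of 0 j] j by simp
 then show False using c j True by simp
 qed
 then show ?thesis using True by (simp add: ipos_def)
 next
 case cn: False
 have "rh (c - 1) < k" using s(2)[of "c - 1" c] c cn by simp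
 then have "k ~= 0" by simp
 then obtain j where j: "j < Suc p" "rh j = k - 1" using ff by (auto simp: face_first_def)
 have "j < c" using s(2)[of c j] c j \<open>k ~= 0\<close> by (metis diff_less less_asym less_numeral_extra(1) linorder_neqE_nat not_gr_zero order_less_irrefl)
 moreover have "~ j < c - 1"
 proof
 assume "j < c - 1"
 then have "rh j < rh (c - 1)" using c by (intro s(2)) auto
 then show False using j \<open>rh (c - 1) < k\<close> by simp
 qed
 ultimately have "rh (c - 1) = k - 1" using j by (metis Suc_diff_1 cn less_antisym not_gr_zero)
 moreover have "rh (c - 1) = skip k (pp (c - 1))"
 using pins_skip[of c k pp "c - 1"] cn by (simp add: pp(2) skip_def)
 ultimately have "pp (c - 1) = k - 1" using \<open>k ~= 0\<close> by (auto simp: skip_def split: if_splits)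
 then show ?thesis using cn c \<open>k ~= 0\<close> by (simp add: ipos_def)
 qed
 then show ?thesis
 using pp c by (intro image_eqI[of _ _ "(pp, c)"]) (auto simp: x insert_face_def min_def)
 qed
qed

text \<open>Face and insertion cancel away from the added coordinate. At the added coordinate the
  face has the value 1, the value 0 or a repetition, which is the \<open>i\<close>-th face of the
  first factor.\<close>

lemma shuffle_face_insert:
 assumes pp: "pp : shuffle_perms p q" and i: "i <= Suc p"
 defines "x \<equiv> insert_face p q (pp, i)"
 shows "sign (fst x) * (- 1) ^ snd x = (- 1) ^ i * sign pp"
 and "shuffle_face (Suc p) q (fst x) (snd x) =
 (\<lambda>t\<in>splx (p + q). (simplical_face i (block_map (p + q) p pp t), block_map (p + q) q (%m. pp (p + m)) t))"
proof -
 note s = shuffle_perms_strict[OF pp]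
 let ?l = "ipos p q pp i" and ?c = "min i p"
 define k where "k = snd x"
 have k: "k = (if i = Suc p then Suc (p + q) else ?l)" and rh: "fst x = pins ?c ?l pp"
 by (simp_all add: k_def x_def insert_face_def)
 have l: "?l <= p + q" by (rule ipos_le[OF pp i])
 have kn: "k <= Suc (p + q)" using l k by auto
 have sg: "sign (fst x) = (- 1) ^ (?c + ?l) * sign pp"
 unfolding rh by (rule sign_pins[OF s(1) _ l]) simp
 \<comment> \<open>\<open>k\<close> equals \<open>?l\<close>, except for the last face: there it is
   one larger, which makes up for \<open>?c = i - 1\<close>.\<close>
 have "(- 1 :: int) ^ (?c + ?l) * (- 1) ^ k = (- 1) ^ i"
 proof (cases "i = Suc p")
 case True
 then show ?thesis by (simp add: k ipos_def power_add[symmetric]) (simp add: power_add flip: power_mult_distrib)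
 next
 case False
 then have "?c = i" "k = ?l" using i k by auto
 then show ?thesis by (simp add: power_add mult.assoc flip: power_mult_distrib)
 qed
 then show "sign (fst x) * (- 1) ^ snd x = (- 1) ^ i * sign pp"
 unfolding sg k_def[symmetric] by (simp add: ac_simps)
 have shx: "fst x : shuffle_perms (Suc p) q"
 unfolding rh by (rule insert_face_shuffle(1)[OF pp i])
 note sx = shuffle_perms_strict[OF shx]
 show "shuffle_face (Suc p) q (fst x) (snd x) =
 (\<lambda>t\<in>splx (p + q). (simplical_face i (block_map (p + q) p pp t), block_map (p + q) q (%m. pp (p + m)) t))"
 unfolding shuffle_face_def k_def[symmetric]
 proof (simp, rule restrict_ext)
 fix t assume t: "t : splx (p + q)"
 let ?n = "Suc (p + q)" and ?u = "simplical_face k t"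
 have u: "?u : splx (Suc p + q)"
 using simplical_face_in_standard_simplex[of ?n k t] kn t by simp
 have face: "crd ?n ?u m = (if m < k then crd (p + q) t m else if m = 0 then 1 else crd (p + q) t (m - 1))"
 if "m < ?n" for m
 using crd_face[of ?n k m t] kn t that by simp
 have less: "pp m < p + q" if "m < p + q" for m using permutes_in_image[OF s(1), of m] that by simp
 have outer: "crd ?n ?u (skip ?l a) = crd (p + q) t a" if "a < p + q" for a
 using face[of "skip ?l a"] that l by (auto simp: skip_less skip_def k split: if_splits) (auto simp: ipos_def)
 have bm: "block_map (p + q) p pp t : splx p" using t s(2) by (rule block_map_in_simplex)
 have A: "block_map (Suc p + q) (Suc p) (fst x) ?u = simplical_face i (block_map (p + q) p pp t)"
 proof (rule simplex_eqI)
 show "block_map (Suc p + q) (Suc p) (fst x) ?u : splx (Suc p)"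
 using u sx(2) by (rule block_map_in_simplex)
 show "simplical_face i (block_map (p + q) p pp t) : splx (Suc p)"
 using simplical_face_in_standard_simplex[of "Suc p" i] i bm by simp
 fix m assume m: "m < Suc p"
 have rhs: "crd (Suc p) (simplical_face i (block_map (p + q) p pp t)) m =
 (if m < i then crd p (block_map (p + q) p pp t) m else if m = 0 then 1 else crd p (block_map (p + q) p pp t) (m - 1))"
 using crd_face[of "Suc p" i m "block_map (p + q) p pp t"] i m bm by simp
 have lhs: "crd (Suc p) (block_map (Suc p + q) (Suc p) (fst x) ?u) m = crd ?n ?u (fst x m)"
 using m by (simp add: crd_block_map)
 show "crd (Suc p) (block_map (Suc p + q) (Suc p) (fst x) ?u) m = crd (Suc p) (simplical_face i (block_map (p + q) p pp t)) m"
 proof (cases m ?c rule: skip_cases)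
 case 1
 have "crd ?n ?u ?l = (if i = Suc p then 0 else if i = 0 then 1 else crd (p + q) t (pp (i - 1)))"
 using face[of ?l] l i less[of "i - 1"] by (auto simp: k ipos_def crd_eq_0)
 moreover have "fst x m = ?l" unfolding rh 1 by simp
 ultimately show ?thesis
 unfolding lhs rhs using i 1 m
 by (auto simp: crd_block_map crd_eq_0 min_def split: if_splits)
 next
 case (2 y)
 have y: "y < p" using 2 m by (auto simp: skip_def split: if_splits)
 have "crd ?n ?u (fst x m) = crd (p + q) t (pp y)"
 unfolding rh 2 pins_skip using less[of y] y by (intro outer) simp
 moreover have "crd p (block_map (p + q) p pp t) y = crd (p + q) t (pp y)"
 using y by (simp add: crd_block_map)
 ultimately show ?thesis
 unfolding lhs rhs using 2 y i by (auto simp: skip_def split: if_splits)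
 qed
 qed
 have B: "block_map (Suc p + q) q (%m. fst x (Suc p + m)) ?u = block_map (p + q) q (%m. pp (p + m)) t"
 unfolding block_map_def
 proof (rule dfs_cong)
 fix m assume m: "m < q"
 have "Suc p + m = skip ?c (p + m)" by (simp add: skip_def)
 then have "fst x (Suc p + m) = skip ?l (pp (p + m))" by (simp add: rh)
 then show "crd (Suc p + q) ?u (fst x (Suc p + m)) = crd (p + q) t (pp (p + m))"
 using outer[of "pp (p + m)"] less[of "p + m"] m by simp
 qed
 show "shuffle_map (Suc p) q (fst x) ?u = (simplical_face i (block_map (p + q) p pp t), block_map (p + q) q (%m. pp (p + m)) t)"
 using A B by (simp add: shuffle_map_def)
 qed
qed

lemma sum_face_first:
 assumes "0 < p + q"
 shows "(\<Sum>x | x : shuffle_faces p q & face_first p q (fst x) (snd x). sface_term p q x) =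
 nop2 (splx (p + q - 1)) (simp_pr (p - 1) q) (simp_bd p) (universal (splx q))"
proof (cases p)
 case 0
 then show ?thesis using assms by (auto simp: face_first_def simp_bd_def chain_boundary_def intro!: sum.neutral)
next
 case (Suc p')
 let ?D = "splx (p' + q)"
 have "(\<Sum>x | x : shuffle_faces p q & face_first p q (fst x) (snd x). sface_term p q x) =
 (\<Sum>y\<in>shuffle_perms p' q \<times> {..Suc p'}. sface_term p q (insert_face p' q y))"
 unfolding Suc by (rule sum.reindex_bij_betw[OF bij_betw_insert_face, symmetric])
 also have "... = (\<Sum>(pp, i)\<in>shuffle_perms p' q \<times> {..Suc p'}. frag_cmul ((- 1) ^ i * sign pp)
 (frag_of (restrict (map_prod (restrict (simplical_face i) (splx p')) (restrict id (splx q))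
 o restrict (shuffle_map p' q pp) ?D) ?D)))"
 proof (intro sum.cong refl, goal_cases)
 case (1 y)
 then obtain pp i where y: "y = (pp, i)" and pp: "pp : shuffle_perms p' q" and i: "i : {..Suc p'}" by auto
 note s = shuffle_perms_strict[OF pp]
 have "restrict (map_prod (restrict (simplical_face i) (splx p')) (restrict id (splx q))
 o restrict (shuffle_map p' q pp) ?D) ?D =
 (\<lambda>t\<in>?D. (simplical_face i (block_map (p' + q) p' pp t), block_map (p' + q) q (%m. pp (p' + m)) t))"
 proof (rule restrict_ext)
 fix t assume t: "t : ?D"
 have "block_map (p' + q) p' pp t : splx p'" "block_map (p' + q) q (%m. pp (p' + m)) t : splx q"
 using t s(2,3) by (intro block_map_in_simplex; simp)+
 then show "(map_prod (restrict (simplical_face i) (splx p')) (restrict id (splx q))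
 o restrict (shuffle_map p' q pp) ?D) t = (simplical_face i (block_map (p' + q) p' pp t), block_map (p' + q) q (%m. pp (p' + m)) t)"
 using t by (simp add: shuffle_map_def)
 qed
 then show ?case
 using shuffle_face_insert[OF pp, of i] i by (simp add: Suc y)
 qed
 also have "... = (\<Sum>i\<le>Suc p'. \<Sum>pp\<in>shuffle_perms p' q. frag_cmul ((- 1) ^ i * sign pp)
 (frag_of (restrict (map_prod (restrict (simplical_face i) (splx p')) (restrict id (splx q))
 o restrict (shuffle_map p' q pp) ?D) ?D)))"
 by (subst sum.swap) (rule sum.cartesian_product[symmetric])
 also have "... = nop2 ?D (simp_pr p' q) (simp_bd (Suc p')) (universal (splx q))"
 by (simp add: simp_bd_eq universal_def nop2_sum_left nop2_cmul_left nop2_of simp_pr_def push_sum push_cmul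
 frag_cmul_sum del: sum.atMost_Suc)
 finally show ?thesis by (simp add: Suc)
qed

text \<open>Exchanging the factors reduces this to \<open>sum_face_first\<close>. The two signs,
  with exponents \<open>p * q\<close> and \<open>(q - 1) * p\<close>, leave
  \<open>(- 1) ^ p\<close>.\<close>

lemma sum_face_second:
 assumes "0 < p + q"
 shows "(\<Sum>x | x : shuffle_faces p q & face_second p q (fst x) (snd x). sface_term p q x) =
 frag_cmul ((- 1) ^ p) (nop2 (splx (p + q - 1)) (simp_pr p (q - 1)) (universal (splx p)) (simp_bd q))"
proof -
 let ?D = "splx (p + q - 1)"
 let ?f = "%(pp, k). (pp o bswap p q, k)"
 have second: "face_second p q pp k \<longleftrightarrow> face_first q p (pp o bswap p q) k" for pp k
 proof -
 have "bswap p q ` {..<q} = {p..<p + q}"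
 by (auto simp: bswap_def image_iff) (metis le_add_diff_inverse lessThan_iff nat_add_left_cancel_less)
 then have "(pp o bswap p q) ` {..<q} = pp ` {p..<p + q}"
 by (simp only: image_comp[symmetric])
 then show ?thesis by (simp add: face_first_def face_second_def add.commute)
 qed
 have bij: "bij_betw ?f {x : shuffle_faces p q. face_second p q (fst x) (snd x)}
 {x : shuffle_faces q p. face_first q p (fst x) (snd x)}"
 proof (rule bij_betwI[where g = "%(pp, k). (pp o bswap q p, k)"])
 have inv: "pp o bswap q p o bswap p q = pp" "pp o bswap p q o bswap q p = pp" for pp :: "nat => nat"
 by (auto simp: fun_eq_iff bswap_inverse)
 show "?f : {x : shuffle_faces p q. face_second p q (fst x) (snd x)} \<rightarrow> {x : shuffle_faces q p. face_first q p (fst x) (snd x)}"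
 using shuffle_bswap(1) second by (auto simp: add.commute)
 show "(%(pp, k). (pp o bswap q p, k)) : {x : shuffle_faces q p. face_first q p (fst x) (snd x)} \<rightarrow>
 {x : shuffle_faces p q. face_second p q (fst x) (snd x)}"
 using shuffle_bswap(1) second inv by (auto simp: add.commute)
 show "(case ?f x of (pp, k) => (pp o bswap q p, k)) = x" for x :: "(nat => nat) \<times> nat"
 by (simp add: case_prod_unfold inv)
 show "?f (case x of (pp, k) => (pp o bswap q p, k)) = x" for x :: "(nat => nat) \<times> nat"
 by (simp add: case_prod_unfold inv)
 qed
 have "(\<Sum>x | x : shuffle_faces p q & face_second p q (fst x) (snd x). sface_term p q x) =
 (\<Sum>x | x : shuffle_faces p q & face_second p q (fst x) (snd x).
 frag_cmul ((- 1) ^ (p * q)) (push ?D prod.swap (sface_term q p (?f x))))"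
 proof (intro sum.cong refl)
 fix x assume "x : {x : shuffle_faces p q. face_second p q (fst x) (snd x)}"
 then obtain pp k where x: "x = (pp, k)" and pp: "pp : shuffle_perms p q" by auto
 have one: "(- 1 :: int) ^ (p * q) * (- 1) ^ (p * q) = 1"
 by (simp flip: power_mult_distrib)
 have "block_map (q + p) q (pp o bswap p q) = block_map (q + p) q (%m. pp (p + m))"
 "block_map (q + p) p (%m. (pp o bswap p q) (q + m)) = block_map (q + p) p pp"
 by (rule block_map_cong; simp add: bswap_def)+
 then have "restrict (prod.swap o shuffle_face q p (pp o bswap p q) k) ?D = shuffle_face p q pp k"
 by (auto simp: restrict_def shuffle_face_def shuffle_map_def add.commute)
 then show "sface_term p q x = frag_cmul ((- 1) ^ (p * q)) (push ?D prod.swap (sface_term q p (?f x)))"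
 using shuffle_bswap(2)[OF pp] one by (simp add: x push_cmul mult.assoc[symmetric])
 qed
 also have "... = frag_cmul ((- 1) ^ (p * q)) (push ?D prod.swap
 (\<Sum>x | x : shuffle_faces p q & face_second p q (fst x) (snd x). sface_term q p (?f x)))"
 by (simp add: push_sum frag_cmul_sum)
 also have "(\<Sum>x | x : shuffle_faces p q & face_second p q (fst x) (snd x). sface_term q p (?f x)) =
 (\<Sum>x | x : shuffle_faces q p & face_first q p (fst x) (snd x). sface_term q p x)"
 by (rule sum.reindex_bij_betw[OF bij, of "sface_term q p"])
 also have "... = nop2 ?D (simp_pr (q - 1) p) (simp_bd q) (universal (splx p))"
 using sum_face_first[of q p] assms by (simp add: add.commute)
 also have "push ?D prod.swap ... = nop2 ?D (push ?D prod.swap (simp_pr (q - 1) p)) (universal (splx p)) (simp_bd q)"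
 by (rule nop2_swap)
 also have "frag_cmul ((- 1) ^ (p * q)) ... =
 frag_cmul ((- 1) ^ p) (nop2 ?D (simp_pr p (q - 1)) (universal (splx p)) (simp_bd q))"
 proof (cases q)
 case (Suc q')
 have "push ?D prod.swap (simp_pr q' p) = frag_cmul ((- 1) ^ (q' * p)) (simp_pr p q')"
 using simp_pr_swap[of q' p] by (simp add: Suc add.commute)
 moreover have "(- 1 :: int) ^ (p * Suc q') * (- 1) ^ (q' * p) = (- 1) ^ p"
 by (simp add: power_add mult.commute mult.left_commute flip: power_mult_distrib)
 ultimately show ?thesis
 by (simp add: Suc nop2_cmul_universal del: mult_Suc mult_Suc_right)
 qed (simp add: simp_bd_def chain_boundary_def)
 finally show ?thesis .
qed

lemma simp_leibniz:
 "nop (splx (p + q - 1)) (simp_bd (p + q)) (simp_pr p q) =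
 nop2 (splx (p + q - 1)) (simp_pr (p - 1) q) (simp_bd p) (universal (splx q)) +
 frag_cmul ((- 1) ^ p) (nop2 (splx (p + q - 1)) (simp_pr p (q - 1)) (universal (splx p)) (simp_bd q))"
proof (cases "p + q = 0")
 case True
 then show ?thesis by (simp add: simp_bd_def chain_boundary_def)
next
 case False
 then have n: "0 < p + q" by simp
 let ?U = "shuffle_faces p q" and ?T = "sface_term p q"
 let ?A = "{x : ?U. face_first p q (fst x) (snd x)}" and ?B = "{x : ?U. face_second p q (fst x) (snd x)}"
 let ?M = "?U - ?A - ?B"
 have "nop (splx (p + q - 1)) (simp_bd (p + q)) (simp_pr p q) = (\<Sum>x\<in>?U. ?T x)"
 proof -
 have "chain_boundary (p + q) (frag_of (restrict (shuffle_map p q pp) (splx (p + q)))) =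
 (\<Sum>k\<le>p + q. frag_cmul ((- 1) ^ k) (frag_of (shuffle_face p q pp k)))" for pp
 using n by (auto simp: chain_boundary_of singular_face_def shuffle_face_def simplical_face_in_standard_simplex o_def
 intro!: sum.cong arg_cong[of _ _ "frag_cmul _"] arg_cong[of _ _ frag_of] restrict_ext)
 then have "chain_boundary (p + q) (simp_pr p q) =
 (\<Sum>pp\<in>shuffle_perms p q. \<Sum>k\<le>p + q. frag_cmul (sign pp * (- 1) ^ k) (frag_of (shuffle_face p q pp k)))"
 by (simp add: simp_pr_def chain_boundary_sum chain_boundary_cmul frag_cmul_sum o_def)
 then show ?thesis
 unfolding nop_simp_bd by (simp add: sum.cartesian_product case_prod_unfold)
 qed
 moreover have blocks: "pp ` {..<p} \<union> pp ` {p..<p + q} = {..<p + q}" "pp ` {..<p} \<inter> pp ` {p..<p + q} = {}"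
 if "pp : shuffle_perms p q" for pp
 proof -
 have "{..<p} \<union> {p..<p + q} = {..<p + q}" by auto
 then show "pp ` {..<p} \<union> pp ` {p..<p + q} = {..<p + q}"
 by (simp only: image_Un[symmetric] permutes_image[OF shuffle_perms_strict(1)[OF that]])
 show "pp ` {..<p} \<inter> pp ` {p..<p + q} = {}"
 using permutes_inj[OF shuffle_perms_strict(1)[OF that]] by (auto simp: inj_eq)
 qed
 \<comment> \<open>Because of \<open>p + q > 0\<close> a face has at least one neighbouring
   coordinate, and that one lies in only one factor.\<close>
 have disj: "?A \<inter> ?B = {}"
 proof (rule equals0I)
 fix x assume x: "x : ?A \<inter> ?B"
 then obtain pp k where "x = (pp, k)" and pp: "pp : shuffle_perms p q" and k: "face_first p q pp k" "face_second p q pp k" by auto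
 then show False using blocks(2)[OF pp] n by (auto simp: face_first_def face_second_def)
 qed
 moreover have "(\<Sum>x\<in>?M. ?T x) = 0"
 proof -
 let ?i = "%(pp, k). (Transposition.transpose (k - 1) k o pp, k)"
 have mixed: "0 < k & k < p + q & (k - 1 : pp ` {..<p} \<longleftrightarrow> k \<notin> pp ` {..<p})" if "(pp, k) : ?M" for pp k
 proof -
 have pp: "pp : shuffle_perms p q" "k <= p + q" "~ face_first p q pp k" "~ face_second p q pp k" using that by auto
 have mem: "j : pp ` {..<p} \<or> j : pp ` {p..<p + q}" if "j < p + q" for j using blocks(1)[OF pp(1)] that by blast
 show ?thesis
 proof -
 define A where "A = pp ` {..<p}"
 define B where "B = pp ` {p..<p + q}"
 have "~ (j : A & j : B)" for j using blocks(2)[OF pp(1)] by (auto simp: A_def B_def)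
 moreover have "k - 1 < p + q" using pp(2) n by linarith
 ultimately show ?thesis
 using pp(2-4) mem[of k] mem[of "k - 1"] n
 unfolding face_first_def face_second_def A_def[symmetric] B_def[symmetric]
 by (cases "k = 0"; cases "k = p + q") auto
 qed
 qed
 have mixedD: "(pp, k) : ?M" if "pp : shuffle_perms p q" "0 < k" "k < p + q" "k - 1 : pp ` {..<p} \<longleftrightarrow> k \<notin> pp ` {..<p}" for pp k
 using that blocks(2)[OF that(1)] by (auto simp: face_first_def face_second_def)
 have invol: "?i x : ?M & ?i (?i x) = x & ?T (?i x) = - ?T x" if "x : ?M" for x
 proof -
 obtain pp k where x: "x = (pp, k)" by force
 have pp: "pp : shuffle_perms p q" using that x by auto
 note mx = mixed[OF that[unfolded x]]
 let ?ta = "Transposition.transpose (k - 1) k"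
 note fm = shuffle_face_mixed[OF pp mx[THEN conjunct1] mx[THEN conjunct2, THEN conjunct1] mx[THEN conjunct2, THEN conjunct2]]
 have im: "j : (?ta o pp) ` {..<p} \<longleftrightarrow> ?ta j : pp ` {..<p}" for j
 proof -
 have "Transposition.transpose a b j = y \<longleftrightarrow> j = Transposition.transpose a b y" for a b y :: nat
 by auto
 then show ?thesis by (auto simp: image_iff)
 qed
 have "(?ta o pp, k) : ?M"
 proof (rule mixedD[OF fm(1)])
 show "k - 1 : (?ta o pp) ` {..<p} \<longleftrightarrow> k \<notin> (?ta o pp) ` {..<p}"
 unfolding im using mx by simp
 qed (use mx in auto)
 moreover have "?ta o (?ta o pp) = pp" by (simp add: fun_eq_iff)
 moreover have "sign (?ta o pp) = - sign pp"
 proof -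
 have "k - 1 ~= k" using mx by linarith
 then show ?thesis using permutation_of_permutes[OF shuffle_perms_strict(1)[OF pp]]
 by (simp add: sign_compose permutation_swap_id sign_swap_id)
 qed
 ultimately show ?thesis using fm(2) by (simp add: x)
 qed
 have "(\<Sum>x\<in>?M. ?T x) = (\<Sum>x\<in>?M. ?T (?i x))"
 using invol by (intro sum.reindex_bij_witness[of _ ?i ?i]) auto
 also have "... = - (\<Sum>x\<in>?M. ?T x)"
 unfolding sum_negf[symmetric] using invol by (intro sum.cong) auto
 \<comment> \<open>The sum equals its own negative, and a free abelian group has no
   2-torsion.\<close>
 finally have "frag_cmul 2 (\<Sum>x\<in>?M. ?T x) = 0"
 using frag_cmul_distrib[of 1 1 "\<Sum>x\<in>?M. ?T x"] by (simp add: eq_neg_iff_add_eq_0)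
 then show ?thesis by (simp only: frag_cmul_eq_0_iff) simp
 qed
 moreover have "(\<Sum>x\<in>?U. ?T x) = (\<Sum>x\<in>?A. ?T x) + (\<Sum>x\<in>?B. ?T x) + (\<Sum>x\<in>?M. ?T x)"
 proof -
 have fin: "finite ?U" by simp
 have "(\<Sum>x\<in>?U. ?T x) = (\<Sum>x\<in>?U - (?A \<union> ?B). ?T x) + (\<Sum>x\<in>?A \<union> ?B. ?T x)"
 by (rule sum.subset_diff[OF _ fin]) auto
 moreover have "(\<Sum>x\<in>?A \<union> ?B. ?T x) = (\<Sum>x\<in>?A. ?T x) + (\<Sum>x\<in>?B. ?T x)"
 by (rule sum.union_disjoint[OF _ _ disj]) (auto intro: finite_subset[OF _ fin])
 moreover have "?U - (?A \<union> ?B) = ?M" by auto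
 ultimately show ?thesis by (simp only: add.commute)
 qed
 ultimately show ?thesis
 using sum_face_first[OF n] sum_face_second[OF n] by simp
qed

lemma simplex_model:
 "chain_model splx (%j. if j = 0 then 1 else 0) simp_bd simp_pr (%p. {})"
proof
 fix p q s
 show "nop (splx (p - 1 - 1)) (simp_bd (p - 1)) (simp_bd p) = 0"
 unfolding nop_simp_bd using chain_boundary_boundary[of p "rsub (splx p)" "universal (splx p)"]
 universal_in_chains[of "splx p"]
 by (simp add: simp_bd_def chains_on_simplex)
 show "simp_pr p 0 = frag_of (\<lambda>t\<in>splx p. (t, %j. if j = 0 then 1 else 0))"
 "simp_pr 0 p = frag_of (\<lambda>t\<in>splx p. (%j. if j = 0 then 1 else 0, t))"
 by (auto simp: simp_pr_def shuffle_map_def block_map_def dfs_crd fun_eq_iff dfs_def[of 0] intro!: arg_cong[of _ _ frag_of] restrict_ext)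
qed (simp_all only: standard_simplex_0 simp_bd_in simp_pr_in simp_leibniz simp_pr_assoc simp_pr_swap, simp_all add: simp_bd_def chain_boundary_def)

section \<open>The functor of singular chains\<close>

lemma (in chain_model) star_snoc:
 assumes "any_chain p x"
 shows "mp (p + q) (%(as, a). as @ [a]) (prd p q x y) = star p q x (sgl q y)"
proof -
 have "prd p q x (sgl q y) = prd p q (mp p (%as. as) x) (sgl q y)"
 by (simp add: push_id[OF assms])
 then show ?thesis
 by (simp add: star_def prd_mp push_push case_prod_unfold)
qed

text \<open>\<open>F\<close> stands for the recursion of either operad, which adds factors on the
  right. Strict associativity turns it into the product nested to the right.\<close>

lemma (in chain_model) iterated_product_eq_sprod:
 assumes "!!p x ys. F p [] x ys = x"
 and "!!p q qs x y ys. F p (q # qs) x (y # ys) = F (p + q) qs (mp (p + q) (%(as, a). as @ [a]) (prd p q x y)) ys"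
 and "any_chain p x" "length qs = length ys" "entries (zip qs ys)"
 shows "F p qs x ys = star p (sdeg (zip qs ys)) x (sprod (zip qs ys))"
 using assms(4,3,5)
proof (induction qs ys arbitrary: p x rule: list_induct2)
 case Nil
 then show ?case by (simp add: assms(1) star_pnt)
next
 case (Cons q qs y ys)
 then have e: "any_chain p x" "any_chain q (sgl q y)" "any_chain (sdeg (zip qs ys)) (sprod (zip qs ys))"
 "entries (zip qs ys)"
 by (auto intro: any_chain_of[OF sgl_in] sprod_any)
 have "any_chain (p + q) (star p q x (sgl q y))"
 unfolding star_def by (rule push_in_chains[OF prd_in[OF e(1,2)]]) simp
 then show ?case
 using Cons.IH[OF _ e(4)] by (simp add: assms(2) star_snoc[OF e(1)] star_assoc[OF e(1-3)])
qed

lemma (in operad_chains) rcomp_eq_iterated_product: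
 assumes "!!p x ys. F p [] x ys = x"
 and "!!p q qs x y ys. F p (q # qs) x (y # ys) = F (p + q) qs (mp (p + q) (%(as, a). as @ [a]) (prd p q x y)) ys"
 and x: "x : chz p (sp (length ms))" and ys: "valid ms qs ys"
 shows "rcomp ms p qs x ys =
 mp (nat p + sum_list (map nat qs)) (tc ms) (F (nat p) (map nat qs) (sgl (nat p) x) ys)"
proof -
 have any: "any_chain (nat q) y" if "y : chz q X" for q y and X :: "'a topology"
 using that any_chain_of by (auto simp: chz_def split: if_splits)
 have len: "length (map nat qs) = length ys" using ys by (simp add: valid_def)
 have ent: "entries (zip (map nat qs) ys)"
 using ys any by (force simp: entries_def valid_def set_zip)
 have sum: "sdeg (zip (map nat qs) ys) = sum_list (map nat qs)"
 by (simp only: sdeg_def map_fst_zip[OF len])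
 have "F (nat p) (map nat qs) (sgl (nat p) x) ys =
 star (nat p) (sdeg (zip (map nat qs) ys)) (sgl (nat p) x) (sprod (zip (map nat qs) ys))"
 by (rule iterated_product_eq_sprod[OF assms(1,2) any_chain_of[OF sgl_in[OF any[OF x]]] len ent])
 then show ?thesis
 by (simp add: rcomp_def args_def sum)
qed

text \<open>Morphisms are compared on carriers, whose elements are classes; all functor laws thus
  come down to those of push-forward on representatives.\<close>

lemma presented_op_functor:
 fixes dom :: "nat => point set" and F :: "('a, 'b) op_functor"
 assumes pres: "!!P. top_operad P ==> presented_operad dom pt bd pr rel P (fobj F P) (cls P)"
 and mor: "!!P Q f l n x. top_operad P ==> top_operad Q ==> 1 <= l ==>
 continuous_map (tspace P l) (tspace Q l) (f l) ==> x : operad_chains.chz dom n (tspace P l) ==>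
 fmor F P Q f l n (cls P l n x) = cls Q l n (push (dom (nat n)) (f l) x)"
 shows "is_op_functor F"
proof -
 have elem: "\<exists>a. x = cls P l n a & a : operad_chains.chz dom n (tspace P l)"
 if "top_operad P" "1 <= l" "x : carrier (dgrp (fobj F P) l n)" for P l n x
 using that presented_operad.carr[OF pres[OF that(1)] that(2)] by auto
 have opc: "operad_chains dom pt bd pr rel P" if "top_operad P" for P :: "'a top_operad_data"
 using pres[OF that] by (simp add: presented_operad_def)
 have morD: "top_operad P & top_operad Q & (\<forall>l\<ge>1. continuous_map (tspace P l) (tspace Q l) (f l))"
 if "top_operad_mor P Q f" for P Q :: "'a top_operad_data" and f
 using that unfolding top_operad_mor_def by blast
 have D: "dg_operad_mor (fobj F P) (fobj F Q) (fmor F P Q f)" if f: "top_operad_mor P Q f" for P Q f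
 proof -
 note d = morD[OF f]
 show ?thesis
 using d by (intro presented_operad.presented_dg_operad_mor_top[OF pres pres f]) (auto intro: mor)
 qed
 have E: "dg_mor_eq (fobj F P) (fmor F P Q f) (fmor F P Q g)"
 if f: "top_operad_mor P Q f" "top_operad_mor P Q g" "top_mor_eq P f g" for P Q f g
 unfolding dg_mor_eq_def
 proof (intro allI impI ballI)
 fix l n x assume l: "1 <= l" and "x : carrier (dgrp (fobj F P) l n)"
 note d = morD[OF f(1)] morD[OF f(2)]
 then obtain a where a: "x = cls P l n a" "a : operad_chains.chz dom n (tspace P l)"
 using elem[of P l x n] l \<open>x : _\<close> by blast
 have "push (dom (nat n)) (f l) a = push (dom (nat n)) (g l) a"
 using f(3) l d by (intro operad_chains.chz_cong[OF opc[of P] a(2)]) (auto simp: top_mor_eq_def)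
 then show "fmor F P Q f l n x = fmor F P Q g l n x"
 using d l a by (simp add: mor)
 qed
 have I: "dg_mor_eq (fobj F P) (fmor F P P (%l x. x)) (%l n x. x)" if P: "top_operad P" for P
 unfolding dg_mor_eq_def
 proof (intro allI impI ballI)
 fix l n x assume l: "1 <= l" and "x : carrier (dgrp (fobj F P) l n)"
 then obtain a where a: "x = cls P l n a" "a : operad_chains.chz dom n (tspace P l)"
 using elem[OF P, of l x n] by blast
 have "push (dom (nat n)) (%x. x) a = a"
 using a(2) push_id[of a "dom (nat n)" "tspace P l" "%x. x"]
 by (auto simp: operad_chains.chz_def[OF opc[OF P]] split: if_splits)
 then show "fmor F P P (%l x. x) l n x = x"
 using mor[OF P P l, of "%l x. x" a n] a by simp
 qed
 have C: "dg_mor_eq (fobj F P) (fmor F P R (%l x. g l (f l x)))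
 (%l n x. fmor F Q R g l n (fmor F P Q f l n x))"
 if f: "top_operad_mor P Q f" and g: "top_operad_mor Q R g" for P Q R f g
 unfolding dg_mor_eq_def
 proof (intro allI impI ballI)
 fix l n x assume l: "1 <= l" and "x : carrier (dgrp (fobj F P) l n)"
 note d = morD[OF f] morD[OF g]
 then obtain a where a: "x = cls P l n a" "a : operad_chains.chz dom n (tspace P l)"
 using elem[of P l x n] l \<open>x : _\<close> by blast
 have "push (dom (nat n)) (f l) a : operad_chains.chz dom n (tspace Q l)"
 using d l by (intro operad_chains.chz_mp[OF opc[of P] a(2)]) auto
 moreover have "continuous_map (tspace P l) (tspace R l) (%x. g l (f l x))"
 using d l continuous_map_compose[of "tspace P l" "tspace Q l" "f l" "tspace R l" "g l"] by (auto simp: o_def)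
 ultimately show "fmor F P R (%l x. g l (f l x)) l n x = fmor F Q R g l n (fmor F P Q f l n x)"
 using d l a by (simp add: mor push_push mor[where f = "%l x. g l (f l x)"])
 qed
 show ?thesis
 unfolding is_op_functor_def using presented_operad.presented_dg_operad[OF pres] D E I C by blast
qed

section \<open>Iterated degeneracies and the shuffle product\<close>

lemma strict_mono_le: "(!!i j. i < j ==> j < p ==> e i < (e j :: nat)) ==> i < p ==> i <= e i"
proof (induction i)
 case (Suc i)
 then have "i <= e i" "e i < e (Suc i)" by auto
 then show ?case by simp
qed simp

text \<open>The value \<open>i\<close> is taken at some place \<open>a <= i\<close>, and
  \<open>a < i\<close> is impossible because there \<open>e a = a\<close> already.\<close>

lemma strict_mono_initial:
 assumes mono: "!!i j. i < j ==> j < p ==> e i < (e j :: nat)" and sub: "{..<j} \<subseteq> e ` {..<p}" and "i < j"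
 shows "e i = i"
 using \<open>i < j\<close>
proof (induction i rule: less_induct)
 case (less i)
 then obtain a where a: "a < p" "e a = i" using sub by auto
 then have "a <= i" using strict_mono_le[of p e a, OF mono] by simp
 then show ?case using less.IH[of a] less.prems a by (cases "a = i") auto
qed

text \<open>Induction on the list: \<open>e\<close> enumerates the coordinates that survive, and for
  the tail of the list they are \<open>e\<close> with the head \<open>j\<close> put back.\<close>

lemma degeneracies_apply:
 assumes "sorted_wrt (<) js" "!!i j. i < j ==> j < p ==> e i < e j"
 "e ` {..<p} \<union> set js = {..<p + length js}" "e ` {..<p} \<inter> set js = {}"
 "t : splx (p + length js)"
 shows "degeneracies p js sgg t = sgg (block_map (p + length js) p e t)"
 using assms
proof (induction js arbitrary: p e sgg)
 case Nil
 have "e i = i" if "i < p" for i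
 using Nil.prems(3) that by (intro strict_mono_initial[OF Nil.prems(2), of p]) auto
 then have "block_map p p e t = block_map p p (%m. m) t"
 by (intro block_map_cong[THEN fun_cong]) auto
 then show ?case using Nil.prems(5) by (simp add: block_map_id)
next
 case (Cons j js)
 let ?n = "p + length (j # js)" and ?e = "%i. if i <= j then i else e (i - 1)"
 note mono = Cons.prems(2)
 have jn: "j < ?n" using Cons.prems(3) by auto
 \<comment> \<open>As the list is increasing, nothing below \<open>j\<close> is forgotten, so
   \<open>j\<close> is also the place of the coordinate that \<open>degeneracy p j\<close>
   removes.\<close>
 have sub: "{..<j} \<subseteq> e ` {..<p}"
 proof
 fix i assume i: "i : {..<j}"
 then have "i \<notin> set (j # js)" using Cons.prems(1) by auto
 moreover have "i : e ` {..<p} \<union> set (j # js)" unfolding Cons.prems(3) using i jn by auto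
 ultimately show "i : e ` {..<p}" by blast
 qed
 have jp: "j <= p"
 using card_mono[OF _ sub] card_image_le[of "{..<p}" e] by simp
 have ei: "e i = i" if "i < j" for i by (rule strict_mono_initial[OF mono sub that])
 have ge: "j < e i" if "j <= i" "i < p" for i
 proof -
 have "i <= e i" by (rule strict_mono_le[OF mono that(2)])
 moreover have "e i ~= j" using Cons.prems(4) that(2) by auto
 ultimately show ?thesis using that by simp
 qed
 have skip: "?e (skip j i) = e i" for i
 using ei[of i] by (simp add: skip_def)
 have image: "?e ` {..<Suc p} = insert j (e ` {..<p})"
 proof -
 have "{..<Suc p} = insert j (skip j ` {..<p})"
 proof (intro equalityI subsetI)
 fix i assume "i : {..<Suc p}"
 then show "i : insert j (skip j ` {..<p})"
 using jp by (cases i j rule: skip_cases) (auto simp: skip_def split: if_splits)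
 qed (use jp in \<open>auto simp: skip_def split: if_splits\<close>)
 then show ?thesis by (simp only: image_insert image_image skip) simp
 qed
 have n: "Suc p + length js = ?n" by simp
 have mono': "?e i < ?e i'" if "i < i'" "i' < Suc p" for i i'
 proof -
 have "i < e (i' - 1)" if "i <= j" "j < i'"
 proof -
 have "j < e (i' - 1)" using that \<open>i' < Suc p\<close> by (intro ge) linarith+
 then show ?thesis using that by simp
 qed
 moreover have "e (i - 1) < e (i' - 1)" if "j < i"
 using that \<open>i < i'\<close> \<open>i' < Suc p\<close> by (intro mono) linarith+
 ultimately show ?thesis using \<open>i < i'\<close> by auto
 qed
 have IH: "degeneracies (Suc p) js (degeneracy p j sgg) t = degeneracy p j sgg (block_map (Suc p + length js) (Suc p) ?e t)"
 proof (rule Cons.IH)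
 show "?e i < ?e i'" if "i < i'" "i' < Suc p" for i i' by (rule mono'[OF that])
 show "?e ` {..<Suc p} \<union> set js = {..<Suc p + length js}"
 unfolding image n using Cons.prems(3) by auto
 show "?e ` {..<Suc p} \<inter> set js = {}"
 unfolding image using Cons.prems(1,4) by auto
 qed (use Cons.prems in auto)
 have inn: "block_map ?n (Suc p) ?e t : splx (Suc p)"
 proof (rule block_map_in_simplex[OF Cons.prems(5)])
 show "?e i < ?e i'" if "i < i'" "i' < Suc p" for i i' by (rule mono'[OF that])
 qed
 have "collapse_map j (block_map ?n (Suc p) ?e t) = block_map ?n p e t"
 proof (rule simplex_eqI)
 show "collapse_map j (block_map ?n (Suc p) ?e t) : splx p"
 by (rule collapse_map_in_simplex(1)[OF jp inn])
 show "block_map ?n p e t : splx p"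
 by (rule block_map_in_simplex[OF Cons.prems(5) mono])
 fix m assume m: "m < p"
 then have "skip j m < Suc p" by (simp add: skip_def)
 then have "crd (Suc p) (block_map ?n (Suc p) ?e t) (skip j m) = crd ?n t (?e (skip j m))"
 by (rule crd_block_map)
 then show "crd p (collapse_map j (block_map ?n (Suc p) ?e t)) m = crd p (block_map ?n p e t) m"
 unfolding collapse_map_in_simplex(2)[OF jp inn m] crd_block_map[OF m] skip .
 qed
 then show ?case
 unfolding degeneracies.simps IH using inn by (simp add: degeneracy_def)
qed

text \<open>Degenerating at the places of one factor amounts to keeping the coordinates at the
  places of the other.\<close>

lemma shuffle_simplex_eq:
 assumes pp: "pp : shuffle_perms p q"
 shows "shuffle_simplex p q pp sgg ta =
 restrict (map_prod sgg ta o restrict (shuffle_map p q pp) (splx (p + q))) (splx (p + q))"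
 unfolding shuffle_simplex_def
proof (rule restrict_ext)
 fix t assume t: "t : splx (p + q)"
 note s = shuffle_perms_strict[OF pp]
 have img: "pp ` ({..<p} \<union> {p..<p + q}) = {..<p + q}"
 using permutes_image[OF s(1)] by (simp add: ivl_disj_un)
 have dis: "pp ` {..<p} \<inter> pp ` {p..<p + q} = {}"
 using permutes_inj[OF s(1)] by (auto simp: inj_eq)
 have "(+) p ` {..<q} = {p..<p + q}"
 by (simp add: lessThan_atLeast0 add.commute)
 then have shift: "(%m. pp (p + m)) ` {..<q} = pp ` {p..<p + q}"
 by (metis image_image)
 have sorted: "sorted_wrt (<) (map pp [p..<p + q])" "sorted_wrt (<) (map pp [0..<p])"
 using s(2,3) by (auto simp: sorted_wrt_iff_nth_less)
 have "degeneracies p (map pp [p..<p + q]) sgg t = sgg (block_map (p + length (map pp [p..<p + q])) p pp t)"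
 by (rule degeneracies_apply[OF sorted(1)]) (use s(2) t img dis in \<open>simp_all add: image_Un\<close>)
 moreover have "degeneracies q (map pp [0..<p]) ta t =
 ta (block_map (q + length (map pp [0..<p])) q (%m. pp (p + m)) t)"
 proof (rule degeneracies_apply[OF sorted(2)])
 show "(%m. pp (p + m)) ` {..<q} \<union> set (map pp [0..<p]) = {..<q + length (map pp [0..<p])}"
 unfolding shift using img by (simp add: image_Un Un_commute add.commute atLeast0LessThan)
 show "(%m. pp (p + m)) ` {..<q} \<inter> set (map pp [0..<p]) = {}"
 unfolding shift using dis by (simp add: Int_commute atLeast0LessThan)
 qed (use s(3) t in \<open>simp_all add: add.commute\<close>)
 ultimately have "degeneracies p (map pp [p..<p + q]) sgg t = sgg (block_map (p + q) p pp t)"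
 "degeneracies q (map pp [0..<p]) ta t = ta (block_map (p + q) q (%m. pp (p + m)) t)"
 by (simp_all add: add.commute)
 then show "(degeneracies p (map pp [p..<p + q]) sgg t, degeneracies q (map pp [0..<p]) ta t) =
 (map_prod sgg ta o restrict (shuffle_map p q pp) (splx (p + q))) t"
 using t by (simp add: shuffle_map_def)
qed

lemma shuffle_product_eq: "shuffle_product p q c d = nop2 (splx (p + q)) (simp_pr p q) c d"
 unfolding shuffle_product_def nop2_def simp_pr_def push_sum push_cmul push_of
 by (simp add: shuffle_simplex_eq cong: sum.cong)

text \<open>Singular chains are their own representatives, whence \<open>cls\<close> is the identity
  and the set of relations is empty.\<close>

lemma sing_operad_presented:
 assumes "top_operad P"
 shows "presented_operad splx (%j. if j = 0 then 1 else 0) simp_bd simp_pr (%p. {})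
 P (sing_operad P) (%l n x. x)"
proof -
 interpret operad_chains splx "%j. if j = 0 then 1 else 0" simp_bd simp_pr "%p. {}" P
 by (rule operad_chains.intro[OF simplex_model]) (unfold_locales, rule assms)
 have grp: "dgrp (sing_operad P) l n = sing_group n (sp l)" for l n
 by (simp add: sing_operad_def sing_complex_def)
 have one: "\<one>\<^bsub>sing_group n X\<^esub> = 0" for n and X :: "'a topology"
 by (simp add: sing_group_def)
 show ?thesis
 proof (intro presented_operad.intro presented_operad_axioms.intro operad_chains_axioms)
 fix l n and x y :: "'a chain"
 show "comm_group (dgrp (sing_operad P) l n)"
 by (simp add: grp sing_group_def abelian_free_Abelian_group abelian_chain_group)
 show "carrier (dgrp (sing_operad P) l n) = (%x. x) ` chz n (sp l)"
 by (auto simp: grp sing_group_def chz_def chains_on_simplex singular_chain_def)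
 show "x + y = x \<otimes>\<^bsub>dgrp (sing_operad P) l n\<^esub> y"
 by (simp add: grp sing_group_def)
 show "x = \<one>\<^bsub>dgrp (sing_operad P) l n\<^esub> \<longleftrightarrow> x = 0 \<or> 0 <= n & x : Rel (nat n) (sp l)"
 by (auto simp: grp one)
 show "ddiff (sing_operad P) l n x = bdry (nat n) x"
 unfolding bdry_def nop_simp_bd by (simp add: sing_operad_def sing_complex_def)
 show "dact (sing_operad P) l n sgg x = mp (nat n) (tact P l sgg) x" for sgg
 by (simp add: sing_operad_def push_simplex)
 next
 fix ms p qs x ys assume "arity_list ms" "x : chz p (sp (length ms))" and ys: "valid ms qs ys"
 have "map (%i. ys ! i) [0..<length ms] = ys"
 using ys by (metis valid_def map_nth)
 moreover have "rcomp ms p qs x ys = mp (nat p + sum_list (map nat qs)) (tc ms)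
 (shuffle_products (nat p) (map nat qs) (sgl (nat p) x) ys)"
 by (rule rcomp_eq_iterated_product[OF _ _ \<open>x : _\<close> ys])
 (simp_all add: push_simplex prd_def shuffle_product_eq)
 ultimately show "dcomp (sing_operad P) ms p qs x (map (%i. ys ! i) [0..<length ms]) = rcomp ms p qs x ys"
 by (simp add: sing_operad_def push_simplex)
 qed (simp add: sing_operad_def pnt_def)
qed

lemma is_op_functor_sing: "is_op_functor (sing_functor :: ('a, 'a chain) op_functor)"
proof -
 have presented: "presented_operad splx (%j. if j = 0 then 1 else 0) simp_bd simp_pr (%p. {})
 P (fobj sing_functor P) (%l n x. x)" if "top_operad P" for P :: "'a top_operad_data"
 using sing_operad_presented[OF that] by (simp add: sing_functor_def)
 show ?thesis
 by (rule presented_op_functor[where cls = "%P l n x. x" and dom = splx, OF presented])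
 (simp_all add: sing_functor_def push_simplex)
qed

section \<open>The cubical model\<close>

text \<open>The involution equates the sum with its negative, and there is no 2-torsion. Fixed
  points need no separate treatment: on them \<open>F\<close> vanishes for the same reason.\<close>

lemma frag_sum_involution:
 fixes F :: "'b => 'a \<Rightarrow>\<^sub>0 int"
 assumes "!!x. x : A ==> \<phi> x : A" "!!x. x : A ==> \<phi> (\<phi> x) = x" "!!x. x : A ==> F (\<phi> x) = - F x"
 shows "(\<Sum>x\<in>A. F x) = 0"
proof -
 have "(\<Sum>x\<in>A. F x) = (\<Sum>x\<in>A. F (\<phi> x))"
 using assms(1,2) by (intro sum.reindex_bij_witness[of _ \<phi> \<phi>]) auto
 also have "... = - (\<Sum>x\<in>A. F x)"
 unfolding sum_negf[symmetric] using assms(3) by (intro sum.cong) auto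
 finally have "frag_cmul 2 (\<Sum>x\<in>A. F x) = 0"
 using frag_cmul_distrib[of 1 1 "\<Sum>x\<in>A. F x"] by (simp add: eq_neg_iff_add_eq_0)
 then show ?thesis by (simp only: frag_cmul_eq_0_iff) simp
qed

lemma sum_lessThan_add: "(\<Sum>i<p + q. f i) = (\<Sum>i<p. f i) + (\<Sum>i<q. f (p + i))" for q :: nat
 by (induction q) (simp_all add: add.assoc)

lemma continuous_map_if_const:
 "(b ==> continuous_map X Y f) ==> (~ b ==> continuous_map X Y g) ==> continuous_map X Y (%t. if b then f t else g t)"
 by (cases b) auto

lemma cube_continuous:
 assumes "!!j. continuous_map (powertop_real UNIV) euclideanreal (%t. f t j)"
 and "!!t. t : S ==> f t : S'"
 shows "continuous_map (rsub S) (rsub S') f"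
 using assms
 by (auto simp: continuous_map_in_subtopology continuous_map_componentwise_UNIV
 intro: continuous_map_from_subtopology)

definition cins :: "nat => real => point => point" where
 "cins i a t = (%j. if j < i then t j else if j = i then a else t (j - 1))"

definition cspl :: "nat => nat => point => point \<times> point" where
 "cspl p q t = (%i. if i < p then t i else 0, %i. if i < q then t (p + i) else 0)"

abbreviation cube_gen :: "nat => (point => 'a) => 'a chain" where
 "cube_gen n f \<equiv> frag_of (restrict f (cube n))"

lemma cube_gen_eqI: "(!!t. t : cube n ==> f t = g t) ==> cube_gen n f = cube_gen n g"
 by (auto intro!: arg_cong[of _ _ frag_of] restrict_ext)

lemma push_cube_gen: "push (cube n) f (cube_gen n g) = cube_gen n (%t. f (g t))"
 unfolding push_of by (rule cube_gen_eqI) simp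

definition cube_bd :: "nat => point chain" where
 "cube_bd p = (\<Sum>i<p. \<Sum>e\<in>{0, 1}. frag_cmul ((- 1) ^ (Suc i + e)) (cube_gen (p - 1) (cins i (real e))))"

text \<open>A product of cubes is a cube, so a single term suffices and no subdivision
  occurs.\<close>

definition cube_pr :: "nat => nat => (point \<times> point) chain" where
 "cube_pr p q = cube_gen (p + q) (cspl p q)"

text \<open>Ordered cubes: a cube is degenerate if it does not change when some coordinate is replaced by 0.\<close>

definition cube_rel :: "nat => point chain set" where
 "cube_rel n = {cube_gen n (%t. t(i := 0)) | i. i < n} \<union>
 {cube_gen n (%t. t) - frag_cmul (sign pp) (cube_gen n (%t. t o pp)) | pp. pp permutes {..<n}}"

section \<open>Faces and products of cubes\<close>

lemma cins_insert:
 assumes "j <= i"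
 shows "cins (Suc i) a (cins j b t) = cins j b (cins i a t)"
proof
 fix x
 consider "x < j" | "x = j" | "j < x" "x < Suc i" | "x = Suc i" | "Suc i < x"
 by linarith
 then show "cins (Suc i) a (cins j b t) x = cins j b (cins i a t) x"
 using assms by cases (auto simp: cins_def)
qed

lemma cins_in: "i < p ==> 0 <= a ==> a <= 1 ==> t : cube (p - 1) ==> cins i a t : cube p"
 by (auto simp: unit_cube_def cins_def)

lemma cube_zero_in: "t : cube n ==> t(i := 0) : cube n"
 by (auto simp: unit_cube_def)

lemma cube_perm_in: "t : cube n ==> pp permutes {..<n} ==> t o pp : cube n"
 by (auto simp: unit_cube_def permutes_def)

lemma cspl_in:
 assumes "t : cube (p + q)"
 shows "fst (cspl p q t) : cube p" "snd (cspl p q t) : cube q"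
 using assms by (auto simp: unit_cube_def cspl_def)

lemma cins_continuous:
 assumes "i < p" "0 <= a" "a <= 1"
 shows "continuous_map (rsub (cube (p - 1))) (rsub (cube p)) (cins i a)"
proof (rule cube_continuous)
 show "continuous_map (powertop_real UNIV) euclideanreal (%t. cins i a t j)" for j
 unfolding cins_def by (intro continuous_map_if_const continuous_map_product_projection) auto
qed (rule cins_in[OF assms])

lemma cube_zero_continuous: "continuous_map (rsub (cube n)) (rsub (cube n)) (%t. t(i := 0))"
proof (rule cube_continuous)
 show "continuous_map (powertop_real UNIV) euclideanreal (%t. (t(i := 0)) j)" for j
 unfolding fun_upd_def by (intro continuous_map_if_const continuous_map_product_projection) auto
qed (rule cube_zero_in)

lemma cube_perm_continuous:
 "pp permutes {..<n} ==> continuous_map (rsub (cube n)) (rsub (cube n)) (%t. t o pp)"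
 by (rule cube_continuous)
 (auto simp: cube_perm_in intro!: continuous_map_product_projection)

lemma cspl_continuous:
 "continuous_map (rsub (cube (p + q))) (prod_topology (rsub (cube p)) (rsub (cube q))) (cspl p q)"
proof -
 have "continuous_map (rsub (cube (p + q))) (rsub (cube p)) (%t. fst (cspl p q t))"
 by (rule cube_continuous)
 (use cspl_in in \<open>auto simp: cspl_def intro!: continuous_map_if_const continuous_map_product_projection\<close>)
 moreover have "continuous_map (rsub (cube (p + q))) (rsub (cube q)) (%t. snd (cspl p q t))"
 by (rule cube_continuous)
 (use cspl_in in \<open>auto simp: cspl_def intro!: continuous_map_if_const continuous_map_product_projection\<close>)
 ultimately show ?thesis
 by (simp add: continuous_map_pairwise o_def)
qed

lemma nop_cube_bd: "nop (cube (p - 1)) (cube_bd p) x = cube_boundary p x"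
proof (induction x rule: frag_induct)
 case (one c)
 have "restrict (c o restrict (cins i (real e)) (cube (p - 1))) (cube (p - 1)) = cube_face p i e c" for i e
 by (auto simp: cube_face_def cins_def)
 then show ?case
 by (simp only: nop_of cube_bd_def push_sum push_cmul push_of cube_boundary_def frag_extend_of)
qed (simp_all add: nop_diff cube_boundary_def frag_extend_diff)

lemma cbd_gen:
 "cube_boundary p (cube_gen p f) = (\<Sum>i<p. \<Sum>e\<in>{0, 1}. frag_cmul ((- 1) ^ (Suc i + e))
 (cube_gen (p - 1) (%t. f (cins i (real e) t))))"
proof -
 have "cube_face p i e (restrict f (cube p)) = restrict (%t. f (cins i (real e) t)) (cube (p - 1))"
 if "i < p" "e : {0, 1}" for i e
 using that cins_in[of i p "real e"] by (auto simp: cube_face_def cins_def[abs_def] restrict_def)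
 then show ?thesis
 by (auto simp: cube_boundary_def simp del: sum.insert intro!: sum.cong)
qed

lemma cube_bd_in: "cube_bd p : chains_on (cube (p - 1)) (rsub (cube p))"
 unfolding cube_bd_def by (intro chains_sum chains_cmul) (auto intro!: maps_on_restrict cins_continuous simp del: One_nat_def)

lemma cube_boundary_bd: "cube_boundary (p - 1) (cube_bd p) = 0"
proof -
 let ?A = "({..<p} \<times> {0, 1 :: nat}) \<times> ({..<p - 1} \<times> {0, 1 :: nat})"
 define F where "F = (%((i, e), (j, f)). frag_cmul ((- 1) ^ (Suc i + e) * (- 1) ^ (Suc j + f))
 (cube_gen (p - 1 - 1) (%t. cins i (real e) (cins j (real f) t))))"
 \<comment> \<open>Exchanges the two insertions by the cubical identity. One of the indices shifts
   by one in the exchange, which reverses the sign.\<close>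
 define \<phi> where "\<phi> = (%((i, e), (j, f)). if j < i then ((j, f), (i - 1, e)) else ((Suc j, f), (i, e :: nat)) :: (nat \<times> nat) \<times> (nat \<times> nat))"
 have "cube_boundary (p - 1) (cube_bd p) = (\<Sum>i<p. \<Sum>e\<in>{0, 1}. frag_cmul ((- 1) ^ (Suc i + e))
 (cube_boundary (p - 1) (cube_gen (p - 1) (cins i (real e)))))"
 unfolding nop_cube_bd[symmetric] cube_bd_def[of p] nop_sum nop_cmul ..
 also have "... = (\<Sum>x\<in>?A. F x)"
 unfolding cbd_gen frag_cmul_sum frag_cmul_cmul
 by (simp only: sum.cartesian_product' F_def prod.case)
 also have "... = 0"
 proof (rule frag_sum_involution[where \<phi> = \<phi>])
 fix x assume x: "x : ?A"
 obtain i e j f where [simp]: "x = ((i, e), (j, f))" by (metis prod.collapse)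
 have ij: "i < p" "j < p - 1" using x by auto
 show "\<phi> x : ?A" using x by (auto simp: \<phi>_def)
 show "\<phi> (\<phi> x) = x" by (auto simp: \<phi>_def)
 show "F (\<phi> x) = - F x"
 proof (cases "j < i")
 case True
 obtain k where "i = Suc k" using True by (cases i) auto
 moreover from this have "cins j (real f) (cins k (real e) t) = cins i (real e) (cins j (real f) t)" for t
 using True by (simp add: cins_insert)
 ultimately show ?thesis using True by (simp add: \<phi>_def F_def power_add mult_ac)
 next
 case False
 have "cins (Suc j) (real f) (cins i (real e) t) = cins i (real e) (cins j (real f) t)" for t
 using False by (simp add: cins_insert)
 then show ?thesis using False by (simp add: \<phi>_def F_def power_add mult_ac)
 qed
 qed
 finally show ?thesis .
qed

lemma cube_pr_in: "cube_pr p q : chains_on (cube (p + q)) (prod_topology (rsub (cube p)) (rsub (cube q)))"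
 by (simp add: cube_pr_def maps_on_restrict cspl_continuous)

lemma nop2_cpr:
 "nop2 (cube (p + q)) (cube_pr p q) (cube_gen p f) (cube_gen q f') =
 cube_gen (p + q) (%t. (f (fst (cspl p q t)), f' (snd (cspl p q t))))"
 unfolding nop2_of cube_pr_def push_cube_gen
 by (rule cube_gen_eqI) (simp add: map_prod_def case_prod_unfold cspl_in)

text \<open>The first \<open>p\<close> directions are those of the first factor, the others those of
  the second; renumbering the latter produces the sign \<open>(- 1) ^ p\<close>.\<close>

lemma cube_leibniz:
 "nop (cube (p + q - 1)) (cube_bd (p + q)) (cube_pr p q) =
 nop2 (cube (p + q - 1)) (cube_pr (p - 1) q) (cube_bd p) (universal (cube q)) +
 frag_cmul ((- 1) ^ p) (nop2 (cube (p + q - 1)) (cube_pr p (q - 1)) (universal (cube p)) (cube_bd q))"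
proof -
 let ?D = "cube (p + q - 1)"
 let ?t = "%i e. frag_cmul ((- 1) ^ (Suc i + e)) (cube_gen (p + q - 1) (%t. cspl p q (cins i (real e) t)))"
 have "nop ?D (cube_bd (p + q)) (cube_pr p q) =
 (\<Sum>i<p. \<Sum>e\<in>{0, 1}. ?t i e) + (\<Sum>i<q. \<Sum>e\<in>{0, 1}. ?t (p + i) e)"
 unfolding nop_cube_bd unfolding cube_pr_def cbd_gen by (rule sum_lessThan_add)
 also have "(\<Sum>i<p. \<Sum>e\<in>{0, 1}. ?t i e) = nop2 ?D (cube_pr (p - 1) q) (cube_bd p) (universal (cube q))"
 unfolding cube_bd_def nop2_sum_left nop2_cmul_left universal_def
 proof (intro sum.cong refl arg_cong2[of _ _ _ _ frag_cmul])
 fix i e assume i: "i : {..<p}"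
 then have D: "?D = cube (p - 1 + q)" by (auto intro!: arg_cong[of _ _ cube])
 have "cspl p q (cins i (real e) t) = (cins i (real e) (fst (cspl (p - 1) q t)), snd (cspl (p - 1) q t))" for t
 using i by (auto simp: cspl_def cins_def fun_eq_iff)
 then show "cube_gen (p + q - 1) (%t. cspl p q (cins i (real e) t)) =
 nop2 ?D (cube_pr (p - 1) q) (cube_gen (p - 1) (cins i (real e))) (cube_gen q id)"
 unfolding D nop2_cpr using i by (simp add: D)
 qed
 also have "(\<Sum>i<q. \<Sum>e\<in>{0, 1}. ?t (p + i) e) =
 frag_cmul ((- 1) ^ p) (nop2 ?D (cube_pr p (q - 1)) (universal (cube p)) (cube_bd q))"
 unfolding cube_bd_def nop2_sum_right nop2_cmul_right universal_def frag_cmul_sum frag_cmul_cmul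
 proof (intro sum.cong refl arg_cong2[of _ _ _ _ frag_cmul])
 fix i e assume i: "i : {..<q}"
 then have D: "?D = cube (p + (q - 1))" by (auto intro!: arg_cong[of _ _ cube])
 show "(- 1 :: int) ^ (Suc (p + i) + e) = (- 1) ^ p * (- 1) ^ (Suc i + e)"
 by (simp add: power_add)
 have "cspl p q (cins (p + i) (real e) t) = (fst (cspl p (q - 1) t), cins i (real e) (snd (cspl p (q - 1) t)))" for t
 using i by (auto simp: cspl_def cins_def fun_eq_iff)
 then show "cube_gen (p + q - 1) (%t. cspl p q (cins (p + i) (real e) t)) =
 nop2 ?D (cube_pr p (q - 1)) (cube_gen p id) (cube_gen (q - 1) (cins i (real e)))"
 unfolding D nop2_cpr using i by (simp add: D)
 qed
 finally show ?thesis .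
qed

section \<open>Degeneracy and ordering relations\<close>

lemma cube_rel_in: "cube_rel n \<subseteq> chains_on (cube n) (rsub (cube n))"
 by (auto simp: cube_rel_def intro!: chains_diff chains_cmul maps_on_restrict cube_zero_continuous
 cube_perm_continuous)

lemma cube_rel_push:
 assumes "continuous_map (rsub (cube n)) X f"
 shows "i < n ==> cube_gen n (%t. f (t(i := 0))) : relations (cube n) (cube_rel n) X"
 and "pp permutes {..<n} ==> cube_gen n f - frag_cmul (sign pp) (cube_gen n (%t. f (t o pp)))
 : relations (cube n) (cube_rel n) X"
proof -
 note gen = relations_gen[OF maps_on_restrict[OF assms], of _ "cube_rel n"]
 show "cube_gen n (%t. f (t(i := 0))) : relations (cube n) (cube_rel n) X" if "i < n"
 proof -
 have "cube_gen n (%t. restrict f (cube n) (t(i := 0))) = cube_gen n (%t. f (t(i := 0)))"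
 by (rule cube_gen_eqI) (simp add: cube_zero_in)
 moreover have "cube_gen n (%t. t(i := 0)) : cube_rel n" using that by (auto simp: cube_rel_def)
 ultimately show ?thesis using gen by (metis push_cube_gen)
 qed
 show "cube_gen n f - frag_cmul (sign pp) (cube_gen n (%t. f (t o pp))) : relations (cube n) (cube_rel n) X"
 if pp: "pp permutes {..<n}"
 proof -
 have "cube_gen n (%t. restrict f (cube n) (t o pp)) = cube_gen n (%t. f (t o pp))"
 "cube_gen n (%t. restrict f (cube n) t) = cube_gen n f"
 by (rule cube_gen_eqI; simp add: cube_perm_in pp)+
 then have "push (cube n) (restrict f (cube n)) (cube_gen n (%t. t) - frag_cmul (sign pp) (cube_gen n (%t. t o pp))) =
 cube_gen n f - frag_cmul (sign pp) (cube_gen n (%t. f (t o pp)))"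
 by (simp only: push_diff push_cmul push_cube_gen)
 moreover have "cube_gen n (%t. t) - frag_cmul (sign pp) (cube_gen n (%t. t o pp)) : cube_rel n"
 using pp by (auto simp: cube_rel_def)
 ultimately show ?thesis using gen by metis
 qed
qed

text \<open>For a degenerate cube the two faces in its direction cancel, and the others stay
  degenerate. For a permuted cube, the face in direction \<open>pp l\<close> is a permutation of the
  face in direction \<open>l\<close>; \<open>sign_pins\<close> matches the signs.\<close>

lemma cube_rel_bd:
 assumes "r : cube_rel p"
 shows "cube_boundary p r : relations (cube (p - 1)) (cube_rel (p - 1)) (rsub (cube p))"
 using assms unfolding cube_rel_def[of p]
proof (elim UnE CollectE exE conjE)
 fix i assume r: "r = cube_gen p (%t. t(i := 0))" and i: "i < p"
 let ?F = "%k. \<Sum>e\<in>{0, 1}. frag_cmul ((- 1) ^ (Suc k + e)) (cube_gen (p - 1) (%t. (cins k (real e) t)(i := 0)))"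
 have "?F k : relations (cube (p - 1)) (cube_rel (p - 1)) (rsub (cube p))" if k: "k < p" for k
 proof (cases "k = i")
 case True
 have "(cins k (real e) t)(i := 0) = cins i 0 t" for e t
 using True by (auto simp: cins_def)
 then have "?F k = 0" by (simp add: True flip: frag_cmul_distrib)
 then show ?thesis by simp
 next
 case False
 let ?i = "if i < k then i else i - 1"
 have "(cins k (real e) t)(i := 0) = cins k (real e) (t(?i := 0))" for e t
 using False by (auto simp: cins_def fun_eq_iff)
 moreover have "?i < p - 1" using i k False by auto
 ultimately show ?thesis
 using k by (auto intro!: relations_sum relations_cmul cube_rel_push cins_continuous simp del: sum.insert One_nat_def)
 qed
 then show ?thesis
 unfolding r cbd_gen by (intro relations_sum[where I = "{..<p}"]) (simp only: lessThan_iff)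
next
 fix pp assume r: "r = cube_gen p (%t. t) - frag_cmul (sign pp) (cube_gen p (%t. t o pp))" and pp: "pp permutes {..<p}"
 let ?t = "%l e. cube_gen (p - 1) (cins l (real e))"
 let ?s = "%l e. cube_gen (p - 1) (%t. cins (pp l) (real e) t o pp)"
 have bd: "cube_boundary p r = cube_boundary p (cube_gen p (%t. t)) - frag_cmul (sign pp) (cube_boundary p (cube_gen p (%t. t o pp)))"
 unfolding r cube_boundary_def by (simp only: frag_extend_diff frag_extend_cmul)
 \<comment> \<open>The sum is indexed by \<open>pp l\<close>, so that each face of the permuted cube
   meets the face of the cube it permutes.\<close>
 have "cube_boundary p (cube_gen p (%t. t o pp)) = (\<Sum>l<p. \<Sum>e\<in>{0, 1}. frag_cmul ((- 1) ^ (Suc (pp l) + e)) (?s l e))"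
 unfolding cbd_gen by (subst sum.permute[OF pp]) (simp only: o_def)
 then have "cube_boundary p r = (\<Sum>l<p. \<Sum>e\<in>{0, 1}. frag_cmul ((- 1) ^ (Suc l + e)) (?t l e) -
 frag_cmul (sign pp * (- 1) ^ (Suc (pp l) + e)) (?s l e))"
 unfolding bd cbd_gen by (simp only: sum_subtractf frag_cmul_sum frag_cmul_cmul)
 moreover have "frag_cmul ((- 1) ^ (Suc l + e)) (?t l e) - frag_cmul (sign pp * (- 1) ^ (Suc (pp l) + e)) (?s l e)
 : relations (cube (p - 1)) (cube_rel (p - 1)) (rsub (cube p))" if l: "l < p" and e: "e : {0, 1}" for l e
 proof -
 obtain n where n: "p = Suc n" using l by (cases p) auto
 obtain pp' where pp': "pp' permutes {..<n}" "pp = pins l (pp l) pp'"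
 using perm_insertE[of pp n l "pp l"] pp l n by auto
 have pl: "pp l <= n" using permutes_in_image[OF pp, of l] l n by simp
 have "cins (pp l) (real e) t o pp = cins l (real e) (t o pp')" for t
 proof
 fix j show "(cins (pp l) (real e) t o pp) j = cins l (real e) (t o pp') j"
 proof (cases j l rule: skip_cases)
 case (2 y)
 have "pp j = skip (pp l) (pp' y)" using pins_skip[of l "pp l" pp' y] 2 pp'(2) by simp
 then show ?thesis by (auto simp: 2 cins_def skip_def)
 qed (simp add: cins_def)
 qed
 moreover have "sign pp * (- 1) ^ (Suc (pp l) + e) = (- 1) ^ (Suc l + e) * sign pp'"
 proof -
 have "sign pp = (- 1) ^ (l + pp l) * sign pp'"
 using sign_pins[OF pp'(1), of l "pp l"] pp'(2) l n pl by simp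
 then show ?thesis
 by (simp add: power_add)
 qed
 moreover have "cube_gen (p - 1) (cins l (real e)) - frag_cmul (sign pp') (cube_gen (p - 1) (%t. cins l (real e) (t o pp')))
 : relations (cube (p - 1)) (cube_rel (p - 1)) (rsub (cube p))"
 using l e pp'(1) n by (intro cube_rel_push(2) cins_continuous) auto
 note relations_cmul[OF this, of "(- 1) ^ (Suc l + e)"]
 ultimately show ?thesis
 by (simp add: frag_cmul_diff_distrib2 del: power_Suc)
 qed
 ultimately show ?thesis
 by (auto intro!: relations_sum simp del: sum.insert power_Suc)
qed

text \<open>A degenerate direction of a factor is one of the product, and a permutation of its
  coordinates extends by the identity without change of sign.\<close>

lemma cube_rel_pr_left:
 assumes "r : cube_rel p"
 shows "nop2 (cube (p + q)) (cube_pr p q) r (universal (cube q))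
 : relations (cube (p + q)) (cube_rel (p + q)) (prod_topology (rsub (cube p)) (rsub (cube q)))"
 using assms unfolding cube_rel_def[of p]
proof (elim UnE CollectE exE conjE)
 fix i assume r: "r = cube_gen p (%t. t(i := 0))" and i: "i < p"
 have "nop2 (cube (p + q)) (cube_pr p q) r (universal (cube q)) = cube_gen (p + q) (%t. cspl p q (t(i := 0)))"
 unfolding r universal_def nop2_cpr
 by (rule cube_gen_eqI) (use i in \<open>auto simp: cspl_def fun_eq_iff\<close>)
 then show ?thesis
 using cube_rel_push(1)[OF cspl_continuous, of i p q] i by simp
next
 fix pp assume r: "r = cube_gen p (%t. t) - frag_cmul (sign pp) (cube_gen p (%t. t o pp))" and pp: "pp permutes {..<p}"
 have less: "pp x < p \<longleftrightarrow> x < p" for x using permutes_in_image[OF pp, of x] by simp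
 have 1: "(fst (cspl p q t) o pp, id (snd (cspl p q t))) = cspl p q (t o perm_sum p pp id)" for t
 by (auto simp: cspl_def perm_sum_def fun_eq_iff less)
 have "nop2 (cube (p + q)) (cube_pr p q) r (universal (cube q)) = cube_gen (p + q) (cspl p q) -
 frag_cmul (sign pp) (cube_gen (p + q) (%t. cspl p q (t o perm_sum p pp id)))"
 unfolding r universal_def nop2_diff_left nop2_cmul_left nop2_cpr 1 by simp
 then show ?thesis
 using cube_rel_push(2)[OF cspl_continuous perm_sum_permutes[OF pp permutes_id, of q]]
 sign_perm_sum[OF pp permutes_id] by simp
qed

lemma cube_rel_pr_right:
 assumes "r : cube_rel p"
 shows "nop2 (cube (q + p)) (cube_pr q p) (universal (cube q)) r
 : relations (cube (q + p)) (cube_rel (q + p)) (prod_topology (rsub (cube q)) (rsub (cube p)))"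
 using assms unfolding cube_rel_def[of p]
proof (elim UnE CollectE exE conjE)
 fix i assume r: "r = cube_gen p (%t. t(i := 0))" and i: "i < p"
 have "nop2 (cube (q + p)) (cube_pr q p) (universal (cube q)) r = cube_gen (q + p) (%t. cspl q p (t(q + i := 0)))"
 unfolding r universal_def nop2_cpr
 by (rule cube_gen_eqI) (use i in \<open>auto simp: cspl_def fun_eq_iff\<close>)
 then show ?thesis
 using cube_rel_push(1)[OF cspl_continuous, of "q + i" q p] i by simp
next
 fix pp assume r: "r = cube_gen p (%t. t) - frag_cmul (sign pp) (cube_gen p (%t. t o pp))" and pp: "pp permutes {..<p}"
 have less: "pp x < p \<longleftrightarrow> x < p" for x using permutes_in_image[OF pp, of x] by simp
 have 1: "(id (fst (cspl q p t)), snd (cspl q p t) o pp) = cspl q p (t o perm_sum q id pp)" for t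
 by (auto simp: cspl_def perm_sum_def fun_eq_iff less)
 have "nop2 (cube (q + p)) (cube_pr q p) (universal (cube q)) r = cube_gen (q + p) (cspl q p) -
 frag_cmul (sign pp) (cube_gen (q + p) (%t. cspl q p (t o perm_sum q id pp)))"
 unfolding r universal_def nop2_diff_right nop2_cmul_right nop2_cpr 1 by simp
 then show ?thesis
 using cube_rel_push(2)[OF cspl_continuous perm_sum_permutes[OF permutes_id pp, of q]]
 sign_perm_sum[OF permutes_id pp] by simp
qed

text \<open>Exchanging the factors permutes the coordinates by \<open>bswap\<close>, whose sign is
  \<open>(- 1) ^ (p * q)\<close>, so the defect is an ordering relation.\<close>

lemma cube_pr_swap:
 "push (cube (p + q)) prod.swap (cube_pr p q) - frag_cmul ((- 1) ^ (p * q)) (cube_pr q p)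
 : relations (cube (p + q)) (cube_rel (p + q)) (prod_topology (rsub (cube q)) (rsub (cube p)))"
proof -
 have D: "cube (q + p) = cube (p + q)" by (simp add: add.commute)
 let ?u = "push (cube (p + q)) prod.swap (cube_pr p q)"
 have "prod.swap (cspl p q t) = cspl q p (t o bswap p q)" for t
 by (auto simp: cspl_def bswap_def fun_eq_iff)
 then have u: "?u = cube_gen (q + p) (%t. cspl q p (t o bswap p q))"
 unfolding cube_pr_def push_cube_gen by (simp add: D)
 have "bswap p q permutes {..<q + p}" using bswap_permutes[of p q] by (simp add: add.commute)
 then have "cube_pr q p - frag_cmul ((- 1) ^ (p * q)) ?u \<in>
 relations (cube (q + p)) (cube_rel (q + p)) (prod_topology (rsub (cube q)) (rsub (cube p)))"
 using cube_rel_push(2)[OF cspl_continuous, of "bswap p q" q p] unfolding u by (simp add: cube_pr_def sign_bswap)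
 note rel = relations_cmul[OF this, of "- ((- 1) ^ (p * q))"]
 have one: "(- 1 :: int) ^ (p * q) * (- 1) ^ (p * q) = 1" by (simp flip: power_mult_distrib)
 have "?u - frag_cmul ((- 1) ^ (p * q)) (cube_pr q p) = frag_cmul (- ((- 1) ^ (p * q))) (cube_pr q p - frag_cmul ((- 1) ^ (p * q)) ?u)"
 by (rule poly_mapping_eqI) (simp add: lookup_minus right_diff_distrib mult.assoc[symmetric] one)
 with rel show ?thesis by (simp add: D add.commute)
qed

text \<open>For a degenerate cube the identity serves, zeroing a coordinate being idempotent. For an
  ordering relation \<open>e\<close> is the identity or the inverse permutation, according to which
  of the two terms \<open>k\<close> is.\<close>

lemma cube_rel_keys:
 assumes "r : cube_rel p" "k : Poly_Mapping.keys r"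
 shows "\<exists>e\<in>maps_on (cube p) (rsub (cube p)). push (cube p) (k o e) r = r"
 using assms(1) unfolding cube_rel_def
proof (elim UnE CollectE exE conjE)
 fix i assume r: "r = cube_gen p (%t. t(i := 0))"
 have "push (cube p) (k o restrict id (cube p)) r = r"
 using assms(2) unfolding r push_cube_gen by (intro cube_gen_eqI) (simp add: cube_zero_in)
 then show ?thesis
 by (intro bexI[of _ "restrict id (cube p)"]) (simp_all add: maps_on_restrict)
next
 fix pp assume r: "r = cube_gen p (%t. t) - frag_cmul (sign pp) (cube_gen p (%t. t o pp))" and pp: "pp permutes {..<p}"
 have "k = restrict (%t. t) (cube p) \<or> k = restrict (%t. t o pp) (cube p)"
 using assms(2) keys_diff[of "cube_gen p (%t. t)" "frag_cmul (sign pp) (cube_gen p (%t. t o pp))"]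
 keys_cmul[of "sign pp" "cube_gen p (%t. t o pp)"] by (auto simp: r)
 then show ?thesis
 proof
 assume k: "k = restrict (%t. t) (cube p)"
 have "push (cube p) (k o restrict id (cube p)) r = r"
 unfolding r k push_diff push_cmul push_cube_gen
 by (intro arg_cong2[of _ _ _ _ "(-)"] arg_cong[of _ _ "frag_cmul _"] cube_gen_eqI) (simp_all add: cube_perm_in pp)
 then show ?thesis
 by (intro bexI[of _ "restrict id (cube p)"]) (simp_all add: maps_on_restrict)
 next
 assume k: "k = restrict (%t. t o pp) (cube p)"
 let ?e = "restrict (%t. t o inv_into UNIV pp) (cube p)"
 note inv = permutes_inv[OF pp]
 have "t o inv_into UNIV pp o pp = t" for t :: "point"
 using permutes_inverses(2)[OF pp] by (simp add: fun_eq_iff)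
 then have "push (cube p) (k o ?e) r = r"
 unfolding r k push_diff push_cmul push_cube_gen
 by (intro arg_cong2[of _ _ _ _ "(-)"] arg_cong[of _ _ "frag_cmul _"] cube_gen_eqI) (simp_all add: cube_perm_in pp inv)
 then show ?thesis
 by (intro bexI[of _ ?e]) (simp_all add: maps_on_restrict cube_perm_continuous inv)
 qed
qed

lemma cube_model: "chain_model cube (%_. 0) cube_bd cube_pr cube_rel"
proof
 fix p q s
 show "cube 0 = {%_. 0}" by (auto simp: unit_cube_def)
 show "cube_bd 0 = 0" by (simp add: cube_bd_def)
 show "nop (cube (p - 1 - 1)) (cube_bd (p - 1)) (cube_bd p) = 0"
 unfolding nop_cube_bd by (rule cube_boundary_bd)
 show "push (cube (p + q + s)) (%((a, b), c). (a, (b, c)))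
 (nop2 (cube (p + q + s)) (cube_pr (p + q) s) (cube_pr p q) (universal (cube s))) =
 nop2 (cube (p + q + s)) (cube_pr p (q + s)) (universal (cube p)) (cube_pr q s)"
 proof -
 have D: "cube (p + q + s) = cube (p + (q + s))" by (simp add: add.assoc)
 show ?thesis
 unfolding universal_def cube_pr_def[of p q] cube_pr_def[of q s] nop2_cpr push_cube_gen
 unfolding D nop2_cpr
 by (rule cube_gen_eqI) (auto simp: fun_eq_iff cspl_def add.assoc)
 qed
 show "cube_pr p 0 = frag_of (\<lambda>t\<in>cube p. (t, %_. 0))" "cube_pr 0 p = frag_of (\<lambda>t\<in>cube p. (%_. 0, t))"
 by (auto simp: cube_pr_def cspl_def unit_cube_def fun_eq_iff not_less intro!: arg_cong[of _ _ frag_of] restrict_ext)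
qed (simp_all only: cube_bd_in cube_pr_in cube_leibniz[unfolded nop_cube_bd] cube_pr_swap cube_rel_in nop_cube_bd cube_rel_bd
 cube_rel_pr_left cube_rel_pr_right cube_rel_keys)

section \<open>The functor of ordered cubical chains\<close>

text \<open>The preimage of the subgroup generated by the classes of \<open>B\<close> is generated
  by \<open>A\<close> and \<open>B\<close> together. Dividing out degeneracies and afterwards the
  ordering relations is thus one quotient.\<close>

lemma (in comm_group) double_quotient:
 assumes A: "A \<subseteq> carrier G" and B: "B \<subseteq> carrier G"
 defines "N \<equiv> generate G A"
 defines "Q \<equiv> G Mod N"
 defines "M \<equiv> generate Q ((%b. N #> b) ` B)"
 defines "cl \<equiv> %x. M #>\<^bsub>Q\<^esub> (N #> x)"
 shows "comm_group (Q Mod M)" "carrier (Q Mod M) = cl ` carrier G"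
 and "x : carrier G ==> y : carrier G ==> cl (x \<otimes> y) = cl x \<otimes>\<^bsub>Q Mod M\<^esub> cl y"
 and "x : carrier G ==> cl x = \<one>\<^bsub>Q Mod M\<^esub> \<longleftrightarrow> x : generate G (A \<union> B)"
proof -
 have N: "subgroup N G" unfolding N_def by (rule generate_is_subgroup[OF A])
 interpret N: normal N G by (rule subgroup_imp_normal[OF N])
 interpret Q: comm_group Q unfolding Q_def by (rule abelian_FactGroup[OF N])
 have hN: "(%x. N #> x) : hom G Q" unfolding Q_def by (rule N.r_coset_hom_Mod)
 then interpret hN: group_hom G Q "%x. N #> x" by (unfold_locales)
 have carQ: "carrier Q = (%x. N #> x) ` carrier G" by (auto simp: Q_def FactGroup_def RCOSETS_def)
 have B': "(%b. N #> b) ` B \<subseteq> carrier Q" using B by (auto simp: carQ)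
 have M: "subgroup M Q" unfolding M_def by (rule Q.generate_is_subgroup[OF B'])
 interpret M: normal M Q by (rule Q.subgroup_imp_normal[OF M])
 show comm: "comm_group (Q Mod M)" by (rule Q.abelian_FactGroup[OF M])
 have hM: "(%X. M #>\<^bsub>Q\<^esub> X) : hom Q (Q Mod M)" by (rule M.r_coset_hom_Mod)
 have "cl : hom G (Q Mod M)"
 using hN hM by (auto simp: cl_def hom_def Pi_def)
 then interpret cl: group_hom G "Q Mod M" cl
 using comm by (simp add: group_hom_def group_hom_axioms_def comm_group_def)
 show "carrier (Q Mod M) = cl ` carrier G"
 by (auto simp: cl_def FactGroup_def RCOSETS_def carQ)
 show "cl (x \<otimes> y) = cl x \<otimes>\<^bsub>Q Mod M\<^esub> cl y" if "x : carrier G" "y : carrier G"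
 using that by simp
 show "cl x = \<one>\<^bsub>Q Mod M\<^esub> \<longleftrightarrow> x : generate G (A \<union> B)" if x: "x : carrier G"
 proof
 assume "cl x = \<one>\<^bsub>Q Mod M\<^esub>"
 then have "N #> x : M"
 using Q.coset_join1[OF _ _ M, of "N #> x"] x by (simp add: cl_def FactGroup_def[of Q])
 then obtain b where b: "b : generate G B" "N #> x = N #> b"
 unfolding M_def hN.generate_img[OF B] by auto
 have bc: "b : carrier G" using b(1) generate_in_carrier[OF B] by blast
 have "x : N #> b" using b(2) rcos_self[OF x N] by simp
 then obtain a where a: "a : N" "x = a \<otimes> b" by (auto simp: r_coset_def)
 have "a : generate G (A \<union> B)" "b : generate G (A \<union> B)"
 using a(1) b(1) mono_generate[of A "A \<union> B"] mono_generate[of B "A \<union> B"] by (auto simp: N_def)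
 then show "x : generate G (A \<union> B)" unfolding a(2) by (rule generate.eng)
 next
 have "A \<union> B \<subseteq> kernel G (Q Mod M) cl"
 proof
 fix z assume z: "z : A \<union> B"
 then have zc: "z : carrier G" using A B by auto
 have "N #> z : M"
 proof (cases "z : A")
 case True
 then have "z : N" unfolding N_def by (rule generate.incl)
 then have "N #> z = N" by (rule coset_join2[OF zc N])
 then show ?thesis using subgroup.one_closed[OF M] by (simp add: Q_def FactGroup_def)
 next
 case False
 then show ?thesis using z by (auto simp: M_def intro: generate.incl)
 qed
 then have "cl z = M"
 unfolding cl_def using zc M by (intro Q.coset_join2) auto
 then show "z : kernel G (Q Mod M) cl" using zc by (simp add: kernel_def FactGroup_def[of Q])
 qed
 then have "generate G (A \<union> B) \<subseteq> kernel G (Q Mod M) cl"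
 by (rule generate_subgroup_incl[OF _ cl.subgroup_kernel])
 moreover assume "x : generate G (A \<union> B)"
 ultimately have "x : kernel G (Q Mod M) cl" by (rule subsetD)
 then show "cl x = \<one>\<^bsub>Q Mod M\<^esub>" unfolding kernel_def by blast
 qed
qed

text \<open>Passes from the multiplicative notation of the definitions to the additive closure by
  which \<open>relations\<close> is defined.\<close>

lemma generate_free_Abelian_group:
 assumes "S \<subseteq> carrier (free_Abelian_group B)"
 shows "generate (free_Abelian_group B) S = group_closure S"
proof (intro equalityI subsetI)
 fix x assume "x : generate (free_Abelian_group B) S"
 then show "x : group_closure S"
 proof induction
 case (inv h)
 then have "h : carrier (free_Abelian_group B)" using assms by blast
 then have "inv\<^bsub>free_Abelian_group B\<^esub> h = - h" by simp
 then show ?case using inv group_closure.base[of h S] by simp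
 qed (auto intro: group_closure.base group_closure_add)
next
 have sub: "subgroup (generate (free_Abelian_group B) S) (free_Abelian_group B)"
 by (rule group.generate_is_subgroup[OF group_free_Abelian_group assms])
 fix x assume "x : group_closure S"
 then show "x : generate (free_Abelian_group B) S"
 proof induction
 case (base s)
 then show ?case using generate.one[of "free_Abelian_group B" S] by (auto intro: generate.incl)
 next
 case (diff s t)
 then have "t : carrier (free_Abelian_group B)" using subgroup.subset[OF sub] by blast
 then have "inv\<^bsub>free_Abelian_group B\<^esub> t = - t" by simp
 then show ?case
 using subgroup.m_closed[OF sub diff(3) subgroup.m_inv_closed[OF sub diff(4)]] by simp
 qed
qed

lemma cube_set_eq: "0 <= n ==> cube_set n X = maps_on (cube (nat n)) X" "n < 0 ==> cube_set n X = {}"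
 by (auto simp: cube_set_def singular_cube_def maps_on_def)

definition cchains :: "int => 'a topology => 'a chain set" where
 "cchains n X = (if n < 0 then {0} else chains_on (cube (nat n)) X)"

lemma carrier_cube_group: "carrier (cube_group n X) = cchains n X"
 by (auto simp: cube_group_def cchains_def cube_set_eq chains_on_def free_Abelian_group_def)

text \<open>Two points that differ only in coordinate \<open>i\<close> become equal when it is set
  to 0, and the cube contains the result.\<close>

lemma degenerate_cube_iff:
 assumes "c : extensional (cube n)"
 shows "degenerate_cube n c \<longleftrightarrow> (\<exists>i<n. restrict (%t. c (t(i := 0))) (cube n) = c)"
 unfolding degenerate_cube_def
proof (intro ex_cong conj_cong refl iffI)
 fix i assume i: "i < n"
 {
 assume *: "\<forall>s\<in>cube n. \<forall>t\<in>cube n. (\<forall>j. j ~= i --> s j = t j) --> c s = c t"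
 show "restrict (%t. c (t(i := 0))) (cube n) = c"
 proof (rule extensionalityI[OF restrict_extensional assms])
 fix t assume t: "t : cube n"
 have "c (t(i := 0)) = c t" using *[rule_format, OF cube_zero_in[OF t] t] by simp
 then show "restrict (%t. c (t(i := 0))) (cube n) t = c t" using t by simp
 qed
 next
 assume *: "restrict (%t. c (t(i := 0))) (cube n) = c"
 show "\<forall>s\<in>cube n. \<forall>t\<in>cube n. (\<forall>j. j ~= i --> s j = t j) --> c s = c t"
 proof (intro ballI impI)
 fix s t assume st: "s : cube n" "t : cube n" "\<forall>j. j ~= i --> s j = t j"
 then have "s(i := 0) = t(i := 0)" by auto
 then show "c s = c t" using st(1,2) fun_cong[OF *, of s] fun_cong[OF *, of t] by (metis restrict_apply')
 qed
 }
qed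

lemma cube_relations_eq:
 assumes "0 <= n"
 shows "relations (cube (nat n)) (cube_rel (nat n)) X = group_closure
 (frag_of ` {c : cube_set n X. degenerate_cube (nat n) c} \<union>
 {frag_of c - permuted_cube (nat n) pp c | c pp. c : cube_set n X & pp permutes {..<nat n}})"
proof -
 let ?n = "nat n"
 have zero: "push (cube ?n) c (cube_gen ?n (%t. t(i := 0))) = cube_gen ?n (%t. c (t(i := 0)))" for c :: "_ => 'a" and i
 by (rule push_cube_gen)
 have perm: "push (cube ?n) c (cube_gen ?n (%t. t) - frag_cmul (sign pp) (cube_gen ?n (%t. t o pp))) =
 frag_of c - permuted_cube ?n pp c" if "c : maps_on (cube ?n) X" for c pp
 proof -
 have "restrict c (cube ?n) = c" using that by (simp add: maps_on_def extensional_restrict)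
 then show ?thesis by (simp only: push_diff push_cmul push_cube_gen permuted_cube_def o_def)
 qed
 have "{push (cube ?n) c r | c r. c : maps_on (cube ?n) X & r : cube_rel ?n} =
 frag_of ` {c : maps_on (cube ?n) X. degenerate_cube ?n c} \<union>
 {frag_of c - permuted_cube ?n pp c | c pp. c : maps_on (cube ?n) X & pp permutes {..<?n}}"
 proof (intro equalityI subsetI; (elim UnE CollectE exE conjE imageE)?)
 fix x c r assume x: "x = push (cube ?n) c r" and c: "c : maps_on (cube ?n) X" and r: "r : cube_rel ?n"
 from r consider i where "i < ?n" "r = cube_gen ?n (%t. t(i := 0))"
 | pp where "pp permutes {..<?n}" "r = cube_gen ?n (%t. t) - frag_cmul (sign pp) (cube_gen ?n (%t. t o pp))"
 by (auto simp: cube_rel_def)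
 then show "x : frag_of ` {c : maps_on (cube ?n) X. degenerate_cube ?n c} \<union>
 {frag_of c - permuted_cube ?n pp c | c pp. c : maps_on (cube ?n) X & pp permutes {..<?n}}"
 proof cases
 case 1
 let ?c = "restrict (%t. c (t(i := 0))) (cube ?n)"
 have "?c : maps_on (cube ?n) X"
 using continuous_map_compose[OF cube_zero_continuous maps_on_continuous[OF c]] by (intro maps_on_restrict) (simp add: o_def)
 moreover have "degenerate_cube ?n ?c"
 using 1(1) by (subst degenerate_cube_iff) (auto intro!: exI[of _ i] simp: cube_zero_in)
 ultimately show ?thesis unfolding x 1(2) zero by blast
 next
 case 2
 then show ?thesis unfolding x 2(2) perm[OF c] using c by blast
 qed
 next
 fix x c assume x: "x = frag_of c" and c: "c : maps_on (cube ?n) X" "degenerate_cube ?n c"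
 then obtain i where "i < ?n" "restrict (%t. c (t(i := 0))) (cube ?n) = c"
 using degenerate_cube_iff[of c ?n] by (auto simp: maps_on_def)
 then show "x : {push (cube ?n) c r | c r. c : maps_on (cube ?n) X & r : cube_rel ?n}"
 using x c zero[of c i] by (intro CollectI exI[of _ c] exI[of _ "cube_gen ?n (%t. t(i := 0))"]) (auto simp: cube_rel_def)
 next
 fix x c pp assume "x = frag_of c - permuted_cube ?n pp c" "c : maps_on (cube ?n) X" "pp permutes {..<?n}"
 then show "x : {push (cube ?n) c r | c r. c : maps_on (cube ?n) X & r : cube_rel ?n}"
 using perm[of c pp] by (intro CollectI exI[of _ c] exI[of _ "cube_gen ?n (%t. t) - frag_cmul (sign pp) (cube_gen ?n (%t. t o pp))"])
 (auto simp: cube_rel_def)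
 qed
 then show ?thesis
 by (simp add: relations_def cube_set_eq(1)[OF assms])
qed

text \<open>The disjunct \<open>x = 0\<close> covers negative degrees, for which
  \<open>nat n\<close> would refer to the relations of degree 0.\<close>

definition crelation :: "int => 'a chain => 'a topology => bool" where
 "crelation n x X \<longleftrightarrow> x = 0 \<or> 0 <= n & x : relations (cube (nat n)) (cube_rel (nat n)) X"

lemma ord_group:
 shows "comm_group (ord_group n X)" "carrier (ord_group n X) = ord_class n X ` cchains n X"
 and "x : cchains n X ==> y : cchains n X ==>
 ord_class n X (x + y) = ord_class n X x \<otimes>\<^bsub>ord_group n X\<^esub> ord_class n X y"
 and "x : cchains n X ==> ord_class n X x = \<one>\<^bsub>ord_group n X\<^esub> \<longleftrightarrow> crelation n x X"
proof -
 let ?G = "cube_group n X"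
 let ?A = "frag_of ` {c : cube_set n X. degenerate_cube (nat n) c}"
 let ?B = "{frag_of c - permuted_cube (nat n) pp c | c pp. c : cube_set n X & pp permutes {..<nat n}}"
 interpret G: comm_group ?G unfolding cube_group_def by (rule abelian_free_Abelian_group)
 have per: "permuted_cube (nat n) pp c : carrier ?G" if "c : cube_set n X" "pp permutes {..<nat n}" for c pp
 proof -
 have n: "0 <= n" and c: "c : maps_on (cube (nat n)) X" using that(1) cube_set_eq[of n X] by (auto simp: cube_set_def)
 have "continuous_map (rsub (cube (nat n))) X (%t. c (%i. t (pp i)))"
 using continuous_map_compose[OF cube_perm_continuous[OF that(2)] maps_on_continuous[OF c]] by (simp add: o_def)
 then show ?thesis
 using n by (simp add: carrier_cube_group cchains_def permuted_cube_def chains_cmul maps_on_restrict)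
 qed
 have cs: "frag_of c : carrier ?G" if "c : cube_set n X" for c
 using that by (simp add: cube_group_def)
 have A: "?A \<subseteq> carrier ?G" using cs by auto
 have inv: "inv\<^bsub>?G\<^esub> x = - x" if "x : carrier ?G" for x
 using that by (simp add: cube_group_def)
 have diff: "x - y = x \<otimes>\<^bsub>?G\<^esub> inv\<^bsub>?G\<^esub> y" if "y : carrier ?G" for x y
 using that by (simp add: inv) (simp add: cube_group_def)
 have B: "?B \<subseteq> carrier ?G" using per cs by (auto simp: diff)
 have N: "degenerate_subgroup n X = generate ?G ?A" by (simp add: degenerate_subgroup_def)
 have sN: "subgroup (degenerate_subgroup n X) ?G" unfolding N by (rule G.generate_is_subgroup[OF A])
 interpret nN: normal "degenerate_subgroup n X" ?G by (rule G.subgroup_imp_normal[OF sN])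
 have Q: "cubical_group n X = ?G Mod generate ?G ?A" by (simp add: cubical_group_def N)
 have "cubical_class n X : hom ?G (cubical_group n X)"
 using nN.r_coset_hom_Mod by (simp add: cubical_class_def[abs_def] cubical_group_def)
 then interpret h: group_hom ?G "cubical_group n X" "cubical_class n X"
 using nN.factorgroup_is_group by (simp add: group_hom_def group_hom_axioms_def cubical_group_def)
 have eq: "cubical_class n X (frag_of c) \<otimes>\<^bsub>cubical_group n X\<^esub> inv\<^bsub>cubical_group n X\<^esub> cubical_class n X (permuted_cube (nat n) pp c) =
 cubical_class n X (frag_of c - permuted_cube (nat n) pp c)"
 if "c : cube_set n X" "pp permutes {..<nat n}" for c pp
 using that per cs by (simp add: diff)
 have "{cubical_class n X (frag_of c) \<otimes>\<^bsub>cubical_group n X\<^esub> inv\<^bsub>cubical_group n X\<^esub> cubical_class n X (permuted_cube (nat n) pp c)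
 | c pp. c : cube_set n X & pp permutes {..<nat n}} = {cubical_class n X (frag_of c - permuted_cube (nat n) pp c)
 | c pp. c : cube_set n X & pp permutes {..<nat n}}"
 using eq by (intro Collect_cong) metis
 also have "... = cubical_class n X ` ?B" by blast
 finally have gens: "order_subgroup n X = generate (cubical_group n X) (cubical_class n X ` ?B)"
 by (simp only: order_subgroup_def)
 have cc: "cubical_class n X = (%b. generate ?G ?A #>\<^bsub>?G\<^esub> b)"
 by (simp add: cubical_class_def[abs_def] N)
 have M: "order_subgroup n X = generate (?G Mod generate ?G ?A) ((%b. generate ?G ?A #>\<^bsub>?G\<^esub> b) ` ?B)"
 unfolding gens cc Q ..
 have cl: "ord_class n X x = order_subgroup n X #>\<^bsub>?G Mod generate ?G ?A\<^esub> (generate ?G ?A #>\<^bsub>?G\<^esub> x)" for x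
 by (simp add: ord_class_def cubical_class_def Q N)
 note dq = G.double_quotient[OF A B, folded M, folded cl Q, folded ord_group_def]
 show "comm_group (ord_group n X)" "carrier (ord_group n X) = ord_class n X ` cchains n X"
 using dq(1,2) by (simp_all add: carrier_cube_group)
 show "ord_class n X (x + y) = ord_class n X x \<otimes>\<^bsub>ord_group n X\<^esub> ord_class n X y"
 if "x : cchains n X" "y : cchains n X"
 using dq(3)[of x y] that by (simp add: carrier_cube_group) (simp add: cube_group_def)
 show "ord_class n X x = \<one>\<^bsub>ord_group n X\<^esub> \<longleftrightarrow> crelation n x X" if "x : cchains n X"
 proof -
 have "generate ?G (?A \<union> ?B) = group_closure (?A \<union> ?B)"
 using A B unfolding cube_group_def by (intro generate_free_Abelian_group) simp
 moreover have "x : group_closure (?A \<union> ?B) \<longleftrightarrow> crelation n x X"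
 proof (cases "0 <= n")
 case True
 then show ?thesis using relations_0 by (auto simp: crelation_def cube_relations_eq)
 next
 case False
 then show ?thesis using that by (simp add: crelation_def cchains_def)
 qed
 ultimately show ?thesis using dq(4)[of x] that by (simp add: carrier_cube_group)
 qed
qed

lemma ord_class_eq_iff:
 assumes "x : cchains n X" "y : cchains n X"
 shows "ord_class n X x = ord_class n X y \<longleftrightarrow> crelation n (x - y) X"
proof -
 interpret comm_group "ord_group n X" by (rule ord_group)
 have cl: "ord_class n X z : carrier (ord_group n X)" if "z : cchains n X" for z
 using that by (simp add: ord_group(2))
 have d: "x - y : cchains n X" using assms chains_diff by (auto simp: cchains_def)
 have "ord_class n X x = ord_class n X (x - y) \<otimes>\<^bsub>ord_group n X\<^esub> ord_class n X y"
 using ord_group(3)[OF d assms(2)] by simp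
 then have "ord_class n X x = ord_class n X y \<longleftrightarrow> ord_class n X (x - y) = \<one>\<^bsub>ord_group n X\<^esub>"
 using cl[OF d] cl[OF assms(2)] l_cancel_one' by (metis r_cancel_one l_cancel_one)
 then show ?thesis by (simp add: ord_group(4)[OF d])
qed

text \<open>The chosen representative is under control only up to relations, so every operation of
  the operad has to be independent of the choice.\<close>

lemma ord_rep:
 assumes "x : cchains n X"
 shows "ord_rep n X (ord_class n X x) : cchains n X" "crelation n (ord_rep n X (ord_class n X x) - x) X"
proof -
 have "ord_rep n X (ord_class n X x) : carrier (cube_group n X) & ord_class n X (ord_rep n X (ord_class n X x)) = ord_class n X x"
 unfolding ord_rep_def by (rule someI[where x = x]) (simp add: assms carrier_cube_group)
 then show *: "ord_rep n X (ord_class n X x) : cchains n X" "crelation n (ord_rep n X (ord_class n X x) - x) X"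
 using ord_class_eq_iff[OF _ assms] by (auto simp: carrier_cube_group)
qed

lemma push_cube: "push (cube n) f x = cube_map n f x"
 by (simp add: push_def cube_map_def)

lemma cube_product_eq: "cube_product p q x y = nop2 (cube (p + q)) (cube_pr p q) x y"
 unfolding cube_product_def nop2_def cube_pr_def push_cube_gen by (simp add: cspl_def)

lemma ord_operad_presented:
 fixes P :: "'a top_operad_data"
 assumes "top_operad P"
 shows "presented_operad cube (%_. 0) cube_bd cube_pr cube_rel P (ord_operad P) (%l n. ord_class n (tspace P l))"
proof -
 interpret operad_chains cube "%_. 0" cube_bd cube_pr cube_rel P
 by (rule operad_chains.intro[OF cube_model]) (unfold_locales, rule assms)
 have chz: "chz n X = cchains n X" for n and X :: "'a topology"
 by (simp add: chz_def cchains_def)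
 have bdry: "bdry n x = cube_boundary n x" for n and x :: "'a chain" unfolding bdry_def by (rule nop_cube_bd)
 have rel: "crelation n x X \<longleftrightarrow> x = 0 \<or> 0 <= n & x : Rel (nat n) X" for n x and X :: "'a topology"
 by (simp add: crelation_def)
 have rel0: "0 : Rel n X" for n and X :: "'a topology" by (rule relations_0)
 have mp_rel: "ord_class n Y (cube_map (nat n) f (ord_rep n X (ord_class n X x))) = ord_class n Y (mp (nat n) f x)"
 if x: "x : chz n X" and f: "continuous_map X Y f" for n x f and X Y :: "'a topology"
 proof -
 note r = ord_rep[of x n X, folded chz, OF x]
 have "crelation n (mp (nat n) f (ord_rep n X (ord_class n X x)) - mp (nat n) f x) Y"
 using r(2) mp_Rel[OF _ f] by (auto simp: rel push_diff[symmetric])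
 then show ?thesis
 using chz_mp[OF r(1) f] chz_mp[OF x f] by (subst ord_class_eq_iff) (simp_all add: chz push_cube)
 qed
 show ?thesis
 proof (intro presented_operad.intro presented_operad_axioms.intro operad_chains_axioms)
 fix l n and x y :: "'a chain"
 have grp: "dgrp (ord_operad P) l n = ord_group n (sp l)" by (simp add: ord_operad_def ord_complex_def)
 show "comm_group (dgrp (ord_operad P) l n)" "carrier (dgrp (ord_operad P) l n) = ord_class n (sp l) ` chz n (sp l)"
 by (simp_all add: grp ord_group chz)
 show "x : chz n (sp l) ==> y : chz n (sp l) ==>
 ord_class n (sp l) (x + y) = ord_class n (sp l) x \<otimes>\<^bsub>dgrp (ord_operad P) l n\<^esub> ord_class n (sp l) y"
 by (simp add: grp ord_group chz)
 show "x : chz n (sp l) ==> ord_class n (sp l) x = \<one>\<^bsub>dgrp (ord_operad P) l n\<^esub> \<longleftrightarrow> x = 0 \<or> 0 <= n & x : Rel (nat n) (sp l)"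
 by (simp add: grp ord_group chz rel)
 show "ddiff (ord_operad P) l n (ord_class n (sp l) x) = ord_class (n - 1) (sp l) (bdry (nat n) x)" if x: "x : chz n (sp l)"
 proof -
 note r = ord_rep[of x n "sp l", folded chz, OF x]
 let ?d = "bdry (nat n) (ord_rep n (sp l) (ord_class n (sp l) x)) - bdry (nat n) x"
 have "?d = bdry (nat n) (ord_rep n (sp l) (ord_class n (sp l) x) - x)" by (simp add: bdry_def nop_diff)
 moreover have "bdry (nat 0) z = 0" for z :: "'a chain" by (simp add: bdry cube_boundary_def)
 ultimately have "crelation (n - 1) ?d (sp l)"
 using r(2) bdry_Rel[of "ord_rep n (sp l) (ord_class n (sp l) x) - x" "nat n" "sp l"]
 by (cases "n = 0") (auto simp: rel bdry_def nat_minus_one)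
 then show ?thesis
 using ord_class_eq_iff[OF chz_bdry[OF r(1), unfolded chz] chz_bdry[OF x, unfolded chz]]
 by (simp add: ord_operad_def ord_complex_def bdry[symmetric])
 qed
 show "dact (ord_operad P) l n sgg (ord_class n (sp l) x) = ord_class n (sp l) (mp (nat n) (tact P l sgg) x)"
 if "1 <= l" "sgg permutes {..<l}" "x : chz n (sp l)" for sgg
 using mp_rel[OF that(3) act_continuous[OF that(1,2)]] by (simp add: ord_operad_def)
 next
 fix ms p qs x ys assume ms: "arity_list ms" and x: "x : chz p (sp (length ms))" and ys: "valid ms qs ys"
 let ?x = "ord_rep p (sp (length ms)) (ord_class p (sp (length ms)) x)"
 let ?y = "%i. ord_rep (qs ! i) (sp (ms ! i)) (ord_class (qs ! i) (sp (ms ! i)) (ys ! i))"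
 let ?ys = "map ?y [0..<length ms]"
 have y: "ys ! i : chz (qs ! i) (sp (ms ! i))" if "i < length ms" for i using ys that by (simp add: valid_def)
 have x': "?x : chz p (sp (length ms))" "crelation p (?x - x) (sp (length ms))"
 using ord_rep x by (simp_all add: chz)
 have y': "?y i : chz (qs ! i) (sp (ms ! i))" "crelation (qs ! i) (?y i - ys ! i) (sp (ms ! i))" if "i < length ms" for i
 using ord_rep y[OF that] by (simp_all add: chz)
 have ys': "valid ms qs ?ys" using y'(1) ys by (simp add: valid_def)
 have "rcomp ms p qs ?x ?ys = mp (nat p + sum_list (map nat qs)) (tc ms)
 (cube_products (nat p) (map nat qs) (sgl (nat p) ?x) ?ys)"
 by (rule rcomp_eq_iterated_product[OF _ _ x'(1) ys'])
 (simp_all add: push_cube prd_def cube_product_eq)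
 moreover have "map (%i. ord_rep (qs ! i) (sp (ms ! i)) (map (%i. ord_class (qs ! i) (sp (ms ! i)) (ys ! i)) [0..<length ms] ! i)) [0..<length ms] = ?ys"
 by (intro map_cong) auto
 ultimately have dc: "dcomp (ord_operad P) ms p qs (ord_class p (sp (length ms)) x) (map (%i. ord_class (qs ! i) (sp (ms ! i)) (ys ! i)) [0..<length ms]) =
 ord_class (p + sum_list qs) (sp (sum_list ms)) (rcomp ms p qs ?x ?ys)"
 by (simp add: ord_operad_def push_cube del: map_eq_conv)
 \<comment> \<open>Independence of the representatives: by \<open>sprod_cong\<close> if all degrees
   are nonnegative, and because both composites are 0 otherwise.\<close>
 have "crelation (p + sum_list qs) (rcomp ms p qs ?x ?ys - rcomp ms p qs x ys) (sp (sum_list ms))"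
 proof (cases "0 <= p & (\<forall>i<length ms. 0 <= qs ! i)")
 case True
 then have nn: "0 <= p" "!!i. i < length ms ==> 0 <= qs ! i" by auto
 note a = args_in[OF ys x nn] and a' = args_in[OF ys' x'(1) nn]
 have coarse: "z : Rel k (coarse UNIV)" if "z : Rel k X" for z k and X :: "'a topology"
 proof -
 have "mp k (%a. a) z : Rel k (coarse UNIV)" by (rule mp_Rel[OF that]) simp
 then show ?thesis using push_id[OF relations_in_chains[OF that rel_in], of "%a. a"] by simp
 qed
 have len: "length qs = length ms" "length ys = length ms" using ys by (auto simp: valid_def)
 have "list_all2 (%(q, y) (q', y'). q = q' & y - y' : Rel q (coarse UNIV) & any_chain q y) (args p qs ?x ?ys) (args p qs x ys)"
 unfolding args_def
 proof (intro list_all2_Cons[THEN iffD2] conjI)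
 show "(%(q, y) (q', y'). q = q' & y - y' : Rel q (coarse UNIV) & any_chain q y) (nat p, ?x) (nat p, x)"
 using x' nn rel0 by (auto simp: rel chz_def intro: coarse any_chain_of)
 show "list_all2 (%(q, y) (q', y'). q = q' & y - y' : Rel q (coarse UNIV) & any_chain q y) (zip (map nat qs) ?ys) (zip (map nat qs) ys)"
 proof (rule list_all2_all_nthI)
 fix i assume "i < length (zip (map nat qs) ?ys)"
 then have i: "i < length ms" by simp
 have "?y i - ys ! i : Rel (nat (qs ! i)) (sp (ms ! i))"
 using y'(2)[OF i] rel0 unfolding rel by metis
 moreover have "?y i : Ch (nat (qs ! i)) (sp (ms ! i))"
 using y'(1)[OF i] nn(2)[OF i] by (simp add: chz_def)
 ultimately show "(%(q, y) (q', y'). q = q' & y - y' : Rel q (coarse UNIV) & any_chain q y)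
 (zip (map nat qs) ?ys ! i) (zip (map nat qs) ys ! i)"
 using i len by (simp add: coarse any_chain_of)
 qed (simp add: len)
 qed
 then have "cong (sdeg (args p qs ?x ?ys)) (length (args p qs ?x ?ys)) (sprod (args p qs ?x ?ys)) (sprod (args p qs x ys))"
 by (rule sprod_cong[OF _ a(2)])
 then have "mp (sdeg (args p qs ?x ?ys)) (tc ms) (sprod (args p qs ?x ?ys)) -
 mp (sdeg (args p qs ?x ?ys)) (tc ms) (sprod (args p qs x ys)) : Rel (sdeg (args p qs ?x ?ys)) (coarse UNIV)"
 by (rule cong_mp_coarse)
 moreover have deg: "sdeg (args p qs ?x ?ys) = sdeg (args p qs x ys)" "nat (p + sum_list qs) = sdeg (args p qs x ys)"
 using a(3) a'(3) by linarith+
 ultimately have "rcomp ms p qs ?x ?ys - rcomp ms p qs x ys : Rel (nat (p + sum_list qs)) (coarse UNIV)"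
 by (simp add: rcomp_def)
 moreover have "rcomp ms p qs ?x ?ys - rcomp ms p qs x ys : Ch (nat (p + sum_list qs)) (sp (sum_list ms))" "0 <= p + sum_list qs"
 using rcomp_in[OF ms ys' x'(1)] rcomp_in[OF ms ys x] a(3) by (auto simp: chz_def intro: chains_diff)
 ultimately show ?thesis by (simp add: rel Rel_coarse)
 next
 case False
 then consider "p < 0" | i where "i < length ms" "qs ! i < 0" by force
 then have "0 : set (x # ys) & 0 : set (?x # ?ys)"
 proof cases
 case 1
 then have "x = 0 & ?x = 0" using x x'(1) by (simp add: chz_def)
 then show ?thesis by (metis list.set_intros(1))
 next
 case 2
 show ?thesis using valid_zero[OF ys 2] valid_zero[OF ys' 2] by (simp del: set_map)
 qed
 then show ?thesis using ys by (simp add: rcomp_zero rel valid_def del: list.set)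
 qed
 then show "dcomp (ord_operad P) ms p qs (ord_class p (sp (length ms)) x) (map (%i. ord_class (qs ! i) (sp (ms ! i)) (ys ! i)) [0..<length ms]) =
 ord_class (p + sum_list qs) (sp (sum_list ms)) (rcomp ms p qs x ys)"
 unfolding dc using rcomp_in[OF ms ys' x'(1)] rcomp_in[OF ms ys x] by (subst ord_class_eq_iff) (simp_all add: chz)
 qed (simp add: ord_operad_def pnt_def)
qed

lemma ord_functor_mor:
 assumes f: "continuous_map (tspace P l) (tspace Q l) (f l)" and x: "x : cchains n (tspace P l)"
 shows "fmor ord_functor P Q f l n (ord_class n (tspace P l) x) = ord_class n (tspace Q l) (push (cube (nat n)) (f l) x)"
proof -
 note r = ord_rep[OF x]
 have "crelation n (push (cube (nat n)) (f l) (ord_rep n (tspace P l) (ord_class n (tspace P l) x)) - push (cube (nat n)) (f l) x) (tspace Q l)"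
 using r(2) relations_push[OF _ f cube_rel_in] by (auto simp: crelation_def push_diff[symmetric])
 moreover have "push (cube (nat n)) (f l) z : cchains n (tspace Q l)" if "z : cchains n (tspace P l)" for z
 using that push_in_chains[OF _ f] by (auto simp: cchains_def split: if_splits)
 ultimately show ?thesis
 using r(1) x by (simp add: ord_functor_def push_cube[symmetric] ord_class_eq_iff)
qed

lemma is_op_functor_ord: "is_op_functor (ord_functor :: ('a, 'a chain set set) op_functor)"
proof (rule presented_op_functor)
 fix P :: "'a top_operad_data" assume P: "top_operad P"
 then show "presented_operad cube (%_. 0) cube_bd cube_pr cube_rel P (fobj ord_functor P) ((%P l n. ord_class n (tspace P l)) P)"
 using ord_operad_presented by (simp add: ord_functor_def)
 fix Q :: "'a top_operad_data" and f :: "nat => 'a => 'a" and l n x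
 assume f: "continuous_map (tspace P l) (tspace Q l) (f l)" and x: "x : operad_chains.chz cube n (tspace P l)"
 have "operad_chains cube (%_. 0) cube_bd cube_pr cube_rel P"
 by (rule operad_chains.intro[OF cube_model]) (unfold_locales, rule P)
 then have "x : cchains n (tspace P l)" using x by (simp add: operad_chains.chz_def cchains_def)
 then show "fmor ord_functor P Q f l n ((%P l n. ord_class n (tspace P l)) P l n x) =
 (%P l n. ord_class n (tspace P l)) Q l n (push (cube (nat n)) (f l) x)"
 by (rule ord_functor_mor[where P = P and Q = Q and f = f and l = l, OF f])
qed

section \<open>From ordered cubes to simplices\<close>

text \<open>
 The cube is normalised, so that degenerate cubes are sent to 0, and then triangulated by the
 chambers, one for each permutation.
\<close>

abbreviation simp_gen :: "nat => (point => 'a) => 'a chain" where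
 "simp_gen n f \<equiv> frag_of (restrict f (splx n))"

abbreviation perms :: "nat => (nat => nat) set" where
 "perms n \<equiv> {pp. pp permutes {..<n}}"

text \<open>The decreasing upper sums of \<open>t\<close> are distributed over the coordinates by
  \<open>pp\<close>; the image is the part of the cube on which the coordinates are in the order
  given by \<open>pp\<close>.\<close>

definition chamber :: "nat => (nat => nat) => point => point" where
 "chamber n pp t = (%i. if i < n then crd n t (pp i) else 0)"

definition tri :: "nat => point chain" where
 "tri n = (\<Sum>pp\<in>perms n. frag_cmul (sign pp) (simp_gen n (chamber n pp)))"

definition zero_on :: "nat set => point => point" where
 "zero_on A t = (%i. if i : A then 0 else t i)"

text \<open>The product of the commuting operators, multiplied out: \<open>A\<close> consists of the
  coordinates in which the term of zeroing has been taken, each with a minus sign.\<close>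

definition cnorm :: "nat => point chain" where
 "cnorm n = (\<Sum>A\<in>Pow {..<n}. frag_cmul ((- 1) ^ card A) (cube_gen n (zero_on A)))"

definition tau :: "nat => point chain" where
 "tau n = nop (splx n) (tri n) (cnorm n)"

lemma simp_gen_eqI: "(!!t. t : splx n ==> f t = g t) ==> simp_gen n f = simp_gen n g"
 by (auto intro!: arg_cong[of _ _ frag_of] restrict_ext)

lemma push_simp_gen: "push (splx n) f (simp_gen n g) = simp_gen n (%t. f (g t))"
 unfolding push_of by (rule simp_gen_eqI) simp

lemma chamber_in: "t : splx n ==> chamber n pp t : cube n"
 by (simp add: chamber_def unit_cube_def crd_bounds)

lemma zero_on_in: "t : cube n ==> zero_on A t : cube n"
 by (auto simp: unit_cube_def zero_on_def)

lemma crd_continuous: "continuous_map (powertop_real UNIV) euclideanreal (%t. crd n t k)"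
 unfolding crd_def by (intro continuous_map_sum continuous_map_product_projection) auto

lemma tri_in: "tri n : chains_on (splx n) (rsub (cube n))"
proof -
 have "continuous_map (rsub (splx n)) (rsub (cube n)) (chamber n pp)" for pp
 proof (rule cube_continuous)
 show "continuous_map (powertop_real UNIV) euclideanreal (%t. chamber n pp t j)" for j
 unfolding chamber_def by (intro continuous_map_if_const crd_continuous) auto
 qed (rule chamber_in)
 then show ?thesis
 unfolding tri_def by (intro chains_sum chains_cmul) (simp add: maps_on_restrict)
qed

lemma cnorm_in: "cnorm n : chains_on (cube n) (rsub (cube n))"
proof -
 have "continuous_map (rsub (cube n)) (rsub (cube n)) (zero_on A)" for A
 proof (rule cube_continuous)
 show "continuous_map (powertop_real UNIV) euclideanreal (%t. zero_on A t j)" for j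
 unfolding zero_on_def by (intro continuous_map_if_const continuous_map_product_projection) auto
 qed (rule zero_on_in)
 then show ?thesis
 unfolding cnorm_def by (intro chains_sum chains_cmul) (simp add: maps_on_restrict)
qed

lemma tau_in: "tau n : chains_on (splx n) (rsub (cube n))"
 unfolding tau_def by (rule nop_in_chains[OF tri_in cnorm_in])

lemma nop_tri_gen: "nop (splx n) (tri n) (cube_gen n f) =
 (\<Sum>pp\<in>perms n. frag_cmul (sign pp) (simp_gen n (%t. f (chamber n pp t))))"
 unfolding nop_of tri_def push_sum push_cmul push_simp_gen
 by (intro sum.cong refl arg_cong[of _ _ "frag_cmul _"] simp_gen_eqI) (simp add: chamber_in)

lemma nop_cnorm_gen: "nop (cube n) (cnorm n) (cube_gen n f) =
 (\<Sum>A\<in>Pow {..<n}. frag_cmul ((- 1) ^ card A) (cube_gen n (%t. f (zero_on A t))))"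
 unfolding nop_of cnorm_def push_sum push_cmul push_cube_gen
 by (intro sum.cong refl arg_cong[of _ _ "frag_cmul _"] cube_gen_eqI) (simp add: zero_on_in)

section \<open>Normalisation and triangulation of relations\<close>

lemma card_flip:
 assumes "finite A"
 shows "(- 1 :: int) ^ card (if i : A then A - {i} else insert i A) = - ((- 1) ^ card A)"
proof (cases "i : A")
 case True
 then have "card A = Suc (card (A - {i}))" using assms by (metis card.remove)
 then show ?thesis by (simp only: True if_True power_Suc mult_minus1 minus_minus)
qed (simp add: assms)

text \<open>Sets with and without \<open>i\<close> cancel in pairs, since for a cube degenerate in
  direction \<open>i\<close> both give the same term.\<close>

lemma cnorm_degenerate:
 assumes i: "i < n"
 shows "nop (cube n) (cnorm n) (cube_gen n (%t. t(i := 0))) = 0"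
 unfolding nop_cnorm_gen
proof (rule frag_sum_involution[where \<phi> = "%A. if i : A then A - {i} else insert i A"])
 fix A assume A: "A : Pow {..<n}"
 show "(if i : A then A - {i} else insert i A) : Pow {..<n}" using A i by auto
 have z: "(zero_on (if i : A then A - {i} else insert i A) t)(i := 0) = (zero_on A t)(i := 0)" for t
 by (auto simp: zero_on_def)
 have "finite A" using A finite_subset by auto
 then show "frag_cmul ((- 1) ^ card (if i : A then A - {i} else insert i A))
 (cube_gen n (%t. (zero_on (if i : A then A - {i} else insert i A) t)(i := 0))) =
 - frag_cmul ((- 1) ^ card A) (cube_gen n (%t. (zero_on A t)(i := 0)))"
 unfolding z by (subst card_flip) simp_all
qed auto

lemma cnorm_perm:
 assumes pp: "pp permutes {..<n}"
 shows "nop (cube n) (cnorm n) (cube_gen n (%t. t o pp)) =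
 (\<Sum>A\<in>Pow {..<n}. frag_cmul ((- 1) ^ card A) (cube_gen n (%t. zero_on A (t o pp))))"
proof -
 have "bij_betw ((`) pp) (Pow {..<n}) (Pow {..<n})"
 using bij_betw_Pow[OF permutes_imp_bij[OF pp]] .
 then have "nop (cube n) (cnorm n) (cube_gen n (%t. t o pp)) =
 (\<Sum>A\<in>Pow {..<n}. frag_cmul ((- 1) ^ card (pp ` A)) (cube_gen n (%t. zero_on (pp ` A) t o pp)))"
 unfolding nop_cnorm_gen by (rule sum.reindex_bij_betw[symmetric])
 also have "... = (\<Sum>A\<in>Pow {..<n}. frag_cmul ((- 1) ^ card A) (cube_gen n (%t. zero_on A (t o pp))))"
 proof -
 have "card (pp ` A) = card A" for A using permutes_inj_on[OF pp] by (rule card_image)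
 moreover have "zero_on (pp ` A) t o pp = zero_on A (t o pp)" for A t
 using permutes_inj[OF pp] by (auto simp: zero_on_def fun_eq_iff inj_image_mem_iff)
 ultimately show ?thesis by simp
 qed
 finally show ?thesis .
qed

text \<open>Permuting the coordinates permutes the chambers, so the signed sum over them is
  alternating.\<close>

lemma tri_perm:
 assumes pp: "pp permutes {..<n}"
 shows "nop (splx n) (tri n) (cube_gen n (%t. f (t o pp))) =
 frag_cmul (sign pp) (nop (splx n) (tri n) (cube_gen n f))"
proof -
 have "nop (splx n) (tri n) (cube_gen n f) =
 (\<Sum>ka\<in>perms n. frag_cmul (sign (ka o pp)) (simp_gen n (%t. f (chamber n (ka o pp) t))))"
 unfolding nop_tri_gen by (rule sum_permutations_compose_right[OF pp])
 moreover have "chamber n (ka o pp) t = chamber n ka t o pp" for ka t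
 using permutes_in_image[OF pp] by (auto simp: chamber_def fun_eq_iff)
 moreover have "sign pp * sign (ka o pp) = sign ka" if "ka permutes {..<n}" for ka
 using permutation_of_permutes[OF pp] permutation_of_permutes[OF that]
 by (simp add: sign_compose mult.left_commute)
 ultimately show ?thesis
 unfolding nop_tri_gen[of n "%t. f (t o pp)"] by (simp add: frag_cmul_sum)
qed

lemma nop_tau: "nop (splx n) (tau n) x = nop (splx n) (tri n) (nop (cube n) (cnorm n) x)"
 unfolding tau_def by (rule nop_nop[OF tri_in, symmetric])

text \<open>Degenerate cubes die under normalisation. It also commutes with permutations, under
  which the triangulation is alternating, so ordering relations vanish as well, exactly and not
  merely up to degenerate simplices.\<close>

lemma tau_rel:
 assumes "r : cube_rel n"
 shows "nop (splx n) (tau n) r = 0"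
 using assms unfolding cube_rel_def
proof (elim UnE CollectE exE conjE)
 fix i assume "r = cube_gen n (%t. t(i := 0))" "i < n"
 then show ?thesis by (simp add: nop_tau cnorm_degenerate del: nop_of)
next
 fix pp assume r: "r = cube_gen n (%t. t) - frag_cmul (sign pp) (cube_gen n (%t. t o pp))" and pp: "pp permutes {..<n}"
 have "nop (splx n) (tau n) (cube_gen n (%t. t o pp)) =
 frag_cmul (sign pp) (nop (splx n) (tau n) (cube_gen n (%t. t)))"
 unfolding nop_tau cnorm_perm[OF pp] nop_sum nop_cmul tri_perm[OF pp] unfolding nop_cnorm_gen nop_sum nop_cmul
 by (simp add: frag_cmul_sum mult.commute)
 then show ?thesis
 unfolding r nop_diff nop_cmul by (simp del: nop_of)
qed

text \<open>If \<open>k : A\<close>, the faces at 0 and 1 in direction \<open>k\<close> coincide and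
  cancel. The sets without \<open>k\<close> are those of the face, relabelled by
  \<open>skip k\<close>.\<close>

lemma cnorm_bd: "nop (cube (n - 1)) (cube_bd n) (cnorm n) = nop (cube (n - 1)) (cnorm (n - 1)) (cube_bd n)"
proof -
 let ?t = "%k e A. frag_cmul ((- 1) ^ (Suc k + e) * (- 1) ^ card A) (cube_gen (n - 1) (%t. zero_on A (cins k (real e) t)))"
 have "nop (cube (n - 1)) (cube_bd n) (cnorm n) = (\<Sum>A\<in>Pow {..<n}. \<Sum>k<n. \<Sum>e\<in>{0, 1}. ?t k e A)"
 unfolding cnorm_def[of n] nop_sum nop_cmul unfolding nop_cube_bd cbd_gen frag_cmul_sum frag_cmul_cmul
 by (simp only: mult.commute)
 also have "... = (\<Sum>k<n. \<Sum>A\<in>Pow {..<n}. \<Sum>e\<in>{0, 1}. ?t k e A)"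
 by (rule sum.swap)
 also have "... = (\<Sum>k<n. \<Sum>e\<in>{0, 1}. frag_cmul ((- 1) ^ (Suc k + e))
 (nop (cube (n - 1)) (cnorm (n - 1)) (cube_gen (n - 1) (cins k (real e)))))"
 proof (intro sum.cong refl)
 fix k assume k: "k : {..<n}"
 have "(\<Sum>A\<in>Pow {..<n}. \<Sum>e\<in>{0, 1}. ?t k e A) = (\<Sum>A\<in>(`) (skip k) ` Pow {..<n - 1}. \<Sum>e\<in>{0, 1}. ?t k e A)"
 proof (rule sum.mono_neutral_right)
 show "(`) (skip k) ` Pow {..<n - 1} \<subseteq> Pow {..<n}" using k by (auto simp: skip_def split: if_splits)
 show "\<forall>A\<in>Pow {..<n} - (`) (skip k) ` Pow {..<n - 1}. (\<Sum>e\<in>{0, 1}. ?t k e A) = 0"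
 proof
 fix A assume A: "A : Pow {..<n} - (`) (skip k) ` Pow {..<n - 1}"
 have "k : A"
 proof (rule ccontr)
 assume "k \<notin> A"
 have "A = skip k ` {y. skip k y : A}"
 proof (intro equalityI subsetI)
 fix x assume "x : A"
 then show "x : skip k ` {y. skip k y : A}" using \<open>k \<notin> A\<close> by (cases x k rule: skip_cases) auto
 qed auto
 moreover have "{y. skip k y : A} \<subseteq> {..<n - 1}" using A k by (auto simp: skip_def split: if_splits)
 ultimately show False using A by blast
 qed
 then have "zero_on A (cins k a t) = zero_on A (cins k 0 t)" for a t
 by (auto simp: zero_on_def cins_def)
 note z = this[of 1]
 show "(\<Sum>e\<in>{0, 1}. ?t k e A) = 0" by (simp add: z flip: frag_cmul_distrib)
 qed
 qed simp
 also have "... = (\<Sum>A\<in>Pow {..<n - 1}. \<Sum>e\<in>{0, 1}. ?t k e (skip k ` A))"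
 proof -
 have "inj_on ((`) (skip k)) (Pow {..<n - 1})" by (rule inj_on_image_Pow) (simp add: inj_on_def)
 then show ?thesis by (subst sum.reindex) (simp_all only: o_def)
 qed
 also have "... = (\<Sum>e\<in>{0, 1}. \<Sum>A\<in>Pow {..<n - 1}. ?t k e (skip k ` A))"
 by (rule sum.swap)
 also have "... = (\<Sum>e\<in>{0, 1}. frag_cmul ((- 1) ^ (Suc k + e))
 (nop (cube (n - 1)) (cnorm (n - 1)) (cube_gen (n - 1) (cins k (real e)))))"
 proof -
 have "card (skip k ` A) = card A" for A by (rule card_image) (simp add: inj_on_def)
 moreover have "zero_on (skip k ` A) (cins k a t) = cins k a (zero_on A t)" for A a t
 proof
 fix j show "zero_on (skip k ` A) (cins k a t) j = cins k a (zero_on A t) j"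
 by (cases j k rule: skip_cases) (auto simp: zero_on_def cins_def skip_def image_iff)
 qed
 ultimately show ?thesis
 unfolding nop_cnorm_gen frag_cmul_sum frag_cmul_cmul by (simp only:)
 qed
 finally show "(\<Sum>A\<in>Pow {..<n}. \<Sum>e\<in>{0, 1}. ?t k e A) = (\<Sum>e\<in>{0, 1}. frag_cmul ((- 1) ^ (Suc k + e))
 (nop (cube (n - 1)) (cnorm (n - 1)) (cube_gen (n - 1) (cins k (real e)))))" .
 qed
 also have "... = nop (cube (n - 1)) (cnorm (n - 1)) (cube_bd n)"
 unfolding cube_bd_def nop_sum nop_cmul ..
 finally show ?thesis .
qed

text \<open>Sorts the permutations by the place of the value \<open>k\<close>, as in a Laplace
  expansion.\<close>

lemma sum_pins:
 assumes "k <= n"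
 shows "(\<Sum>pp\<in>perms (Suc n). g pp) = (\<Sum>i<Suc n. \<Sum>pp\<in>perms n. g (pins i k pp))"
proof -
 have "bij_betw (%(i, pp). pins i k pp) ({..<Suc n} \<times> perms n) (perms (Suc n))"
 unfolding bij_betw_def
 proof (intro conjI equalityI subsetI)
 show "inj_on (%(i, pp). pins i k pp) ({..<Suc n} \<times> perms n)"
 proof (rule inj_onI, clarify)
 fix i pp j rh assume eq: "pins i k pp = pins j k rh"
 have "i = j"
 proof (cases i j rule: skip_cases)
 case (2 y)
 then show ?thesis using fun_cong[OF eq, of i] by simp
 qed
 then show "i = j & pp = rh" using pins_inj eq by blast
 qed
 fix pp assume pp: "pp : perms (Suc n)"
 then obtain i where i: "i < Suc n" "pp i = k"
 using permutes_image[of pp "{..<Suc n}"] assms by (metis imageE lessThan_iff less_Suc_eq_le mem_Collect_eq)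
 then obtain pp' where "pp' permutes {..<n}" "pp = pins i k pp'"
 using perm_insertE[of pp n i k] pp by auto
 then show "pp : (%(i, pp). pins i k pp) ` ({..<Suc n} \<times> perms n)" using i by auto
 qed (use pins_permutes[OF _ _ assms] in auto)
 then have "(\<Sum>pp\<in>perms (Suc n). g pp) = (\<Sum>x\<in>{..<Suc n} \<times> perms n. g (case x of (i, pp) => pins i k pp))"
 by (rule sum.reindex_bij_betw[symmetric])
 then show ?thesis by (simp only: sum.cartesian_product' prod.case)
qed

text \<open>The face 0 makes the largest upper sum equal to 1, and \<open>pins i 0 pp\<close>
  assigns that sum to coordinate \<open>i\<close>. Dually, the last face makes the smallest one
  0.\<close>

lemma chamber_face_first:
 assumes t: "t : splx m" and pp: "pp permutes {..<m}" and i: "i < Suc m"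
 shows "chamber (Suc m) (pins i 0 pp) (simplical_face 0 t) = cins i 1 (chamber m pp t)"
proof
 fix x
 have less: "pp y < m \<longleftrightarrow> y < m" for y using permutes_in_image[OF pp, of y] by simp
 show "chamber (Suc m) (pins i 0 pp) (simplical_face 0 t) x = cins i 1 (chamber m pp t) x"
 proof (cases x i rule: skip_cases)
 case 1
 then show ?thesis using i t by (simp add: chamber_def cins_def crd_face)
 next
 case (2 y)
 have "crd (Suc m) (simplical_face 0 t) (Suc (pp y)) = crd m t (pp y)" if "y < m"
 using that t less[of y] by (simp add: crd_face)
 moreover have "skip i y < Suc m \<longleftrightarrow> y < m" using i by (intro skip_less) simp
 moreover have "cins i 1 u (skip i y) = u y" for u by (simp add: cins_def skip_def)
 ultimately show ?thesis by (simp add: 2 chamber_def) (simp add: skip_def)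
 qed
qed

lemma chamber_face_last:
 assumes t: "t : splx m" and pp: "pp permutes {..<m}" and i: "i < Suc m"
 shows "chamber (Suc m) (pins i m pp) (simplical_face (Suc m) t) = cins i 0 (chamber m pp t)"
proof
 fix x
 have less: "pp y < m \<longleftrightarrow> y < m" for y using permutes_in_image[OF pp, of y] by simp
 show "chamber (Suc m) (pins i m pp) (simplical_face (Suc m) t) x = cins i 0 (chamber m pp t) x"
 proof (cases x i rule: skip_cases)
 case 1
 then show ?thesis using i t by (simp add: chamber_def cins_def crd_face crd_eq_0)
 next
 case (2 y)
 have "crd (Suc m) (simplical_face (Suc m) t) (pp y) = crd m t (pp y)" if "y < m"
 using that t less[of y] by (simp add: crd_face)
 moreover have "skip m (pp y) = pp y" if "y < m" using less[of y] that by (simp add: skip_def)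
 moreover have "skip i y < Suc m \<longleftrightarrow> y < m" using i by (intro skip_less) simp
 moreover have "cins i 0 u (skip i y) = u y" for u by (simp add: cins_def skip_def)
 ultimately show ?thesis by (simp add: 2 chamber_def)
 qed
qed

lemma chain_boundary_gen:
 "1 <= n ==> chain_boundary n (simp_gen n f) = (\<Sum>k\<le>n. frag_cmul ((- 1) ^ k) (simp_gen (n - 1) (%t. f (simplical_face k t))))"
 by (auto simp: chain_boundary_of singular_face_def simplical_face_in_standard_simplex
 intro!: sum.cong arg_cong[of _ _ "frag_cmul _"] simp_gen_eqI)

text \<open>
 The inner faces of adjacent chambers cancel; the first and the last face of the chambers
 triangulate the faces of the cube.
\<close>

lemma tri_bd: "nop (splx (n - 1)) (simp_bd n) (tri n) = nop (splx (n - 1)) (tri (n - 1)) (cube_bd n)"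
proof (cases n)
 case 0
 then show ?thesis unfolding nop_simp_bd by (simp add: chain_boundary_def cube_bd_def)
next
 case (Suc m)
 let ?t = "%k pp. frag_cmul (sign pp * (- 1) ^ k) (simp_gen m (%t. chamber (Suc m) pp (simplical_face k t)))"
 let ?s = "%i e pp. frag_cmul ((- 1) ^ (Suc i + e) * sign pp) (simp_gen m (%t. cins i (real e) (chamber m pp t)))"
 have inner: "(\<Sum>pp\<in>perms (Suc m). ?t k pp) = 0" if k: "0 < k" "k <= m" for k
 proof (rule frag_sum_involution[where \<phi> = "%pp. Transposition.transpose (k - 1) k o pp"])
 let ?ta = "Transposition.transpose (k - 1) k"
 fix pp assume pp: "pp : perms (Suc m)"
 have ta: "?ta permutes {..<Suc m}" using k by (intro permutes_swap_id) auto
 then show "?ta o pp : perms (Suc m)" using pp permutes_compose[of pp _ ?ta] by simp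
 show "?ta o (?ta o pp) = pp" by (simp add: fun_eq_iff)
 have "k - 1 ~= k" using k by linarith
 then have sg: "sign (?ta o pp) = - sign pp"
 using pp permutation_of_permutes[of pp "Suc m"] by (simp add: sign_compose permutation_swap_id sign_swap_id)
 have "simp_gen m (%t. chamber (Suc m) (?ta o pp) (simplical_face k t)) = simp_gen m (%t. chamber (Suc m) pp (simplical_face k t))"
 proof (rule simp_gen_eqI)
 fix t assume t: "t : splx m"
 have "crd (Suc m) (simplical_face k t) (k - 1) = crd (Suc m) (simplical_face k t) k"
 using k t by (subst (1 2) crd_face) auto
 then have "crd (Suc m) (simplical_face k t) (?ta j) = crd (Suc m) (simplical_face k t) j" for j
 by (auto simp: Transposition.transpose_def)
 then show "chamber (Suc m) (?ta o pp) (simplical_face k t) = chamber (Suc m) pp (simplical_face k t)"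
 by (simp add: chamber_def fun_eq_iff)
 qed
 then show "?t k (?ta o pp) = - ?t k pp" unfolding sg by simp
 qed
 have "nop (splx m) (simp_bd (Suc m)) (tri (Suc m)) = (\<Sum>pp\<in>perms (Suc m). \<Sum>k\<le>Suc m. ?t k pp)"
 proof -
 have "nop (splx m) (simp_bd (Suc m)) (simp_gen (Suc m) f) =
 (\<Sum>k\<le>Suc m. frag_cmul ((- 1) ^ k) (simp_gen m (%t. f (simplical_face k t))))" for f :: "point => point"
 using chain_boundary_gen[of "Suc m" f] nop_simp_bd[of "Suc m" "simp_gen (Suc m) f"] by simp
 then show ?thesis
 by (simp only: tri_def nop_sum nop_cmul frag_cmul_sum frag_cmul_cmul)
 qed
 also have "... = (\<Sum>k\<le>Suc m. \<Sum>pp\<in>perms (Suc m). ?t k pp)"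
 by (rule sum.swap)
 also have "... = (\<Sum>k\<in>{0, Suc m}. \<Sum>pp\<in>perms (Suc m). ?t k pp)"
 by (rule sum.mono_neutral_right) (use inner in auto)
 also have "... = (\<Sum>i<Suc m. \<Sum>e\<in>{0, 1}. \<Sum>pp\<in>perms m. ?s i e pp)"
 proof -
 have "(\<Sum>pp\<in>perms (Suc m). ?t 0 pp) = (\<Sum>i<Suc m. \<Sum>pp\<in>perms m. ?s i 1 pp)"
 unfolding sum_pins[of 0 m, OF le0]
 proof (intro sum.cong refl arg_cong2[of _ _ _ _ frag_cmul] simp_gen_eqI)
 fix i pp assume i: "i : {..<Suc m}" and pp: "pp : perms m"
 show "sign (pins i 0 pp) * (- 1) ^ 0 = (- 1) ^ (Suc i + 1) * sign pp"
 using sign_pins[of pp m i 0] i pp by simp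
 show "chamber (Suc m) (pins i 0 pp) (simplical_face 0 t) = cins i (real 1) (chamber m pp t)"
 if "t : splx m" for t using chamber_face_first[OF that, of pp i] i pp by simp
 qed
 moreover have "(\<Sum>pp\<in>perms (Suc m). ?t (Suc m) pp) = (\<Sum>i<Suc m. \<Sum>pp\<in>perms m. ?s i 0 pp)"
 unfolding sum_pins[of m m, OF order_refl]
 proof (intro sum.cong refl arg_cong2[of _ _ _ _ frag_cmul] simp_gen_eqI)
 fix i pp assume i: "i : {..<Suc m}" and pp: "pp : perms m"
 have "(- 1 :: int) ^ m * (- 1) ^ m = 1" by (simp flip: power_mult_distrib)
 then show "sign (pins i m pp) * (- 1) ^ Suc m = (- 1) ^ (Suc i + 0) * sign pp"
 using sign_pins[of pp m i m] i pp by (simp add: power_add mult.assoc mult.left_commute)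
 show "chamber (Suc m) (pins i m pp) (simplical_face (Suc m) t) = cins i (real 0) (chamber m pp t)"
 if "t : splx m" for t using chamber_face_last[OF that, of pp i] i pp by simp
 qed
 ultimately show ?thesis
 by (simp add: sum.distrib add.commute del: sum.lessThan_Suc)
 qed
 also have "... = nop (splx m) (tri m) (cube_bd (Suc m))"
 unfolding cube_bd_def nop_sum nop_cmul diff_Suc_1 nop_tri_gen frag_cmul_sum frag_cmul_cmul ..
 finally show ?thesis by (simp add: Suc)
qed

lemma tau_bd: "nop (splx (n - 1)) (simp_bd n) (tau n) = nop (splx (n - 1)) (tau (n - 1)) (cube_bd n)"
proof -
 let ?D = "splx (n - 1)"
 have "nop ?D (simp_bd n) (tau n) = nop ?D (nop ?D (simp_bd n) (tri n)) (cnorm n)"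
 unfolding tau_def by (rule nop_nop[OF simp_bd_in])
 also have "... = nop ?D (tri (n - 1)) (nop (cube (n - 1)) (cube_bd n) (cnorm n))"
 unfolding tri_bd by (rule nop_nop[OF tri_in, symmetric])
 finally show ?thesis unfolding cnorm_bd nop_tau .
qed

text \<open>A set of coordinates of the product is a pair of such sets for the factors, and the
  cardinalities in the signs add up.\<close>

lemma cnorm_pr: "nop (cube (p + q)) (cnorm (p + q)) (cube_pr p q) = nop2 (cube (p + q)) (cube_pr p q) (cnorm p) (cnorm q)"
proof -
 let ?u = "%(A, B). A \<union> (+) p ` B"
 have bij: "bij_betw ?u (Pow {..<p} \<times> Pow {..<q}) (Pow {..<p + q})"
 proof (rule bij_betwI[where g = "%C. (C \<inter> {..<p}, {j. p + j : C})"])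
 show "?u : Pow {..<p} \<times> Pow {..<q} \<rightarrow> Pow {..<p + q}" by auto
 show "(%C. (C \<inter> {..<p}, {j. p + j : C})) : Pow {..<p + q} \<rightarrow> Pow {..<p} \<times> Pow {..<q}" by auto
 show "(?u x \<inter> {..<p}, {j. p + j : ?u x}) = x" if "x : Pow {..<p} \<times> Pow {..<q}" for x
 using that by (cases x) auto
 show "?u (C \<inter> {..<p}, {j. p + j : C}) = C" for C
 proof (intro equalityI subsetI)
 fix x assume "x : C"
 then show "x : ?u (C \<inter> {..<p}, {j. p + j : C})"
 by (cases "x < p") (auto simp: image_iff not_less dest!: le_Suc_ex)
 qed auto
 qed
 let ?g = "%C. frag_cmul ((- 1) ^ card C) (cube_gen (p + q) (%t. cspl p q (zero_on C t)))"
 have "nop (cube (p + q)) (cnorm (p + q)) (cube_pr p q) = (\<Sum>x\<in>Pow {..<p} \<times> Pow {..<q}. ?g (?u x))"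
 unfolding cube_pr_def nop_cnorm_gen by (rule sum.reindex_bij_betw[OF bij, symmetric])
 also have "... = (\<Sum>A\<in>Pow {..<p}. \<Sum>B\<in>Pow {..<q}. ?g (A \<union> (+) p ` B))"
 by (simp only: sum.cartesian_product' prod.case)
 also have "... = (\<Sum>A\<in>Pow {..<p}. \<Sum>B\<in>Pow {..<q}. frag_cmul ((- 1) ^ card A * (- 1) ^ card B)
 (cube_gen (p + q) (%t. (zero_on A (fst (cspl p q t)), zero_on B (snd (cspl p q t))))))"
 proof (intro sum.cong refl arg_cong2[of _ _ _ _ frag_cmul] cube_gen_eqI)
 fix A B assume AB: "A : Pow {..<p}" "B : Pow {..<q}"
 have "finite A" "finite B" using AB finite_subset by auto
 moreover have "A \<inter> (+) p ` B = {}" using AB by auto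
 ultimately have "card (A \<union> (+) p ` B) = card A + card B"
 by (subst card_Un_disjoint) (auto simp: card_image)
 then show "(- 1 :: int) ^ card (A \<union> (+) p ` B) = (- 1) ^ card A * (- 1) ^ card B"
 by (simp add: power_add)
 show "cspl p q (zero_on (A \<union> (+) p ` B) t) = (zero_on A (fst (cspl p q t)), zero_on B (snd (cspl p q t)))" for t
 using AB by (auto simp: cspl_def zero_on_def fun_eq_iff image_iff)
 qed
 also have "... = (\<Sum>A\<in>Pow {..<p}. \<Sum>B\<in>Pow {..<q}. frag_cmul ((- 1) ^ card A) (frag_cmul ((- 1) ^ card B)
 (nop2 (cube (p + q)) (cube_pr p q) (cube_gen p (zero_on A)) (cube_gen q (zero_on B)))))"
 unfolding nop2_cpr frag_cmul_cmul ..
 also have "... = nop2 (cube (p + q)) (cube_pr p q) (cnorm p) (cnorm q)"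
 unfolding cnorm_def unfolding nop2_sum_left nop2_cmul_left unfolding nop2_sum_right nop2_cmul_right
 by (simp only: frag_cmul_sum frag_cmul_cmul)
 finally show ?thesis .
qed

lemma bij_betw_shuffle_decomposition:
 "bij_betw (%(pp, ka, ka'). pp o perm_sum p ka ka') (shuffle_perms p q \<times> perms p \<times> perms q) (perms (p + q))"
 unfolding bij_betw_def
proof (intro conjI equalityI subsetI)
 show "inj_on (%(pp, ka, ka'). pp o perm_sum p ka ka') (shuffle_perms p q \<times> perms p \<times> perms q)"
 proof (rule inj_onI)
 fix x y assume x: "x : shuffle_perms p q \<times> perms p \<times> perms q" and y: "y : shuffle_perms p q \<times> perms p \<times> perms q"
 and eq: "(case x of (pp, ka, ka') => pp o perm_sum p ka ka') = (case y of (pp, ka, ka') => pp o perm_sum p ka ka')"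
 obtain pp ka ka' rh \<mu> \<mu>' where [simp]: "x = (pp, ka, ka')" "y = (rh, \<mu>, \<mu>')" by (metis prod.collapse)
 show "x = y"
 using shuffle_decomposition_unique[of pp p q rh ka ka' \<mu> \<mu>'] x y eq by simp
 qed
 fix rh
 show "rh : perms (p + q)" if "rh : (%(pp, ka, ka'). pp o perm_sum p ka ka') ` (shuffle_perms p q \<times> perms p \<times> perms q)"
 using that shuffle_perms_strict(1) by (auto intro!: permutes_compose perm_sum_permutes)
 show "rh : (%(pp, ka, ka'). pp o perm_sum p ka ka') ` (shuffle_perms p q \<times> perms p \<times> perms q)" if rh: "rh : perms (p + q)"
 proof -
 obtain pp ka ka' where "pp : shuffle_perms p q" "ka permutes {..<p}" "ka' permutes {..<q}" "rh = pp o perm_sum p ka ka'"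
 using shuffle_decomposition_exists[of rh p q] rh by auto
 then show ?thesis by (intro image_eqI[of _ _ "(pp, ka, ka')"]) auto
 qed
qed

text \<open>Reading the upper sums through \<open>pp o perm_sum p ka ka'\<close> means that
  \<open>pp\<close> selects a decreasing sequence for each factor, which \<open>ka\<close> and
  \<open>ka'\<close> distribute over its coordinates.\<close>

lemma tri_pr: "nop (splx (p + q)) (tri (p + q)) (cube_pr p q) = nop2 (splx (p + q)) (simp_pr p q) (tri p) (tri q)"
proof -
 let ?D = "splx (p + q)"
 let ?g = "%rh. frag_cmul (sign rh) (simp_gen (p + q) (%t. cspl p q (chamber (p + q) rh t)))"
 have "nop ?D (tri (p + q)) (cube_pr p q) =
 (\<Sum>x\<in>shuffle_perms p q \<times> perms p \<times> perms q. ?g (case x of (pp, ka, ka') => pp o perm_sum p ka ka'))"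
 unfolding cube_pr_def nop_tri_gen by (rule sum.reindex_bij_betw[OF bij_betw_shuffle_decomposition, symmetric])
 also have "... = (\<Sum>pp\<in>shuffle_perms p q. \<Sum>ka\<in>perms p. \<Sum>ka'\<in>perms q. ?g (pp o perm_sum p ka ka'))"
 by (simp only: sum.cartesian_product' prod.case)
 also have "... = (\<Sum>pp\<in>shuffle_perms p q. \<Sum>ka\<in>perms p. \<Sum>ka'\<in>perms q. frag_cmul (sign ka * (sign ka' * sign pp))
 (push ?D (map_prod (restrict (chamber p ka) (splx p)) (restrict (chamber q ka') (splx q))) (simp_gen (p + q) (shuffle_map p q pp))))"
 proof (intro sum.cong refl arg_cong2[of _ _ _ _ frag_cmul])
 fix pp ka ka' assume pp: "pp : shuffle_perms p q" and ka: "ka : perms p" "ka' : perms q"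
 note s = shuffle_perms_strict[OF pp]
 have k: "ka permutes {..<p}" "ka' permutes {..<q}" using ka by auto
 have less: "ka i < p \<longleftrightarrow> i < p" "ka' j < q \<longleftrightarrow> j < q" for i j
 using permutes_in_image[OF k(1), of i] permutes_in_image[OF k(2), of j] by auto
 show "sign (pp o perm_sum p ka ka') = sign ka * (sign ka' * sign pp)"
 using sign_perm_sum[OF k] permutation_of_permutes[OF s(1)] permutation_of_permutes[OF perm_sum_permutes[OF k]]
 by (simp add: sign_compose ac_simps)
 show "simp_gen (p + q) (%t. cspl p q (chamber (p + q) (pp o perm_sum p ka ka') t)) =
 push ?D (map_prod (restrict (chamber p ka) (splx p)) (restrict (chamber q ka') (splx q))) (simp_gen (p + q) (shuffle_map p q pp))"
 unfolding push_simp_gen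
 proof (rule simp_gen_eqI)
 fix t assume t: "t : ?D"
 have "block_map (p + q) p pp t : splx p" "block_map (p + q) q (%m. pp (p + m)) t : splx q"
 using t s(2,3) by (intro block_map_in_simplex; simp)+
 then show "cspl p q (chamber (p + q) (pp o perm_sum p ka ka') t) =
 map_prod (restrict (chamber p ka) (splx p)) (restrict (chamber q ka') (splx q)) (shuffle_map p q pp t)"
 by (auto simp: shuffle_map_def cspl_def chamber_def fun_eq_iff crd_block_map less perm_sum_def)
 qed
 qed
 also have "... = (\<Sum>ka\<in>perms p. \<Sum>ka'\<in>perms q. \<Sum>pp\<in>shuffle_perms p q. frag_cmul (sign ka * (sign ka' * sign pp))
 (push ?D (map_prod (restrict (chamber p ka) (splx p)) (restrict (chamber q ka') (splx q))) (simp_gen (p + q) (shuffle_map p q pp))))"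
 by (rule trans[OF sum.swap]) (intro sum.cong refl sum.swap)
 also have "... = nop2 ?D (simp_pr p q) (tri p) (tri q)"
 unfolding tri_def unfolding nop2_sum_left nop2_cmul_left unfolding nop2_sum_right nop2_cmul_right nop2_of
 unfolding simp_pr_def push_sum push_cmul by (simp only: frag_cmul_sum frag_cmul_cmul)
 finally show ?thesis .
qed

lemma tau_pr: "nop (splx (p + q)) (tau (p + q)) (cube_pr p q) = nop2 (splx (p + q)) (simp_pr p q) (tau p) (tau q)"
proof -
 let ?D = "splx (p + q)"
 have "nop ?D (tau (p + q)) (cube_pr p q) = nop ?D (tri (p + q)) (nop2 (cube (p + q)) (cube_pr p q) (cnorm p) (cnorm q))"
 unfolding nop_tau cnorm_pr ..
 also have "... = nop2 ?D (nop2 ?D (simp_pr p q) (tri p) (tri q)) (cnorm p) (cnorm q)"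
 unfolding tri_pr[symmetric] by (rule nop_nop2[OF tri_in])
 also have "... = nop2 ?D (simp_pr p q) (tau p) (tau q)"
 unfolding tau_def by (rule nop2_nop[OF simp_pr_in, symmetric])
 finally show ?thesis .
qed

lemma tau_0: "tau 0 = simp_gen 0 (%t. %_. 0)"
 unfolding tau_def cnorm_def by (simp add: nop_tri_gen zero_on_def chamber_def del: nop_of)

section \<open>The morphism of operads\<close>

text \<open>Composites are built from products, push-forwards and the point chain of the empty list.
  An operator that respects these between two models respects composites, for every operad
  \<open>P\<close>.\<close>

lemma (in operad_chains) rcomp_model_mor:
 assumes M: "operad_chains dom' pt' bd' pr' rel' P"
 and tin: "!!n. ta n : chains_on (dom' n) (rsub (dom n))"
 and tpr: "!!p q. nop (dom' (p + q)) (ta (p + q)) (pr p q) = nop2 (dom' (p + q)) (pr' p q) (ta p) (ta q)"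
 and t0: "ta 0 = frag_of (\<lambda>t\<in>dom' 0. pt)"
 and x: "x : chz p (sp (length ms))" and v: "valid ms qs ys"
 shows "nop (dom' (nat (p + sum_list qs))) (ta (nat (p + sum_list qs))) (rcomp ms p qs x ys) =
 operad_chains.rcomp dom' pr' P ms p qs (nop (dom' (nat p)) (ta (nat p)) x)
 (map (%i. nop (dom' (nat (qs ! i))) (ta (nat (qs ! i))) (ys ! i)) [0..<length ms])"
proof -
 interpret M: operad_chains dom' pt' bd' pr' rel' P by (rule M)
 have t_prd: "nop (dom' (p + q)) (ta (p + q)) (prd p q x y) = M.prd p q (nop (dom' p) (ta p) x) (nop (dom' q) (ta q) y)"
 for p q and x :: "'x chain" and y :: "'y chain"
 unfolding prd_def M.prd_def nop_nop2[OF tin] tpr by (rule nop2_nop[OF M.pr_in, symmetric])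
 have t_mp: "nop (dom' n) (ta n) (mp n f x) = M.mp n f (nop (dom' n) (ta n) x)" for n x and f :: "'x => 'y"
 by (rule nop_push[OF tin])
 have t_star: "nop (dom' (p + q)) (ta (p + q)) (star p q x y) = M.star p q (nop (dom' p) (ta p) x) (nop (dom' q) (ta q) y)"
 for p q and x y :: "'a list chain"
 unfolding star_def M.star_def t_mp t_prd ..
 have t_pnt: "nop (dom' 0) (ta 0) (pnt a) = M.pnt a" for a :: 'x
 unfolding pnt_def M.pnt_def nop_of t0 push_of by (auto simp: dom_0 intro!: arg_cong[of _ _ frag_of])
 have t_sprod: "nop (dom' (sdeg r)) (ta (sdeg r)) (sprod r) =
 M.sprod (map (%(q, y). (q, nop (dom' q) (ta q) y)) r)" for r :: "(nat \<times> 'a chain) list"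
 proof (induction r)
 case (Cons e r)
 have "sdeg (map (%(q, y). (q, nop (dom' q) (ta q) y)) r) = sdeg r"
 by (simp add: sdeg_def case_prod_unfold o_def)
 then show ?case using Cons by (cases e) (simp add: t_star t_mp)
 qed (simp add: t_pnt)
 let ?x = "nop (dom' (nat p)) (ta (nat p)) x"
 let ?ys = "map (%i. nop (dom' (nat (qs ! i))) (ta (nat (qs ! i))) (ys ! i)) [0..<length ms]"
 have len: "length qs = length ms" "length ys = length ms" using v by (auto simp: valid_def)
 show ?thesis
 proof (rule negative_degree_cases[OF v x])
 assume 0: "0 : set (x # ys)"
 have "0 : set (?x # ?ys)"
 proof (cases "x = 0")
 case False
 then obtain j where "j < length ms" "ys ! j = 0" using 0 len by (auto simp: in_set_conv_nth)
 then show ?thesis by force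
 qed simp
 then have "M.rcomp ms p qs ?x ?ys = 0" using len by (intro M.rcomp_zero) simp_all
 then show ?thesis using rcomp_zero[OF _ 0] len by simp
 next
 assume nn: "0 <= p" "!!i. i < length ms ==> 0 <= qs ! i"
 have args: "map (%(q, y). (q, nop (dom' q) (ta q) y)) (args p qs x ys) = M.args p qs ?x ?ys"
 unfolding args_def M.args_def using len by (auto intro!: nth_equalityI)
 have "sdeg (M.args p qs ?x ?ys) = sdeg (args p qs x ys)"
 unfolding args[symmetric] by (simp add: sdeg_def case_prod_unfold o_def)
 moreover have "nat (p + sum_list qs) = sdeg (args p qs x ys)"
 using args_in(3)[OF v x nn] by linarith
 ultimately show ?thesis
 unfolding rcomp_def M.rcomp_def by (simp add: t_mp t_sprod args)
 qed
qed

definition tri_mor :: "'a top_operad_data => nat => int => 'a chain set set => 'a chain" where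
 "tri_mor P l n A = nop (splx (nat n)) (tau (nat n)) (ord_rep n (tspace P l) A)"

text \<open>The empty set of relations on the target turns stability under relations into an
  equation.\<close>

lemma tau_relations:
 assumes "x : relations (cube n) (cube_rel n) X"
 shows "nop (splx n) (tau n) x = 0"
proof -
 have "nop (splx n) (tau n) x : relations (splx n) {} X"
 by (rule nop_relations[OF assms tau_in]) (simp_all add: tau_rel)
 then show ?thesis by simp
qed

lemma tri_mor_class:
 assumes "x : cchains n (tspace P l)"
 shows "tri_mor P l n (ord_class n (tspace P l) x) = nop (splx (nat n)) (tau (nat n)) x"
proof -
 have "nop (splx (nat n)) (tau (nat n)) (ord_rep n (tspace P l) (ord_class n (tspace P l) x) - x) = 0"
 using ord_rep(2)[OF assms] tau_relations unfolding crelation_def by (metis nop_0)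
 then show ?thesis by (simp add: tri_mor_def nop_diff)
qed

lemma tri_mor:
 assumes P: "top_operad P"
 shows "dg_operad_mor (ord_operad P) (sing_operad P) (tri_mor P)"
proof -
 note cub = ord_operad_presented[OF P] and sim = sing_operad_presented[OF P]
 interpret presented_operad cube "%_. 0" cube_bd cube_pr cube_rel P "ord_operad P" "%l n. ord_class n (tspace P l)"
 by (rule cub)
 interpret M: presented_operad splx "%j. if j = 0 then 1 else 0" simp_bd simp_pr "%p. {}" P "sing_operad P" "%l n x. x"
 by (rule sim)
 have chz: "chz n X = cchains n X" for n and X :: "'a topology" by (simp add: chz_def cchains_def)
 show ?thesis
 proof (rule presented_dg_operad_mor[OF sim, where h = "%l n. nop (splx (nat n)) (tau (nat n))"])
 fix l n and x y :: "'a chain"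
 show "x : chz n (sp l) ==> tri_mor P l n (ord_class n (sp l) x) = nop (splx (nat n)) (tau (nat n)) x"
 by (rule tri_mor_class) (simp add: chz)
 show "x : chz n (sp l) ==> nop (splx (nat n)) (tau (nat n)) x : M.chz n (sp l)"
 using nop_in_chains[OF tau_in] by (auto simp: chz_def M.chz_def)
 show "nop (splx (nat n)) (tau (nat n)) (x + y) =
 nop (splx (nat n)) (tau (nat n)) x + nop (splx (nat n)) (tau (nat n)) y"
 by (rule nop_add)
 show "nop (splx (nat (n - 1))) (tau (nat (n - 1))) (bdry (nat n) x) = M.bdry (nat n) (nop (splx (nat n)) (tau (nat n)) x)"
 unfolding nat_minus_one bdry_def M.bdry_def nop_nop[OF tau_in] nop_nop[OF simp_bd_in] tau_bd ..
 show "nop (splx (nat n)) (tau (nat n)) (mp (nat n) (tact P l sgg) x) =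
 M.mp (nat n) (tact P l sgg) (nop (splx (nat n)) (tau (nat n)) x)" for sgg
 by (rule nop_push[OF tau_in])
 next
 fix ms p qs x ys assume "x : chz p (sp (length ms))" "valid ms qs ys"
 then show "nop (splx (nat (p + sum_list qs))) (tau (nat (p + sum_list qs))) (rcomp ms p qs x ys) =
 M.rcomp ms p qs (nop (splx (nat p)) (tau (nat p)) x)
 (map (%i. nop (splx (nat (qs ! i))) (tau (nat (qs ! i))) (ys ! i)) [0..<length ms])"
 by (intro rcomp_model_mor[OF M.operad_chains_axioms]) (simp_all add: tau_in tau_pr tau_0)
 next
 show "nop (splx (nat 0)) (tau (nat 0)) (pnt (tunit P)) = M.pnt (tunit P)"
 unfolding pnt_def M.pnt_def nop_of nat_zero_as_int[symmetric]
 by (auto simp: tau_0 unit_cube_def intro!: arg_cong[of _ _ frag_of])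
 qed
qed


section \<open>From simplices to ordered cubes\<close>

text \<open>Partial products of numbers in the unit interval decrease, so they are upper sums.
  Setting a coordinate to 1 repeats an upper sum or puts 1 in front, setting the last one to 0 ends
  with 0: these are the simplicial faces. The remaining faces at 0 are degenerate.\<close>

definition gam :: "nat => point chain" where
 "gam n = cube_gen n (%t. dfs n (%k. \<Prod>j\<le>k. t j))"

lemma gam_map_in: "t : cube n ==> dfs m (%k. \<Prod>j\<le>k. t j) : splx m"
 by (intro dfs_in_simplex) (auto simp: unit_cube_def intro!: prod_nonneg prod_le_1 mult_left_le)

lemma gam_continuous: "continuous_map (rsub (cube n)) (rsub (splx m)) (%t. dfs m (%k. \<Prod>j\<le>k. t j))"
proof (rule cube_continuous)
 show "continuous_map (powertop_real UNIV) euclideanreal (%t. dfs m (%k. \<Prod>j\<le>k. t j) i)" for i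
 unfolding dfs_def
 by (intro continuous_map_if_const continuous_map_diff continuous_map_prod continuous_map_product_projection) auto
qed (rule gam_map_in)

lemma gam_in: "gam n : chains_on (cube n) (rsub (splx n))"
 by (simp add: gam_def maps_on_restrict gam_continuous)

lemma prod_cins:
 "i < k ==> (\<Prod>j\<le>i. cins k a t j) = (\<Prod>j\<le>i. t j)"
 "k <= i ==> (\<Prod>j\<le>i. cins k a t j) = a * (\<Prod>j<i. t j)"
proof -
 show "i < k ==> (\<Prod>j\<le>i. cins k a t j) = (\<Prod>j\<le>i. t j)"
 by (intro prod.cong) (auto simp: cins_def)
 assume k: "k <= i"
 have "{..i} = insert k (skip k ` {..<i})"
 proof (intro equalityI subsetI)
 fix j assume "j : {..i}"
 then show "j : insert k (skip k ` {..<i})"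
 using k by (cases j k rule: skip_cases) (auto simp: skip_def split: if_splits)
 qed (use k in \<open>auto simp: skip_def split: if_splits\<close>)
 then have "(\<Prod>j\<le>i. cins k a t j) = cins k a t k * (\<Prod>j\<in>skip k ` {..<i}. cins k a t j)"
 by (simp add: image_iff)
 also have "... = a * (\<Prod>j<i. cins k a t (skip k j))"
 by (subst prod.reindex) (auto simp: inj_on_def cins_def)
 also have "... = a * (\<Prod>j<i. t j)"
 by (intro arg_cong2[of _ _ _ _ "(*)"] prod.cong refl) (auto simp: cins_def skip_def)
 finally show "(\<Prod>j\<le>i. cins k a t j) = a * (\<Prod>j<i. t j)" .
qed

lemma gam_bd: "nop (cube (n - 1)) (cube_bd n) (gam n) - nop (cube (n - 1)) (gam (n - 1)) (simp_bd n)
 : relations (cube (n - 1)) (cube_rel (n - 1)) (rsub (splx n))"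
proof (cases n)
 case 0
 then show ?thesis by (simp add: cube_bd_def simp_bd_def chain_boundary_def relations_0)
next
 case (Suc m)
 let ?P = "%t k. \<Prod>j\<le>k. t j :: real"
 let ?f = "%k. cube_gen m (%t. simplical_face k (dfs m (?P t)))"
 let ?z = "%k. cube_gen m (%t. dfs (Suc m) (?P (cins k 0 t)))"
 have face: "dfs (Suc m) (?P (cins k a t)) = simplical_face l (dfs m (?P t))"
 if t: "t : cube m" and k: "k <= m" and a: "a = 1 & l = k \<or> a = 0 & k = m & l = Suc m" for k a l t
 proof (rule simplex_eqI)
 have "cins k a t : cube (Suc m)" using cins_in[of k "Suc m" a t] t k a by auto
 then show "dfs (Suc m) (?P (cins k a t)) : splx (Suc m)" by (rule gam_map_in)
 have d: "dfs m (?P t) : splx m" by (rule gam_map_in[OF t])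
 then show "simplical_face l (dfs m (?P t)) : splx (Suc m)"
 using simplical_face_in_standard_simplex[of "Suc m" l] k a by auto
 fix i assume i: "i < Suc m"
 have "crd (Suc m) (simplical_face l (dfs m (?P t))) i =
 (if i < l then crd m (dfs m (?P t)) i else if i = 0 then 1 else crd m (dfs m (?P t)) (i - 1))"
 using crd_face[of "Suc m" l i "dfs m (?P t)"] i k a d by auto
 also have "... = ?P (cins k a t) i"
 proof (cases "i < k")
 case True
 then show ?thesis using a k by (auto simp: prod_cins crd_dfs)
 next
 case False
 then have "?P (cins k a t) i = a * (\<Prod>j<i. t j)" by (intro prod_cins) simp
 moreover have "(\<Prod>j<i. t j) = ?P t (i - 1)" if "i ~= 0" using that by (cases i) (simp_all add: lessThan_Suc_atMost)
 ultimately show ?thesis using a k i False by (auto simp: crd_dfs crd_eq_0)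
 qed
 finally show "crd (Suc m) (dfs (Suc m) (?P (cins k a t))) i = crd (Suc m) (simplical_face l (dfs m (?P t))) i"
 using i by (simp add: crd_dfs)
 qed
 have bd: "nop (cube m) (cube_bd (Suc m)) (gam (Suc m)) =
 (\<Sum>k<Suc m. frag_cmul ((- 1) ^ Suc k) (?z k)) + (\<Sum>k<Suc m. frag_cmul ((- 1) ^ k) (?f k))"
 proof -
 have "cube_gen m (%t. dfs (Suc m) (?P (cins k 1 t))) = ?f k" if "k < Suc m" for k
 using that by (intro cube_gen_eqI face) auto
 then have "cube_boundary (Suc m) (gam (Suc m)) = (\<Sum>k<Suc m. frag_cmul ((- 1) ^ Suc k) (?z k) + frag_cmul ((- 1) ^ k) (?f k))"
 unfolding gam_def cbd_gen by (intro sum.cong) auto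
 then show ?thesis using nop_cube_bd[of "Suc m" "gam (Suc m)"] by (simp only: diff_Suc_1 sum.distrib)
 qed
 have "?z m = ?f (Suc m)" by (intro cube_gen_eqI face) auto
 then have "nop (cube m) (cube_bd (Suc m)) (gam (Suc m)) =
 (\<Sum>k<m. frag_cmul ((- 1) ^ Suc k) (?z k)) + (\<Sum>k\<le>Suc m. frag_cmul ((- 1) ^ k) (?f k))"
 unfolding bd lessThan_Suc_atMost[symmetric] by (simp add: ac_simps)
 moreover have "nop (cube m) (gam m) (simp_bd (Suc m)) = (\<Sum>k\<le>Suc m. frag_cmul ((- 1) ^ k) (?f k))"
 proof -
 have "nop (cube m) (gam m) (simp_gen m (simplical_face k)) = ?f k" for k
 unfolding nop_of gam_def push_cube_gen by (rule cube_gen_eqI) (simp add: gam_map_in)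
 then show ?thesis
 using simp_bd_eq[of "Suc m"] by (simp add: nop_sum nop_cmul del: sum.atMost_Suc nop_of)
 qed
 moreover have "?z k : relations (cube m) (cube_rel m) (rsub (splx (Suc m)))" if k: "k < m" for k
 proof -
 let ?h = "%t. dfs (Suc m) (?P (cins k 0 t))"
 \<comment> \<open>All products from place \<open>k\<close> on contain the inserted 0, so coordinate
   \<open>k\<close> of the face is not seen; it exists because of \<open>k < m\<close>.\<close>
 have "?P (cins k 0 t) = ?P (cins k 0 (t(k := 0)))" for t
 proof
 fix i show "?P (cins k 0 t) i = ?P (cins k 0 (t(k := 0))) i"
 by (cases "i < k") (auto simp: prod_cins not_less intro!: prod.cong)
 qed
 then have "?z k = cube_gen m (%t. ?h (t(k := 0)))" by (simp only:)
 moreover have "continuous_map (rsub (cube m)) (rsub (splx (Suc m))) ?h"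
 using continuous_map_compose[OF cins_continuous[of k "Suc m" 0] gam_continuous[of "Suc m" "Suc m"]] k
 by (simp add: o_def)
 ultimately show ?thesis using cube_rel_push(1)[of m _ ?h k] k by simp
 qed
 ultimately show ?thesis
 by (auto simp: Suc intro!: relations_sum relations_cmul simp del: power_Suc sum.atMost_Suc)
qed


section \<open>Homotopies\<close>

text \<open>The simplex contracts linearly to its vertex \<open>a\<close>, and on a one-point space
  every cycle of positive degree is a boundary.\<close>

lemma simplex_acyclic:
 assumes z: "z : chains_on (splx n) (rsub (splx m))" "chain_boundary n z = 0" and n: "1 <= n"
 shows "\<exists>b\<in>chains_on (splx (Suc n)) (rsub (splx m)). chain_boundary (Suc n) b = z"
proof -
 let ?X = "rsub (splx m)"
 define a :: "point" where "a = (%j. if j = 0 then 1 else 0)"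
 have a: "a : splx m" by (simp add: a_def standard_simplex_def)
 have z': "singular_relcycle n ?X {} z" using z by (simp add: singular_cycle chains_on_simplex)
 let ?h = "%(u, t). %i. (1 - u) * t i + u * a i"
 have "continuous_map (prod_topology (top_of_set {0..1}) ?X) ?X ?h"
 proof -
 have "continuous_map (prod_topology (top_of_set {0..1}) ?X) euclideanreal (%x. (1 - fst x) * snd x i + fst x * a i)" for i
 proof -
 have 1: "continuous_map (prod_topology (top_of_set {0..1::real}) ?X) euclideanreal fst"
 using continuous_map_fst continuous_map_into_fulltopology by blast
 have "continuous_map ?X euclideanreal (%t. t i)"
 by (intro continuous_map_from_subtopology continuous_map_product_projection) simp
 then have 2: "continuous_map (prod_topology (top_of_set {0..1::real}) ?X) euclideanreal (%x. snd x i)"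
 using continuous_map_compose[OF continuous_map_snd] by (fastforce simp: o_def)
 show ?thesis by (intro continuous_map_add continuous_map_real_mult continuous_map_diff 1 2) auto
 qed
 moreover have "?h x : splx m" if "x : topspace (prod_topology (top_of_set {0..1}) ?X)" for x
 using that convex_standard_simplex[of "snd x" m a "fst x"] a by (auto simp: case_prod_unfold)
 ultimately show ?thesis
 by (auto simp: continuous_map_in_subtopology continuous_map_componentwise_UNIV case_prod_unfold)
 qed
 then have "homotopic_with (%h. h : {} \<rightarrow> {}) ?X ?X (%t. t) (%t. a)"
 unfolding homotopic_with_def by (intro exI[of _ ?h]) auto
 then have 1: "singular_relboundary n ?X {} (chain_map n (%t. t) z - chain_map n (%t. a) z)"
 using homotopic_imp_homologous_rel_chain_maps[OF _ z'] unfolding homologous_rel_def by blast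
 let ?A = "subtopology ?X {a}"
 have top: "topspace ?A = {a}" using a by auto
 have "continuous_map ?X ?A (%t. a)" using a by (simp add: continuous_map_in_subtopology)
 then have "singular_relcycle n ?A {} (chain_map n (%t. a) z)"
 using singular_chain_chain_map[of n ?X z ?A "%t. a"] z' chain_boundary_chain_map[of n ?X z "%t. a"]
 by (simp add: singular_cycle)
 then have "singular_relboundary n ?A {} (chain_map n (%t. a) z)"
 using singular_boundary_eq_cycle_singleton[OF top n] by blast
 then obtain d where d: "singular_chain (Suc n) ?A d" "chain_boundary (Suc n) d = chain_map n (%t. a) z"
 by (auto simp: singular_boundary)
 obtain d' where d': "singular_chain (Suc n) ?X d'" "chain_boundary (Suc n) d' = chain_map n (%t. t) z - chain_map n (%t. a) z"
 using 1 by (auto simp: singular_boundary)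
 have "chain_map n (%t. t) z = z"
 using push_id[OF z(1), of "%t. t"] by (simp add: push_simplex)
 moreover have "singular_chain (Suc n) ?X d"
 using d(1) by (simp add: singular_chain_subtopology)
 ultimately show ?thesis
 using d d' by (intro bexI[of _ "d' + d"]) (simp_all add: chain_boundary_add chains_on_simplex singular_chain_add)
qed

section \<open>From simplices to cubes and back\<close>

definition sendo :: "nat => point chain" where
 "sendo n = nop (splx n) (tau n) (gam n)"

lemma sendo_in: "sendo n : chains_on (splx n) (rsub (splx n))"
 unfolding sendo_def by (rule nop_in_chains[OF tau_in gam_in])

text \<open>\<open>gam\<close> is a chain map only modulo relations, but \<open>tau\<close>
  annihilates these, so the composite is strictly a chain map.\<close>

lemma sendo_bd: "chain_boundary n (sendo n) = nop (splx (n - 1)) (sendo (n - 1)) (simp_bd n)"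
proof -
 let ?D = "splx (n - 1)"
 have "chain_boundary n (sendo n) = nop ?D (nop ?D (simp_bd n) (tau n)) (gam n)"
 unfolding nop_simp_bd[symmetric] sendo_def by (rule nop_nop[OF simp_bd_in])
 also have "... = nop ?D (tau (n - 1)) (nop (cube (n - 1)) (cube_bd n) (gam n))"
 unfolding tau_bd by (rule nop_nop[OF tau_in, symmetric])
 also have "... = nop ?D (tau (n - 1)) (nop (cube (n - 1)) (gam (n - 1)) (simp_bd n))"
 using tau_relations[OF gam_bd[of n]] by (simp add: nop_diff)
 also have "... = nop ?D (sendo (n - 1)) (simp_bd n)"
 unfolding sendo_def by (rule nop_nop[OF tau_in])
 finally show ?thesis .
qed

lemma sendo_0: "sendo 0 = universal (splx 0)"
 unfolding sendo_def gam_def nop_of tau_0 push_of universal_def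
 by (intro arg_cong[of _ _ frag_of] restrict_ext) (auto simp: dfs_def unit_cube_def standard_simplex_0 fun_eq_iff)

lemma simp_bd_bd: "nop (splx n) (simp_bd (Suc n)) (simp_bd (Suc (Suc n))) = 0"
 using chain_model.bd_bd[OF simplex_model, of "Suc (Suc n)"] by simp

lemma chain_boundary_nop:
 "chain_boundary n (nop (splx n) b y) = nop (splx (n - 1)) (chain_boundary n b) y"
 unfolding nop_simp_bd[symmetric] by (rule nop_nop[OF simp_bd_in])

text \<open>The method of acyclic models.\<close>

lemma sing_homotopy:
 obtains b where "!!n. b n : chains_on (splx (Suc n)) (rsub (splx n))"
 "!!n. chain_boundary (Suc n) (b n) = universal (splx n) - sendo n - nop (splx n) (b (n - 1)) (simp_bd n)"
proof -
 \<comment> \<open>The homotopy equation involves the previous term. Composed with the next boundary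
   it no longer does, as two boundaries compose to 0; \<open>good\<close> keeps this consequence, so
   that a choice depending on one predecessor suffices.\<close>
 define good where "good n b \<longleftrightarrow> b : chains_on (splx (Suc n)) (rsub (splx n)) & (n = 0 --> b = 0) \<and>
 nop (splx n) (chain_boundary (Suc n) b) (simp_bd (Suc n)) = simp_bd (Suc n) - nop (splx n) (sendo n) (simp_bd (Suc n))" for n b
 define succ where "succ n b b' \<longleftrightarrow> chain_boundary (Suc (Suc n)) b' =
 universal (splx (Suc n)) - sendo (Suc n) - nop (splx (Suc n)) b (simp_bd (Suc n))" for n b b'
 have bd_in: "simp_bd (Suc n) : chains_on (splx n) (rsub (splx (Suc n)))" for n
 using simp_bd_in[of "Suc n"] by simp
 have "\<exists>b. \<forall>n. good n (b n) & succ n (b n) (b (Suc n))"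
 proof (rule dependent_nat_choice)
 \<comment> \<open>In degree 0 the composite is the identity, so the homotopy starts with 0.\<close>
 show "\<exists>b. good 0 b"
 by (intro exI[of _ 0]) (simp add: good_def sendo_0 universal_nop[OF bd_in] chain_boundary_def)
 fix b n assume b: "good n b"
 let ?z = "universal (splx (Suc n)) - sendo (Suc n) - nop (splx (Suc n)) b (simp_bd (Suc n))"
 have b_in: "b : chains_on (splx (Suc n)) (rsub (splx n))" using b by (simp add: good_def)
 have z_in: "?z : chains_on (splx (Suc n)) (rsub (splx (Suc n)))"
 by (intro chains_diff universal_in_chains sendo_in nop_in_chains[OF b_in bd_in])
 \<comment> \<open>The obstruction is a cycle in the positive degree \<open>Suc n\<close>, where the
   model is acyclic.\<close>
 have "chain_boundary (Suc n) ?z = simp_bd (Suc n) - nop (splx n) (sendo n) (simp_bd (Suc n)) -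
 nop (splx n) (chain_boundary (Suc n) b) (simp_bd (Suc n))"
 using chain_boundary_nop[of "Suc n" b "simp_bd (Suc n)"] sendo_bd[of "Suc n"]
 by (simp add: chain_boundary_diff simp_bd_def)
 also have "... = 0" using b by (simp add: good_def)
 finally obtain b' where b': "b' : chains_on (splx (Suc (Suc n))) (rsub (splx (Suc n)))"
 "chain_boundary (Suc (Suc n)) b' = ?z" using simplex_acyclic[OF z_in] by auto
 have "nop (splx (Suc n)) (nop (splx (Suc n)) b (simp_bd (Suc n))) (simp_bd (Suc (Suc n))) = 0"
 unfolding nop_nop[OF b_in, symmetric] simp_bd_bd by simp
 then have "good (Suc n) b'"
 unfolding good_def b'(2) using b'(1) by (simp add: nop_diff_left universal_nop[OF bd_in])
 then show "\<exists>b'. good (Suc n) b' & succ n b b'" using b'(2) by (auto simp: succ_def)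
 qed
 then obtain b where b: "!!n. good n (b n)" "!!n. succ n (b n) (b (Suc n))" by blast
 show thesis
 proof (rule that)
 show "b n : chains_on (splx (Suc n)) (rsub (splx n))" for n
 using b(1)[of n] by (simp add: good_def)
 show "chain_boundary (Suc n) (b n) = universal (splx n) - sendo n - nop (splx n) (b (n - 1)) (simp_bd n)" for n
 proof (cases n)
 case 0
 then show ?thesis using b(1)[of 0] by (simp add: good_def sendo_0 simp_bd_def chain_boundary_def)
 next
 case (Suc m)
 then show ?thesis using b(2)[of m] by (simp add: succ_def)
 qed
 qed
qed

text \<open>
 On the side of the cubes a contraction of the models that is compatible with the relations is
 needed. The cone with vertex 0 is, because zeroing and permuting coordinates are linear.
\<close>

definition cone_map :: "(point => nat => real) => point => point" where
 "cone_map c s = (%i. s 0 * c (%j. s (Suc j)) i)"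

definition cube_cone :: "nat => point chain => point chain" where
 "cube_cone m = frag_extend (%c. cube_gen (Suc m) (cone_map c))"

lemma cube_shift_in: "s : cube (Suc m) ==> (%j. s (Suc j)) : cube m"
 by (auto simp: unit_cube_def)

lemma cube_cone_gen: "cube_cone m (cube_gen m f) = cube_gen (Suc m) (cone_map f)"
 unfolding cube_cone_def frag_extend_of by (rule cube_gen_eqI) (simp add: cone_map_def cube_shift_in)

lemma cube_cone_diff: "cube_cone m (x - y) = cube_cone m x - cube_cone m y"
 by (simp add: cube_cone_def frag_extend_diff)

lemma cube_cone_cmul: "cube_cone m (frag_cmul k x) = frag_cmul k (cube_cone m x)"
 by (simp add: cube_cone_def frag_extend_cmul)

lemma cube_cone_sum: "finite I ==> cube_cone m (\<Sum>i\<in>I. g i) = (\<Sum>i\<in>I. cube_cone m (g i))"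
 by (simp add: cube_cone_def frag_extend_sum o_def)

lemma cone_map_in:
 assumes "s : cube (Suc m)" "c (%j. s (Suc j)) : cube n"
 shows "cone_map c s : cube n"
 using assms by (auto simp: unit_cube_def cone_map_def intro: mult_le_one)

lemma maps_on_cube_in: "c : maps_on (cube m) (rsub (cube n)) ==> t : cube m ==> c t : cube n"
 using maps_on_in by fastforce

lemma cone_map_continuous:
 assumes c: "c : maps_on (cube m) (rsub (cube n))"
 shows "continuous_map (rsub (cube (Suc m))) (rsub (cube n)) (cone_map c)"
proof -
 have proj: "continuous_map (rsub (cube (Suc m))) euclideanreal (%s. s j)" for j
 by (intro continuous_map_from_subtopology continuous_map_product_projection) simp
 have shift: "continuous_map (rsub (cube (Suc m))) (rsub (cube m)) (%s j. s (Suc j))"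
 by (rule cube_continuous) (auto intro: continuous_map_product_projection cube_shift_in)
 have "continuous_map (rsub (cube m)) euclideanreal (%t. c t i)" for i
 using maps_on_continuous[OF c] by (simp add: continuous_map_in_subtopology continuous_map_componentwise_UNIV)
 from continuous_map_compose[OF shift this]
 have "continuous_map (rsub (cube (Suc m))) euclideanreal (%s. cone_map c s i)" for i
 unfolding cone_map_def by (intro continuous_map_real_mult proj) (simp add: o_def)
 then show ?thesis
 using cone_map_in maps_on_cube_in[OF c] cube_shift_in
 by (auto simp: continuous_map_in_subtopology continuous_map_componentwise_UNIV)
qed

lemma cube_cone_in:
 "u : chains_on (cube m) (rsub (cube n)) ==> cube_cone m u : chains_on (cube (Suc m)) (rsub (cube n))"
 unfolding cube_cone_def by (erule chains_frag_extend) (simp add: maps_on_restrict cone_map_continuous)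

lemma maps_on_eq_gen: "c : maps_on (cube m) X ==> frag_of c = cube_gen m c"
 by (simp add: maps_on_def extensional_restrict)

text \<open>The cone parameter is a new coordinate in front: a degenerate direction moves from
  \<open>i\<close> to \<open>Suc i\<close>, and a permutation is extended by a fixed point, with the
  same sign.\<close>

lemma cube_cone_relations:
 assumes "u : relations (cube m) (cube_rel m) (rsub (cube n))"
 shows "cube_cone m u : relations (cube (Suc m)) (cube_rel (Suc m)) (rsub (cube n))"
 using assms
proof (rule relations_additive)
 fix c r assume c: "c : maps_on (cube m) (rsub (cube n))" and r: "r : cube_rel m"
 note cont = cone_map_continuous[OF c]
 from r show "cube_cone m (push (cube m) c r) : relations (cube (Suc m)) (cube_rel (Suc m)) (rsub (cube n))"
 unfolding cube_rel_def[of m]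
 proof (elim UnE CollectE exE conjE)
 fix i assume r: "r = cube_gen m (%t. t(i := 0))" and i: "i < m"
 have "cone_map (%t. c (t(i := 0))) = (%s. cone_map c (s(Suc i := 0)))"
 by (auto simp: cone_map_def fun_eq_iff fun_upd_def intro!: arg_cong2[of _ _ _ _ c])
 then show ?thesis
 unfolding r push_cube_gen cube_cone_gen using cube_rel_push(1)[OF cont, of "Suc i"] i by simp
 next
 fix pp assume r: "r = cube_gen m (%t. t) - frag_cmul (sign pp) (cube_gen m (%t. t o pp))" and pp: "pp permutes {..<m}"
 have "cone_map (%t. c (t o pp)) = (%s. cone_map c (s o perm_sum 1 id pp))"
 by (simp add: cone_map_def fun_eq_iff perm_sum_def o_def)
 then show ?thesis
 unfolding r push_diff push_cmul push_cube_gen cube_cone_diff cube_cone_cmul cube_cone_gen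
 using cube_rel_push(2)[OF cont, of "perm_sum 1 id pp"] perm_sum_permutes[OF permutes_id pp, of 1]
 sign_perm_sum[OF permutes_id pp, of 1] by simp
 qed
qed (rule cube_cone_diff)

text \<open>The vertex of the cone is the origin, so maps that commute with scaling commute with
  forming cones.\<close>

lemma cube_cone_push:
 assumes f: "!!a t. f (%i. a * t i) = (%i. a * f t i)"
 and u: "u : chains_on (cube m) (rsub (cube n))"
 shows "push (cube (Suc m)) (restrict f (cube n)) (cube_cone m u) = cube_cone m (push (cube m) (restrict f (cube n)) u)"
 using u
proof (induction u rule: chains_induct)
 case (one c)
 have "cube_cone m (push (cube m) (restrict f (cube n)) (frag_of c)) = cube_cone m (cube_gen m (%t. f (c t)))"
 unfolding maps_on_eq_gen[OF one] push_cube_gen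
 by (intro arg_cong[of _ _ "cube_cone m"] cube_gen_eqI) (simp add: maps_on_cube_in[OF one])
 moreover have "push (cube (Suc m)) (restrict f (cube n)) (cube_cone m (frag_of c)) = cube_gen (Suc m) (%s. f (cone_map c s))"
 unfolding maps_on_eq_gen[OF one] cube_cone_gen push_cube_gen
 by (rule cube_gen_eqI) (simp add: cone_map_in maps_on_cube_in[OF one] cube_shift_in)
 moreover have "f (cone_map c s) = cone_map (%t. f (c t)) s" for s
 unfolding cone_map_def by (rule f)
 ultimately show ?case by (simp only: cube_cone_gen)
qed (simp_all add: cube_cone_diff push_diff cube_cone_def[of m, THEN fun_cong, of 0])

lemma cube_cone_nop:
 assumes u: "u : chains_on (cube m) (rsub (cube m))" and r: "r : cube_rel m"
 shows "nop (cube (Suc m)) (cube_cone m u) r = cube_cone m (nop (cube m) u r)"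
 using r unfolding cube_rel_def
proof (elim UnE CollectE exE conjE)
 fix i assume "r = cube_gen m (%t. t(i := 0))"
 then show ?thesis
 unfolding nop_of by (simp only: nop_of) (rule cube_cone_push[OF _ u], auto simp: fun_eq_iff)
next
 fix pp assume "r = cube_gen m (%t. t) - frag_cmul (sign pp) (cube_gen m (%t. t o pp))"
 moreover have "push (cube (Suc m)) (restrict (%t. t) (cube m)) (cube_cone m u) = cube_cone m (push (cube m) (restrict (%t. t) (cube m)) u)"
 by (rule cube_cone_push[OF _ u]) simp
 moreover have "push (cube (Suc m)) (restrict (%t. t o pp) (cube m)) (cube_cone m u) = cube_cone m (push (cube m) (restrict (%t. t o pp) (cube m)) u)"
 by (rule cube_cone_push[OF _ u]) (simp add: fun_eq_iff)
 ultimately show ?thesis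
 by (simp only: nop_diff nop_cmul nop_of cube_cone_diff cube_cone_cmul)
qed

text \<open>In the new direction the face at 1 is the given cube and the face at 0 is constant. In
  the other directions the cone on the boundary appears with the opposite sign. A constant cube is
  degenerate in positive dimension, hence \<open>Suc m\<close>.\<close>

lemma cube_cone_bd:
 assumes u: "u : chains_on (cube (Suc m)) (rsub (cube n))"
 shows "cube_boundary (Suc (Suc m)) (cube_cone (Suc m) u) + cube_cone m (cube_boundary (Suc m) u) - u
 : relations (cube (Suc m)) (cube_rel (Suc m)) (rsub (cube n))"
 using u
proof (induction u rule: chains_induct)
 case zero
 then show ?case by (simp add: cube_cone_def cube_boundary_def relations_0)
next
 case (one c)
 let ?M = "Suc m"
 let ?t = "%i e. frag_cmul ((- 1) ^ (Suc i + e)) (cube_gen ?M (%t. cone_map c (cins i (real e) t)))"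
 let ?s = "%i e. frag_cmul ((- 1) ^ (Suc i + e)) (cube_gen ?M (cone_map (%t. c (cins i (real e) t))))"
 have "cone_map c (cins (Suc i) a t) = cone_map (%t. c (cins i a t)) t" for i a t
 by (auto simp: cone_map_def cins_def fun_eq_iff intro!: arg_cong2[of _ _ _ _ c])
 then have ts: "?t (Suc i) e = - ?s i e" for i e by simp
 have "cube_boundary (Suc ?M) (cube_cone ?M (frag_of c)) = (\<Sum>i<Suc ?M. \<Sum>e\<in>{0, 1}. ?t i e)"
 unfolding maps_on_eq_gen[OF one] cube_cone_gen cbd_gen by simp
 also have "... = (\<Sum>e\<in>{0, 1}. ?t 0 e) + (\<Sum>i<?M. \<Sum>e\<in>{0, 1}. ?t (Suc i) e)"
 by (rule sum.lessThan_Suc_shift)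
 also have "(\<Sum>i<?M. \<Sum>e\<in>{0, 1}. ?t (Suc i) e) = - cube_cone m (cube_boundary ?M (frag_of c))"
 unfolding maps_on_eq_gen[OF one] cbd_gen ts sum_negf
 by (simp only: cube_cone_sum finite_lessThan finite.insertI finite.emptyI cube_cone_cmul diff_Suc_1 cube_cone_gen)
 also have "(\<Sum>e\<in>{0, 1}. ?t 0 e) = frag_of c - cube_gen ?M (%t i. 0)"
 proof -
 have "cone_map c (cins 0 0 t) = (%i. 0)" "cone_map c (cins 0 1 t) = c t" for t
 by (auto simp: cone_map_def cins_def)
 then show ?thesis unfolding maps_on_eq_gen[OF one] by simp
 qed
 finally have "cube_boundary (Suc ?M) (cube_cone ?M (frag_of c)) + cube_cone m (cube_boundary ?M (frag_of c)) - frag_of c =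
 - cube_gen ?M (%t i. 0)" by simp
 moreover have "continuous_map (rsub (cube ?M)) (rsub (cube n)) (%t i. 0)"
 by (rule cube_continuous) (auto simp: unit_cube_def)
 from cube_rel_push(1)[OF this, of 0]
 have "cube_gen ?M (%t i. 0) : relations (cube ?M) (cube_rel ?M) (rsub (cube n))" by simp
 ultimately show ?case using relations_minus by metis
next
 case (diff a b)
 have lin: "cube_boundary k (x - y) = cube_boundary k x - cube_boundary k y" for k and x y :: "point chain"
 by (simp add: cube_boundary_def frag_extend_diff)
 have "cube_boundary (Suc (Suc m)) (cube_cone (Suc m) (a - b)) + cube_cone m (cube_boundary (Suc m) (a - b)) - (a - b) =
 (cube_boundary (Suc (Suc m)) (cube_cone (Suc m) a) + cube_cone m (cube_boundary (Suc m) a) - a) -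
 (cube_boundary (Suc (Suc m)) (cube_cone (Suc m) b) + cube_cone m (cube_boundary (Suc m) b) - b)"
 unfolding cube_cone_diff lin by simp
 then show ?case using relations_diff[OF diff(3,4)] by (simp only:)
qed

section \<open>From cubes to simplices and back\<close>

definition cendo :: "nat => point chain" where
 "cendo n = nop (cube n) (gam n) (tau n)"

lemma cendo_in: "cendo n : chains_on (cube n) (rsub (cube n))"
 unfolding cendo_def by (rule nop_in_chains[OF gam_in tau_in])

lemma nop_cendo: "nop (cube n) (cendo n) x = nop (cube n) (gam n) (nop (splx n) (tau n) x)"
 unfolding cendo_def by (rule nop_nop[OF gam_in, symmetric])

lemma cendo_0: "cendo 0 = universal (cube 0)"
 unfolding cendo_def tau_0 nop_of gam_def push_cube_gen universal_def
 by (rule cube_gen_eqI) (auto simp: dfs_def unit_cube_def standard_simplex_0 fun_eq_iff)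

text \<open>\<open>tau\<close> is a chain map, so the defect is that of \<open>gam\<close>, applied
  to \<open>tau n\<close>; a universal chain that is a relation gives relations only.\<close>

lemma cendo_bd: "cube_boundary n (cendo n) - nop (cube (n - 1)) (cendo (n - 1)) (cube_bd n)
 : relations (cube (n - 1)) (cube_rel (n - 1)) (rsub (cube n))"
proof -
 let ?D = "cube (n - 1)"
 let ?r = "nop ?D (cube_bd n) (gam n) - nop ?D (gam (n - 1)) (simp_bd n)"
 have "cube_boundary n (cendo n) = nop ?D (nop ?D (cube_bd n) (gam n)) (tau n)"
 unfolding nop_cube_bd[symmetric] cendo_def by (rule nop_nop[OF cube_bd_in])
 moreover have "nop ?D (cendo (n - 1)) (cube_bd n) = nop ?D (nop ?D (gam (n - 1)) (simp_bd n)) (tau n)"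
 unfolding nop_cendo tau_bd[symmetric] by (rule nop_nop[OF gam_in])
 ultimately have "cube_boundary n (cendo n) - nop ?D (cendo (n - 1)) (cube_bd n) = nop ?D ?r (tau n)"
 by (simp add: nop_diff_left)
 then show ?thesis
 using nop_in_relations[OF gam_bd cube_rel_in tau_in, of n] by simp
qed

text \<open>The recursion of acyclic models, with the cone as filling of the obstruction in place of
  a choice. It starts with 0 because \<open>cendo 0\<close> is the identity.\<close>

primrec chtpy :: "nat => point chain" where
 "chtpy 0 = 0"
| "chtpy (Suc n) = cube_cone (Suc n) (universal (cube (Suc n)) - cendo (Suc n) -
 nop (cube (Suc n)) (chtpy n) (cube_bd (Suc n)))"

text \<open>The obstruction in degree \<open>n\<close>, which the homotopy has to bound modulo
  relations.\<close>

definition cube_defect :: "nat => point chain" where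
 "cube_defect n = universal (cube n) - cendo n - nop (cube n) (chtpy (n - 1)) (cube_bd n)"

lemma chtpy_in: "chtpy n : chains_on (cube (Suc n)) (rsub (cube n))"
proof (induction n)
 case (Suc n)
 have "cube_bd (Suc n) : chains_on (cube n) (rsub (cube (Suc n)))" using cube_bd_in[of "Suc n"] by simp
 then show ?case
 by (auto intro!: cube_cone_in chains_diff cendo_in nop_in_chains[OF Suc])
qed simp

text \<open>The first part lets the homotopy descend to the ordered chains; it rests on the cone
  being compatible with the relations and on \<open>cendo\<close> annihilating them. The second is
  the homotopy equation, by the cone formula for an obstruction that is a cycle modulo
  relations.\<close>

lemma chtpy:
 "r : cube_rel n ==> nop (cube (Suc n)) (chtpy n) r : relations (cube (Suc n)) (cube_rel (Suc n)) (rsub (cube n))"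
 "cube_boundary (Suc n) (chtpy n) - cube_defect n : relations (cube n) (cube_rel n) (rsub (cube n))"
proof (induction n arbitrary: r)
 case 0
 {
 case 1 then show ?case by (simp add: relations_0)
 next
 case 2 then show ?case by (simp add: cube_defect_def cendo_0 cube_bd_def cube_boundary_def relations_0)
 }
next
 case (Suc n)
 let ?N = "Suc n" and ?h = "chtpy n"
 define z where "z = cube_defect ?N"
 have z: "z = universal (cube ?N) - cendo ?N - nop (cube ?N) ?h (cube_bd ?N)"
 by (simp add: z_def cube_defect_def)
 have h: "chtpy ?N = cube_cone ?N z" by (simp add: z)
 have bd_in: "cube_bd ?N : chains_on (cube n) (rsub (cube ?N))" using cube_bd_in[of ?N] by simp
 have z_in: "z : chains_on (cube ?N) (rsub (cube ?N))"
 unfolding z by (intro chains_diff universal_in_chains cendo_in nop_in_chains[OF chtpy_in bd_in])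
 have lin: "cube_boundary k (x - y) = cube_boundary k x - cube_boundary k y" for k and x y :: "point chain"
 by (simp add: cube_boundary_def frag_extend_diff)
 have bd_uni: "cube_boundary ?N (universal (cube ?N)) = cube_bd ?N"
 using nop_universal[OF cube_bd_in[of ?N]] unfolding nop_cube_bd .
 let ?r = "cube_boundary ?N ?h - cube_defect n"
 have "cube_boundary ?N (nop (cube ?N) ?h (cube_bd ?N)) = nop (cube n) (cube_boundary ?N ?h) (cube_bd ?N)"
 using nop_nop[OF cube_bd_in[of ?N], of ?h "cube_bd ?N"] nop_cube_bd[of ?N ?h] nop_cube_bd[of ?N "nop (cube ?N) ?h (cube_bd ?N)"] by simp
 also have "... = nop (cube n) ?r (cube_bd ?N) + nop (cube n) (cube_defect n) (cube_bd ?N)"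
 unfolding nop_add_left[symmetric] by simp
 also have "nop (cube n) (cube_defect n) (cube_bd ?N) = cube_bd ?N - nop (cube n) (cendo n) (cube_bd ?N)"
 proof -
 have "nop (cube n) (nop (cube n) (chtpy (n - 1)) (cube_bd n)) (cube_bd ?N) = 0"
 proof (cases n)
 case (Suc k)
 have "chtpy k : chains_on (cube (Suc k)) (rsub (cube k))" by (rule chtpy_in)
 note hk = nop_nop[OF this, symmetric]
 have "nop (cube k) (cube_bd (Suc k)) (cube_bd (Suc (Suc k))) = 0"
 using nop_cube_bd[of "Suc k" "cube_bd (Suc (Suc k))"] cube_boundary_bd[of "Suc (Suc k)"] by simp
 then show ?thesis unfolding Suc diff_Suc_1 hk by simp
 qed (simp add: cube_bd_def)
 then show ?thesis unfolding cube_defect_def by (simp add: nop_diff_left universal_nop[OF bd_in])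
 qed
 \<comment> \<open>What prevents the obstruction from being a cycle is the defect of
   \<open>cendo\<close> as a chain map and that of the previous homotopy equation, and both are
   relations.\<close>
 finally have "cube_boundary ?N z = - (cube_boundary ?N (cendo ?N) - nop (cube n) (cendo n) (cube_bd ?N)) - nop (cube n) ?r (cube_bd ?N)"
 unfolding z lin bd_uni by (simp add: algebra_simps)
 moreover have "cube_boundary ?N (cendo ?N) - nop (cube n) (cendo n) (cube_bd ?N) : relations (cube n) (cube_rel n) (rsub (cube ?N))"
 using cendo_bd[of ?N] by simp
 moreover have "nop (cube n) ?r (cube_bd ?N) : relations (cube n) (cube_rel n) (rsub (cube ?N))"
 by (rule nop_in_relations[OF Suc(2) cube_rel_in bd_in])
 ultimately have bz: "cube_boundary ?N z : relations (cube n) (cube_rel n) (rsub (cube ?N))"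
 using relations_diff relations_minus by metis
 {
 case 1
 have "nop (cube ?N) z r = r - nop (cube ?N) (cendo ?N) r - nop (cube ?N) ?h (cube_boundary ?N r)"
 proof -
 have "r : chains_on (cube ?N) (rsub (cube ?N))" using 1 cube_rel_in by blast
 then show ?thesis
 unfolding z nop_diff_left nop_nop[OF chtpy_in, symmetric] using nop_cube_bd[of ?N r] by (simp add: universal_nop)
 qed
 \<comment> \<open>\<open>cendo\<close> passes through the simplices, where the relations have
   become 0.\<close>
 moreover have "nop (cube ?N) (cendo ?N) r = 0" unfolding nop_cendo tau_rel[OF 1] by simp
 moreover have "nop (cube ?N) ?h (cube_boundary ?N r) : relations (cube ?N) (cube_rel ?N) (rsub (cube ?N))"
 by (rule nop_relations[OF _ chtpy_in cube_rel_in Suc(1)]) (use cube_rel_bd[OF 1] in simp)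
 ultimately have "nop (cube ?N) z r : relations (cube ?N) (cube_rel ?N) (rsub (cube ?N))"
 using relations_diff relations_universal[OF 1 cube_rel_in] by simp
 then show ?case unfolding h cube_cone_nop[OF z_in 1] by (rule cube_cone_relations)
 next
 case 2
 have "cube_boundary (Suc ?N) (cube_cone ?N z) - z = (cube_boundary (Suc ?N) (cube_cone ?N z) + cube_cone n (cube_boundary ?N z) - z) - cube_cone n (cube_boundary ?N z)"
 by simp
 then show ?case
 unfolding h z_def[symmetric] using relations_diff[OF cube_cone_bd[OF z_in] cube_cone_relations[OF bz]] by simp
 }
qed

lemma chtpy_bd:
 assumes x: "x : chains_on (cube n) X"
 shows "x - nop (cube n) (cendo n) x - nop (cube n) (chtpy (n - 1)) (cube_boundary n x) -
 cube_boundary (Suc n) (nop (cube (Suc n)) (chtpy n) x) : relations (cube n) (cube_rel n) X"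
proof -
 \<comment> \<open>For \<open>n = 0\<close> the truncated index gives \<open>chtpy 0 = 0\<close>,
   which is a chain on any domain.\<close>
 have hin: "chtpy (n - 1) : chains_on (cube n) (rsub (cube (n - 1)))"
 using chtpy_in[of "n - 1"] by (cases n) (auto simp del: chtpy.simps(2))
 have "- nop (cube n) (cube_boundary (Suc n) (chtpy n) - cube_defect n) x : relations (cube n) (cube_rel n) X"
 by (rule relations_minus[OF nop_in_relations[OF chtpy(2) cube_rel_in x]])
 moreover have "nop (cube n) (cube_boundary (Suc n) (chtpy n)) x = cube_boundary (Suc n) (nop (cube (Suc n)) (chtpy n) x)"
 proof -
 have "nop (cube n) (cube_bd (Suc n)) (nop (cube (Suc n)) (chtpy n) x) =
 nop (cube n) (nop (cube n) (cube_bd (Suc n)) (chtpy n)) x"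
 using nop_nop[OF cube_bd_in[of "Suc n"]] by simp
 then show ?thesis
 using nop_cube_bd[of "Suc n" "chtpy n"] nop_cube_bd[of "Suc n" "nop (cube (Suc n)) (chtpy n) x"] by simp
 qed
 moreover have "nop (cube n) (cube_defect n) x = x - nop (cube n) (cendo n) x - nop (cube n) (chtpy (n - 1)) (cube_boundary n x)"
 unfolding cube_defect_def nop_diff_left universal_nop[OF x] nop_nop[OF hin, symmetric] nop_cube_bd ..
 ultimately show ?thesis
 by (simp add: nop_diff_left)
qed


section \<open>The weak equivalence\<close>

text \<open>If \<open>?T n x\<close> is the boundary of \<open>w\<close>, then modulo relations
  \<open>x\<close> is the boundary of \<open>?H n x + ?G (Suc n) w\<close>. Conversely a singular
  cycle \<open>y\<close> differs from \<open>?T n (?G n y)\<close> by a boundary, through the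
  homotopy on simplices.\<close>

lemma tri_mor_quasi_iso:
 assumes P: "top_operad P" and l: "1 <= l"
 shows "quasi_iso (dcx (ord_operad P) l) (dcx (sing_operad P) l) (tri_mor P l)"
proof -
 note sim = sing_operad_presented[OF P]
 interpret presented_operad cube "%_. 0" cube_bd cube_pr cube_rel P "ord_operad P" "%l n. ord_class n (tspace P l)"
 by (rule ord_operad_presented[OF P])
 interpret M: presented_operad splx "%j. if j = 0 then 1 else 0" simp_bd simp_pr "%p. {}" P "sing_operad P" "%l n x. x"
 by (rule sim)
 have chz: "chz n X = cchains n X" for n and X :: "'a topology" by (simp add: chz_def cchains_def)
 have bdry: "bdry n x = cube_boundary n x" "M.bdry n x = chain_boundary n x" for n and x :: "'a chain"
 unfolding bdry_def M.bdry_def by (rule nop_cube_bd nop_simp_bd)+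
 let ?T = "%n. nop (splx n) (tau n)" and ?G = "%n. nop (cube n) (gam n)"
 let ?H = "%n. nop (cube (Suc n)) (chtpy n)"
 have G_bd: "bdry n (?G n w) - ?G (n - 1) (chain_boundary n w) : Rel (n - 1) X"
 if "w : chains_on (splx n) X" for n w and X :: "'a topology"
 proof -
 have "bdry n (?G n w) - ?G (n - 1) (chain_boundary n w) =
 nop (cube (n - 1)) (nop (cube (n - 1)) (cube_bd n) (gam n) - nop (cube (n - 1)) (gam (n - 1)) (simp_bd n)) w"
 unfolding bdry_def nop_diff_left nop_simp_bd[symmetric] nop_nop[OF cube_bd_in] nop_nop[OF gam_in] ..
 then show ?thesis using nop_in_relations[OF gam_bd cube_rel_in that] by simp
 qed
 have H_Rel: "?H n x : Rel (Suc n) X" if "x : Rel n X" for n x and X :: "'a topology"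
 by (rule nop_relations[OF that chtpy_in cube_rel_in chtpy(1)])
 have mor: "complex_mor (dcx (ord_operad P) l) (dcx (sing_operad P) l) (tri_mor P l)"
 using tri_mor[OF P] l unfolding dg_operad_mor_def by blast
 show ?thesis
 proof (rule presented_quasi_iso[OF sim l mor, where h = "%n. ?T (nat n)"])
 fix n and x :: "'a chain" assume x: "x : chz n (sp l)"
 show "tri_mor P l n (ord_class n (sp l) x) = ?T (nat n) x" using x by (intro tri_mor_class) (simp add: chz)
 show "?T (nat n) x : M.chz n (sp l)" using x nop_in_chains[OF tau_in] by (auto simp: chz_def M.chz_def)
 next
 fix n x w assume x: "x : Ch n (sp l)" "bdry n x : Rel (n - 1) (sp l)" and w: "w : chains_on (splx (Suc n)) (sp l)"
 and "?T (nat (int n)) x - M.bdry (Suc n) w : relations (splx n) {} (sp l)"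
 then have Tx: "?T n x = chain_boundary (Suc n) w" by (simp add: bdry)
 let ?v = "?H n x + ?G (Suc n) w"
 have "?v : Ch (Suc n) (sp l)"
 by (intro chains_add nop_in_chains[OF chtpy_in x(1)] nop_in_chains[OF gam_in w])
 moreover have "x - bdry (Suc n) ?v : Rel n (sp l)"
 proof -
 \<comment> \<open>The boundary of \<open>x\<close> is a relation and in general not 0; that the
   homotopy preserves relations disposes of this term.\<close>
 have h: "nop (cube n) (chtpy (n - 1)) (bdry n x) : Rel n (sp l)"
 using H_Rel[OF x(2)] by (cases n) (auto simp: relations_0)
 have "bdry (Suc n) (?G (Suc n) w) - ?G n (?T n x) : Rel n (sp l)"
 using G_bd[OF w] by (simp add: Tx)
 from relations_diff[OF relations_add[OF chtpy_bd[OF x(1)] h] this]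
 show ?thesis by (simp add: bdry_def[of _ ?v] nop_add nop_cendo bdry[symmetric]) (simp add: bdry_def diff_diff_eq[symmetric])
 qed
 ultimately show "\<exists>v\<in>Ch (Suc n) (sp l). x - bdry (Suc n) v : Rel n (sp l)" by blast
 next
 fix n y assume y: "y : chains_on (splx n) (sp l)" and "M.bdry n y : relations (splx (n - 1)) {} (sp l)"
 then have dy: "chain_boundary n y = 0" by (simp add: bdry)
 obtain b where b: "!!n. b n : chains_on (splx (Suc n)) (rsub (splx n))"
 "!!n. chain_boundary (Suc n) (b n) = universal (splx n) - sendo n - nop (splx n) (b (n - 1)) (simp_bd n)"
 using sing_homotopy by blast
 let ?w = "nop (splx (Suc n)) (b n) y"
 have "nop (splx n) (nop (splx n) (b (n - 1)) (simp_bd n)) y = 0"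
 proof (cases n)
 case (Suc k)
 then have b': "b (n - 1) : chains_on (splx n) (rsub (splx (n - 1)))" using b(1)[of k] by simp
 show ?thesis unfolding nop_nop[OF b', symmetric] nop_simp_bd dy by simp
 qed (simp add: simp_bd_def chain_boundary_def)
 then have "chain_boundary (Suc n) ?w = y - ?T n (?G n y)"
 using chain_boundary_nop[of "Suc n" "b n" y] nop_nop[OF tau_in[of n], of "gam n" y]
 by (simp add: b(2) nop_diff_left universal_nop[OF y] sendo_def)
 then have "y - (M.bdry (Suc n) ?w + ?T (nat (int n)) (?G n y)) : relations (splx n) {} (sp l)"
 by (simp add: bdry)
 moreover have "bdry n (?G n y) : Rel (n - 1) (sp l)" using G_bd[OF y] dy by simp
 ultimately show "\<exists>x\<in>Ch n (sp l). bdry n x : Rel (n - 1) (sp l) & (\<exists>w\<in>chains_on (splx (Suc n)) (sp l).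
 y - (M.bdry (Suc n) w + ?T (nat (int n)) x) : relations (splx n) {} (sp l))"
 using nop_in_chains[OF gam_in y] nop_in_chains[OF b(1) y] by blast
 qed
qed

lemma tri_mor_weak_eq: "top_operad P ==> dg_weak_eq (ord_operad P) (sing_operad P) (tri_mor P)"
 unfolding dg_weak_eq_def using tri_mor tri_mor_quasi_iso by blast

text \<open>A zigzag has an outer arrow at either end; with a single weak equivalence at hand, the
  other one is an identity.\<close>

lemma dg_weak_eq_id:
 assumes "dg_operad D"
 shows "dg_weak_eq D D (%l n x. x)"
proof -
 have q: "quasi_iso (dcx D l) (dcx D l) (%n x. x)" if "1 <= l" for l
 using assms that by (intro quasi_iso_id) (simp add: dg_operad_def)
 have "map (%i. ys ! i) [0..<length ms] = ys" if "delems D ms qs ys" for ms qs ys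
 using that by (metis delems_def map_nth)
 then have "dg_operad_mor D D (%l n x. x)"
 unfolding dg_operad_mor_def using assms q by (auto simp: quasi_iso_def)
 then show ?thesis using q by (auto simp: dg_weak_eq_def)
qed

text \<open>Naturality in the operad is automatic, as \<open>tau\<close> acts through universal
  chains and so commutes with push-forward.\<close>

lemma tri_mor_nat: "nat_weak_eq ord_functor sing_functor tri_mor"
 unfolding nat_weak_eq_def nat_transformation_def
proof (intro conjI allI impI is_op_functor_ord is_op_functor_sing)
 fix P :: "'a top_operad_data" assume P: "top_operad P"
 show "dg_weak_eq (fobj ord_functor P) (fobj sing_functor P) (tri_mor P)"
 using tri_mor_weak_eq[OF P] by (simp add: ord_functor_def sing_functor_def)
 then show "dg_operad_mor (fobj ord_functor P) (fobj sing_functor P) (tri_mor P)"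
 by (simp add: dg_weak_eq_def)
next
 fix P Q :: "'a top_operad_data" and f assume f: "top_operad_mor P Q f"
 show "dg_mor_eq (fobj ord_functor P) (%l n x. tri_mor Q l n (fmor ord_functor P Q f l n x))
 (%l n x. fmor sing_functor P Q f l n (tri_mor P l n x))"
 unfolding dg_mor_eq_def
 proof (intro allI impI ballI)
 fix l n X assume l: "1 <= l" and "X : carrier (dgrp (fobj ord_functor P) l n)"
 then obtain x where x: "X = ord_class n (tspace P l) x" "x : cchains n (tspace P l)"
 by (auto simp: ord_functor_def ord_operad_def ord_complex_def ord_group(2))
 have c: "continuous_map (tspace P l) (tspace Q l) (f l)" using f l unfolding top_operad_mor_def by blast
 have "push (cube (nat n)) (f l) x : cchains n (tspace Q l)"
 using x(2) push_in_chains[OF _ c] by (auto simp: cchains_def split: if_splits)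
 then show "tri_mor Q l n (fmor ord_functor P Q f l n X) = fmor sing_functor P Q f l n (tri_mor P l n X)"
 using ord_functor_mor[where P = P and Q = Q and f = f and l = l, OF c x(2)] tri_mor_class[OF x(2)] nop_push[OF tau_in]
 by (simp add: x(1) tri_mor_class sing_functor_def push_simplex[symmetric])
 qed
qed

lemma nat_weak_eq_id:
 assumes "is_op_functor F"
 shows "nat_weak_eq F F (%P l n x. x)"
proof -
 have "dg_weak_eq (fobj F P) (fobj F P) (%l n x. x)" if "top_operad P" for P
 using assms that by (intro dg_weak_eq_id) (simp add: is_op_functor_def)
 then show ?thesis
 using assms by (simp add: nat_weak_eq_def nat_transformation_def dg_weak_eq_def dg_mor_eq_def)
qed

theorem theorem7p2p2:
  shows "functors_weakly_equivalent TYPE('a chain set set)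
           (sing_functor :: ('a, 'a chain) op_functor)
           (ord_functor :: ('a, 'a chain set set) op_functor)
         \<and> (\<forall>P :: 'a top_operad_data. top_operad P \<longrightarrow>
              dg_weakly_equivalent TYPE('a chain set set) (sing_operad P) (ord_operad P))"
proof (intro conjI allI impI)
  show "functors_weakly_equivalent TYPE('a chain set set)
           (sing_functor :: ('a, 'a chain) op_functor) (ord_functor :: ('a, 'a chain set set) op_functor)"
    \<comment> \<open>Both intermediate functors are \<open>ord_functor\<close>, with the
      triangulation as arrow to the singular chains and the identity at the other end.\<close>
    unfolding functors_weakly_equivalent_def
    using tri_mor_nat nat_weak_eq_id[OF is_op_functor_ord] equivclp_refl by blast
  fix P :: "'a top_operad_data" assume P: "top_operad P"
  have "dg_operad (ord_operad P)"
    using presented_operad.presented_dg_operad[OF ord_operad_presented[OF P]] .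
  then show "dg_weakly_equivalent TYPE('a chain set set) (sing_operad P) (ord_operad P)"
    unfolding dg_weakly_equivalent_def
    using tri_mor_weak_eq[OF P] dg_weak_eq_id equivclp_refl by blast
qed
end
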